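(* Let $i\colon \mathsf{FinSet}\hookrightarrow\mathsf{Set}$ be the inclusion of the category of finite sets into the category of sets. Then: (i) if $E$ is a finite set, then the category of Eilenberg--Moore algebras $\mathsf{Set}^{i_\#((\cdot)+E)}$ is the category of $E$-pointed compact Hausdorff spaces; (ii) if $M$ is a finite monoid, then $\mathsf{Set}^{i_\#(M\times(\cdot))}$ is the category of compact Hausdorff spaces with a discrete $M$-action; (iii) $\mathsf{Set}^{i_\#\mathscr{P}}$ is the category of continuous lattices. Here "is" means "is equivalent, as a category, to".
   Context: Pushforward: for a functor $G\colon \mathcal{A}\to\mathcal{B}$ between locally small categories and a monad $T=(T,\eta^T,\mu^T)$ on $\mathcal{A}$, the pushforward $G_\#T$ is, when it exists, the right Kan extension $(G_\#T,\ \varepsilon\colon (G_\#T)G\to GT)$ of $GT$ along $G$, equipped with the unique monad structure on $\mathcal{B}$ such that $\varepsilon\cdot\eta^{G_\#T}G=G\eta^T$ and $\varepsilon\cdot\mu^{G_\#T}G=G\mu^T\cdot\varepsilon T\cdot (G_\#T)\varepsilon$. (Pushforwards along $i$ always exist.) The monads being pushed forward are monads on $\mathsf{FinSet}$: $(\cdot)+E$ is the exception monad $X\mapsto X+E$ (algebras: sets $X$ with a function $E\to X$); $M\times(\cdot)$ is the monad whose algebras are left $M$-sets, with unit $x\mapsto(1,x)$ and multiplication $(m,(n,x))\mapsto(mn,x)$; $\mathscr{P}$ is the covariant powerset monad (unit: singletons; multiplication: union). All three restrict from $\mathsf{Set}$ to $\mathsf{FinSet}$. For a monad $S$ on $\mathsf{Set}$,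 $\mathsf{Set}^S$ is its category of Eilenberg--Moore algebras. An $E$-pointed compact Hausdorff space is a compact Hausdorff space $X$ with a function $E\to X$; morphisms are continuous maps commuting with the functions from $E$ (i.e. this is the coslice $E/\mathsf{CHaus}$ with $E$ discrete). A compact Hausdorff space with a discrete $M$-action is a compact Hausdorff space $X$ with a left action $M\times X\to X$ that is continuous when $M$ has the discrete topology; morphisms are $M$-equivariant continuous maps. The category of continuous lattices has as objects the complete lattices in which every element is the directed join of the elements way below it, and as morphisms the maps preserving directed joins and arbitrary meets. *)

theory Defs
  imports "HOL-Analysis.Analysis" "HOL-Algebra.Complete_Lattice" "HOL-Algebra.Group"
begin

section \<open>A universe of sets\<close>

text \<open>
  HOL has no type of all small sets, so the universe over which the category of sets is
  formed is a type \<open>'u\<close> carrying the structure of a transitive model of second-order ZF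
  (equivalently, an uncountable Grothendieck universe); \<open>elts x\<close> is the extension of the set \<open>x\<close>.
  Choice is inherited from the ambient logic.
\<close>

class zf_universe =
  fixes elts :: "'a \<Rightarrow> 'a set"
  assumes elts_ext: "elts x = elts y \<Longrightarrow> x = y"
    and elts_foundation: "wf {(x, y). x \<in> elts y}"
    and elts_separation: "A \<subseteq> elts x \<Longrightarrow> \<exists>y. elts y = A"
    and elts_replacement: "\<exists>y. elts y = f ` elts x"
    and elts_union: "\<exists>y. elts y = (\<Union>z\<in>elts x. elts z)"
    and elts_powerset: "\<exists>y. elts y = {z. elts z \<subseteq> elts x}"
    and elts_infinity: "\<exists>x. infinite (elts x)"

definition small :: "'u::zf_universe set \<Rightarrow> bool"
  where "small A \<longleftrightarrow> A \<in> range elts"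

text \<open>\<open>mk_set A\<close> is the element of the universe with extension \<open>A\<close>, for small \<open>A\<close>.\<close>

definition mk_set :: "'u::zf_universe set \<Rightarrow> 'u"
  where "mk_set A = (THE x. elts x = A)"

definition opair :: "'u::zf_universe \<Rightarrow> 'u \<Rightarrow> 'u"
  where "opair a b = mk_set {mk_set {a}, mk_set {a, b}}"

definition ofst :: "'u::zf_universe \<Rightarrow> 'u"
  where "ofst p = (THE a. \<exists>b. p = opair a b)"

definition osnd :: "'u::zf_universe \<Rightarrow> 'u"
  where "osnd p = (THE b. \<exists>a. p = opair a b)"

definition inl :: "'u::zf_universe \<Rightarrow> 'u"
  where "inl x = opair (mk_set {}) x"

definition inr :: "'u::zf_universe \<Rightarrow> 'u"
  where "inr e = opair (mk_set {mk_set {}}) e"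

definition copair :: "('u::zf_universe \<Rightarrow> 'u) \<Rightarrow> ('u \<Rightarrow> 'u) \<Rightarrow> 'u \<Rightarrow> 'u"
  where "copair f g z = (if z \<in> range inl then f (osnd z) else g (osnd z))"


section \<open>Categories, functors, natural transformations\<close>

record ('o, 'm) cat =
  obj :: "'o set"
  arr :: "'m set"
  src :: "'m \<Rightarrow> 'o"
  trg :: "'m \<Rightarrow> 'o"
  idt :: "'o \<Rightarrow> 'm"
  cmp :: "'m \<Rightarrow> 'm \<Rightarrow> 'm" (infixl \<open>\<cdot>\<index>\<close> 70)

definition hom_set :: "('o, 'm) cat \<Rightarrow> 'o \<Rightarrow> 'o \<Rightarrow> 'm set"
  where "hom_set C x y = {f \<in> arr C. src C f = x \<and> trg C f = y}"

locale category =
  fixes C :: "('o, 'm) cat" (structure)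
  assumes src_obj: "f \<in> arr C \<Longrightarrow> src C f \<in> obj C"
    and trg_obj: "f \<in> arr C \<Longrightarrow> trg C f \<in> obj C"
    and idt_hom: "x \<in> obj C \<Longrightarrow> idt C x \<in> hom_set C x x"
    and cmp_hom: "\<lbrakk>f \<in> hom_set C x y; g \<in> hom_set C y z\<rbrakk> \<Longrightarrow> g \<cdot> f \<in> hom_set C x z"
    and cmp_idt_right: "f \<in> hom_set C x y \<Longrightarrow> f \<cdot> idt C x = f"
    and cmp_idt_left: "f \<in> hom_set C x y \<Longrightarrow> idt C y \<cdot> f = f"
    and cmp_assoc: "\<lbrakk>f \<in> hom_set C w x; g \<in> hom_set C x y; h \<in> hom_set C y z\<rbrakk>
      \<Longrightarrow> (h \<cdot> g) \<cdot> f = h \<cdot> (g \<cdot> f)"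

record ('o, 'm, 'p, 'n) ftor =
  fob :: "'o \<Rightarrow> 'p"
  far :: "'m \<Rightarrow> 'n"

locale cat_functor = C: category C + D: category D
  for C :: "('o, 'm) cat" and D :: "('p, 'n) cat" and F :: "('o, 'm, 'p, 'n) ftor" +
  assumes far_hom: "f \<in> hom_set C x y \<Longrightarrow> far F f \<in> hom_set D (fob F x) (fob F y)"
    and fob_obj: "x \<in> obj C \<Longrightarrow> fob F x \<in> obj D"
    and far_idt: "x \<in> obj C \<Longrightarrow> far F (idt C x) = idt D (fob F x)"
    and far_cmp: "\<lbrakk>f \<in> hom_set C x y; g \<in> hom_set C y z\<rbrakk>
      \<Longrightarrow> far F (g \<cdot>\<^bsub>C\<^esub> f) = far F g \<cdot>\<^bsub>D\<^esub> far F f"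

definition id_ftor :: "('o, 'm, 'o, 'm) ftor"
  where "id_ftor = \<lparr>fob = (\<lambda>x. x), far = (\<lambda>f. f)\<rparr>"

definition comp_ftor ::
  "('p, 'n, 'q, 'r) ftor \<Rightarrow> ('o, 'm, 'p, 'n) ftor \<Rightarrow> ('o, 'm, 'q, 'r) ftor" (infixr \<open>\<circ>\<^sub>F\<close> 75)
  where "G \<circ>\<^sub>F F = \<lparr>fob = fob G \<circ> fob F, far = far G \<circ> far F\<rparr>"

text \<open>A transformation is a function on all of the object type; only its values on objects matter.\<close>

locale nat_trans = F: cat_functor C D F + G: cat_functor C D G
  for C :: "('o, 'm) cat" and D :: "('p, 'n) cat" and F G and \<alpha> :: "'o \<Rightarrow> 'n" +
  assumes component: "x \<in> obj C \<Longrightarrow> \<alpha> x \<in> hom_set D (fob F x) (fob G x)"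
    and naturality: "f \<in> hom_set C x y \<Longrightarrow> \<alpha> y \<cdot>\<^bsub>D\<^esub> far F f = far G f \<cdot>\<^bsub>D\<^esub> \<alpha> x"

definition iso_arr :: "('o, 'm) cat \<Rightarrow> 'm \<Rightarrow> bool"
  where "iso_arr C f \<longleftrightarrow> f \<in> arr C \<and> (\<exists>g \<in> hom_set C (trg C f) (src C f).
    g \<cdot>\<^bsub>C\<^esub> f = idt C (src C f) \<and> f \<cdot>\<^bsub>C\<^esub> g = idt C (trg C f))"

definition nat_isomorphic ::
  "('o, 'm) cat \<Rightarrow> ('p, 'n) cat \<Rightarrow> ('o, 'm, 'p, 'n) ftor \<Rightarrow> ('o, 'm, 'p, 'n) ftor \<Rightarrow> bool"
  where "nat_isomorphic C D F G \<longleftrightarrow>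
    (\<exists>\<alpha>. nat_trans C D F G \<alpha> \<and> (\<forall>x\<in>obj C. iso_arr D (\<alpha> x)))"

definition equivalent_categories :: "('o, 'm) cat \<Rightarrow> ('p, 'n) cat \<Rightarrow> bool"
  where "equivalent_categories C D \<longleftrightarrow>
    (\<exists>F G. cat_functor C D F \<and> cat_functor D C G \<and>
      nat_isomorphic C C (G \<circ>\<^sub>F F) id_ftor \<and> nat_isomorphic D D (F \<circ>\<^sub>F G) id_ftor)"


section \<open>Monads, algebras, pushforwards\<close>

record ('o, 'm) mnd =
  mfun :: "('o, 'm, 'o, 'm) ftor"
  munit :: "'o \<Rightarrow> 'm"
  mmult :: "'o \<Rightarrow> 'm"

locale monad_on =
  C: category C +
  unit: nat_trans C C id_ftor "mfun T" "munit T" +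
  mult: nat_trans C C "mfun T \<circ>\<^sub>F mfun T" "mfun T" "mmult T"
  for C :: "('o, 'm) cat" and T :: "('o, 'm) mnd" +
  assumes unit_left:
      "x \<in> obj C \<Longrightarrow> mmult T x \<cdot>\<^bsub>C\<^esub> munit T (fob (mfun T) x) = idt C (fob (mfun T) x)"
    and unit_right:
      "x \<in> obj C \<Longrightarrow> mmult T x \<cdot>\<^bsub>C\<^esub> far (mfun T) (munit T x) = idt C (fob (mfun T) x)"
    and assoc:
      "x \<in> obj C \<Longrightarrow>
        mmult T x \<cdot>\<^bsub>C\<^esub> mmult T (fob (mfun T) x) = mmult T x \<cdot>\<^bsub>C\<^esub> far (mfun T) (mmult T x)"

definition em_algebras :: "('o, 'm) cat \<Rightarrow> ('o, 'm) mnd \<Rightarrow> ('o \<times> 'm) set"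
  where "em_algebras C T = {(x, a). x \<in> obj C \<and> a \<in> hom_set C (fob (mfun T) x) x \<and>
    a \<cdot>\<^bsub>C\<^esub> munit T x = idt C x \<and> a \<cdot>\<^bsub>C\<^esub> mmult T x = a \<cdot>\<^bsub>C\<^esub> far (mfun T) a}"

definition em_category ::
  "('o, 'm) cat \<Rightarrow> ('o, 'm) mnd \<Rightarrow> ('o \<times> 'm, ('o \<times> 'm) \<times> 'm \<times> ('o \<times> 'm)) cat"
  where "em_category C T = \<lparr>
    obj = em_algebras C T,
    arr = {((x, a), f, (y, b)) | x a f y b. (x, a) \<in> em_algebras C T \<and> (y, b) \<in> em_algebras C T \<and>
      f \<in> hom_set C x y \<and> f \<cdot>\<^bsub>C\<^esub> a = b \<cdot>\<^bsub>C\<^esub> far (mfun T) f},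
    src = (\<lambda>(A, f, B). A),
    trg = (\<lambda>(A, f, B). B),
    idt = (\<lambda>(x, a). ((x, a), idt C x, (x, a))),
    cmp = (\<lambda>(B', g, D) (A, f, B). (A, g \<cdot>\<^bsub>C\<^esub> f, D))\<rparr>"

text \<open>\<open>(R, \<epsilon>)\<close> is the right Kan extension of \<open>F : A \<rightarrow> C\<close> along \<open>G : A \<rightarrow> B\<close>.\<close>

definition right_kan_extension ::
  "('o, 'm) cat \<Rightarrow> ('p, 'n) cat \<Rightarrow> ('q, 'r) cat \<Rightarrow> ('o, 'm, 'p, 'n) ftor \<Rightarrow> ('o, 'm, 'q, 'r) ftor
    \<Rightarrow> ('p, 'n, 'q, 'r) ftor \<Rightarrow> ('o \<Rightarrow> 'r) \<Rightarrow> bool"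
  where "right_kan_extension A B C G F R \<epsilon> \<longleftrightarrow>
    cat_functor A B G \<and> cat_functor A C F \<and> cat_functor B C R \<and>
    nat_trans A C (R \<circ>\<^sub>F G) F \<epsilon> \<and>
    (\<forall>H \<sigma>. cat_functor B C H \<and> nat_trans A C (H \<circ>\<^sub>F G) F \<sigma> \<longrightarrow>
      (\<exists>\<tau>. nat_trans B C H R \<tau> \<and> (\<forall>a\<in>obj A. \<epsilon> a \<cdot>\<^bsub>C\<^esub> \<tau> (fob G a) = \<sigma> a) \<and>
        (\<forall>\<tau>'. nat_trans B C H R \<tau>' \<and> (\<forall>a\<in>obj A. \<epsilon> a \<cdot>\<^bsub>C\<^esub> \<tau>' (fob G a) = \<sigma> a) \<longrightarrow>
          (\<forall>b\<in>obj B. \<tau>' b = \<tau> b))))"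

text \<open>The monad \<open>S\<close> on \<open>B\<close>, with counit \<open>\<epsilon>\<close>, is a pushforward of the monad \<open>T\<close> on \<open>A\<close> along \<open>G\<close>.\<close>

definition is_pushforward ::
  "('o, 'm) cat \<Rightarrow> ('p, 'n) cat \<Rightarrow> ('o, 'm, 'p, 'n) ftor \<Rightarrow> ('o, 'm) mnd \<Rightarrow> ('p, 'n) mnd
    \<Rightarrow> ('o \<Rightarrow> 'n) \<Rightarrow> bool"
  where "is_pushforward A B G T S \<epsilon> \<longleftrightarrow>
    monad_on A T \<and> monad_on B S \<and>
    right_kan_extension A B B G (G \<circ>\<^sub>F mfun T) (mfun S) \<epsilon> \<and>
    (\<forall>a\<in>obj A. \<epsilon> a \<cdot>\<^bsub>B\<^esub> munit S (fob G a) = far G (munit T a)) \<and>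
    (\<forall>a\<in>obj A. \<epsilon> a \<cdot>\<^bsub>B\<^esub> mmult S (fob G a) =
      far G (mmult T a) \<cdot>\<^bsub>B\<^esub> \<epsilon> (fob (mfun T) a) \<cdot>\<^bsub>B\<^esub> far (mfun S) (\<epsilon> a))"


section \<open>Concrete categories\<close>

text \<open>
  Structured sets with underlying set \<open>U A\<close>; an arrow is a function between underlying sets,
  made extensional (\<open>undefined\<close> off its domain), tagged with source and target.
\<close>

definition concrete_cat :: "'o set \<Rightarrow> ('o \<Rightarrow> 'u set) \<Rightarrow> ('o \<Rightarrow> 'o \<Rightarrow> ('u \<Rightarrow> 'u) \<Rightarrow> bool)
    \<Rightarrow> ('o, 'o \<times> ('u \<Rightarrow> 'u) \<times> 'o) cat"
  where "concrete_cat Obs U P = \<lparr>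
    obj = Obs,
    arr = {(A, f, B). A \<in> Obs \<and> B \<in> Obs \<and> f \<in> U A \<rightarrow>\<^sub>E U B \<and> P A B f},
    src = (\<lambda>(A, f, B). A),
    trg = (\<lambda>(A, f, B). B),
    idt = (\<lambda>A. (A, \<lambda>x\<in>U A. x, A)),
    cmp = (\<lambda>(B', g, C) (A, f, B). (A, compose (U A) g f, C))\<rparr>"

type_synonym 'u set_arr = "'u set \<times> ('u \<Rightarrow> 'u) \<times> 'u set"

definition Set_cat :: "('u::zf_universe set, 'u set_arr) cat"
  where "Set_cat = concrete_cat {X. small X} (\<lambda>X. X) (\<lambda>X Y f. True)"

definition FinSet_cat :: "('u::zf_universe set, 'u set_arr) cat"
  where "FinSet_cat = concrete_cat {X. small X \<and> finite X} (\<lambda>X. X) (\<lambda>X Y f. True)"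

definition FinSet_incl :: "('u::zf_universe set, 'u set_arr, 'u set, 'u set_arr) ftor"
  where "FinSet_incl = \<lparr>fob = (\<lambda>X. X), far = (\<lambda>f. f)\<rparr>"

definition CHaus_pointed :: "'u::zf_universe set \<Rightarrow>
    ('u topology \<times> ('u \<Rightarrow> 'u),
     ('u topology \<times> ('u \<Rightarrow> 'u)) \<times> ('u \<Rightarrow> 'u) \<times> ('u topology \<times> ('u \<Rightarrow> 'u))) cat"
  where "CHaus_pointed E = concrete_cat
    {(X, p). small (topspace X) \<and> compact_space X \<and> Hausdorff_space X \<and> p \<in> E \<rightarrow>\<^sub>E topspace X}
    (\<lambda>(X, p). topspace X)
    (\<lambda>(X, p) (Y, q) f. continuous_map X Y f \<and> (\<forall>e\<in>E. f (p e) = q e))"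

definition CHaus_action :: "('u::zf_universe, 'b) monoid_scheme \<Rightarrow>
    ('u topology \<times> ('u \<times> 'u \<Rightarrow> 'u),
     ('u topology \<times> ('u \<times> 'u \<Rightarrow> 'u)) \<times> ('u \<Rightarrow> 'u) \<times> ('u topology \<times> ('u \<times> 'u \<Rightarrow> 'u))) cat"
  where "CHaus_action M = concrete_cat
    {(X, \<alpha>). small (topspace X) \<and> compact_space X \<and> Hausdorff_space X \<and>
      \<alpha> \<in> carrier M \<times> topspace X \<rightarrow>\<^sub>E topspace X \<and>
      continuous_map (prod_topology (discrete_topology (carrier M)) X) X \<alpha> \<and>
      (\<forall>x\<in>topspace X. \<alpha> (\<one>\<^bsub>M\<^esub>, x) = x) \<and>
      (\<forall>m\<in>carrier M. \<forall>n\<in>carrier M. \<forall>x\<in>topspace X. \<alpha> (m \<otimes>\<^bsub>M\<^esub> n, x) = \<alpha> (m, \<alpha> (n, x)))}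
    (\<lambda>(X, \<alpha>). topspace X)
    (\<lambda>(X, \<alpha>) (Y, \<beta>) f. continuous_map X Y f \<and>
      (\<forall>m\<in>carrier M. \<forall>x\<in>topspace X. f (\<alpha> (m, x)) = \<beta> (m, f x)))"

definition directed_in :: "'u gorder \<Rightarrow> 'u set \<Rightarrow> bool"
  where "directed_in L D \<longleftrightarrow> D \<subseteq> carrier L \<and> D \<noteq> {} \<and>
    (\<forall>x\<in>D. \<forall>y\<in>D. \<exists>z\<in>D. x \<sqsubseteq>\<^bsub>L\<^esub> z \<and> y \<sqsubseteq>\<^bsub>L\<^esub> z)"

definition way_below :: "'u gorder \<Rightarrow> 'u \<Rightarrow> 'u \<Rightarrow> bool"
  where "way_below L x y \<longleftrightarrow> x \<in> carrier L \<and> y \<in> carrier L \<and>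
    (\<forall>D. directed_in L D \<and> y \<sqsubseteq>\<^bsub>L\<^esub> \<Squnion>\<^bsub>L\<^esub> D \<longrightarrow> (\<exists>d\<in>D. x \<sqsubseteq>\<^bsub>L\<^esub> d))"

definition continuous_lattice :: "'u gorder \<Rightarrow> bool"
  where "continuous_lattice L \<longleftrightarrow> complete_lattice L \<and>
    (\<forall>y\<in>carrier L. directed_in L {x. way_below L x y} \<and> \<Squnion>\<^bsub>L\<^esub> {x. way_below L x y} = y)"

text \<open>
  Two records with the same carrier and the same order on it may differ in the values of \<open>le\<close>
  off the carrier; they are then isomorphic objects.
\<close>

definition ContLat_cat :: "('u::zf_universe gorder, 'u gorder \<times> ('u \<Rightarrow> 'u) \<times> 'u gorder) cat"
  where "ContLat_cat = concrete_cat
    {L. small (carrier L) \<and> continuous_lattice L}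
    carrier
    (\<lambda>L K f. (\<forall>D. directed_in L D \<longrightarrow> f (\<Squnion>\<^bsub>L\<^esub> D) = \<Squnion>\<^bsub>K\<^esub> (f ` D)) \<and>
      (\<forall>A. A \<subseteq> carrier L \<longrightarrow> f (\<Sqinter>\<^bsub>L\<^esub> A) = \<Sqinter>\<^bsub>K\<^esub> (f ` A)))"


section \<open>The three monads on finite sets\<close>

definition sum_set :: "'u::zf_universe set \<Rightarrow> 'u set \<Rightarrow> 'u set"
  where "sum_set X E = inl ` X \<union> inr ` E"

definition exception_monad :: "'u::zf_universe set \<Rightarrow> ('u set, 'u set_arr) mnd"
  where "exception_monad E = \<lparr>
    mfun = \<lparr>fob = (\<lambda>X. sum_set X E),
      far = (\<lambda>(X, f, Y). (sum_set X E, \<lambda>z\<in>sum_set X E. copair (inl \<circ> f) inr z, sum_set Y E))\<rparr>,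
    munit = (\<lambda>X. (X, \<lambda>x\<in>X. inl x, sum_set X E)),
    mmult = (\<lambda>X. (sum_set (sum_set X E) E,
      \<lambda>z\<in>sum_set (sum_set X E) E. copair (\<lambda>w. w) inr z, sum_set X E))\<rparr>"

definition prod_set :: "'u::zf_universe set \<Rightarrow> 'u set \<Rightarrow> 'u set"
  where "prod_set A X = (\<lambda>(a, x). opair a x) ` (A \<times> X)"

definition action_monad :: "('u::zf_universe, 'b) monoid_scheme \<Rightarrow> ('u set, 'u set_arr) mnd"
  where "action_monad M = \<lparr>
    mfun = \<lparr>fob = (\<lambda>X. prod_set (carrier M) X),
      far = (\<lambda>(X, f, Y). (prod_set (carrier M) X,
        \<lambda>z\<in>prod_set (carrier M) X. opair (ofst z) (f (osnd z)), prod_set (carrier M) Y))\<rparr>,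
    munit = (\<lambda>X. (X, \<lambda>x\<in>X. opair \<one>\<^bsub>M\<^esub> x, prod_set (carrier M) X)),
    mmult = (\<lambda>X. (prod_set (carrier M) (prod_set (carrier M) X),
      \<lambda>z\<in>prod_set (carrier M) (prod_set (carrier M) X).
        opair (ofst z \<otimes>\<^bsub>M\<^esub> ofst (osnd z)) (osnd (osnd z)),
      prod_set (carrier M) X))\<rparr>"

definition power_set :: "'u::zf_universe set \<Rightarrow> 'u set"
  where "power_set X = {y. elts y \<subseteq> X}"

definition powerset_monad :: "('u::zf_universe set, 'u set_arr) mnd"
  where "powerset_monad = \<lparr>
    mfun = \<lparr>fob = power_set,
      far = (\<lambda>(X, f, Y). (power_set X, \<lambda>y\<in>power_set X. mk_set (f ` elts y), power_set Y))\<rparr>,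
    munit = (\<lambda>X. (X, \<lambda>x\<in>X. mk_set {x}, power_set X)),
    mmult = (\<lambda>X. (power_set (power_set X),
      \<lambda>z\<in>power_set (power_set X). mk_set (\<Union>y\<in>elts z. elts y), power_set X))\<rparr>"

end

(*
Elements of the pushforward at X are natural families: an element of T A for every map from X to a
finite set A. In these terms unit, multiplication and functor action are evaluated pointwise
by those of T, so the pushforward monad exists, and every pushforward is described by such
families. For the powerset monad a family is the same as a filter on X (improper filter included),
for E + (-) it is an ultrafilter or a point of E, and for M x (-) an element of M together with an
ultrafilter, because the limit of the sets T A is cofiltered and commutes with E + (-) and M x (-).

It remains to recognise the algebras. Ultrafilter algebras are compact Hausdorff spaces
(Manes): the structure map is the limit of ultrafilters. Filter algebras are continuous lattices
(Day): the structure map is the lower limit, the join over A in F of the meets of A.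
*)
theory Submission
  imports Defs
begin

section \<open>Small sets\<close>

text \<open>The maps from X to finite sets of the universe do not form a small set, so the limit
  defining the pushforward is not literally an object. A family is determined by its components on a
  small skeleton, which bounds the size; a chosen coding then turns families into elements of
  \<open>'u\<close>. A pushforward S is known only through its universal property. Instead of
  transporting algebras along an isomorphism, the proof works inside S: \<open>val f s\<close> plays
  the part of the component of s at f. The existence half of the universal property makes every
  family occur, the uniqueness half makes values separate points. Between families of subsets and
  filters: the value at the characteristic map of B decides whether B is in the filter; conversely
  the value at f is the least subset of the codomain whose preimage is in the filter, which exists
  because the codomain is finite. In the converse half of the theorems of Manes and Day the
  associativity law is applied to filters of filters built to order: the product is one filter of
  interest, the image under the structure map another, and so their limits agree.\<close>

lemma elts_mk_set [simp]: "small A \<Longrightarrow> elts (mk_set A) = A"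
proof -
  assume "small A"
  then obtain x where x: "elts x = A" by (auto simp: small_def)
  then have "mk_set A = x" unfolding mk_set_def by (metis (mono_tags, lifting) elts_ext the_equality)
  then show ?thesis using x by simp
qed

lemma small_elts [simp]: "small (elts x)" by (simp add: small_def)

lemma mk_set_elts [simp]: "mk_set (elts x) = x"
  by (rule elts_ext) simp

lemma mk_set_inj: "small A \<Longrightarrow> small B \<Longrightarrow> mk_set A = mk_set B \<longleftrightarrow> A = B"
  by (metis elts_mk_set)

lemma small_subset: "small B \<Longrightarrow> A \<subseteq> B \<Longrightarrow> small A"
  by (metis elts_mk_set elts_separation rangeI small_def)

lemma small_image [simp]: "small (A :: 'u::zf_universe set) \<Longrightarrow> small ((f :: 'u \<Rightarrow> 'u) ` A)"
proof -
  assume "small A"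
  then obtain x where "A = elts x" by (metis elts_mk_set)
  then show "small (f ` A)" using elts_replacement[of f x] by (metis small_elts)
qed

lemma small_UN: "small (I :: 'u::zf_universe set) \<Longrightarrow> (\<And>i. i \<in> I \<Longrightarrow> small (A i :: 'u set)) \<Longrightarrow> small (\<Union>i\<in>I. A i)"
proof -
  assume I: "small I" and A: "\<And>i. i \<in> I \<Longrightarrow> small (A i)"
  have "small ((\<lambda>i. mk_set (A i)) ` I)" using I by simp
  then obtain x where x: "elts x = (\<lambda>i. mk_set (A i)) ` I" by (metis elts_mk_set)
  obtain y where "elts y = (\<Union>z\<in>elts x. elts z)" using elts_union by blast
  also have "\<dots> = (\<Union>i\<in>I. elts (mk_set (A i)))" unfolding x by simp
  also have "\<dots> = (\<Union>i\<in>I. A i)" by (rule SUP_cong) (simp_all add: A)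
  finally have "(\<Union>i\<in>I. A i) \<in> range elts" by (rule range_eqI[OF sym])
  then show ?thesis unfolding small_def .
qed

lemma small_empty [simp]: "small {}"
  by (rule small_subset[OF small_elts]) simp

lemma small_power_set [simp]: "small X \<Longrightarrow> small (power_set X)"
proof -
  assume "small X"
  then obtain x where x: "X = elts x" by (metis elts_mk_set)
  obtain y where "elts y = power_set (elts x)"
    unfolding power_set_def using elts_powerset[of x] by blast
  then show "small (power_set X)" unfolding x by (metis small_elts)
qed

text \<open>Pairing is not among the axioms of the class: two power sets starting from the empty set
  give a two-element set, and replacement maps it onto {a, b}.\<close>

lemma small_pair: "small {a, b}"
proof -
  let ?z = "mk_set {} :: 'a" and ?o = "mk_set {mk_set {}} :: 'a"
  have s1: "small {?z}"
  proof -
    have "power_set {} = {?z}" unfolding power_set_def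
      using elts_ext[of _ ?z] by auto
    then show ?thesis using small_power_set[OF small_empty] by metis
  qed
  have ne: "?z \<noteq> ?o" using mk_set_inj[OF small_empty s1] by simp
  have "{?z, ?o} \<subseteq> power_set {?z}" unfolding power_set_def using s1 by auto
  then have "small {?z, ?o}" using small_subset small_power_set s1 by blast
  then have "small ((\<lambda>x. if x = ?z then a else b) ` {?z, ?o})" by (rule small_image)
  moreover have "(\<lambda>x. if x = ?z then a else b) ` {?z, ?o} = {a, b}" using ne by auto
  ultimately show ?thesis by simp
qed

lemma small_singleton [simp]: "small {a}"
  using small_pair[of a a] by simp

lemma small_Un: "small A \<Longrightarrow> small B \<Longrightarrow> small (A \<union> B)"
proof -
  assume A: "small A" and B: "small B"
  have "small (\<Union>i\<in>{mk_set A, mk_set B}. elts i)" by (rule small_UN) (auto simp: small_pair)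
  then show ?thesis using A B by simp
qed

lemma small_insert [simp]: "small A \<Longrightarrow> small (insert a A)"
  using small_Un[of "{a}" A] by simp

lemma small_finite: "finite A \<Longrightarrow> small A"
  by (induction rule: finite_induct) auto

lemma opair_inject [simp]: "opair a b = opair c d \<longleftrightarrow> a = c \<and> b = d"
proof
  assume "opair a b = opair c d"
  then have "{mk_set {a}, mk_set {a, b}} = {mk_set {c}, mk_set {c, d}}"
    unfolding opair_def by (subst (asm) mk_set_inj) (auto simp: small_pair)
  moreover have "mk_set {a} = mk_set {c} \<longleftrightarrow> a = c" for a c :: 'a by (subst mk_set_inj) auto
  moreover have "mk_set {a} = mk_set {c, d} \<longleftrightarrow> a = c \<and> a = d" for a c d :: 'a
    by (subst mk_set_inj) auto
  moreover have "mk_set {c, d} = mk_set {a} \<longleftrightarrow> a = c \<and> a = d" for a c d :: 'a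
    by (subst mk_set_inj) auto
  moreover have "mk_set {a, b} = mk_set {c, d} \<longleftrightarrow> {a, b} = {c, d}" for a b c d :: 'a
    by (subst mk_set_inj) auto
  ultimately show "a = c \<and> b = d" by (auto simp: doubleton_eq_iff)
qed simp

lemma ofst_opair [simp]: "ofst (opair a b) = a" by (simp add: ofst_def)
lemma osnd_opair [simp]: "osnd (opair a b) = b" by (simp add: osnd_def)

lemma inl_inject [simp]: "inl x = inl y \<longleftrightarrow> x = y" by (simp add: inl_def)
lemma inr_inject [simp]: "inr x = inr y \<longleftrightarrow> x = y" by (simp add: inr_def)
lemma inl_neq_inr [simp]: "inl x \<noteq> inr y" "inr y \<noteq> inl x"
proof -
  have "(mk_set {} :: 'a) \<noteq> mk_set {mk_set {}}" by (subst mk_set_inj) auto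
  then show "inl x \<noteq> inr y" "inr y \<noteq> inl x" by (auto simp: inl_def inr_def)
qed

lemma copair_inl [simp]: "copair f g (inl x) = f x" by (simp add: copair_def) (simp add: inl_def)
lemma copair_inr [simp]: "copair f g (inr x) = g x"
proof -
  have "inr x \<notin> range inl" using inl_neq_inr by blast
  then show ?thesis by (simp add: copair_def) (simp add: inr_def)
qed

lemma small_prod_set [simp]: "small A \<Longrightarrow> small X \<Longrightarrow> small (prod_set A X)"
proof -
  assume "small A" "small X"
  then have "small (\<Union>a\<in>A. opair a ` X)" by (intro small_UN) auto
  moreover have "(\<Union>a\<in>A. opair a ` X) = prod_set A X" unfolding prod_set_def by auto
  ultimately show ?thesis by simp
qed

lemma finite_power_set: "finite X \<Longrightarrow> finite (power_set X)"
proof (rule finite_subset)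
  show "power_set X \<subseteq> mk_set ` Pow X" unfolding power_set_def
    by (clarify, rule image_eqI[where x = "elts _"]) auto
qed simp

text \<open>Sets of functions are not sets of elements of the universe; their size is measured by
  codes in the universe.\<close>

definition encodable :: "'u::zf_universe itself \<Rightarrow> 'b set \<Rightarrow> bool"
  where "encodable _ B \<longleftrightarrow> (\<exists>c :: 'b \<Rightarrow> 'u. inj_on c B \<and> small (c ` B))"

lemma encodable_small: "small X \<Longrightarrow> encodable TYPE('u) (X :: 'u::zf_universe set)"
  unfolding encodable_def by (rule exI[of _ id]) auto

lemma encodable_inj:
  assumes "encodable TYPE('u::zf_universe) (B :: 'b set)" "inj_on h A" "h ` A \<subseteq> B"
  shows "encodable TYPE('u) A"
proof -
  obtain c :: "'b \<Rightarrow> 'u" where c: "inj_on c B" "small (c ` B)" using assms unfolding encodable_def by auto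
  have "inj_on (c \<circ> h) A" using c assms by (auto intro: comp_inj_on inj_on_subset)
  moreover have "small ((c \<circ> h) ` A)" by (rule small_subset[OF c(2)]) (use assms in auto)
  ultimately show ?thesis unfolding encodable_def by blast
qed

lemma encodable_subset: "encodable TYPE('u::zf_universe) B \<Longrightarrow> A \<subseteq> B \<Longrightarrow> encodable TYPE('u) A"
  by (rule encodable_inj[where h = id]) auto

lemma encodable_image: "encodable TYPE('u::zf_universe) B \<Longrightarrow> encodable TYPE('u) (h ` B)"
  by (rule encodable_inj[where h = "inv_into B h"])
    (auto simp: inj_on_inv_into inv_into_into)

lemma encodable_Pow:
  assumes "encodable TYPE('u::zf_universe) B" shows "encodable TYPE('u) (Pow B)"
proof -
  obtain c :: "'a \<Rightarrow> 'u" where c: "inj_on c B" "small (c ` B)" using assms unfolding encodable_def by auto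
  have sm: "small (c ` A)" if "A \<subseteq> B" for A by (rule small_subset[OF c(2)]) (use that in auto)
  have "inj_on (\<lambda>A. mk_set (c ` A)) (Pow B)"
    using c sm by (auto intro!: inj_onI simp: mk_set_inj inj_on_image_eq_iff)
  moreover have "small ((\<lambda>A. mk_set (c ` A)) ` Pow B)"
    by (rule small_subset[OF small_power_set[OF c(2)]]) (use sm in \<open>clarsimp simp: power_set_def, blast\<close>)
  ultimately show ?thesis unfolding encodable_def by blast
qed

lemma encodable_Times:
  assumes "encodable TYPE('u::zf_universe) A" "encodable TYPE('u) B" shows "encodable TYPE('u) (A \<times> B)"
proof -
  obtain c :: "'a \<Rightarrow> 'u" where c: "inj_on c A" "small (c ` A)" using assms unfolding encodable_def by auto
  obtain d :: "'b \<Rightarrow> 'u" where d: "inj_on d B" "small (d ` B)" using assms unfolding encodable_def by auto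
  have "inj_on (\<lambda>(a, b). opair (c a) (d b)) (A \<times> B)"
    using c d by (auto simp: inj_on_def)
  moreover have "small ((\<lambda>(a, b). opair (c a) (d b)) ` (A \<times> B))"
    by (rule small_subset[OF small_prod_set[OF c(2) d(2)]]) (auto simp: prod_set_def)
  ultimately show ?thesis unfolding encodable_def by blast
qed

lemma encodable_UN:
  assumes "encodable TYPE('u::zf_universe) I" "\<And>i. i \<in> I \<Longrightarrow> encodable TYPE('u) (B i)"
  shows "encodable TYPE('u) (\<Union>i\<in>I. B i)"
proof -
  obtain c :: "'a \<Rightarrow> 'u" where c: "inj_on c I" "small (c ` I)" using assms unfolding encodable_def by auto
  obtain d :: "'a \<Rightarrow> 'b \<Rightarrow> 'u" where d: "\<And>i. i \<in> I \<Longrightarrow> inj_on (d i) (B i)" "\<And>i. i \<in> I \<Longrightarrow> small (d i ` B i)"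
    using assms(2) unfolding encodable_def by metis
  \<comment> \<open>The sets \<open>B i\<close> may overlap and their codes may clash, so the
    disjoint union is coded first; the union itself is its image under \<open>snd\<close>.\<close>
  let ?S = "\<Union>i\<in>I. (\<lambda>x. (i, x)) ` B i"
  have "inj_on (\<lambda>(i, x). opair (c i) (d i x)) ?S"
    using c d by (auto simp: inj_on_def)
  moreover have "small ((\<lambda>(i, x). opair (c i) (d i x)) ` ?S)"
  proof (rule small_subset)
    have "small (\<Union>i\<in>c ` I. opair i ` d (inv_into I c i) ` B (inv_into I c i))"
      by (intro small_UN) (use c d in \<open>auto simp: inv_into_f_f\<close>)
    then show "small (\<Union>i\<in>I. opair (c i) ` d i ` B i)" using c by (simp add: inv_into_f_f)
    show "(\<lambda>(i, x). opair (c i) (d i x)) ` ?S \<subseteq> (\<Union>i\<in>I. opair (c i) ` d i ` B i)" by auto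
  qed
  ultimately have "encodable TYPE('u) ?S" unfolding encodable_def by blast
  then have "encodable TYPE('u) (snd ` ?S)" by (rule encodable_image)
  moreover have "snd ` ?S = (\<Union>i\<in>I. B i)" by force
  ultimately show ?thesis by simp
qed

text \<open>Functions are coded by their graphs, which determine them because extensional functions
  are fixed outside A.\<close>

lemma encodable_PiE:
  assumes "encodable TYPE('u::zf_universe) A" "encodable TYPE('u) B" shows "encodable TYPE('u) (A \<rightarrow>\<^sub>E B)"
proof (rule encodable_inj[OF encodable_Pow[OF encodable_Times[OF assms]]])
  show "inj_on (\<lambda>f. (\<lambda>x. (x, f x)) ` A) (A \<rightarrow>\<^sub>E B)"
    by (rule inj_onI, rule PiE_ext, assumption, assumption) auto
qed auto

text \<open>The axiom of infinity only gives some infinite set, so the copy of the natural numbers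
  is an arbitrary injective sequence with small range. Its initial segments represent all finite
  cardinalities.\<close>

definition nat_code :: "nat \<Rightarrow> 'u::zf_universe"
  where "nat_code = (SOME c. inj c \<and> small (range c))"

lemma nat_code: "inj (nat_code :: nat \<Rightarrow> 'u::zf_universe)" "small (range (nat_code :: nat \<Rightarrow> 'u))"
proof -
  obtain x :: 'u where "infinite (elts x)" using elts_infinity by blast
  then obtain c :: "nat \<Rightarrow> 'u" where "inj c" "range c \<subseteq> elts x" using infinite_countable_subset by blast
  then have "\<exists>c :: nat \<Rightarrow> 'u. inj c \<and> small (range c)" using small_subset small_elts by blast
  from someI_ex[OF this] show "inj (nat_code :: nat \<Rightarrow> 'u)" "small (range (nat_code :: nat \<Rightarrow> 'u))"
    unfolding nat_code_def by auto
qed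

lemma encodable_nat: "encodable TYPE('u::zf_universe) (A :: nat set)"
  by (rule encodable_subset[of UNIV]) (use nat_code in \<open>auto simp: encodable_def\<close>)

section \<open>The category of sets\<close>

definition fn :: "'u set_arr \<Rightarrow> 'u \<Rightarrow> 'u" where "fn m = fst (snd m)"
definition dm :: "'u set_arr \<Rightarrow> 'u set" where "dm m = fst m"
definition cd :: "'u set_arr \<Rightarrow> 'u set" where "cd m = snd (snd m)"

text \<open>The restriction makes any function on \<open>'u\<close> acceptable as an arrow, since
  arrows have to be \<open>undefined\<close> off their source.\<close>

definition mk_arr :: "'u set \<Rightarrow> ('u \<Rightarrow> 'u) \<Rightarrow> 'u set \<Rightarrow> 'u set_arr"
  where "mk_arr X f Y = (X, restrict f X, Y)"

abbreviation Hom :: "'u::zf_universe set \<Rightarrow> 'u set \<Rightarrow> 'u set_arr set"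
  where "Hom \<equiv> hom_set Set_cat"

abbreviation scmp :: "'u::zf_universe set_arr \<Rightarrow> 'u set_arr \<Rightarrow> 'u set_arr" (infixl \<open>\<odot>\<close> 70)
  where "g \<odot> f \<equiv> g \<cdot>\<^bsub>Set_cat\<^esub> f"

abbreviation sid :: "'u::zf_universe set \<Rightarrow> 'u set_arr"
  where "sid \<equiv> idt Set_cat"

lemma hom_iff: "m \<in> Hom X Y \<longleftrightarrow> small X \<and> small Y \<and> dm m = X \<and> cd m = Y \<and> fn m \<in> X \<rightarrow>\<^sub>E Y"
  by (cases m) (auto simp: hom_set_def Set_cat_def concrete_cat_def dm_def cd_def fn_def)

lemma obj_Set [simp]: "obj Set_cat = {X. small X}"
  by (simp add: Set_cat_def concrete_cat_def)

lemma obj_FinSet [simp]: "obj FinSet_cat = {X. finite X}"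
  by (auto simp: FinSet_cat_def concrete_cat_def small_finite)

lemma idt_FinSet [simp]: "idt FinSet_cat = sid"
  by (simp add: FinSet_cat_def Set_cat_def concrete_cat_def)

lemma cmp_FinSet [simp]: "cmp FinSet_cat = cmp Set_cat"
  by (simp add: FinSet_cat_def Set_cat_def concrete_cat_def)

lemma hom_FinSet: "m \<in> hom_set FinSet_cat X Y \<longleftrightarrow> m \<in> Hom X Y \<and> finite X \<and> finite Y"
  by (cases m) (auto simp: hom_set_def Set_cat_def FinSet_cat_def concrete_cat_def)

lemma dm_cd: "m \<in> Hom X Y \<Longrightarrow> dm m = X" "m \<in> Hom X Y \<Longrightarrow> cd m = Y"
  by (auto simp: hom_iff)

lemma hom_small: "m \<in> Hom X Y \<Longrightarrow> small X" "m \<in> Hom X Y \<Longrightarrow> small Y"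
  by (auto simp: hom_iff)

lemma fn_mem: "m \<in> Hom X Y \<Longrightarrow> x \<in> X \<Longrightarrow> fn m x \<in> Y"
  by (auto simp: hom_iff)

lemma hom_arr: "m \<in> Hom X Y \<Longrightarrow> m = (X, fn m, Y)"
  by (cases m) (auto simp: hom_iff dm_def cd_def fn_def)

lemma arr_eqI:
  assumes "m \<in> Hom X Y" "m' \<in> Hom X Y" "\<And>x. x \<in> X \<Longrightarrow> fn m x = fn m' x"
  shows "m = m'"
proof -
  have "fn m \<in> X \<rightarrow>\<^sub>E Y" "fn m' \<in> X \<rightarrow>\<^sub>E Y" using assms(1,2) by (simp_all add: hom_iff)
  then have "fn m = fn m'" using assms(3) by (rule PiE_ext)
  then show ?thesis using hom_arr[OF assms(1)] hom_arr[OF assms(2)] by simp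
qed

lemma mk_arr_hom [simp]: "mk_arr X f Y \<in> Hom X Y \<longleftrightarrow> small X \<and> small Y \<and> f \<in> X \<rightarrow> Y"
  by (auto simp: hom_iff mk_arr_def dm_def cd_def fn_def)

lemma mk_arr_sel [simp]: "dm (mk_arr X f Y) = X" "cd (mk_arr X f Y) = Y" "x \<in> X \<Longrightarrow> fn (mk_arr X f Y) x = f x"
  by (auto simp: mk_arr_def dm_def cd_def fn_def)

lemma scmp_triple: "(Y', g, Z) \<odot> (X, f, Y) = (X, compose X g f, Z)"
  by (simp add: Set_cat_def concrete_cat_def)

lemma scmp_mk_arr: "f \<in> Hom X Y \<Longrightarrow> g \<in> Hom Y Z \<Longrightarrow> g \<odot> f = mk_arr X (\<lambda>x. fn g (fn f x)) Z"
  by (subst hom_arr[of f], assumption, subst hom_arr[of g], assumption)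
    (simp add: scmp_triple mk_arr_def compose_def)

lemma scmp_hom: "f \<in> Hom X Y \<Longrightarrow> g \<in> Hom Y Z \<Longrightarrow> g \<odot> f \<in> Hom X Z"
  by (auto simp: scmp_mk_arr intro: hom_small fn_mem)

lemma fn_scmp [simp]: "f \<in> Hom X Y \<Longrightarrow> x \<in> X \<Longrightarrow> fn (g \<odot> f) x = fn g (fn f x)"
  by (subst hom_arr[of f], assumption, cases g)
    (simp add: scmp_triple compose_def fn_def)

lemma sid_mk_arr: "sid X = mk_arr X (\<lambda>x. x) X"
  by (simp add: Set_cat_def concrete_cat_def mk_arr_def)

lemma sid_hom: "small X \<Longrightarrow> sid X \<in> Hom X X"
  by (auto simp: sid_mk_arr)

lemma fn_sid [simp]: "x \<in> X \<Longrightarrow> fn (sid X) x = x"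
  by (simp add: sid_mk_arr)

lemma scmp_sid: "f \<in> Hom X Y \<Longrightarrow> f \<odot> sid X = f" "f \<in> Hom X Y \<Longrightarrow> sid Y \<odot> f = f"
proof -
  assume f: "f \<in> Hom X Y"
  note s = sid_hom[OF hom_small(1)[OF f]] sid_hom[OF hom_small(2)[OF f]]
  show "f \<odot> sid X = f" by (rule arr_eqI[OF scmp_hom[OF s(1) f] f]) (simp add: fn_scmp[OF s(1)])
  show "sid Y \<odot> f = f" by (rule arr_eqI[OF scmp_hom[OF f s(2)] f]) (simp add: fn_scmp[OF f] fn_mem[OF f])
qed

lemma scmp_assoc: "f \<in> Hom W X \<Longrightarrow> g \<in> Hom X Y \<Longrightarrow> h \<in> Hom Y Z \<Longrightarrow> (h \<odot> g) \<odot> f = h \<odot> (g \<odot> f)"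
proof -
  assume f: "f \<in> Hom W X" and g: "g \<in> Hom X Y" and h: "h \<in> Hom Y Z"
  show ?thesis
    by (rule arr_eqI[OF scmp_hom[OF f scmp_hom[OF g h]] scmp_hom[OF scmp_hom[OF f g] h]])
      (simp add: fn_scmp[OF f] fn_scmp[OF g] fn_scmp[OF scmp_hom[OF f g]] fn_mem[OF f])
qed

lemma category_Set: "category Set_cat"
proof
  fix f assume "f \<in> arr Set_cat" then show "src Set_cat f \<in> obj Set_cat" "trg Set_cat f \<in> obj Set_cat"
    by (auto simp: Set_cat_def concrete_cat_def)
qed (auto intro: sid_hom scmp_hom simp: scmp_sid scmp_assoc)

lemma category_FinSet: "category FinSet_cat"
proof
  fix f assume "f \<in> arr FinSet_cat" then show "src FinSet_cat f \<in> obj FinSet_cat" "trg FinSet_cat f \<in> obj FinSet_cat"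
    by (auto simp: FinSet_cat_def concrete_cat_def)
qed (auto intro: sid_hom scmp_hom small_finite simp: scmp_sid scmp_assoc hom_FinSet)

lemma cat_functorI:
  assumes "category C" "category D"
    "\<And>x. x \<in> obj C \<Longrightarrow> fob F x \<in> obj D"
    "\<And>f x y. f \<in> hom_set C x y \<Longrightarrow> far F f \<in> hom_set D (fob F x) (fob F y)"
    "\<And>x. x \<in> obj C \<Longrightarrow> far F (idt C x) = idt D (fob F x)"
    "\<And>f g x y z. f \<in> hom_set C x y \<Longrightarrow> g \<in> hom_set C y z \<Longrightarrow>
       far F (g \<cdot>\<^bsub>C\<^esub> f) = far F g \<cdot>\<^bsub>D\<^esub> far F f"
  shows "cat_functor C D F"
  using assms unfolding cat_functor_def cat_functor_axioms_def by blast

lemma nat_transI: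
  assumes "cat_functor C D F" "cat_functor C D G"
    "\<And>x. x \<in> obj C \<Longrightarrow> \<alpha> x \<in> hom_set D (fob F x) (fob G x)"
    "\<And>f x y. f \<in> hom_set C x y \<Longrightarrow> \<alpha> y \<cdot>\<^bsub>D\<^esub> far F f = far G f \<cdot>\<^bsub>D\<^esub> \<alpha> x"
  shows "nat_trans C D F G \<alpha>"
  using assms unfolding nat_trans_def nat_trans_axioms_def by blast

lemma FinSet_incl_simps [simp]: "fob FinSet_incl X = X" "far FinSet_incl f = f"
  by (simp_all add: FinSet_incl_def)

lemma comp_ftor_simps [simp]: "fob (G \<circ>\<^sub>F F) x = fob G (fob F x)" "far (G \<circ>\<^sub>F F) f = far G (far F f)"
  by (simp_all add: comp_ftor_def)

lemma id_ftor_simps [simp]: "fob id_ftor x = x" "far id_ftor f = f"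
  by (simp_all add: id_ftor_def)

lemma cat_functor_comp:
  assumes "cat_functor C D F" "cat_functor D E G" shows "cat_functor C E (G \<circ>\<^sub>F F)"
proof -
  interpret F: cat_functor C D F by fact
  interpret G: cat_functor D E G by fact
  show ?thesis
    by (rule cat_functorI) (auto intro: F.C.category_axioms G.D.category_axioms G.fob_obj F.fob_obj
        G.far_hom F.far_hom simp: F.far_idt G.far_idt[OF F.fob_obj] F.far_cmp G.far_cmp[OF F.far_hom F.far_hom])
qed

lemma cat_functor_id: "category C \<Longrightarrow> cat_functor C C id_ftor"
  by (rule cat_functorI) (auto intro: category.idt_hom)

lemma FinSet_incl_functor: "cat_functor FinSet_cat Set_cat FinSet_incl"
  by (rule cat_functorI) (auto simp: category_Set category_FinSet hom_FinSet small_finite)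

lemma nat_trans_id: "cat_functor C D F \<Longrightarrow> nat_trans C D F F (\<lambda>x. idt D (fob F x))"
proof -
  assume "cat_functor C D F"
  then interpret cat_functor C D F .
  show ?thesis
    by (rule nat_transI)
      (auto intro!: cat_functor_axioms D.idt_hom fob_obj simp: D.cmp_idt_right[OF far_hom] D.cmp_idt_left[OF far_hom])
qed

section \<open>Pushforwards along the inclusion of finite sets\<close>

text \<open>These are the objects of the comma category of X over the inclusion of finite sets, the
  index category of the limit that computes a right Kan extension at X.\<close>

definition finarr :: "'u::zf_universe set \<Rightarrow> 'u set_arr set"
  where "finarr X = {f. f \<in> Hom X (cd f) \<and> finite (cd f)}"

lemma finarrI: "f \<in> Hom X A \<Longrightarrow> finite A \<Longrightarrow> f \<in> finarr X"
  by (simp add: finarr_def dm_cd)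

lemma finarrD: "f \<in> finarr X \<Longrightarrow> f \<in> Hom X (cd f)" "f \<in> finarr X \<Longrightarrow> finite (cd f)"
  by (simp_all add: finarr_def)

lemma finarr_cmp: "f \<in> Hom X Y \<Longrightarrow> g \<in> finarr Y \<Longrightarrow> g \<odot> f \<in> finarr X"
  by (blast intro: finarrI scmp_hom finarrD)

lemma cd_cmp [simp]: "f \<in> Hom X Y \<Longrightarrow> g \<in> Hom Y Z \<Longrightarrow> cd (g \<odot> f) = Z"
  by (rule dm_cd(2)[OF scmp_hom])

text \<open>Compatible families over this comma category: the pointwise limit formula for the right
  Kan extension of F. Families are extensional on \<open>finarr X\<close>, so that they are equal as
  soon as their components are.\<close>

definition nat_families :: "('u::zf_universe set, 'u set_arr, 'u set, 'u set_arr) ftor \<Rightarrow> 'u set \<Rightarrow> ('u set_arr \<Rightarrow> 'u) set"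
  where "nat_families F X = {\<phi> \<in> (\<Pi>\<^sub>E f\<in>finarr X. fob F (cd f)).
    \<forall>f\<in>finarr X. \<forall>B g. finite B \<and> g \<in> Hom (cd f) B \<longrightarrow> \<phi> (g \<odot> f) = fn (far F g) (\<phi> f)}"

lemma nat_familiesI:
  assumes "\<And>A f. f \<in> Hom X A \<Longrightarrow> finite A \<Longrightarrow> \<phi> f \<in> fob F A"
    "\<And>A B f g. f \<in> Hom X A \<Longrightarrow> g \<in> Hom A B \<Longrightarrow> finite A \<Longrightarrow> finite B \<Longrightarrow> \<phi> (g \<odot> f) = fn (far F g) (\<phi> f)"
  shows "restrict \<phi> (finarr X) \<in> nat_families F X"
proof -
  have "restrict \<phi> (finarr X) \<in> (\<Pi>\<^sub>E f\<in>finarr X. fob F (cd f))"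
    by (rule PiE_I) (simp_all add: assms(1)[OF finarrD])
  moreover have "restrict \<phi> (finarr X) (g \<odot> f) = fn (far F g) (restrict \<phi> (finarr X) f)"
    if "f \<in> finarr X" "finite B" "g \<in> Hom (cd f) B" for f g B
    using that assms(2)[OF finarrD(1)[OF that(1)] that(3) finarrD(2)[OF that(1)] that(2)]
      finarr_cmp[OF finarrD(1)[OF that(1)] finarrI[OF that(3,2)]] by simp
  ultimately show ?thesis unfolding nat_families_def by blast
qed

lemma nat_familiesD:
  assumes "\<phi> \<in> nat_families F X" "f \<in> Hom X A" "finite A"
  shows "\<phi> f \<in> fob F A" "g \<in> Hom A B \<Longrightarrow> finite B \<Longrightarrow> \<phi> (g \<odot> f) = fn (far F g) (\<phi> f)"
proof -
  have f: "f \<in> finarr X" "cd f = A" using assms by (auto intro: finarrI dest: dm_cd)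
  show "\<phi> f \<in> fob F A" using PiE_mem[of \<phi> "finarr X" "\<lambda>f. fob F (cd f)" f] assms(1) f
    unfolding nat_families_def by simp
  show "g \<in> Hom A B \<Longrightarrow> finite B \<Longrightarrow> \<phi> (g \<odot> f) = fn (far F g) (\<phi> f)"
    using assms(1) f unfolding nat_families_def by blast
qed

lemma nat_families_eqI:
  assumes "\<phi> \<in> nat_families F X" "\<psi> \<in> nat_families F X"
    "\<And>f A. f \<in> Hom X A \<Longrightarrow> finite A \<Longrightarrow> \<phi> f = \<psi> f"
  shows "\<phi> = \<psi>"
proof (rule PiE_ext)
  show "\<phi> \<in> (\<Pi>\<^sub>E f\<in>finarr X. fob F (cd f))" "\<psi> \<in> (\<Pi>\<^sub>E f\<in>finarr X. fob F (cd f))"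
    using assms(1,2) unfolding nat_families_def by simp_all
qed (rule assms(3)[OF finarrD])

text \<open>A natural family is determined by its values on the maps into initial segments of the
  chosen copy of the natural numbers, which bounds the size of the set of all families.\<close>

lemma nat_families_encodable:
  fixes F :: "('u::zf_universe set, 'u set_arr, 'u set, 'u set_arr) ftor"
  assumes F: "\<And>A. finite A \<Longrightarrow> finite (fob F A)" and X: "small X"
  shows "encodable TYPE('u) (nat_families F X)"
proof -
  define N where "N n = (nat_code ` {..<n} :: 'u set)" for n
  define W where "W = range (nat_code :: nat \<Rightarrow> 'u)"
  define G where "G = (\<Union>n. (\<lambda>f. (X, f, N n)) ` (X \<rightarrow>\<^sub>E W))"
  define V where "V = (\<Union>n. fob F (N n))"
  have NW: "N n \<subseteq> W" for n by (auto simp: N_def W_def)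
  have finN: "finite (N n)" for n by (simp add: N_def)
  have W: "small W" using nat_code by (simp add: W_def)
  have eG: "encodable TYPE('u) G" unfolding G_def
    by (intro encodable_UN encodable_nat encodable_image encodable_PiE encodable_small X W)
  have eV: "encodable TYPE('u) V" unfolding V_def
    by (intro encodable_UN encodable_nat encodable_small small_finite F finN)
  let ?h = "\<lambda>\<phi>. (\<lambda>f. (f, \<phi> f)) ` (G \<inter> finarr X)"
  show ?thesis
  proof (rule encodable_inj[OF encodable_Pow[OF encodable_Times[OF eG eV]], where h = ?h])
    show "inj_on ?h (nat_families F X)"
    proof (rule inj_onI, rule nat_families_eqI)
      fix \<phi> \<psi> f and A :: "'u set"
      assume \<phi>: "\<phi> \<in> nat_families F X" and \<psi>: "\<psi> \<in> nat_families F X" and eq: "?h \<phi> = ?h \<psi>"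
        and f: "f \<in> Hom X A" and A: "finite A"
      obtain n where "card (N n) = card A"
        by (metis N_def card_image card_lessThan inj_on_subset nat_code(1) subset_UNIV)
      then obtain b where b: "bij_betw b A (N n)"
        using A finN by (metis finite_same_card_bij)
      \<comment> \<open>f equals \<open>?c\<close> after \<open>?b\<close> after f, and
        \<open>?b\<close> after f has codomain \<open>N n\<close>. Naturality along
        \<open>?c\<close> therefore recovers the component at f from a component that
        \<open>?h\<close> records.\<close>
      let ?b = "mk_arr A b (N n)" and ?c = "mk_arr (N n) (inv_into A b) A"
      have bh: "?b \<in> Hom A (N n)" using b A finN by (auto simp: small_finite bij_betw_def)
      have ch: "?c \<in> Hom (N n) A" using b A finN by (auto simp: small_finite bij_betw_def inv_into_into)
      have f': "?b \<odot> f \<in> Hom X (N n)" using f bh by (rule scmp_hom)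
      have cb: "f = ?c \<odot> (?b \<odot> f)"
      proof (rule arr_eqI[OF f scmp_hom[OF f' ch]])
        fix x assume x: "x \<in> X"
        then have "fn f x \<in> A" using f by (auto intro: fn_mem)
        moreover then have "b (fn f x) \<in> N n" using b by (auto simp: bij_betw_def)
        ultimately show "fn f x = fn (?c \<odot> (?b \<odot> f)) x"
          using x b by (simp add: fn_scmp[OF f] fn_scmp[OF f'] bij_betw_inv_into_left[OF b])
      qed
      have "fn (?b \<odot> f) \<in> X \<rightarrow>\<^sub>E N n" using f' by (simp add: hom_iff)
      then have "fn (?b \<odot> f) \<in> X \<rightarrow>\<^sub>E W" using PiE_mono[of X "\<lambda>_. N n" "\<lambda>_. W"] NW by blast
      then have "?b \<odot> f \<in> G" by (subst hom_arr[OF f']) (unfold G_def, blast)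
      moreover have "?b \<odot> f \<in> finarr X" using f' finN by (rule finarrI)
      ultimately have "(?b \<odot> f, \<phi> (?b \<odot> f)) \<in> ?h \<psi>" unfolding eq[symmetric] by blast
      then have "\<phi> (?b \<odot> f) = \<psi> (?b \<odot> f)" by auto
      then show "\<phi> f = \<psi> f"
        using nat_familiesD(2)[OF \<phi> f' finN ch A] nat_familiesD(2)[OF \<psi> f' finN ch A] cb by simp
    qed auto
    show "?h ` nat_families F X \<subseteq> Pow (G \<times> V)"
    proof clarsimp
      fix \<phi> f assume \<phi>: "\<phi> \<in> nat_families F X" and f: "f \<in> G" "f \<in> finarr X"
      then obtain n where "cd f = N n" by (auto simp: G_def cd_def)
      then show "\<phi> f \<in> V" using nat_familiesD(1)[OF \<phi> finarrD[OF f(2)]] by (auto simp: V_def)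
    qed
  qed
qed

section \<open>The constructed pushforward of a monad on finite sets\<close>

locale finset_monad =
  fixes T :: "('u::zf_universe set, 'u set_arr) mnd"
  assumes monad: "monad_on FinSet_cat T"
begin

sublocale T: monad_on FinSet_cat T by (rule monad)

abbreviation "To \<equiv> fob (mfun T)"
abbreviation "Tm \<equiv> far (mfun T)"
abbreviation "\<eta> \<equiv> munit T"
abbreviation "\<mu> \<equiv> mmult T"

lemma T_finite: "finite A \<Longrightarrow> finite (To A)"
  using T.unit.G.fob_obj by simp

lemma T_hom: "f \<in> Hom A B \<Longrightarrow> finite A \<Longrightarrow> finite B \<Longrightarrow> Tm f \<in> Hom (To A) (To B)"
  using T.unit.G.far_hom[of f A B] by (simp add: hom_FinSet)

lemma \<eta>_hom: "finite A \<Longrightarrow> \<eta> A \<in> Hom A (To A)"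
  using T.unit.component[of A] by (simp add: hom_FinSet)

lemma \<mu>_hom: "finite A \<Longrightarrow> \<mu> A \<in> Hom (To (To A)) (To A)"
  using T.mult.component[of A] by (simp add: hom_FinSet)

lemma \<eta>_nat: "f \<in> Hom A B \<Longrightarrow> finite A \<Longrightarrow> finite B \<Longrightarrow> \<eta> B \<odot> f = Tm f \<odot> \<eta> A"
  using T.unit.naturality[of f A B] by (simp add: hom_FinSet)

lemma \<mu>_nat: "f \<in> Hom A B \<Longrightarrow> finite A \<Longrightarrow> finite B \<Longrightarrow> \<mu> B \<odot> Tm (Tm f) = Tm f \<odot> \<mu> A"
  using T.mult.naturality[of f A B] by (simp add: hom_FinSet)

abbreviation "Fam \<equiv> nat_families (mfun T)"

text \<open>Objects of the category are sets of elements of \<open>'u\<close>, whereas families are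
  functions. An arbitrary injective coding with small image turns the set of families into an
  object; only injectivity and smallness are used of it.\<close>

definition enc :: "'u set \<Rightarrow> ('u set_arr \<Rightarrow> 'u) \<Rightarrow> 'u"
  where "enc X = (SOME c. inj_on c (Fam X) \<and> small (c ` Fam X))"

definition So :: "'u set \<Rightarrow> 'u set"
  where "So X = enc X ` Fam X"

definition dec :: "'u set \<Rightarrow> 'u \<Rightarrow> 'u set_arr \<Rightarrow> 'u"
  where "dec X = inv_into (Fam X) (enc X)"

lemma enc: "small X \<Longrightarrow> inj_on (enc X) (Fam X)" "small X \<Longrightarrow> small (So X)"
proof -
  assume X: "small X"
  have "\<exists>c :: _ \<Rightarrow> 'u. inj_on c (Fam X) \<and> small (c ` Fam X)"
    using nat_families_encodable[OF T_finite X] unfolding encodable_def by blast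
  from someI_ex[OF this] show "inj_on (enc X) (Fam X)" "small (So X)"
    unfolding enc_def So_def by auto
qed

lemma dec_enc: "small X \<Longrightarrow> \<phi> \<in> Fam X \<Longrightarrow> dec X (enc X \<phi>) = \<phi>"
  by (simp add: dec_def enc inv_into_f_f)

lemma dec_Fam: "s \<in> So X \<Longrightarrow> dec X s \<in> Fam X"
  by (simp add: dec_def So_def inv_into_into)

lemma enc_mem: "\<phi> \<in> Fam X \<Longrightarrow> enc X \<phi> \<in> So X"
  by (simp add: So_def)

lemma So_eqI: "s \<in> So X \<Longrightarrow> t \<in> So X \<Longrightarrow>
    (\<And>f A. f \<in> Hom X A \<Longrightarrow> finite A \<Longrightarrow> dec X s f = dec X t f) \<Longrightarrow> s = t"
  unfolding dec_def
  by (rule inv_into_injective[of "Fam X" "enc X"])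
    (auto simp: So_def intro!: nat_families_eqI[where F = "mfun T" and X = X] inv_into_into)

definition famc :: "'u set \<Rightarrow> ('u set_arr \<Rightarrow> 'u) \<Rightarrow> 'u"
  where "famc X h = enc X (restrict h (finarr X))"

lemma famc:
  assumes "small X" "\<And>A f. f \<in> Hom X A \<Longrightarrow> finite A \<Longrightarrow> h f \<in> To A"
    "\<And>A B f g. f \<in> Hom X A \<Longrightarrow> g \<in> Hom A B \<Longrightarrow> finite A \<Longrightarrow> finite B \<Longrightarrow> h (g \<odot> f) = fn (Tm g) (h f)"
  shows "famc X h \<in> So X" "f \<in> Hom X A \<Longrightarrow> finite A \<Longrightarrow> dec X (famc X h) f = h f"
proof -
  have "restrict h (finarr X) \<in> Fam X" by (rule nat_familiesI) (use assms in auto)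
  then show "famc X h \<in> So X" "f \<in> Hom X A \<Longrightarrow> finite A \<Longrightarrow> dec X (famc X h) f = h f"
    by (simp_all add: famc_def enc_mem dec_enc assms(1) finarrI)
qed

lemma dec_mem: "s \<in> So X \<Longrightarrow> f \<in> Hom X A \<Longrightarrow> finite A \<Longrightarrow> dec X s f \<in> To A"
  using nat_familiesD(1)[OF dec_Fam] by blast

lemma dec_nat: "s \<in> So X \<Longrightarrow> f \<in> Hom X A \<Longrightarrow> g \<in> Hom A B \<Longrightarrow> finite A \<Longrightarrow> finite B \<Longrightarrow>
    dec X s (g \<odot> f) = fn (Tm g) (dec X s f)"
  using nat_familiesD(2)[OF dec_Fam] by blast

text \<open>These are the projections of the limit \<open>So X\<close>. They are jointly monic
  (\<open>arr_So_ev_eqI\<close>), so an equation between arrows into \<open>So X\<close> may be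
  checked after composing with them.\<close>

definition ev :: "'u set \<Rightarrow> 'u set_arr \<Rightarrow> 'u set_arr"
  where "ev X f = mk_arr (So X) (\<lambda>s. dec X s f) (To (cd f))"

lemma ev_hom: "f \<in> Hom X A \<Longrightarrow> finite A \<Longrightarrow> ev X f \<in> Hom (So X) (To A)"
  by (auto simp: ev_def dm_cd enc small_finite T_finite dec_mem dest: hom_small)

lemma fn_ev: "f \<in> Hom X A \<Longrightarrow> s \<in> So X \<Longrightarrow> fn (ev X f) s = dec X s f"
  by (simp add: ev_def)

lemma ev_nat: "f \<in> Hom X A \<Longrightarrow> g \<in> Hom A B \<Longrightarrow> finite A \<Longrightarrow> finite B \<Longrightarrow>
    ev X (g \<odot> f) = Tm g \<odot> ev X f"
proof -
  assume f: "f \<in> Hom X A" and g: "g \<in> Hom A B" and A: "finite A" and B: "finite B"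
  note gf = scmp_hom[OF f g]
  show ?thesis
    by (rule arr_eqI[OF ev_hom[OF gf B] scmp_hom[OF ev_hom[OF f A] T_hom[OF g A B]]])
      (simp add: fn_scmp[OF ev_hom[OF f A]] fn_ev[OF f] fn_ev[OF gf] dec_nat[OF _ f g A B])
qed

definition Sm :: "'u set_arr \<Rightarrow> 'u set_arr"
  where "Sm g = mk_arr (So (dm g)) (\<lambda>s. famc (cd g) (\<lambda>f. dec (dm g) s (f \<odot> g))) (So (cd g))"

definition S\<eta> :: "'u set \<Rightarrow> 'u set_arr"
  where "S\<eta> X = mk_arr X (\<lambda>x. famc X (\<lambda>f. fn (\<eta> (cd f)) (fn f x))) (So X)"

text \<open>The component of a product \<open>\<mu> \<Phi>\<close> at \<open>f : X \<rightarrow> A\<close> is obtained from the component of \<open>\<Phi>\<close> at the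
  evaluation map \<open>ev X f\<close>, which is again a map into a finite set.\<close>

definition S\<mu> :: "'u set \<Rightarrow> 'u set_arr"
  where "S\<mu> X = mk_arr (So (So X)) (\<lambda>\<Phi>. famc X (\<lambda>f. fn (\<mu> (cd f)) (dec (So X) \<Phi> (ev X f)))) (So X)"

lemma dec_Sm:
  assumes g: "g \<in> Hom X Y" and s: "s \<in> So X"
  shows "fn (Sm g) s \<in> So Y" "f \<in> Hom Y A \<Longrightarrow> finite A \<Longrightarrow> dec Y (fn (Sm g) s) f = dec X s (f \<odot> g)"
proof -
  have 1: "fn (Sm g) s = famc Y (\<lambda>f. dec X s (f \<odot> g))" using g s by (simp add: Sm_def dm_cd)
  have 2: "dec X s (f \<odot> g) \<in> To A" if "f \<in> Hom Y A" "finite A" for f A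
    using that dec_mem[OF s scmp_hom[OF g]] by blast
  have 3: "dec X s ((h \<odot> f) \<odot> g) = fn (Tm h) (dec X s (f \<odot> g))"
    if "f \<in> Hom Y A" "h \<in> Hom A B" "finite A" "finite B" for f h A B
    using that dec_nat[OF s scmp_hom[OF g]] by (simp add: scmp_assoc[OF g])
  note c = famc[of Y "\<lambda>f. dec X s (f \<odot> g)", OF hom_small(2)[OF g] 2 3]
  show "fn (Sm g) s \<in> So Y" "f \<in> Hom Y A \<Longrightarrow> finite A \<Longrightarrow> dec Y (fn (Sm g) s) f = dec X s (f \<odot> g)"
    unfolding 1 by (rule c, assumption+)+
qed

lemma Sm_hom: "g \<in> Hom X Y \<Longrightarrow> Sm g \<in> Hom (So X) (So Y)"
proof -
  assume g: "g \<in> Hom X Y"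
  have "fn (Sm g) s \<in> So Y" if "s \<in> So X" for s by (rule dec_Sm[OF g that])
  then show ?thesis using hom_small[OF g] enc(2) g
    by (auto simp: Sm_def dm_cd)
qed

lemma dec_S\<eta>:
  assumes X: "small X" and x: "x \<in> X"
  shows "fn (S\<eta> X) x \<in> So X" "f \<in> Hom X A \<Longrightarrow> finite A \<Longrightarrow> dec X (fn (S\<eta> X) x) f = fn (\<eta> A) (fn f x)"
proof -
  let ?h = "\<lambda>f. fn (\<eta> (cd f)) (fn f x)"
  have 1: "fn (S\<eta> X) x = famc X ?h" using x by (simp add: S\<eta>_def)
  have 2: "?h f \<in> To A" if "f \<in> Hom X A" "finite A" for f A
    using that x by (auto simp: dm_cd intro: fn_mem \<eta>_hom)
  have 3: "?h (g \<odot> f) = fn (Tm g) (?h f)"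
    if f: "f \<in> Hom X A" and g: "g \<in> Hom A B" and A: "finite A" and B: "finite B" for f g A B
  proof -
    have "fn (\<eta> B \<odot> g) (fn f x) = fn (Tm g \<odot> \<eta> A) (fn f x)" using \<eta>_nat[OF g A B] by simp
    then show ?thesis
      using fn_mem[OF f x] x by (simp add: fn_scmp[OF g] fn_scmp[OF \<eta>_hom[OF A]] fn_scmp[OF f] dm_cd[OF f] cd_cmp[OF f g])
  qed
  note c = famc[of X ?h, OF X 2 3]
  show "fn (S\<eta> X) x \<in> So X" unfolding 1 by (rule c, assumption+)
  show "dec X (fn (S\<eta> X) x) f = fn (\<eta> A) (fn f x)" if "f \<in> Hom X A" "finite A"
  proof -
    have "dec X (famc X ?h) f = ?h f" by (rule c(2), assumption+, (rule that)+)
    then show ?thesis unfolding 1 using that by (simp add: dm_cd)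
  qed
qed

lemma S\<eta>_hom: "small X \<Longrightarrow> S\<eta> X \<in> Hom X (So X)"
proof -
  assume X: "small X"
  have "fn (S\<eta> X) x \<in> So X" if "x \<in> X" for x by (rule dec_S\<eta>[OF X that])
  then show ?thesis using X enc(2) by (auto simp: S\<eta>_def)
qed

text \<open>The proposed components of the product are compatible because three naturalities
  combine: that of the projections (\<open>ev_nat\<close>), that of the family \<Phi> along
  \<open>Tm g\<close>, and that of \<open>\<mu>\<close>.\<close>

lemma dec_S\<mu>:
  assumes X: "small X" and \<Phi>: "\<Phi> \<in> So (So X)"
  shows "fn (S\<mu> X) \<Phi> \<in> So X"
    "f \<in> Hom X A \<Longrightarrow> finite A \<Longrightarrow> dec X (fn (S\<mu> X) \<Phi>) f = fn (\<mu> A) (dec (So X) \<Phi> (ev X f))"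
proof -
  let ?h = "\<lambda>f. fn (\<mu> (cd f)) (dec (So X) \<Phi> (ev X f))"
  have 1: "fn (S\<mu> X) \<Phi> = famc X ?h" using \<Phi> by (simp add: S\<mu>_def)
  have m: "dec (So X) \<Phi> (ev X f) \<in> To (To A)" if "f \<in> Hom X A" "finite A" for f A
    using dec_mem[OF \<Phi> ev_hom[OF that] T_finite[OF that(2)]] .
  have 2: "?h f \<in> To A" if "f \<in> Hom X A" "finite A" for f A
    using fn_mem[OF \<mu>_hom m[OF that]] that by (simp add: dm_cd)
  have 3: "?h (g \<odot> f) = fn (Tm g) (?h f)"
    if f: "f \<in> Hom X A" and g: "g \<in> Hom A B" and A: "finite A" and B: "finite B" for f g A B
  proof -
    note TA = T_finite[OF A] and TB = T_finite[OF B] and Tg = T_hom[OF g A B]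
    let ?t = "dec (So X) \<Phi> (ev X f)"
    have "dec (So X) \<Phi> (ev X (g \<odot> f)) = fn (Tm (Tm g)) ?t"
      using dec_nat[OF \<Phi> ev_hom[OF f A] Tg TA TB] by (simp add: ev_nat[OF f g A B])
    moreover have "fn (\<mu> B \<odot> Tm (Tm g)) ?t = fn (Tm g \<odot> \<mu> A) ?t" using \<mu>_nat[OF g A B] by simp
    ultimately show ?thesis using m[OF f A]
      by (simp add: fn_scmp[OF T_hom[OF Tg TA TB]] fn_scmp[OF \<mu>_hom[OF A]] dm_cd[OF f] cd_cmp[OF f g])
  qed
  note c = famc[of X ?h, OF X 2 3]
  show "fn (S\<mu> X) \<Phi> \<in> So X" unfolding 1 by (rule c, assumption+)
  show "dec X (fn (S\<mu> X) \<Phi>) f = fn (\<mu> A) (dec (So X) \<Phi> (ev X f))" if "f \<in> Hom X A" "finite A"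
  proof -
    have "dec X (famc X ?h) f = ?h f" by (rule c(2), assumption+, (rule that)+)
    then show ?thesis unfolding 1 using that by (simp add: dm_cd)
  qed
qed

lemma S\<mu>_hom: "small X \<Longrightarrow> S\<mu> X \<in> Hom (So (So X)) (So X)"
proof -
  assume X: "small X"
  have "fn (S\<mu> X) x \<in> So X" if "x \<in> So (So X)" for x by (rule dec_S\<mu>[OF X that])
  then show ?thesis using X enc(2) by (auto simp: S\<mu>_def)
qed

definition push_ftor :: "('u set, 'u set_arr, 'u set, 'u set_arr) ftor"
  where "push_ftor = \<lparr>fob = So, far = Sm\<rparr>"

definition push_mnd :: "('u set, 'u set_arr) mnd"
  where "push_mnd = \<lparr>mfun = push_ftor, munit = S\<eta>, mmult = S\<mu>\<rparr>"

definition counit :: "'u set \<Rightarrow> 'u set_arr"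
  where "counit A = ev A (sid A)"

lemma push_simps [simp]: "fob push_ftor = So" "far push_ftor = Sm"
  "mfun push_mnd = push_ftor" "munit push_mnd = S\<eta>" "mmult push_mnd = S\<mu>"
  by (simp_all add: push_ftor_def push_mnd_def)

lemma arr_So_eqI:
  assumes "p \<in> Hom Z (So X)" "q \<in> Hom Z (So X)"
    "\<And>z f A. z \<in> Z \<Longrightarrow> f \<in> Hom X A \<Longrightarrow> finite A \<Longrightarrow> dec X (fn p z) f = dec X (fn q z) f"
  shows "p = q"
  using assms by (blast intro: arr_eqI So_eqI fn_mem)

lemma push_ftor: "cat_functor Set_cat Set_cat push_ftor"
proof (rule cat_functorI; (intro category_Set)?)
  fix X :: "'u set" assume "X \<in> obj Set_cat" then have X: "small X" by simp
  then show "fob push_ftor X \<in> obj Set_cat" by (simp add: enc)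
  show "far push_ftor (sid X) = sid (fob push_ftor X)"
    using X by (simp, intro arr_So_eqI[OF Sm_hom[OF sid_hom] sid_hom]) 
      (simp_all add: enc dec_Sm[OF sid_hom] scmp_sid)
next
  fix f and X Y :: "'u set" assume "f \<in> Hom X Y" then show "far push_ftor f \<in> Hom (fob push_ftor X) (fob push_ftor Y)"
    by (simp add: Sm_hom)
next
  fix f g and X Y Z :: "'u set" assume f: "f \<in> Hom X Y" and g: "g \<in> Hom Y Z"
  note gf = scmp_hom[OF f g]
  have "Sm (g \<odot> f) = Sm g \<odot> Sm f"
  proof (rule arr_So_eqI[OF Sm_hom[OF gf] scmp_hom[OF Sm_hom[OF f] Sm_hom[OF g]]])
    fix s h A assume s: "s \<in> So X" and h: "h \<in> Hom Z A" and A: "finite A"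
    show "dec Z (fn (Sm (g \<odot> f)) s) h = dec Z (fn (Sm g \<odot> Sm f) s) h"
      using s dec_Sm[OF gf s] dec_Sm[OF g dec_Sm(1)[OF f s]] dec_Sm[OF f s] scmp_hom[OF g h] h A
      by (simp add: fn_scmp[OF Sm_hom[OF f]] scmp_assoc[OF f g h])
  qed
  then show "far push_ftor (g \<odot> f) = far push_ftor g \<odot> far push_ftor f" by simp
qed

text \<open>Together with \<open>ev_S\<eta>\<close> and \<open>ev_S\<mu>\<close> this moves a
  projection past each structure map of the pushforward, leaving structure maps of T at finite sets.
  Every monad law then reduces to the law of T at one finite set.\<close>

lemma ev_Sm: "g \<in> Hom X Y \<Longrightarrow> f \<in> Hom Y A \<Longrightarrow> finite A \<Longrightarrow> ev Y f \<odot> Sm g = ev X (f \<odot> g)"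
proof -
  assume g: "g \<in> Hom X Y" and f: "f \<in> Hom Y A" and A: "finite A"
  note fg = scmp_hom[OF g f]
  show ?thesis
    by (rule arr_eqI[OF scmp_hom[OF Sm_hom[OF g] ev_hom[OF f A]] ev_hom[OF fg A]])
      (simp add: fn_scmp[OF Sm_hom[OF g]] fn_ev[OF f] fn_ev[OF fg] dec_Sm(1)[OF g] dec_Sm(2)[OF g _ f A])
qed

lemma ev_S\<eta>: "f \<in> Hom X A \<Longrightarrow> finite A \<Longrightarrow> ev X f \<odot> S\<eta> X = \<eta> A \<odot> f"
proof -
  assume f: "f \<in> Hom X A" and A: "finite A"
  note X = hom_small(1)[OF f]
  show ?thesis
    by (rule arr_eqI[OF scmp_hom[OF S\<eta>_hom[OF X] ev_hom[OF f A]] scmp_hom[OF f \<eta>_hom[OF A]]])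
      (simp add: fn_scmp[OF S\<eta>_hom[OF X]] fn_scmp[OF f] fn_ev[OF f] dec_S\<eta>[OF X] f A)
qed

lemma ev_S\<mu>: "f \<in> Hom X A \<Longrightarrow> finite A \<Longrightarrow> ev X f \<odot> S\<mu> X = \<mu> A \<odot> ev (So X) (ev X f)"
proof -
  assume f: "f \<in> Hom X A" and A: "finite A"
  note X = hom_small(1)[OF f] and e = ev_hom[OF f A] and TA = T_finite[OF A]
  show ?thesis
    by (rule arr_eqI[OF scmp_hom[OF S\<mu>_hom[OF X] e] scmp_hom[OF ev_hom[OF e TA] \<mu>_hom[OF A]]])
      (simp add: fn_scmp[OF S\<mu>_hom[OF X]] fn_scmp[OF ev_hom[OF e TA]] fn_ev[OF f] fn_ev[OF e] dec_S\<mu>[OF X] f A)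
qed

lemma arr_So_ev_eqI:
  assumes p: "p \<in> Hom Z (So X)" and q: "q \<in> Hom Z (So X)"
    and eq: "\<And>f A. f \<in> Hom X A \<Longrightarrow> finite A \<Longrightarrow> ev X f \<odot> p = ev X f \<odot> q"
  shows "p = q"
proof (rule arr_So_eqI[OF p q])
  fix z f A assume z: "z \<in> Z" and f: "f \<in> Hom X A" and A: "finite A"
  have "fn (ev X f \<odot> p) z = fn (ev X f \<odot> q) z" using eq[OF f A] by simp
  then show "dec X (fn p z) f = dec X (fn q z) f"
    using z by (simp add: fn_scmp[OF p] fn_scmp[OF q] fn_ev[OF f] fn_mem[OF p] fn_mem[OF q])
qed

lemma S\<eta>_nat: "f \<in> Hom X Y \<Longrightarrow> S\<eta> Y \<odot> f = Sm f \<odot> S\<eta> X"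
proof -
  assume f: "f \<in> Hom X Y"
  note X = hom_small(1)[OF f] and Y = hom_small(2)[OF f]
  show ?thesis
  proof (rule arr_So_ev_eqI[OF scmp_hom[OF f S\<eta>_hom[OF Y]] scmp_hom[OF S\<eta>_hom[OF X] Sm_hom[OF f]]])
    fix h A assume h: "h \<in> Hom Y A" and A: "finite A"
    have "ev Y h \<odot> (S\<eta> Y \<odot> f) = (\<eta> A \<odot> h) \<odot> f"
      by (simp add: scmp_assoc[OF f S\<eta>_hom[OF Y] ev_hom[OF h A], symmetric] ev_S\<eta>[OF h A])
    also have "\<dots> = ev X (h \<odot> f) \<odot> S\<eta> X"
      by (simp add: ev_S\<eta>[OF scmp_hom[OF f h] A] scmp_assoc[OF f h \<eta>_hom[OF A]])
    also have "\<dots> = ev Y h \<odot> (Sm f \<odot> S\<eta> X)"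
      by (simp add: scmp_assoc[OF S\<eta>_hom[OF X] Sm_hom[OF f] ev_hom[OF h A], symmetric] ev_Sm[OF f h A])
    finally show "ev Y h \<odot> (S\<eta> Y \<odot> f) = ev Y h \<odot> (Sm f \<odot> S\<eta> X)" .
  qed
qed

lemma S\<mu>_nat: "f \<in> Hom X Y \<Longrightarrow> S\<mu> Y \<odot> Sm (Sm f) = Sm f \<odot> S\<mu> X"
proof -
  assume f: "f \<in> Hom X Y"
  note X = hom_small(1)[OF f] and Y = hom_small(2)[OF f] and SSf = Sm_hom[OF Sm_hom[OF f]]
  show ?thesis
  proof (rule arr_So_ev_eqI[OF scmp_hom[OF SSf S\<mu>_hom[OF Y]] scmp_hom[OF S\<mu>_hom[OF X] Sm_hom[OF f]]])
    fix h A assume h: "h \<in> Hom Y A" and A: "finite A"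
    note TA = T_finite[OF A] and e = ev_hom[OF h A]
    have "ev Y h \<odot> (S\<mu> Y \<odot> Sm (Sm f)) = (\<mu> A \<odot> ev (So Y) (ev Y h)) \<odot> Sm (Sm f)"
      by (simp add: scmp_assoc[OF SSf S\<mu>_hom[OF Y] e, symmetric] ev_S\<mu>[OF h A])
    also have "\<dots> = \<mu> A \<odot> ev (So X) (ev X (h \<odot> f))"
      by (simp add: scmp_assoc[OF SSf ev_hom[OF e TA] \<mu>_hom[OF A]] ev_Sm[OF Sm_hom[OF f] e TA] ev_Sm[OF f h A])
    also have "\<dots> = ev Y h \<odot> (Sm f \<odot> S\<mu> X)"
      by (simp add: scmp_assoc[OF S\<mu>_hom[OF X] Sm_hom[OF f] e, symmetric] ev_Sm[OF f h A]
          ev_S\<mu>[OF scmp_hom[OF f h] A])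
    finally show "ev Y h \<odot> (S\<mu> Y \<odot> Sm (Sm f)) = ev Y h \<odot> (Sm f \<odot> S\<mu> X)" .
  qed
qed

lemma push_mnd: "monad_on Set_cat push_mnd"
proof -
  have 1: "nat_trans Set_cat Set_cat id_ftor push_ftor S\<eta>"
    by (rule nat_transI) (auto simp: push_ftor cat_functor_id category_Set S\<eta>_hom S\<eta>_nat)
  have 2: "nat_trans Set_cat Set_cat (push_ftor \<circ>\<^sub>F push_ftor) push_ftor S\<mu>"
    by (rule nat_transI) (auto simp: push_ftor cat_functor_comp[OF push_ftor push_ftor] S\<mu>_hom S\<mu>_nat)
  have 3: "S\<mu> X \<odot> S\<eta> (So X) = sid (So X)" if X: "small X" for X
  proof (rule arr_So_ev_eqI[OF scmp_hom[OF S\<eta>_hom[OF enc(2)[OF X]] S\<mu>_hom[OF X]] sid_hom[OF enc(2)[OF X]]])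
    fix f A assume f: "f \<in> Hom X A" and A: "finite A"
    note e = ev_hom[OF f A] and TA = T_finite[OF A] and SX = enc(2)[OF X]
    have "ev X f \<odot> (S\<mu> X \<odot> S\<eta> (So X)) = (\<mu> A \<odot> \<eta> (To A)) \<odot> ev X f"
      by (simp add: scmp_assoc[OF S\<eta>_hom[OF SX] S\<mu>_hom[OF X] e, symmetric] ev_S\<mu>[OF f A]
          scmp_assoc[OF S\<eta>_hom[OF SX] ev_hom[OF e TA] \<mu>_hom[OF A]] ev_S\<eta>[OF e TA]
          scmp_assoc[OF e \<eta>_hom[OF TA] \<mu>_hom[OF A]])
    also have "\<dots> = ev X f \<odot> sid (So X)" using T.unit_left[of A] A by (simp add: scmp_sid[OF e])
    finally show "ev X f \<odot> (S\<mu> X \<odot> S\<eta> (So X)) = ev X f \<odot> sid (So X)" .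
  qed
  have 4: "S\<mu> X \<odot> Sm (S\<eta> X) = sid (So X)" if X: "small X" for X
  proof (rule arr_So_ev_eqI[OF scmp_hom[OF Sm_hom[OF S\<eta>_hom[OF X]] S\<mu>_hom[OF X]] sid_hom[OF enc(2)[OF X]]])
    fix f A assume f: "f \<in> Hom X A" and A: "finite A"
    note e = ev_hom[OF f A] and TA = T_finite[OF A] and \<eta>A = \<eta>_hom[OF A] and S\<eta>X = S\<eta>_hom[OF X]
    have "ev X f \<odot> (S\<mu> X \<odot> Sm (S\<eta> X)) = \<mu> A \<odot> (ev (So X) (ev X f) \<odot> Sm (S\<eta> X))"
      by (simp add: scmp_assoc[OF Sm_hom[OF S\<eta>X] S\<mu>_hom[OF X] e, symmetric] ev_S\<mu>[OF f A]
          scmp_assoc[OF Sm_hom[OF S\<eta>X] ev_hom[OF e TA] \<mu>_hom[OF A]])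
    also have "\<dots> = (\<mu> A \<odot> Tm (\<eta> A)) \<odot> ev X f"
      by (simp add: ev_Sm[OF S\<eta>X e TA] ev_S\<eta>[OF f A] ev_nat[OF f \<eta>A A TA] scmp_assoc[OF e T_hom[OF \<eta>A A TA] \<mu>_hom[OF A]])
    also have "\<dots> = ev X f \<odot> sid (So X)" using T.unit_right[of A] A by (simp add: scmp_sid[OF e])
    finally show "ev X f \<odot> (S\<mu> X \<odot> Sm (S\<eta> X)) = ev X f \<odot> sid (So X)" .
  qed
  have 5: "S\<mu> X \<odot> S\<mu> (So X) = S\<mu> X \<odot> Sm (S\<mu> X)" if X: "small X" for X
  proof -
    note SX = enc(2)[OF X] note \<mu>X = S\<mu>_hom[OF X] and \<mu>SX = S\<mu>_hom[OF SX]
    show ?thesis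
    proof (rule arr_So_ev_eqI[OF scmp_hom[OF \<mu>SX \<mu>X] scmp_hom[OF Sm_hom[OF \<mu>X] \<mu>X]])
      fix f A assume f: "f \<in> Hom X A" and A: "finite A"
      note e = ev_hom[OF f A] and TA = T_finite[OF A] and \<mu>A = \<mu>_hom[OF A]
      note TTA = T_finite[OF TA] and ee = ev_hom[OF e TA] note eee = ev_hom[OF ee TTA]
      \<comment> \<open>Both sides turn into the threefold evaluation into
        \<open>To (To (To A))\<close> followed by two multiplications, where associativity of T at A
        applies.\<close>
      have "ev X f \<odot> (S\<mu> X \<odot> S\<mu> (So X)) = \<mu> A \<odot> (\<mu> (To A) \<odot> ev (So (So X)) (ev (So X) (ev X f)))"
        by (simp add: scmp_assoc[OF \<mu>SX \<mu>X e, symmetric] ev_S\<mu>[OF f A]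
            scmp_assoc[OF \<mu>SX ee \<mu>A] ev_S\<mu>[OF e TA])
      also have "\<dots> = (\<mu> A \<odot> Tm (\<mu> A)) \<odot> ev (So (So X)) (ev (So X) (ev X f))"
        using T.assoc[of A] A by (simp add: scmp_assoc[OF eee \<mu>_hom[OF TA] \<mu>A, symmetric])
      also have "\<dots> = \<mu> A \<odot> ev (So (So X)) (\<mu> A \<odot> ev (So X) (ev X f))"
        by (simp add: scmp_assoc[OF eee T_hom[OF \<mu>A TTA TA] \<mu>A] ev_nat[OF ee \<mu>A TTA TA])
      also have "\<dots> = ev X f \<odot> (S\<mu> X \<odot> Sm (S\<mu> X))"
        by (simp add: scmp_assoc[OF Sm_hom[OF \<mu>X] \<mu>X e, symmetric] ev_S\<mu>[OF f A]
          scmp_assoc[OF Sm_hom[OF \<mu>X] ee \<mu>A] ev_Sm[OF \<mu>X e TA])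
      finally show "ev X f \<odot> (S\<mu> X \<odot> S\<mu> (So X)) = ev X f \<odot> (S\<mu> X \<odot> Sm (S\<mu> X))" .
    qed
  qed
  show ?thesis unfolding monad_on_def monad_on_axioms_def
    using 1 2 3 4 5 category_Set by simp
qed

end

lemma right_kan_extension_factor:
  assumes kan: "right_kan_extension A B C G F R \<epsilon>" and H: "cat_functor B C H"
    and \<sigma>: "nat_trans A C (H \<circ>\<^sub>F G) F \<sigma>"
  obtains \<tau> where "nat_trans B C H R \<tau>" "\<forall>a\<in>obj A. \<epsilon> a \<cdot>\<^bsub>C\<^esub> \<tau> (fob G a) = \<sigma> a"
    "\<forall>\<tau>'. nat_trans B C H R \<tau>' \<and> (\<forall>a\<in>obj A. \<epsilon> a \<cdot>\<^bsub>C\<^esub> \<tau>' (fob G a) = \<sigma> a) \<longrightarrow>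
      (\<forall>b\<in>obj B. \<tau>' b = \<tau> b)"
proof -
  have *: "\<forall>H \<sigma>. cat_functor B C H \<and> nat_trans A C (H \<circ>\<^sub>F G) F \<sigma> \<longrightarrow>
      (\<exists>\<tau>. nat_trans B C H R \<tau> \<and> (\<forall>a\<in>obj A. \<epsilon> a \<cdot>\<^bsub>C\<^esub> \<tau> (fob G a) = \<sigma> a) \<and>
        (\<forall>\<tau>'. nat_trans B C H R \<tau>' \<and> (\<forall>a\<in>obj A. \<epsilon> a \<cdot>\<^bsub>C\<^esub> \<tau>' (fob G a) = \<sigma> a) \<longrightarrow>
          (\<forall>b\<in>obj B. \<tau>' b = \<tau> b)))"
    using kan unfolding right_kan_extension_def by (elim conjE)
  show ?thesis
    using mp[OF spec[OF spec[OF *]] conjI[OF H \<sigma>]] by (elim exE conjE) (rule that, assumption+)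
qed

context finset_monad
begin

lemma counit_hom: "finite A \<Longrightarrow> counit A \<in> Hom (So A) (To A)"
  unfolding counit_def by (rule ev_hom[OF sid_hom]) (simp_all add: small_finite)

text \<open>Every projection is the counit after a functor action. Hence a transformation into
  \<open>push_ftor\<close> is determined by its components at finite sets followed by the counit,
  which gives uniqueness in the Kan extension.\<close>

lemma counit_Sm: "f \<in> Hom X A \<Longrightarrow> finite A \<Longrightarrow> counit A \<odot> Sm f = ev X f"
  unfolding counit_def
  using ev_Sm[of f X A "sid A" A] sid_hom[of A] hom_small(2)[of f X A] scmp_sid(2)[of f X A] by simp

lemma counit_nat: "f \<in> Hom A B \<Longrightarrow> finite A \<Longrightarrow> finite B \<Longrightarrow> counit B \<odot> Sm f = Tm f \<odot> counit A"
proof -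
  assume f: "f \<in> Hom A B" and A: "finite A" and B: "finite B"
  have "ev A (f \<odot> sid A) = Tm f \<odot> counit A"
    unfolding counit_def by (rule ev_nat[OF sid_hom f A B]) (simp add: A small_finite)
  then show ?thesis using counit_Sm[OF f B] by (simp add: scmp_sid(1)[OF f])
qed

lemma incl_T_functor: "cat_functor FinSet_cat Set_cat (FinSet_incl \<circ>\<^sub>F mfun T)"
  by (rule cat_functor_comp[OF T.unit.G.cat_functor_axioms FinSet_incl_functor])

lemma counit_trans: "nat_trans FinSet_cat Set_cat (push_ftor \<circ>\<^sub>F FinSet_incl) (FinSet_incl \<circ>\<^sub>F mfun T) counit"
  by (rule nat_transI)
    (auto simp: incl_T_functor cat_functor_comp[OF FinSet_incl_functor push_ftor] counit_hom counit_nat hom_FinSet)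

lemma push_kan:
  "right_kan_extension FinSet_cat Set_cat Set_cat FinSet_incl (FinSet_incl \<circ>\<^sub>F mfun T) push_ftor counit"
  unfolding right_kan_extension_def
proof (intro conjI FinSet_incl_functor incl_T_functor push_ftor counit_trans allI impI, elim conjE)
  fix H and \<sigma> :: "'u set \<Rightarrow> 'u set_arr"
  assume H: "cat_functor Set_cat Set_cat H"
    and "nat_trans FinSet_cat Set_cat (H \<circ>\<^sub>F FinSet_incl) (FinSet_incl \<circ>\<^sub>F mfun T) \<sigma>"
  then interpret \<sigma>: nat_trans FinSet_cat Set_cat "H \<circ>\<^sub>F FinSet_incl" "FinSet_incl \<circ>\<^sub>F mfun T" \<sigma> by simp
  interpret H: cat_functor Set_cat Set_cat H by (rule H)
  have \<sigma>h: "\<sigma> A \<in> Hom (fob H A) (To A)" if "finite A" for A using \<sigma>.component[of A] that by simp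
  have \<sigma>n: "\<sigma> B \<odot> far H f = Tm f \<odot> \<sigma> A" if "f \<in> Hom A B" "finite A" "finite B" for f A B
    using \<sigma>.naturality[of f A B] that by (simp add: hom_FinSet)
  have Hh: "far H f \<in> Hom (fob H X) (fob H Y)" if "f \<in> Hom X Y" for f X Y using H.far_hom[OF that] .
  \<comment> \<open>The component at f is forced: naturality carries \<open>\<tau> X\<close> along f
    to the finite codomain, where composing with the counit has to give
    \<open>\<sigma>\<close>.\<close>
  define \<tau> where "\<tau> X = mk_arr (fob H X) (\<lambda>h. famc X (\<lambda>f. fn (\<sigma> (cd f) \<odot> far H f) h)) (So X)" for X
  have 1: "fn (\<tau> X) h \<in> So X"
    and 2: "\<And>f A. f \<in> Hom X A \<Longrightarrow> finite A \<Longrightarrow> dec X (fn (\<tau> X) h) f = fn (\<sigma> A \<odot> far H f) h"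
    if X: "small X" and h: "h \<in> fob H X" for X h
  proof -
    let ?h = "\<lambda>f. fn (\<sigma> (cd f) \<odot> far H f) h"
    have e: "fn (\<tau> X) h = famc X ?h" using h by (simp add: \<tau>_def)
    have 1: "?h f \<in> To A" if "f \<in> Hom X A" "finite A" for f A
      using fn_mem[OF scmp_hom[OF Hh \<sigma>h] h] that by (simp add: dm_cd)
    have 2: "?h (g \<odot> f) = fn (Tm g) (?h f)"
      if f: "f \<in> Hom X A" and g: "g \<in> Hom A B" and A: "finite A" and B: "finite B" for f g A B
    proof -
      have "\<sigma> B \<odot> far H (g \<odot> f) = Tm g \<odot> (\<sigma> A \<odot> far H f)"
        by (simp add: H.far_cmp[OF f g] scmp_assoc[OF Hh[OF f] Hh[OF g] \<sigma>h[OF B], symmetric]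
            scmp_assoc[OF Hh[OF f] \<sigma>h[OF A] T_hom[OF g A B], symmetric] \<sigma>n[OF g A B])
      then show ?thesis using h
        by (simp add: cd_cmp[OF f g] dm_cd[OF f] fn_scmp[OF scmp_hom[OF Hh[OF f] \<sigma>h[OF A]]])
    qed
    note c = famc[of X ?h, OF X 1 2]
    show "fn (\<tau> X) h \<in> So X" unfolding e by (rule c, assumption+)
    show "dec X (fn (\<tau> X) h) f = fn (\<sigma> A \<odot> far H f) h" if "f \<in> Hom X A" "finite A" for f A
    proof -
      have "dec X (famc X ?h) f = ?h f" by (rule c(2), assumption+, (rule that)+)
      then show ?thesis unfolding e using that by (simp add: dm_cd)
    qed
  qed
  have \<tau>h: "\<tau> X \<in> Hom (fob H X) (So X)" if X: "small X" for X
    using 1[OF X] enc(2)[OF X] H.fob_obj[of X] X by (auto simp: \<tau>_def)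
  have ev\<tau>: "ev X f \<odot> \<tau> X = \<sigma> A \<odot> far H f" if f: "f \<in> Hom X A" and A: "finite A" for f X A
  proof -
    note X = hom_small(1)[OF f]
    show ?thesis
      by (rule arr_eqI[OF scmp_hom[OF \<tau>h[OF X] ev_hom[OF f A]] scmp_hom[OF Hh[OF f] \<sigma>h[OF A]]])
        (use 1[OF X] 2[OF X _ f A] in \<open>simp add: fn_scmp[OF \<tau>h[OF X]] fn_ev[OF f]\<close>)
  qed
  have \<tau>n: "\<tau> Y \<odot> far H f = Sm f \<odot> \<tau> X" if f: "f \<in> Hom X Y" for f X Y
  proof -
    note X = hom_small(1)[OF f] and Y = hom_small(2)[OF f]
    show ?thesis
    proof (rule arr_So_ev_eqI[OF scmp_hom[OF Hh[OF f] \<tau>h[OF Y]] scmp_hom[OF \<tau>h[OF X] Sm_hom[OF f]]])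
      fix g A assume g: "g \<in> Hom Y A" and A: "finite A"
      have "ev Y g \<odot> (\<tau> Y \<odot> far H f) = (\<sigma> A \<odot> far H g) \<odot> far H f"
        by (simp add: scmp_assoc[OF Hh[OF f] \<tau>h[OF Y] ev_hom[OF g A], symmetric] ev\<tau>[OF g A])
      also have "\<dots> = ev X (g \<odot> f) \<odot> \<tau> X"
        by (simp add: scmp_assoc[OF Hh[OF f] Hh[OF g] \<sigma>h[OF A]] ev\<tau>[OF scmp_hom[OF f g] A] H.far_cmp[OF f g])
      also have "\<dots> = ev Y g \<odot> (Sm f \<odot> \<tau> X)"
        by (simp add: scmp_assoc[OF \<tau>h[OF X] Sm_hom[OF f] ev_hom[OF g A], symmetric] ev_Sm[OF f g A])
      finally show "ev Y g \<odot> (\<tau> Y \<odot> far H f) = ev Y g \<odot> (Sm f \<odot> \<tau> X)" .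
    qed
  qed
  have c\<tau>: "counit A \<odot> \<tau> A = \<sigma> A" if A: "finite A" for A
    using ev\<tau>[OF sid_hom A] H.far_idt[of A] scmp_sid(1)[OF \<sigma>h[OF A]] A
    by (simp add: counit_def small_finite)
  \<comment> \<open>\<open>ev X f\<close> is the counit after \<open>Sm f\<close>, so naturality
    moves \<open>\<tau>'\<close> from X to the finite set A, where its composite with the counit is
    prescribed.\<close>
  have u: "\<tau>' X = \<tau> X" if \<tau>': "nat_trans Set_cat Set_cat H push_ftor \<tau>'"
    and c\<tau>': "\<And>A. finite A \<Longrightarrow> counit A \<odot> \<tau>' A = \<sigma> A" and X: "small X" for \<tau>' X
  proof -
    interpret \<tau>': nat_trans Set_cat Set_cat H push_ftor \<tau>' by (rule \<tau>')
    have \<tau>'h: "\<tau>' X \<in> Hom (fob H X) (So X)" if "small X" for X using \<tau>'.component[of X] that by simp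
    show ?thesis
    proof (rule arr_So_ev_eqI[OF \<tau>'h[OF X] \<tau>h[OF X]])
      fix f A assume f: "f \<in> Hom X A" and A: "finite A"
      have "ev X f \<odot> \<tau>' X = counit A \<odot> (Sm f \<odot> \<tau>' X)"
        by (simp add: counit_Sm[OF f A, symmetric] scmp_assoc[OF \<tau>'h[OF X] Sm_hom[OF f] counit_hom[OF A]])
      also have "\<dots> = (counit A \<odot> \<tau>' A) \<odot> far H f"
        using \<tau>'.naturality[OF f]
        by (simp add: scmp_assoc[OF Hh[OF f] \<tau>'h[OF small_finite[OF A]] counit_hom[OF A]])
      also have "\<dots> = ev X f \<odot> \<tau> X" by (simp add: c\<tau>'[OF A] ev\<tau>[OF f A])
      finally show "ev X f \<odot> \<tau>' X = ev X f \<odot> \<tau> X" .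
    qed
  qed
  have t: "nat_trans Set_cat Set_cat H push_ftor \<tau>"
    by (rule nat_transI) (auto simp: H push_ftor \<tau>h \<tau>n)
  show "\<exists>\<tau>. nat_trans Set_cat Set_cat H push_ftor \<tau> \<and>
      (\<forall>a\<in>obj FinSet_cat. counit a \<odot> \<tau> (fob FinSet_incl a) = \<sigma> a) \<and>
      (\<forall>\<tau>'. nat_trans Set_cat Set_cat H push_ftor \<tau>' \<and>
        (\<forall>a\<in>obj FinSet_cat. counit a \<odot> \<tau>' (fob FinSet_incl a) = \<sigma> a) \<longrightarrow>
        (\<forall>b\<in>obj Set_cat. \<tau>' b = \<tau> b))"
    by (rule exI[of _ \<tau>]) (auto simp: t c\<tau> intro: u)
qed

text \<open>The counit is the projection at an identity, so both compatibility conditions are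
  instances of \<open>ev_S\<eta>\<close> and \<open>ev_S\<mu>\<close> at
  \<open>sid A\<close>.\<close>

theorem push_is_pushforward: "is_pushforward FinSet_cat Set_cat FinSet_incl T push_mnd counit"
proof -
  have 1: "counit A \<odot> S\<eta> A = \<eta> A" if "finite A" for A
    using ev_S\<eta>[OF sid_hom that] that by (simp add: counit_def small_finite scmp_sid[OF \<eta>_hom])
  have 2: "counit A \<odot> S\<mu> A = \<mu> A \<odot> counit (To A) \<odot> Sm (counit A)" if A: "finite A" for A
  proof -
    note TA = T_finite[OF A] and s = sid_hom[OF small_finite[OF A]]
    show ?thesis using ev_S\<mu>[OF s A] A
      by (simp add: scmp_assoc[OF Sm_hom[OF counit_hom[OF A]] counit_hom[OF TA] \<mu>_hom[OF A]]
          counit_Sm[OF counit_hom[OF A] TA]) (simp add: counit_def)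
  qed
  show ?thesis unfolding is_pushforward_def using 1 2 monad push_mnd push_kan by simp
qed

end

section \<open>Arbitrary pushforwards and the values of their elements\<close>

locale finset_pushforward = finset_monad T
  for T :: "('u::zf_universe set, 'u set_arr) mnd" +
  fixes S :: "('u set, 'u set_arr) mnd" and \<epsilon>
  assumes push: "is_pushforward FinSet_cat Set_cat FinSet_incl T S \<epsilon>"
begin

lemma S_monad: "monad_on Set_cat S" using push by (simp add: is_pushforward_def)

sublocale S: monad_on Set_cat S by (rule S_monad)

lemma kan: "right_kan_extension FinSet_cat Set_cat Set_cat FinSet_incl (FinSet_incl \<circ>\<^sub>F mfun T) (mfun S) \<epsilon>"
  using push by (simp add: is_pushforward_def)

sublocale \<epsilon>: nat_trans FinSet_cat Set_cat "mfun S \<circ>\<^sub>F FinSet_incl" "FinSet_incl \<circ>\<^sub>F mfun T" \<epsilon>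
  using kan by (simp add: right_kan_extension_def)

abbreviation "Po \<equiv> fob (mfun S)"
abbreviation "Pm \<equiv> far (mfun S)"
abbreviation "P\<eta> \<equiv> munit S"
abbreviation "P\<mu> \<equiv> mmult S"

lemma P_small: "small X \<Longrightarrow> small (Po X)"
  using S.unit.G.fob_obj[of X] by simp

lemma Pm_hom: "f \<in> Hom X Y \<Longrightarrow> Pm f \<in> Hom (Po X) (Po Y)"
  by (rule S.unit.G.far_hom)

lemma P\<eta>_hom: "small X \<Longrightarrow> P\<eta> X \<in> Hom X (Po X)"
  using S.unit.component[of X] by simp

lemma P\<mu>_hom: "small X \<Longrightarrow> P\<mu> X \<in> Hom (Po (Po X)) (Po X)"
  using S.mult.component[of X] by simp

lemma P\<eta>_nat: "f \<in> Hom X Y \<Longrightarrow> P\<eta> Y \<odot> f = Pm f \<odot> P\<eta> X"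
  using S.unit.naturality[of f X Y] by simp

lemma P\<mu>_nat: "f \<in> Hom X Y \<Longrightarrow> P\<mu> Y \<odot> Pm (Pm f) = Pm f \<odot> P\<mu> X"
  using S.mult.naturality[of f X Y] by simp

lemma \<epsilon>_hom: "finite A \<Longrightarrow> \<epsilon> A \<in> Hom (Po A) (To A)"
  using \<epsilon>.component[of A] by simp

lemma \<epsilon>_nat: "f \<in> Hom A B \<Longrightarrow> finite A \<Longrightarrow> finite B \<Longrightarrow> \<epsilon> B \<odot> Pm f = Tm f \<odot> \<epsilon> A"
  using \<epsilon>.naturality[of f A B] by (simp add: hom_FinSet)

lemma \<epsilon>_unit: "finite A \<Longrightarrow> \<epsilon> A \<odot> P\<eta> A = \<eta> A"
  using push by (simp add: is_pushforward_def)

lemma \<epsilon>_mult: "finite A \<Longrightarrow> \<epsilon> A \<odot> P\<mu> A = \<mu> A \<odot> \<epsilon> (To A) \<odot> Pm (\<epsilon> A)"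
  using push by (simp add: is_pushforward_def)

text \<open>The counterpart of the projections \<open>ev\<close> for a pushforward given only by its
  universal property. That these arrows are jointly monic is no longer built in; it is the content
  of \<open>val_eqI\<close>.\<close>

definition eval :: "'u set_arr \<Rightarrow> 'u set_arr"
  where "eval f = \<epsilon> (cd f) \<odot> Pm f"

lemma eval_eq: "f \<in> Hom X A \<Longrightarrow> eval f = \<epsilon> A \<odot> Pm f"
  by (simp add: eval_def dm_cd)

lemma eval_hom: "f \<in> Hom X A \<Longrightarrow> finite A \<Longrightarrow> eval f \<in> Hom (Po X) (To A)"
  by (simp add: eval_eq scmp_hom[OF Pm_hom \<epsilon>_hom])

lemma eval_cmp: "f \<in> Hom X A \<Longrightarrow> g \<in> Hom A B \<Longrightarrow> finite A \<Longrightarrow> finite B \<Longrightarrow> eval (g \<odot> f) = Tm g \<odot> eval f"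
  by (simp add: eval_eq[OF scmp_hom] eval_eq S.unit.G.far_cmp \<epsilon>_nat
      scmp_assoc[OF Pm_hom Pm_hom \<epsilon>_hom, symmetric] scmp_assoc[OF Pm_hom \<epsilon>_hom T_hom, symmetric])

lemma eval_Pm: "g \<in> Hom X Y \<Longrightarrow> f \<in> Hom Y A \<Longrightarrow> finite A \<Longrightarrow> eval f \<odot> Pm g = eval (f \<odot> g)"
  by (simp add: eval_eq[OF scmp_hom] eval_eq S.unit.G.far_cmp scmp_assoc[OF Pm_hom Pm_hom \<epsilon>_hom])

lemma eval_unit: "f \<in> Hom X A \<Longrightarrow> finite A \<Longrightarrow> eval f \<odot> P\<eta> X = \<eta> A \<odot> f"
proof -
  assume f: "f \<in> Hom X A" and A: "finite A"
  note X = hom_small(1)[OF f] and A' = hom_small(2)[OF f]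
  have "eval f \<odot> P\<eta> X = \<epsilon> A \<odot> (P\<eta> A \<odot> f)"
    by (simp add: eval_eq[OF f] scmp_assoc[OF P\<eta>_hom[OF X] Pm_hom[OF f] \<epsilon>_hom[OF A]] P\<eta>_nat[OF f])
  then show ?thesis by (simp add: scmp_assoc[OF f P\<eta>_hom[OF A'] \<epsilon>_hom[OF A], symmetric] \<epsilon>_unit[OF A])
qed

text \<open>Naturality of \<open>P\<mu>\<close> moves the product to the finite set A, the
  multiplication condition on \<open>\<epsilon>\<close> applies there, and functoriality reassembles
  \<open>Pm (eval f)\<close>.\<close>

lemma eval_mult: "f \<in> Hom X A \<Longrightarrow> finite A \<Longrightarrow> eval f \<odot> P\<mu> X = \<mu> A \<odot> eval (eval f)"
proof -
  assume f: "f \<in> Hom X A" and A: "finite A"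
  note X = hom_small(1)[OF f] and A' = hom_small(2)[OF f] and TA = T_finite[OF A] and \<epsilon>A = \<epsilon>_hom[OF A]
  note Pf = Pm_hom[OF f]
  have "eval f \<odot> P\<mu> X = (\<epsilon> A \<odot> P\<mu> A) \<odot> Pm (Pm f)"
    by (simp add: eval_eq[OF f] scmp_assoc[OF P\<mu>_hom[OF X] Pf \<epsilon>A] P\<mu>_nat[OF f]
        scmp_assoc[OF Pm_hom[OF Pf] P\<mu>_hom[OF A'] \<epsilon>A])
  also have "\<dots> = \<mu> A \<odot> (\<epsilon> (To A) \<odot> (Pm (\<epsilon> A) \<odot> Pm (Pm f)))"
    by (simp add: \<epsilon>_mult[OF A] scmp_assoc[OF Pm_hom[OF \<epsilon>A] \<epsilon>_hom[OF TA] \<mu>_hom[OF A]]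
       scmp_assoc[OF Pm_hom[OF Pf] scmp_hom[OF Pm_hom[OF \<epsilon>A] \<epsilon>_hom[OF TA]] \<mu>_hom[OF A]]
       scmp_assoc[OF Pm_hom[OF Pf] Pm_hom[OF \<epsilon>A] \<epsilon>_hom[OF TA]])
  also have "Pm (\<epsilon> A) \<odot> Pm (Pm f) = Pm (eval f)"
    by (simp add: eval_eq[OF f] S.unit.G.far_cmp[OF Pf \<epsilon>A])
  finally show ?thesis using eval_eq[OF eval_hom[OF f A]] by simp
qed

definition val :: "'u set_arr \<Rightarrow> 'u \<Rightarrow> 'u"
  where "val f s = fn (eval f) s"

lemma val_mem: "f \<in> Hom X A \<Longrightarrow> finite A \<Longrightarrow> s \<in> Po X \<Longrightarrow> val f s \<in> To A"
  unfolding val_def by (rule fn_mem[OF eval_hom])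

lemma val_cmp: "s \<in> Po X \<Longrightarrow> f \<in> Hom X A \<Longrightarrow> g \<in> Hom A B \<Longrightarrow> finite A \<Longrightarrow> finite B \<Longrightarrow> val (g \<odot> f) s = fn (Tm g) (val f s)"
  unfolding val_def by (simp add: eval_cmp[of f X A] fn_scmp[OF eval_hom])

lemma val_Pm: "s \<in> Po X \<Longrightarrow> g \<in> Hom X Y \<Longrightarrow> f \<in> Hom Y A \<Longrightarrow> finite A \<Longrightarrow> val f (fn (Pm g) s) = val (f \<odot> g) s"
  unfolding val_def by (simp add: eval_Pm[symmetric] fn_scmp[OF Pm_hom])

lemma val_unit: "x \<in> X \<Longrightarrow> f \<in> Hom X A \<Longrightarrow> finite A \<Longrightarrow> val f (fn (P\<eta> X) x) = fn (\<eta> A) (fn f x)"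
proof -
  assume x: "x \<in> X" and f: "f \<in> Hom X A" and A: "finite A"
  show ?thesis using eval_unit[OF f A] fn_scmp[OF P\<eta>_hom[OF hom_small(1)[OF f]] x, of "eval f"] fn_scmp[OF f x, of "\<eta> A"]
    by (simp add: val_def)
qed

lemma val_mult: "\<Phi> \<in> Po (Po X) \<Longrightarrow> f \<in> Hom X A \<Longrightarrow> finite A \<Longrightarrow> val f (fn (P\<mu> X) \<Phi>) = fn (\<mu> A) (val (eval f) \<Phi>)"
proof -
  assume \<Phi>: "\<Phi> \<in> Po (Po X)" and f: "f \<in> Hom X A" and A: "finite A"
  note e = eval_hom[OF eval_hom[OF f A] T_finite[OF A]]
  show ?thesis using eval_mult[OF f A] fn_scmp[OF P\<mu>_hom[OF hom_small(1)[OF f]] \<Phi>, of "eval f"] fn_scmp[OF e \<Phi>, of "\<mu> A"]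
    by (simp add: val_def)
qed

lemma val_family: "s \<in> Po X \<Longrightarrow> restrict (\<lambda>f. val f s) (finarr X) \<in> Fam X"
  by (rule nat_familiesI) (simp_all add: val_mem val_cmp)

text \<open>The existence half of the universal property of S, applied to the constructed functor of
  families with its counit. The third property says that the comparison preserves
  components.\<close>

lemma push_comparison:
  obtains \<tau> where "\<And>X. small X \<Longrightarrow> \<tau> X \<in> Hom (So X) (Po X)"
    "\<And>f X Y. f \<in> Hom X Y \<Longrightarrow> \<tau> Y \<odot> Sm f = Pm f \<odot> \<tau> X"
    "\<And>f X A. f \<in> Hom X A \<Longrightarrow> finite A \<Longrightarrow> eval f \<odot> \<tau> X = ev X f"
proof -
  obtain \<tau> where \<tau>: "nat_trans Set_cat Set_cat push_ftor (mfun S) \<tau>"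
    and c': "\<forall>A\<in>obj FinSet_cat. \<epsilon> A \<odot> \<tau> (fob FinSet_incl A) = counit A"
    by (rule right_kan_extension_factor[OF kan push_ftor counit_trans]) (rule that, assumption+)
  have c: "\<epsilon> A \<odot> \<tau> A = counit A" if "finite A" for A using c' that by simp
  interpret \<tau>: nat_trans Set_cat Set_cat push_ftor "mfun S" \<tau> by (rule \<tau>)
  have h: "\<tau> X \<in> Hom (So X) (Po X)" if "small X" for X using \<tau>.component[of X] that by simp
  have n: "\<tau> Y \<odot> Sm f = Pm f \<odot> \<tau> X" if "f \<in> Hom X Y" for f X Y using \<tau>.naturality[OF that] by simp
  have "eval f \<odot> \<tau> X = ev X f" if f: "f \<in> Hom X A" and A: "finite A" for f X A
    by (simp add: eval_eq[OF f] scmp_assoc[OF h[OF hom_small(1)[OF f]] Pm_hom[OF f] \<epsilon>_hom[OF A]]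
        n[OF f, symmetric] scmp_assoc[OF Sm_hom[OF f] h[OF hom_small(2)[OF f]] \<epsilon>_hom[OF A], symmetric]
        c[OF A] counit_Sm[OF f A])
  then show ?thesis using that h n by blast
qed

text \<open>The comparison map sends the code of the family to an element of \<open>Po X\<close>
  with the same components.\<close>

lemma val_surj:
  assumes X: "small X" and \<phi>: "\<phi> \<in> Fam X"
  obtains s where "s \<in> Po X" "\<And>f A. f \<in> Hom X A \<Longrightarrow> finite A \<Longrightarrow> val f s = \<phi> f"
proof -
  obtain \<tau> where \<tau>: "\<And>X. small X \<Longrightarrow> \<tau> X \<in> Hom (So X) (Po X)"
    and e: "\<And>f X A. f \<in> Hom X A \<Longrightarrow> finite A \<Longrightarrow> eval f \<odot> \<tau> X = ev X f"
    by (rule push_comparison) (rule that)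
  let ?s = "fn (\<tau> X) (enc X \<phi>)"
  have m: "enc X \<phi> \<in> So X" using \<phi> by (rule enc_mem)
  show ?thesis
  proof
    show "?s \<in> Po X" using fn_mem[OF \<tau>[OF X] m] .
    show "val f ?s = \<phi> f" if f: "f \<in> Hom X A" and A: "finite A" for f A
      using e[OF f A] fn_scmp[OF \<tau>[OF X] m, of "eval f"] fn_ev[OF f m] dec_enc[OF X \<phi>] by (simp add: val_def)
  qed
qed

text \<open>Values separate points by the uniqueness half of the universal property: an element can
  be sent to its family of values and back into S, and the round trip is forced to change
  nothing.\<close>

lemma val_eqI:
  assumes X: "small X" and s: "s \<in> Po X" and t: "t \<in> Po X"
    and eq: "\<And>f A. f \<in> Hom X A \<Longrightarrow> finite A \<Longrightarrow> val f s = val f t"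
  shows "s = t"
proof -
  obtain \<tau> where \<tau>: "\<And>X. small X \<Longrightarrow> \<tau> X \<in> Hom (So X) (Po X)"
    and n: "\<And>f X Y. f \<in> Hom X Y \<Longrightarrow> \<tau> Y \<odot> Sm f = Pm f \<odot> \<tau> X"
    and e: "\<And>f X A. f \<in> Hom X A \<Longrightarrow> finite A \<Longrightarrow> eval f \<odot> \<tau> X = ev X f"
    by (rule push_comparison) (rule that)
  define \<rho> where "\<rho> X = mk_arr (Po X) (\<lambda>s. famc X (\<lambda>f. val f s)) (So X)" for X
  have \<rho>m: "fn (\<rho> X) s \<in> So X"
    and d\<rho>: "\<And>f A. f \<in> Hom X A \<Longrightarrow> finite A \<Longrightarrow> dec X (fn (\<rho> X) s) f = val f s"
    if X: "small X" and s: "s \<in> Po X" for X s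
    using s enc_mem[OF val_family[OF s]] dec_enc[OF X val_family[OF s]]
    by (simp_all add: \<rho>_def famc_def finarrI)
  have \<rho>h: "\<rho> X \<in> Hom (Po X) (So X)" if X: "small X" for X
    using \<rho>m[OF X] X by (auto simp: \<rho>_def enc P_small)
  have e\<rho>: "ev X f \<odot> \<rho> X = eval f" if f: "f \<in> Hom X A" and A: "finite A" for f X A
  proof -
    note X = hom_small(1)[OF f]
    show ?thesis
      by (rule arr_eqI[OF scmp_hom[OF \<rho>h[OF X] ev_hom[OF f A]] eval_hom[OF f A]])
        (simp add: fn_scmp[OF \<rho>h[OF X]] fn_ev[OF f] \<rho>m[OF X] d\<rho>[OF X _ f A] val_def)
  qed
  have \<rho>n: "\<rho> Y \<odot> Pm f = Sm f \<odot> \<rho> X" if f: "f \<in> Hom X Y" for f X Y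
  proof -
    note X = hom_small(1)[OF f] and Y = hom_small(2)[OF f]
    show ?thesis
    proof (rule arr_So_ev_eqI[OF scmp_hom[OF Pm_hom[OF f] \<rho>h[OF Y]] scmp_hom[OF \<rho>h[OF X] Sm_hom[OF f]]])
      fix g A assume g: "g \<in> Hom Y A" and A: "finite A"
      show "ev Y g \<odot> (\<rho> Y \<odot> Pm f) = ev Y g \<odot> (Sm f \<odot> \<rho> X)"
        by (simp add: scmp_assoc[OF Pm_hom[OF f] \<rho>h[OF Y] ev_hom[OF g A], symmetric] e\<rho>[OF g A]
            scmp_assoc[OF \<rho>h[OF X] Sm_hom[OF f] ev_hom[OF g A], symmetric] ev_Sm[OF f g A]
            e\<rho>[OF scmp_hom[OF f g] A] eval_Pm[OF f g A])
    qed
  qed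
  (* \<kappa> forgets everything but the values of an element; it is compatible with \<epsilon>, hence the identity *)
  define \<kappa> where "\<kappa> X = \<tau> X \<odot> \<rho> X" for X
  have \<kappa>h: "\<kappa> X \<in> Hom (Po X) (Po X)" if "small X" for X
    unfolding \<kappa>_def by (rule scmp_hom[OF \<rho>h[OF that] \<tau>[OF that]])
  have \<kappa>: "nat_trans Set_cat Set_cat (mfun S) (mfun S) \<kappa>"
  proof (rule nat_transI[OF S.unit.G.cat_functor_axioms S.unit.G.cat_functor_axioms])
    fix f and X Y :: "'u set" assume f: "f \<in> Hom X Y"
    note X = hom_small(1)[OF f] and Y = hom_small(2)[OF f]
    show "\<kappa> Y \<odot> Pm f = Pm f \<odot> \<kappa> X" unfolding \<kappa>_def
      by (simp add: scmp_assoc[OF Pm_hom[OF f] \<rho>h[OF Y] \<tau>[OF Y]] \<rho>n[OF f] scmp_assoc[OF \<rho>h[OF X] \<tau>[OF X] Pm_hom[OF f], symmetric]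
          n[OF f, symmetric] scmp_assoc[OF \<rho>h[OF X] Sm_hom[OF f] \<tau>[OF Y], symmetric])
  qed (simp add: \<kappa>h)
  have \<epsilon>\<kappa>: "\<epsilon> A \<odot> \<kappa> A = \<epsilon> A" if A: "finite A" for A
  proof -
    note A' = small_finite[OF A] and i = sid_hom[OF small_finite[OF A]]
    have E: "eval (sid A) = \<epsilon> A"
      using S.unit.G.far_idt[of A] A' scmp_sid(1)[OF \<epsilon>_hom[OF A]] by (simp add: eval_eq[OF i])
    have "\<epsilon> A \<odot> \<kappa> A = (eval (sid A) \<odot> \<tau> A) \<odot> \<rho> A"
      unfolding E \<kappa>_def by (simp add: scmp_assoc[OF \<rho>h[OF A'] \<tau>[OF A'] \<epsilon>_hom[OF A]])
    then show ?thesis using e[OF i A] e\<rho>[OF i A] E by simp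
  qed
  have "\<kappa> X = sid (Po X)"
  proof -
    obtain \<theta> where \<theta>: "\<And>\<tau>'. nat_trans Set_cat Set_cat (mfun S) (mfun S) \<tau>' \<Longrightarrow>
        (\<And>A. finite A \<Longrightarrow> \<epsilon> A \<odot> \<tau>' A = \<epsilon> A) \<Longrightarrow> \<tau>' X = \<theta> X"
    proof (rule right_kan_extension_factor[OF kan S.unit.G.cat_functor_axioms \<epsilon>.nat_trans_axioms])
      fix \<theta> assume "\<forall>\<tau>'. nat_trans Set_cat Set_cat (mfun S) (mfun S) \<tau>' \<and>
        (\<forall>A\<in>obj FinSet_cat. \<epsilon> A \<odot> \<tau>' (fob FinSet_incl A) = \<epsilon> A) \<longrightarrow> (\<forall>b\<in>obj Set_cat. \<tau>' b = \<theta> b)"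
      then show ?thesis using that[of \<theta>] X by simp
    qed
    have "\<epsilon> A \<odot> sid (Po A) = \<epsilon> A" if "finite A" for A by (rule scmp_sid[OF \<epsilon>_hom[OF that]])
    then have "sid (Po X) = \<theta> X" using \<theta>[OF nat_trans_id[OF S.unit.G.cat_functor_axioms]] by simp
    then show ?thesis using \<theta>[OF \<kappa> \<epsilon>\<kappa>] by simp
  qed
  moreover have "fn (\<rho> X) s = fn (\<rho> X) t"
    by (rule So_eqI[OF \<rho>m[OF X s] \<rho>m[OF X t]]) (simp add: d\<rho>[OF X] s t eq)
  then have "fn (\<kappa> X) s = fn (\<kappa> X) t" unfolding \<kappa>_def by (simp add: fn_scmp[OF \<rho>h[OF X]] s t)
  ultimately show ?thesis using s t by simp
qed

end

section \<open>Filters on a set\<close>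

definition filt :: "'a set \<Rightarrow> 'a set set \<Rightarrow> bool"
  where "filt X F \<longleftrightarrow> F \<subseteq> Pow X \<and> X \<in> F \<and> (\<forall>A\<in>F. \<forall>B\<in>F. A \<inter> B \<in> F) \<and>
    (\<forall>A\<in>F. \<forall>B. A \<subseteq> B \<and> B \<subseteq> X \<longrightarrow> B \<in> F)"

definition ultra :: "'a set \<Rightarrow> 'a set set \<Rightarrow> bool"
  where "ultra X U \<longleftrightarrow> filt X U \<and> {} \<notin> U \<and> (\<forall>A. A \<subseteq> X \<longrightarrow> A \<in> U \<or> X - A \<in> U)"

definition fprin :: "'a set \<Rightarrow> 'a \<Rightarrow> 'a set set"
  where "fprin X x = {A. A \<subseteq> X \<and> x \<in> A}"

definition fimage :: "'b set \<Rightarrow> 'a set \<Rightarrow> ('a \<Rightarrow> 'b) \<Rightarrow> 'a set set \<Rightarrow> 'b set set"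
  where "fimage Y X f F = {B. B \<subseteq> Y \<and> {x\<in>X. f x \<in> B} \<in> F}"

text \<open>The Kleisli extension of the filter monad, with unit \<open>fprin\<close> and functor
  action \<open>fimage\<close>. For k the identity on a set of filters it is the monad
  multiplication (Kowalsky sum). The index set may have any type, so that sets of filters and
  \<open>Po X\<close> can both serve.\<close>

definition fbind :: "'b set \<Rightarrow> 'a set \<Rightarrow> ('a \<Rightarrow> 'b set set) \<Rightarrow> 'a set set \<Rightarrow> 'b set set"
  where "fbind Y X k F = {B. B \<subseteq> Y \<and> {x\<in>X. B \<in> k x} \<in> F}"

lemma filtI:
  assumes "F \<subseteq> Pow X" "X \<in> F" "\<And>A B. A \<in> F \<Longrightarrow> B \<in> F \<Longrightarrow> A \<inter> B \<in> F"
    "\<And>A B. A \<in> F \<Longrightarrow> A \<subseteq> B \<Longrightarrow> B \<subseteq> X \<Longrightarrow> B \<in> F"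
  shows "filt X F"
  using assms unfolding filt_def by simp

lemma filtD:
  assumes "filt X F"
  shows "A \<in> F \<Longrightarrow> A \<subseteq> X" "X \<in> F" "A \<in> F \<Longrightarrow> B \<in> F \<Longrightarrow> A \<inter> B \<in> F"
    "A \<in> F \<Longrightarrow> A \<subseteq> B \<Longrightarrow> B \<subseteq> X \<Longrightarrow> B \<in> F"
  using assms unfolding filt_def by auto

lemma ultra_filt: "ultra X U \<Longrightarrow> filt X U"
  by (simp add: ultra_def)

lemma ultra_compl: "ultra X U \<Longrightarrow> A \<subseteq> X \<Longrightarrow> X - A \<in> U \<longleftrightarrow> A \<notin> U"
proof
  assume U: "ultra X U" and "A \<subseteq> X" "X - A \<in> U"
  then show "A \<notin> U" using filtD(3)[OF ultra_filt[OF U], of A "X - A"] by (auto simp: ultra_def)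
qed (auto simp: ultra_def)

lemma ultra_Int_nonempty: "ultra X U \<Longrightarrow> A \<in> U \<Longrightarrow> B \<in> U \<Longrightarrow> A \<inter> B \<noteq> {}"
  using filtD(3)[OF ultra_filt, of X U A B] by (auto simp: ultra_def)

text \<open>An ultrafilter contains exactly one of A and its complement, hence admits no proper
  ultrafilter extension. Ultrafilters are identified below by proving a single inclusion.\<close>

lemma ultra_subset_eq: "ultra X U \<Longrightarrow> ultra X V \<Longrightarrow> U \<subseteq> V \<Longrightarrow> U = V"
proof
  assume U: "ultra X U" and V: "ultra X V" and "U \<subseteq> V"
  show "V \<subseteq> U"
  proof
    fix A assume A: "A \<in> V"
    then have "A \<subseteq> X" using filtD(1)[OF ultra_filt[OF V]] by blast
    then show "A \<in> U" using ultra_compl[OF U] ultra_compl[OF V] A \<open>U \<subseteq> V\<close> by blast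
  qed
qed

lemma ultra_Union:
  assumes U: "ultra X U" and "finite \<F>" "\<Union>\<F> \<in> U" "\<And>A. A \<in> \<F> \<Longrightarrow> A \<subseteq> X"
  shows "\<exists>A\<in>\<F>. A \<in> U"
  using assms(2-)
proof (induction rule: finite_induct)
  case empty
  then show ?case using U by (auto simp: ultra_def)
next
  case (insert A \<F>)
  show ?case
  proof (cases "A \<in> U")
    case False
    then have "X - A \<in> U" using ultra_compl[OF U] insert.prems(2) by blast
    then have "\<Union>(insert A \<F>) \<inter> (X - A) \<in> U" using filtD(3)[OF ultra_filt[OF U]] insert.prems(1) by blast
    then have "\<Union>\<F> \<in> U" by (rule filtD(4)[OF ultra_filt[OF U]]) (use insert.prems in auto)
    then show ?thesis using insert.IH insert.prems(2) by blast
  qed blast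
qed

lemma filt_fprin: "x \<in> X \<Longrightarrow> filt X (fprin X x)"
  by (rule filtI) (auto simp: fprin_def)

lemma ultra_fprin: "x \<in> X \<Longrightarrow> ultra X (fprin X x)"
  unfolding ultra_def using filt_fprin[of x X] by (auto simp: fprin_def)

lemma filt_fbind:
  assumes F: "filt X F" and k: "\<And>x. x \<in> X \<Longrightarrow> filt Y (k x)"
  shows "filt Y (fbind Y X k F)"
proof (rule filtI)
  have "{x \<in> X. Y \<in> k x} = X" using filtD(2)[OF k] by blast
  then show "Y \<in> fbind Y X k F" using filtD(2)[OF F] by (simp add: fbind_def)
next
  fix A B assume A: "A \<in> fbind Y X k F" and B: "B \<in> fbind Y X k F"
  then have "{x \<in> X. A \<in> k x} \<inter> {x \<in> X. B \<in> k x} \<in> F" by (intro filtD(3)[OF F]) (simp_all add: fbind_def)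
  then have "{x \<in> X. A \<inter> B \<in> k x} \<in> F" by (rule filtD(4)[OF F]) (use filtD(3)[OF k] in auto)
  then show "A \<inter> B \<in> fbind Y X k F" using A by (auto simp: fbind_def)
next
  fix A B assume A: "A \<in> fbind Y X k F" and AB: "A \<subseteq> B" "B \<subseteq> Y"
  then have "{x \<in> X. A \<in> k x} \<in> F" by (simp add: fbind_def)
  then have "{x \<in> X. B \<in> k x} \<in> F" by (rule filtD(4)[OF F]) (use filtD(4)[OF k] AB in auto)
  then show "B \<in> fbind Y X k F" using AB by (auto simp: fbind_def)
qed (auto simp: fbind_def)

lemma ultra_fbind:
  assumes F: "ultra X F" and k: "\<And>x. x \<in> X \<Longrightarrow> ultra Y (k x)"
  shows "ultra Y (fbind Y X k F)"
  unfolding ultra_def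
proof (intro conjI allI impI)
  show "filt Y (fbind Y X k F)" using filt_fbind[OF ultra_filt[OF F] ultra_filt[OF k]] .
  have e: "{x \<in> X. {} \<in> k x} = {}" using k by (auto simp: ultra_def)
  show "{} \<notin> fbind Y X k F" unfolding fbind_def mem_Collect_eq e using F by (simp add: ultra_def)
  fix A assume A: "A \<subseteq> Y"
  have "{x \<in> X. Y - A \<in> k x} = X - {x \<in> X. A \<in> k x}" using ultra_compl[OF k A] by blast
  then show "A \<in> fbind Y X k F \<or> Y - A \<in> fbind Y X k F"
    using A ultra_compl[OF F, of "{x \<in> X. A \<in> k x}"] by (auto simp: fbind_def)
qed

text \<open>The functor action expressed by Kleisli extension and unit, so that preservation of
  filters and of ultrafilters has to be proved for \<open>fbind\<close> only.\<close>

lemma fimage_fbind: "f ` X \<subseteq> Y \<Longrightarrow> fimage Y X f F = fbind Y X (\<lambda>x. fprin Y (f x)) F"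
proof -
  assume "f ` X \<subseteq> Y"
  then have "B \<subseteq> Y \<Longrightarrow> {x \<in> X. f x \<in> B} = {x \<in> X. B \<in> fprin Y (f x)}" for B by (auto simp: fprin_def)
  then show ?thesis unfolding fimage_def fbind_def by (intro Collect_cong conj_cong) simp_all
qed

lemma filt_fimage: "filt X F \<Longrightarrow> f ` X \<subseteq> Y \<Longrightarrow> filt Y (fimage Y X f F)"
  unfolding fimage_fbind by (rule filt_fbind) (auto intro: filt_fprin)

lemma ultra_fimage: "ultra X F \<Longrightarrow> f ` X \<subseteq> Y \<Longrightarrow> ultra Y (fimage Y X f F)"
  unfolding fimage_fbind by (rule ultra_fbind) (auto intro: ultra_fprin)

lemma fimage_cong: "(\<And>x. x \<in> X \<Longrightarrow> f x = g x) \<Longrightarrow> fimage Y X f F = fimage Y X g F"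
  unfolding fimage_def by (metis (mono_tags, lifting) Collect_cong)

lemma fbind_cong: "(\<And>x. x \<in> X \<Longrightarrow> f x = g x) \<Longrightarrow> fbind Y X f F = fbind Y X g F"
  unfolding fbind_def by (metis (mono_tags, lifting) Collect_cong)

lemma fimage_fimage: "f ` X \<subseteq> Y \<Longrightarrow> fimage Z Y g (fimage Y X f F) = fimage Z X (\<lambda>x. g (f x)) F"
proof -
  assume "f ` X \<subseteq> Y"
  then have "{x \<in> X. f x \<in> {y \<in> Y. g y \<in> B}} = {x \<in> X. g (f x) \<in> B}" for B by auto
  then show ?thesis unfolding fimage_def by auto
qed

lemma fbind_fimage: "f ` X \<subseteq> Y \<Longrightarrow> fbind Z Y k (fimage Y X f F) = fbind Z X (\<lambda>x. k (f x)) F"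
proof -
  assume "f ` X \<subseteq> Y"
  then have "{x \<in> X. f x \<in> {y \<in> Y. B \<in> k y}} = {x \<in> X. B \<in> k (f x)}" for B by auto
  then show ?thesis unfolding fimage_def fbind_def by auto
qed

lemma fimage_fprin: "x \<in> X \<Longrightarrow> f ` X \<subseteq> Y \<Longrightarrow> fimage Y X f (fprin X x) = fprin Y (f x)"
  by (auto simp: fimage_def fprin_def)

lemma fbind_fprin: "x \<in> X \<Longrightarrow> k x \<subseteq> Pow Y \<Longrightarrow> fbind Y X k (fprin X x) = k x"
  by (auto simp: fbind_def fprin_def)

lemma fbind_unit: "filt X F \<Longrightarrow> fbind X X (fprin X) F = F"
proof -
  assume F: "filt X F"
  have "B \<subseteq> X \<Longrightarrow> {x \<in> X. B \<in> fprin X x} = B" for B by (auto simp: fprin_def)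
  then show ?thesis using filtD(1)[OF F] unfolding fbind_def by auto
qed

definition fgen :: "'a set \<Rightarrow> 'a set set \<Rightarrow> 'a set set"
  where "fgen X \<B> = {A. A \<subseteq> X \<and> (\<exists>B\<in>\<B>. B \<subseteq> A)}"

lemma fgenI: "A \<subseteq> X \<Longrightarrow> B \<in> \<B> \<Longrightarrow> B \<subseteq> A \<Longrightarrow> A \<in> fgen X \<B>"
  by (auto simp: fgen_def)

lemma fgenE: "A \<in> fgen X \<B> \<Longrightarrow> (\<And>B. A \<subseteq> X \<Longrightarrow> B \<in> \<B> \<Longrightarrow> B \<subseteq> A \<Longrightarrow> P) \<Longrightarrow> P"
  by (auto simp: fgen_def)

lemma filt_fgen:
  assumes ne: "\<B> \<noteq> {}" and sub: "\<And>A. A \<in> \<B> \<Longrightarrow> A \<subseteq> X"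
    and dir: "\<And>A B. A \<in> \<B> \<Longrightarrow> B \<in> \<B> \<Longrightarrow> \<exists>C\<in>\<B>. C \<subseteq> A \<inter> B"
  shows "filt X (fgen X \<B>)"
proof (rule filtI)
  show "fgen X \<B> \<subseteq> Pow X" by (auto simp: fgen_def)
  obtain B where "B \<in> \<B>" using ne by blast
  then show "X \<in> fgen X \<B>" using sub by (intro fgenI) auto
next
  fix A B assume "A \<in> fgen X \<B>" "B \<in> fgen X \<B>"
  then obtain A' B' where *: "A \<subseteq> X" "A' \<in> \<B>" "B' \<in> \<B>" "A' \<subseteq> A" "B' \<subseteq> B" by (elim fgenE) auto
  obtain C where "C \<in> \<B>" "C \<subseteq> A' \<inter> B'" using dir[OF *(2,3)] by auto
  then show "A \<inter> B \<in> fgen X \<B>" using * by (intro fgenI[of _ _ C]) auto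
next
  fix A B assume "A \<in> fgen X \<B>" "A \<subseteq> B" "B \<subseteq> X"
  then show "B \<in> fgen X \<B>" by (elim fgenE) (metis fgenI order_trans)
qed

lemma filt_Union_chain:
  assumes ne: "\<C> \<noteq> {}" and f: "\<And>F. F \<in> \<C> \<Longrightarrow> filt X F"
    and ch: "\<And>F G. F \<in> \<C> \<Longrightarrow> G \<in> \<C> \<Longrightarrow> F \<subseteq> G \<or> G \<subseteq> F"
  shows "filt X (\<Union>\<C>)"
proof (rule filtI)
  show "\<Union>\<C> \<subseteq> Pow X" using filtD(1)[OF f] by blast
  show "X \<in> \<Union>\<C>" using filtD(2)[OF f] ne by blast
  fix A B assume "A \<in> \<Union>\<C>"
  then obtain F where F: "F \<in> \<C>" "A \<in> F" by blast
  show "A \<subseteq> B \<Longrightarrow> B \<subseteq> X \<Longrightarrow> B \<in> \<Union>\<C>" using F filtD(4)[OF f[OF F(1)] F(2)] by blast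
  assume "B \<in> \<Union>\<C>"
  then obtain G where G: "G \<in> \<C>" "B \<in> G" by blast
  show "A \<inter> B \<in> \<Union>\<C>" using ch[OF F(1) G(1)] F G filtD(3)[OF f[OF F(1)], of A B] filtD(3)[OF f[OF G(1)], of A B] by blast
qed

lemma ultrafilter_extension:
  assumes F: "filt X F" and ne: "{} \<notin> F"
  obtains U where "ultra X U" "F \<subseteq> U"
proof -
  define \<A> where "\<A> = {G. filt X G \<and> {} \<notin> G \<and> F \<subseteq> G}"
  have "\<exists>M\<in>\<A>. \<forall>G\<in>\<A>. M \<subseteq> G \<longrightarrow> G = M"
  proof (rule subset_Zorn_nonempty)
    show "\<A> \<noteq> {}" using F ne by (auto simp: \<A>_def)
    fix \<C> assume C: "\<C> \<noteq> {}" "subset.chain \<A> \<C>"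
    then have "filt X (\<Union>\<C>)" by (intro filt_Union_chain) (auto simp: subset_chain_def \<A>_def)
    then show "\<Union>\<C> \<in> \<A>" using C by (auto simp: subset_chain_def \<A>_def)
  qed
  then obtain U where U: "filt X U" "{} \<notin> U" "F \<subseteq> U"
    and max: "\<And>G. filt X G \<Longrightarrow> {} \<notin> G \<Longrightarrow> U \<subseteq> G \<Longrightarrow> G = U" by (auto simp: \<A>_def)
  have "A \<in> U \<or> X - A \<in> U" if A: "A \<subseteq> X" for A
  proof (rule disjCI)
    assume nA: "X - A \<notin> U"
    \<comment> \<open>The filter generated by U and A is proper, since no member of U lies inside X
      - A. By maximality it equals U, and it contains A.\<close>
    let ?B = "(\<lambda>B. B \<inter> A) ` U" let ?G = "fgen X ?B"
    have G: "filt X ?G"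
    proof (rule filt_fgen)
      show "?B \<noteq> {}" using filtD(2)[OF U(1)] by blast
      show "C \<subseteq> X" if "C \<in> ?B" for C using A that by blast
      fix C D assume "C \<in> ?B" "D \<in> ?B"
      then obtain C' D' where C': "C' \<in> U" "D' \<in> U" "C = C' \<inter> A" "D = D' \<inter> A" by auto
      then show "\<exists>E\<in>?B. E \<subseteq> C \<inter> D" using filtD(3)[OF U(1) C'(1,2)] by (intro bexI[of _ "(C' \<inter> D') \<inter> A"]) auto
    qed
    have "B \<inter> A \<noteq> {}" if "B \<in> U" for B
    proof
      assume "B \<inter> A = {}"
      then have "B \<subseteq> X - A" using filtD(1)[OF U(1) that] by blast
      then show False using nA filtD(4)[OF U(1) that] by blast
    qed
    then have "{} \<notin> ?G" by (auto simp: fgen_def)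
    moreover have "U \<subseteq> ?G"
    proof
      fix B assume "B \<in> U"
      then show "B \<in> ?G" using filtD(1)[OF U(1)] by (intro fgenI[of _ _ "B \<inter> A"]) auto
    qed
    ultimately have "?G = U" using max[OF G] by blast
    moreover have "A \<in> ?G" using A filtD(2)[OF U(1)] by (intro fgenI[of _ _ "X \<inter> A"]) auto
    ultimately show "A \<in> U" by blast
  qed
  then have "ultra X U" using U(1,2) unfolding ultra_def by blast
  then show ?thesis using U(3) by (rule that)
qed

lemma ultrafilter_base:
  assumes "\<B> \<noteq> {}" "\<And>A. A \<in> \<B> \<Longrightarrow> A \<subseteq> X" "\<And>A. A \<in> \<B> \<Longrightarrow> A \<noteq> {}"
    "\<And>A B. A \<in> \<B> \<Longrightarrow> B \<in> \<B> \<Longrightarrow> \<exists>C\<in>\<B>. C \<subseteq> A \<inter> B"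
  obtains U where "ultra X U" "\<B> \<subseteq> U"
proof -
  let ?G = "fgen X \<B>"
  have "{} \<notin> ?G" using assms(3) by (auto simp: fgen_def)
  moreover have "filt X ?G"
    by (rule filt_fgen[OF assms(1)]) (rule assms(2), assumption, rule assms(4), assumption+)
  ultimately obtain U where U: "ultra X U" "?G \<subseteq> U"
    using ultrafilter_extension[of X ?G] by metis
  have "\<B> \<subseteq> ?G" using assms(2) by (auto simp: fgen_def)
  then show ?thesis using U by (intro that) (rule U(1), rule order_trans)
qed


section \<open>Compact Hausdorff spaces as ultrafilter algebras\<close>

definition ulim :: "'a topology \<Rightarrow> 'a set set \<Rightarrow> 'a"
  where "ulim T U = (THE x. x \<in> topspace T \<and> (\<forall>W. openin T W \<and> x \<in> W \<longrightarrow> W \<in> U))"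

lemma ulim_unique:
  assumes H: "Hausdorff_space T" and U: "ultra (topspace T) U"
    and x: "x \<in> topspace T" "\<And>W. openin T W \<Longrightarrow> x \<in> W \<Longrightarrow> W \<in> U"
  shows "ulim T U = x"
  unfolding ulim_def
proof (rule the_equality)
  fix y assume y: "y \<in> topspace T \<and> (\<forall>W. openin T W \<and> y \<in> W \<longrightarrow> W \<in> U)"
  show "y = x"
  proof (rule ccontr)
    assume "y \<noteq> x"
    then obtain V W where "openin T V" "openin T W" "y \<in> V" "x \<in> W" "disjnt V W"
      using H[unfolded Hausdorff_space_def, rule_format, of y x] x(1) y by auto
    then show False using ultra_Int_nonempty[OF U, of V W] x(2)[of W] y by (auto simp: disjnt_def)
  qed
qed (use x in auto)

text \<open>If no point were a limit, the open sets outside U would cover the space. A finite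
  subcover would then have its union in U, and by \<open>ultra_Union\<close> one of its members
  too.\<close>

lemma ulim_exists:
  assumes C: "compact_space T" and U: "ultra (topspace T) U"
  shows "\<exists>x\<in>topspace T. \<forall>W. openin T W \<and> x \<in> W \<longrightarrow> W \<in> U"
proof (rule ccontr)
  assume "\<not> ?thesis"
  then have n: "\<exists>W. openin T W \<and> x \<in> W \<and> W \<notin> U" if "x \<in> topspace T" for x using that by blast
  define \<W> where "\<W> = {W. openin T W \<and> W \<notin> U}"
  have "topspace T \<subseteq> \<Union>\<W>" using n by (fastforce simp: \<W>_def)
  then have "(\<forall>W\<in>\<W>. openin T W) \<and> topspace T \<subseteq> \<Union>\<W>" by (simp add: \<W>_def)
  from mp[OF spec[OF C[unfolded compact_space_alt], of \<W>] this]
  obtain \<F> where F: "finite \<F>" "\<F> \<subseteq> \<W>" "topspace T \<subseteq> \<Union>\<F>" by auto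
  have sub: "A \<subseteq> topspace T" if "A \<in> \<F>" for A using F(2) that openin_subset by (auto simp: \<W>_def)
  then have "\<Union>\<F> = topspace T" using F(3) by blast
  then have "\<Union>\<F> \<in> U" using filtD(2)[OF ultra_filt[OF U]] by simp
  then obtain A where "A \<in> \<F>" "A \<in> U" using ultra_Union[OF U F(1)] sub by blast
  then show False using F(2) by (auto simp: \<W>_def)
qed

locale compact_Hausdorff =
  fixes T :: "'a topology"
  assumes compact: "compact_space T" and Hausdorff: "Hausdorff_space T"
begin

lemma ulim:
  assumes U: "ultra (topspace T) U"
  shows "ulim T U \<in> topspace T" "openin T W \<Longrightarrow> ulim T U \<in> W \<Longrightarrow> W \<in> U"
proof -
  obtain x where x: "x \<in> topspace T" "\<And>W. openin T W \<Longrightarrow> x \<in> W \<Longrightarrow> W \<in> U"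
    using ulim_exists[OF compact U] by auto
  moreover have "ulim T U = x" by (rule ulim_unique[OF Hausdorff U]) (use x in auto)
  ultimately show "ulim T U \<in> topspace T" "openin T W \<Longrightarrow> ulim T U \<in> W \<Longrightarrow> W \<in> U" by auto
qed

lemma ulim_fprin: "x \<in> topspace T \<Longrightarrow> ulim T (fprin (topspace T) x) = x"
  by (rule ulim_unique[OF Hausdorff ultra_fprin]) (auto simp: fprin_def dest: openin_subset)

text \<open>An open W around the limit of the limits contains the limit of \<open>k i\<close> for
  G-most i, hence belongs to \<open>k i\<close> for G-most i, hence to the sum. For k ranging over a
  set of ultrafilters this is the associativity law of an algebra.\<close>

lemma ulim_fbind:
  assumes G: "ultra I G" and k: "\<And>i. i \<in> I \<Longrightarrow> ultra (topspace T) (k i)"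
  shows "ulim T (fbind (topspace T) I k G) = ulim T (fimage (topspace T) I (\<lambda>i. ulim T (k i)) G)"
proof -
  have h: "(\<lambda>i. ulim T (k i)) ` I \<subseteq> topspace T" using ulim(1)[OF k] by blast
  note u = ultra_fimage[OF G h]
  show ?thesis
  proof (rule ulim_unique[OF Hausdorff ultra_fbind[OF G k] ulim(1)[OF u]])
    fix W assume W: "openin T W" "ulim T (fimage (topspace T) I (\<lambda>i. ulim T (k i)) G) \<in> W"
    have "W \<in> fimage (topspace T) I (\<lambda>i. ulim T (k i)) G" by (rule ulim(2)[OF u W])
    then have "{i \<in> I. ulim T (k i) \<in> W} \<in> G" by (simp add: fimage_def)
    then have "{i \<in> I. W \<in> k i} \<in> G"
      by (rule filtD(4)[OF ultra_filt[OF G]]) (use ulim(2)[OF k W(1)] in auto)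
    then show "W \<in> fbind (topspace T) I k G" using openin_subset[OF W(1)] by (simp add: fbind_def)
  qed
qed

text \<open>Suppose some x in A has no neighbourhood inside A. Then the sets W - A, for W an open
  neighbourhood of x, generate a proper filter; an ultrafilter above it has limit x and misses
  A.\<close>

lemma openin_ulim:
  assumes A: "A \<subseteq> topspace T" and cl: "\<And>U. ultra (topspace T) U \<Longrightarrow> ulim T U \<in> A \<Longrightarrow> A \<in> U"
  shows "openin T A"
proof (subst openin_subopen, rule ballI, rule ccontr)
  fix x assume x: "x \<in> A" and n: "\<nexists>W. openin T W \<and> x \<in> W \<and> W \<subseteq> A"
  let ?B = "{W - A | W. openin T W \<and> x \<in> W}"
  obtain U where U: "ultra (topspace T) U" "?B \<subseteq> U"
  proof (rule ultrafilter_base[of ?B "topspace T"])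
    show "?B \<noteq> {}" using x A openin_topspace by blast
    show "B \<in> ?B \<Longrightarrow> B \<subseteq> topspace T" for B using openin_subset by blast
    show "B \<in> ?B \<Longrightarrow> B \<noteq> {}" for B using n by blast
    fix B C assume "B \<in> ?B" "C \<in> ?B"
    then obtain V W where "B = V - A" "C = W - A" "openin T V" "openin T W" "x \<in> V" "x \<in> W" by blast
    then show "\<exists>D\<in>?B. D \<subseteq> B \<inter> C" by (intro bexI[of _ "(V \<inter> W) - A"]) auto
  qed (rule that)
  have "ulim T U = x"
  proof (rule ulim_unique[OF Hausdorff U(1)])
    fix W assume W: "openin T W" "x \<in> W"
    then have "W - A \<in> U" using U(2) by blast
    then show "W \<in> U" by (rule filtD(4)[OF ultra_filt[OF U(1)]]) (use openin_subset W in auto)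
  qed (use x A in auto)
  then have "A \<in> U" using cl U(1) x by blast
  moreover have "topspace T - A \<in> U" using U(2) x A by blast
  ultimately show False using ultra_compl[OF U(1) A] by blast
qed

end

text \<open>Algebra homomorphisms are the continuous maps. In the direction towards continuity,
  \<open>openin_ulim\<close> allows the preimage of an open set to be tested on
  ultrafilters.\<close>

lemma continuous_map_iff_ulim:
  assumes "compact_Hausdorff T" "compact_Hausdorff T'" and f: "f ` topspace T \<subseteq> topspace T'"
  shows "continuous_map T T' f \<longleftrightarrow>
    (\<forall>U. ultra (topspace T) U \<longrightarrow> f (ulim T U) = ulim T' (fimage (topspace T') (topspace T) f U))"
proof (intro iffI allI impI)
  interpret T: compact_Hausdorff T by fact
  interpret T': compact_Hausdorff T' by fact
  {
    fix U assume c: "continuous_map T T' f" and U: "ultra (topspace T) U"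
    show "f (ulim T U) = ulim T' (fimage (topspace T') (topspace T) f U)"
    proof (rule sym, rule ulim_unique[OF T'.Hausdorff ultra_fimage[OF U f]])
      show "f (ulim T U) \<in> topspace T'" using T.ulim(1)[OF U] f by blast
      fix W assume W: "openin T' W" "f (ulim T U) \<in> W"
      have "openin T {x \<in> topspace T. f x \<in> W}" using c W(1) by (rule openin_continuous_map_preimage)
      then have "{x \<in> topspace T. f x \<in> W} \<in> U" using T.ulim[OF U] W(2) by simp
      then show "W \<in> fimage (topspace T') (topspace T) f U" using openin_subset[OF W(1)] by (simp add: fimage_def)
    qed
  }
  assume h: "\<forall>U. ultra (topspace T) U \<longrightarrow> f (ulim T U) = ulim T' (fimage (topspace T') (topspace T) f U)"
  show "continuous_map T T' f"
    unfolding continuous_map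
  proof (intro conjI allI impI f)
    fix W assume W: "openin T' W"
    show "openin T {x \<in> topspace T. f x \<in> W}"
    proof (rule T.openin_ulim)
      fix U assume U: "ultra (topspace T) U" and "ulim T U \<in> {x \<in> topspace T. f x \<in> W}"
      then have "ulim T' (fimage (topspace T') (topspace T) f U) \<in> W" using h by simp
      then have "W \<in> fimage (topspace T') (topspace T) f U" by (rule T'.ulim(2)[OF ultra_fimage[OF U f] W])
      then show "{x \<in> topspace T. f x \<in> W} \<in> U" by (simp add: fimage_def)
    qed auto
  qed
qed

section \<open>From ultrafilter algebras to compact Hausdorff spaces\<close>

locale ultrafilter_algebra =
  fixes X :: "'a set" and \<xi> :: "'a set set \<Rightarrow> 'a"
  assumes mem: "ultra X U \<Longrightarrow> \<xi> U \<in> X"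
    and unit: "x \<in> X \<Longrightarrow> \<xi> (fprin X x) = x"
    and assoc: "ultra {U. ultra X U} \<Phi> \<Longrightarrow>
      \<xi> (fbind X {U. ultra X U} (\<lambda>U. U) \<Phi>) = \<xi> (fimage X {U. ultra X U} \<xi> \<Phi>)"
begin

definition topo :: "'a topology"
  where "topo = topology (\<lambda>W. W \<subseteq> X \<and> (\<forall>U. ultra X U \<and> \<xi> U \<in> W \<longrightarrow> W \<in> U))"

lemma openin_topo: "openin topo W \<longleftrightarrow> W \<subseteq> X \<and> (\<forall>U. ultra X U \<and> \<xi> U \<in> W \<longrightarrow> W \<in> U)"
proof -
  have "istopology (\<lambda>W. W \<subseteq> X \<and> (\<forall>U. ultra X U \<and> \<xi> U \<in> W \<longrightarrow> W \<in> U))"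
    unfolding istopology_def
  proof (intro conjI allI impI; (elim conjE)?)
    fix V W U assume "\<forall>U. ultra X U \<and> \<xi> U \<in> V \<longrightarrow> V \<in> U" "\<forall>U. ultra X U \<and> \<xi> U \<in> W \<longrightarrow> W \<in> U"
      "ultra X U" "\<xi> U \<in> V \<inter> W"
    then show "V \<inter> W \<in> U" using filtD(3)[OF ultra_filt, of X U V W] by blast
  next
    fix \<K> U assume K: "\<forall>W\<in>\<K>. W \<subseteq> X \<and> (\<forall>U. ultra X U \<and> \<xi> U \<in> W \<longrightarrow> W \<in> U)" and U: "ultra X U" "\<xi> U \<in> \<Union>\<K>"
    then obtain W where W: "W \<in> \<K>" "W \<in> U" by blast
    show "\<Union>\<K> \<in> U"
    proof (rule filtD(4)[OF ultra_filt[OF U(1)] W(2)])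
      show "W \<subseteq> \<Union>\<K>" using W(1) by (rule Union_upper)
      show "\<Union>\<K> \<subseteq> X" using K by (intro Union_least) simp
    qed
  qed auto
  then show ?thesis unfolding topo_def by (simp add: topology_inverse')
qed

lemma topspace_topo: "topspace topo = X"
proof -
  have "openin topo X" using filtD(2)[OF ultra_filt] by (auto simp: openin_topo)
  moreover have "openin topo W \<Longrightarrow> W \<subseteq> X" for W by (simp add: openin_topo)
  ultimately show ?thesis unfolding topspace_def by blast
qed

text \<open>The candidate for the closure of A. That it is closed is not formal: it rests on
  associativity, through \<open>ucl_idem\<close>.\<close>

definition ucl :: "'a set \<Rightarrow> 'a set"
  where "ucl A = {\<xi> U | U. ultra X U \<and> A \<in> U}"

text \<open>Every B in V meets \<open>ucl A\<close>, so some ultrafilter containing A has its value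
  in B. These sets of ultrafilters generate a \<Phi> whose image under \<xi> is V and whose sum
  contains A. By associativity the value of V is the value of that sum.\<close>

lemma ucl_idem:
  assumes V: "ultra X V" and cl: "ucl A \<in> V"
  shows "\<xi> V \<in> ucl A"
proof -
  let ?UX = "{U. ultra X U}" let ?S = "\<lambda>B. {U. ultra X U \<and> A \<in> U \<and> \<xi> U \<in> B}"
  obtain \<Phi> where \<Phi>: "ultra ?UX \<Phi>" "?S ` V \<subseteq> \<Phi>"
  proof (rule ultrafilter_base[of "?S ` V" ?UX])
    show "?S ` V \<noteq> {}" using cl by blast
    show "C \<in> ?S ` V \<Longrightarrow> C \<subseteq> ?UX" for C by blast
    show "C \<in> ?S ` V \<Longrightarrow> C \<noteq> {}" for C
    proof -
      assume "C \<in> ?S ` V"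
      then obtain B where B: "B \<in> V" "C = ?S B" by blast
      then obtain x where "x \<in> ucl A" "x \<in> B" using ultra_Int_nonempty[OF V cl, of B] by blast
      then show "C \<noteq> {}" using B(2) by (auto simp: ucl_def)
    qed
    fix C D assume "C \<in> ?S ` V" "D \<in> ?S ` V"
    then obtain B B' where B: "B \<in> V" "B' \<in> V" "C = ?S B" "D = ?S B'" by blast
    then have "B \<inter> B' \<in> V" using filtD(3)[OF ultra_filt[OF V]] by blast
    then show "\<exists>E\<in>?S ` V. E \<subseteq> C \<inter> D" by (intro bexI[of _ "?S (B \<inter> B')"]) (auto simp: B)
  qed (rule that)
  let ?W = "fbind X ?UX (\<lambda>U. U) \<Phi>"
  have m: "\<xi> ` ?UX \<subseteq> X" using mem by blast
  have W: "ultra X ?W" by (rule ultra_fbind[OF \<Phi>(1)]) simp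
  have "V \<subseteq> fimage X ?UX \<xi> \<Phi>"
  proof
    fix B assume B: "B \<in> V"
    then have "?S B \<in> \<Phi>" using \<Phi>(2) by blast
    then have "{U \<in> ?UX. \<xi> U \<in> B} \<in> \<Phi>" by (rule filtD(4)[OF ultra_filt[OF \<Phi>(1)]]) auto
    then show "B \<in> fimage X ?UX \<xi> \<Phi>" using filtD(1)[OF ultra_filt[OF V] B] by (simp add: fimage_def)
  qed
  then have "V = fimage X ?UX \<xi> \<Phi>" by (rule ultra_subset_eq[OF V ultra_fimage[OF \<Phi>(1) m]])
  then have "\<xi> V = \<xi> ?W" using assoc[OF \<Phi>(1)] by simp
  moreover have "A \<in> ?W"
  proof -
    obtain U where "ultra X U" "A \<in> U" using ultra_Int_nonempty[OF V cl cl] by (auto simp: ucl_def)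
    then have "A \<subseteq> X" using filtD(1)[OF ultra_filt] by blast
    moreover have "?S (ucl A) \<in> \<Phi>" using \<Phi>(2) cl by blast
    then have "{U \<in> ?UX. A \<in> U} \<in> \<Phi>" by (rule filtD(4)[OF ultra_filt[OF \<Phi>(1)]]) auto
    ultimately show ?thesis by (simp add: fbind_def)
  qed
  ultimately show ?thesis using W by (auto simp: ucl_def)
qed

lemma openin_compl_ucl: "openin topo (X - ucl A)"
  unfolding openin_topo
proof (intro conjI allI impI, blast)
  fix U assume U: "ultra X U \<and> \<xi> U \<in> X - ucl A"
  have "ucl A \<subseteq> X" using mem by (auto simp: ucl_def)
  then show "X - ucl A \<in> U" using ucl_idem[of U A] U ultra_compl[of X U "ucl A"] by blast
qed

lemma subset_ucl: "A \<subseteq> X \<Longrightarrow> A \<subseteq> ucl A"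
  unfolding ucl_def
proof (intro subsetI CollectI)
  fix x assume A: "A \<subseteq> X" and "x \<in> A"
  then have "x \<in> X" "A \<in> fprin X x" by (auto simp: fprin_def)
  then show "\<exists>U. x = \<xi> U \<and> ultra X U \<and> A \<in> U"
    using unit ultra_fprin by (intro exI[of _ "fprin X x"]) simp
qed

text \<open>Topological convergence agrees with \<xi>. Each A in U meets every neighbourhood of x,
  which puts x into \<open>ucl A\<close>: some ultrafilter containing A has value x. So the sets
  \<open>?S A\<close> below are nonempty and form a base.\<close>

lemma converges_unique:
  assumes U: "ultra X U" and x: "x \<in> X" and conv: "\<And>W. openin topo W \<Longrightarrow> x \<in> W \<Longrightarrow> W \<in> U"
  shows "\<xi> U = x"
proof -
  have cl: "x \<in> ucl A" if A: "A \<in> U" for A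
  proof (rule ccontr)
    assume "x \<notin> ucl A"
    then have "X - ucl A \<in> U" using conv[OF openin_compl_ucl] x by blast
    then show False using ultra_Int_nonempty[OF U A] subset_ucl filtD(1)[OF ultra_filt[OF U] A] by blast
  qed
  (* an ultrafilter on ultrafilters that multiplies to U and is mapped by \<xi> to the principal one at x *)
  let ?UX = "{U. ultra X U}" let ?S = "\<lambda>A. {V. ultra X V \<and> A \<in> V \<and> \<xi> V = x}"
  obtain \<Phi> where \<Phi>: "ultra ?UX \<Phi>" "?S ` U \<subseteq> \<Phi>"
  proof (rule ultrafilter_base[of "?S ` U" ?UX])
    show "?S ` U \<noteq> {}" using filtD(2)[OF ultra_filt[OF U]] by blast
    show "C \<in> ?S ` U \<Longrightarrow> C \<subseteq> ?UX" for C by blast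
    show "C \<in> ?S ` U \<Longrightarrow> C \<noteq> {}" for C using cl by (fastforce simp: ucl_def)
    fix C D assume "C \<in> ?S ` U" "D \<in> ?S ` U"
    then obtain B B' where B: "B \<in> U" "B' \<in> U" "C = ?S B" "D = ?S B'" by blast
    then have "B \<inter> B' \<in> U" using filtD(3)[OF ultra_filt[OF U]] by blast
    moreover have "?S (B \<inter> B') \<subseteq> C \<inter> D"
      using filtD(4)[OF ultra_filt] filtD(1)[OF ultra_filt[OF U]] B by blast
    ultimately show "\<exists>E\<in>?S ` U. E \<subseteq> C \<inter> D" by blast
  qed (rule that)
  have m: "\<xi> ` ?UX \<subseteq> X" using mem by blast
  have "U \<subseteq> fbind X ?UX (\<lambda>U. U) \<Phi>"
  proof
    fix A assume A: "A \<in> U"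
    then have "?S A \<in> \<Phi>" using \<Phi>(2) by blast
    then have "{V \<in> ?UX. A \<in> V} \<in> \<Phi>" by (rule filtD(4)[OF ultra_filt[OF \<Phi>(1)]]) auto
    then show "A \<in> fbind X ?UX (\<lambda>U. U) \<Phi>" using filtD(1)[OF ultra_filt[OF U] A] by (simp add: fbind_def)
  qed
  moreover have "ultra X (fbind X ?UX (\<lambda>U. U) \<Phi>)" by (rule ultra_fbind[OF \<Phi>(1)]) simp
  ultimately have 1: "U = fbind X ?UX (\<lambda>U. U) \<Phi>" using ultra_subset_eq[OF U] by simp
  have "fprin X x \<subseteq> fimage X ?UX \<xi> \<Phi>"
  proof
    fix B assume B: "B \<in> fprin X x"
    have "?S X \<in> \<Phi>" using \<Phi>(2) filtD(2)[OF ultra_filt[OF U]] by blast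
    then have "{U \<in> ?UX. \<xi> U \<in> B} \<in> \<Phi>"
      by (rule filtD(4)[OF ultra_filt[OF \<Phi>(1)]]) (use B in \<open>auto simp: fprin_def\<close>)
    then show "B \<in> fimage X ?UX \<xi> \<Phi>" using B by (simp add: fimage_def fprin_def)
  qed
  then have "fprin X x = fimage X ?UX \<xi> \<Phi>" by (rule ultra_subset_eq[OF ultra_fprin[OF x] ultra_fimage[OF \<Phi>(1) m]])
  then show ?thesis using assoc[OF \<Phi>(1)] 1 unit[OF x] by simp
qed

text \<open>If neighbourhoods of x and y always met, some ultrafilter would contain all
  neighbourhoods of both points, and its value would be both x and y by
  \<open>converges_unique\<close>.\<close>

lemma Hausdorff_topo: "Hausdorff_space topo"
  unfolding Hausdorff_space_def topspace_topo
proof (intro allI impI, rule ccontr)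
  fix x y assume xy: "x \<in> X \<and> y \<in> X \<and> x \<noteq> y"
    and n: "\<nexists>V W. openin topo V \<and> openin topo W \<and> x \<in> V \<and> y \<in> W \<and> disjnt V W"
  let ?B = "{V \<inter> W | V W. openin topo V \<and> openin topo W \<and> x \<in> V \<and> y \<in> W}"
  obtain U where U: "ultra X U" "?B \<subseteq> U"
  proof (rule ultrafilter_base[of ?B X])
    show "?B \<noteq> {}" using xy openin_topspace[of topo] topspace_topo by blast
    show "C \<in> ?B \<Longrightarrow> C \<subseteq> X" for C by (auto simp: openin_topo)
    show "C \<in> ?B \<Longrightarrow> C \<noteq> {}" for C using n by (auto simp: disjnt_def)
    fix B C assume "B \<in> ?B" "C \<in> ?B"
    then obtain V W V' W' where "B = V \<inter> W" "C = V' \<inter> W'" "openin topo V" "openin topo W" "openin topo V'" "openin topo W'"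
      "x \<in> V" "x \<in> V'" "y \<in> W" "y \<in> W'" by blast
    then have "(V \<inter> V') \<inter> (W \<inter> W') \<in> ?B" "(V \<inter> V') \<inter> (W \<inter> W') \<subseteq> B \<inter> C" by blast+
    then show "\<exists>D\<in>?B. D \<subseteq> B \<inter> C" by blast
  qed (rule that)
  have X: "openin topo X" using openin_topspace[of topo] topspace_topo by simp
  have "W \<in> U" if "openin topo W" "x \<in> W \<or> y \<in> W" for W
  proof -
    have W: "W \<inter> X = W" "X \<inter> W = W" using that by (auto simp: openin_topo)
    have "\<exists>V V'. W = V \<inter> V' \<and> openin topo V \<and> openin topo V' \<and> x \<in> V \<and> y \<in> V'"
      using that(2)
    proof
      assume "x \<in> W" then show ?thesis using that X xy W by (intro exI[of _ W] exI[of _ X]) simp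
    next
      assume "y \<in> W" then show ?thesis using that X xy W by (intro exI[of _ X] exI[of _ W]) simp
    qed
    then show "W \<in> U" by (intro subsetD[OF U(2)] CollectI)
  qed
  then have "\<xi> U = x" "\<xi> U = y" using converges_unique[OF U(1)] xy by blast+
  then show False using xy by simp
qed

text \<open>Without a finite subcover the complements of finite unions form a base. The value of an
  ultrafilter above it lies in some W of the cover, so W belongs to the ultrafilter together with
  its complement.\<close>

lemma compact_topo: "compact_space topo"
  unfolding compact_space_alt topspace_topo
proof (intro allI impI, rule ccontr)
  fix \<C> assume "(\<forall>W\<in>\<C>. openin topo W) \<and> X \<subseteq> \<Union>\<C>"
  then have C: "\<forall>W\<in>\<C>. openin topo W" "X \<subseteq> \<Union>\<C>" by simp_all
  assume n: "\<nexists>\<F>. finite \<F> \<and> \<F> \<subseteq> \<C> \<and> X \<subseteq> \<Union>\<F>"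
  let ?B = "{X - \<Union>\<F> | \<F>. finite \<F> \<and> \<F> \<subseteq> \<C>}"
  obtain U where U: "ultra X U" "?B \<subseteq> U"
  proof (rule ultrafilter_base[of ?B X])
    show "?B \<noteq> {}" by blast
    show "C \<in> ?B \<Longrightarrow> C \<subseteq> X" for C by blast
    show "C \<in> ?B \<Longrightarrow> C \<noteq> {}" for C using n by blast
    fix B C assume "B \<in> ?B" "C \<in> ?B"
    then obtain \<F> \<G> where F: "B = X - \<Union>\<F>" "C = X - \<Union>\<G>" "finite \<F>" "finite \<G>" "\<F> \<subseteq> \<C>" "\<G> \<subseteq> \<C>" by blast
    then have "X - \<Union>(\<F> \<union> \<G>) \<in> ?B" by (intro CollectI exI[of _ "\<F> \<union> \<G>"]) simp
    moreover have "X - \<Union>(\<F> \<union> \<G>) \<subseteq> B \<inter> C" using F by blast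
    ultimately show "\<exists>D\<in>?B. D \<subseteq> B \<inter> C" by blast
  qed (rule that)
  obtain W where W: "W \<in> \<C>" "\<xi> U \<in> W" using mem[OF U(1)] C(2) by blast
  then have "W \<in> U" using C(1) U(1) by (simp add: openin_topo)
  moreover have "X - \<Union>{W} \<in> ?B" using W(1) by (intro CollectI exI[of _ "{W}"]) simp
  then have "X - W \<in> U" using U(2) by auto
  ultimately show False using ultra_Int_nonempty[OF U(1), of W "X - W"] by blast
qed

lemma ulim_topo: "ultra X U \<Longrightarrow> ulim topo U = \<xi> U"
  by (rule ulim_unique[OF Hausdorff_topo]) (simp_all add: topspace_topo mem openin_topo)

end

section \<open>Continuous lattices as filter algebras\<close>

definition fup :: "'a set \<Rightarrow> 'a set \<Rightarrow> 'a set set"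
  where "fup X A = {B. A \<subseteq> B \<and> B \<subseteq> X}"

text \<open>The filter of final segments of D regarded as a net. Its limit is the join of D, as the
  limit of \<open>fup\<close> is a meet, so that directed joins and arbitrary meets are both
  instances of \<open>flim\<close>.\<close>

definition tails :: "'a gorder \<Rightarrow> 'a set \<Rightarrow> 'a set set"
  where "tails L D = fgen (carrier L) ((\<lambda>d. {e\<in>D. d \<sqsubseteq>\<^bsub>L\<^esub> e}) ` D)"

definition flim :: "'a gorder \<Rightarrow> 'a set set \<Rightarrow> 'a"
  where "flim L F = \<Squnion>\<^bsub>L\<^esub> ((\<lambda>A. \<Sqinter>\<^bsub>L\<^esub> A) ` F)"

lemma filt_fup: "A \<subseteq> X \<Longrightarrow> filt X (fup X A)"
  by (rule filtI) (auto simp: fup_def)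

lemma fprin_fup: "x \<in> X \<Longrightarrow> fprin X x = fup X {x}"
  by (auto simp: fprin_def fup_def)

lemma fimage_fup: "A \<subseteq> X \<Longrightarrow> f ` X \<subseteq> Y \<Longrightarrow> fimage Y X f (fup X A) = fup Y (f ` A)"
  by (auto simp: fimage_def fup_def)

lemma fimage_id: "filt X F \<Longrightarrow> fimage X X (\<lambda>x. x) F = F"
proof -
  assume F: "filt X F"
  have "B \<subseteq> X \<Longrightarrow> {x \<in> X. x \<in> B} = B" for B by auto
  then show ?thesis using filtD(1)[OF F] by (auto simp: fimage_def)
qed

lemma directed_inI:
  assumes "D \<subseteq> carrier L" "D \<noteq> {}" "\<And>x y. x \<in> D \<Longrightarrow> y \<in> D \<Longrightarrow> \<exists>z\<in>D. x \<sqsubseteq>\<^bsub>L\<^esub> z \<and> y \<sqsubseteq>\<^bsub>L\<^esub> z"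
  shows "directed_in L D"
  using assms by (simp add: directed_in_def)

lemma directed_inD:
  assumes "directed_in L D"
  shows "D \<subseteq> carrier L" "D \<noteq> {}" "x \<in> D \<Longrightarrow> y \<in> D \<Longrightarrow> \<exists>z\<in>D. x \<sqsubseteq>\<^bsub>L\<^esub> z \<and> y \<sqsubseteq>\<^bsub>L\<^esub> z"
  using assms unfolding directed_in_def by auto

lemma way_belowD:
  assumes "way_below L x y"
  shows "x \<in> carrier L" "y \<in> carrier L"
    "directed_in L D \<Longrightarrow> y \<sqsubseteq>\<^bsub>L\<^esub> \<Squnion>\<^bsub>L\<^esub> D \<Longrightarrow> \<exists>d\<in>D. x \<sqsubseteq>\<^bsub>L\<^esub> d"
  using assms unfolding way_below_def by auto

text \<open>The predicates \<open>directed_in\<close> and \<open>way_below\<close> are only defined for records of type \<open>gorder\<close>.\<close>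

locale gorder_lattice = complete_lattice L for L :: "'a gorder" (structure)
begin

lemma inf_antimono: "B \<subseteq> carrier L \<Longrightarrow> A \<subseteq> B \<Longrightarrow> \<Sqinter>\<^bsub>L\<^esub> B \<sqsubseteq>\<^bsub>L\<^esub> \<Sqinter>\<^bsub>L\<^esub> A"
  by (rule inf_greatest) (auto intro: inf_lower)

lemma infs_closed: "filt (carrier L) F \<Longrightarrow> (\<lambda>A. \<Sqinter>\<^bsub>L\<^esub> A) ` F \<subseteq> carrier L"
  by (rule image_subsetI) (rule inf_closed[OF filtD(1)])

lemma flim_closed: "filt (carrier L) F \<Longrightarrow> flim L F \<in> carrier L"
  unfolding flim_def by (rule sup_closed[OF infs_closed])

lemma flim_upper: "filt (carrier L) F \<Longrightarrow> A \<in> F \<Longrightarrow> \<Sqinter>\<^bsub>L\<^esub> A \<sqsubseteq>\<^bsub>L\<^esub> flim L F"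
  unfolding flim_def by (rule sup_upper[OF infs_closed]) auto

lemma flim_least:
  "filt (carrier L) F \<Longrightarrow> z \<in> carrier L \<Longrightarrow> (\<And>A. A \<in> F \<Longrightarrow> \<Sqinter>\<^bsub>L\<^esub> A \<sqsubseteq>\<^bsub>L\<^esub> z) \<Longrightarrow> flim L F \<sqsubseteq>\<^bsub>L\<^esub> z"
  unfolding flim_def by (rule sup_least[OF infs_closed]) auto

lemma directed_infs: "filt (carrier L) F \<Longrightarrow> directed_in L ((\<lambda>A. \<Sqinter>\<^bsub>L\<^esub> A) ` F)"
proof (rule directed_inI)
  assume F: "filt (carrier L) F"
  show "(\<lambda>A. \<Sqinter>\<^bsub>L\<^esub> A) ` F \<noteq> {}" using filtD(2)[OF F] by auto
  fix x y assume "x \<in> (\<lambda>A. \<Sqinter>\<^bsub>L\<^esub> A) ` F" "y \<in> (\<lambda>A. \<Sqinter>\<^bsub>L\<^esub> A) ` F"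
  then obtain A B where AB: "A \<in> F" "B \<in> F" "x = \<Sqinter>\<^bsub>L\<^esub> A" "y = \<Sqinter>\<^bsub>L\<^esub> B" by auto
  note c = filtD(1)[OF F AB(1)] filtD(1)[OF F AB(2)]
  have "x \<sqsubseteq>\<^bsub>L\<^esub> \<Sqinter>\<^bsub>L\<^esub> (A \<inter> B)" "y \<sqsubseteq>\<^bsub>L\<^esub> \<Sqinter>\<^bsub>L\<^esub> (A \<inter> B)"
    unfolding AB(3,4) using c by (auto intro: inf_antimono)
  then show "\<exists>z\<in>(\<lambda>A. \<Sqinter>\<^bsub>L\<^esub> A) ` F. x \<sqsubseteq>\<^bsub>L\<^esub> z \<and> y \<sqsubseteq>\<^bsub>L\<^esub> z"
    using filtD(3)[OF F AB(1,2)] by (intro bexI[of _ "\<Sqinter>\<^bsub>L\<^esub> (A \<inter> B)"]) auto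
qed (rule infs_closed)

lemma flim_fup: "A \<subseteq> carrier L \<Longrightarrow> flim L (fup (carrier L) A) = \<Sqinter>\<^bsub>L\<^esub> A"
proof (rule le_antisym)
  assume A: "A \<subseteq> carrier L"
  note F = filt_fup[OF A]
  show "flim L (fup (carrier L) A) \<sqsubseteq>\<^bsub>L\<^esub> \<Sqinter>\<^bsub>L\<^esub> A"
    using A by (intro flim_least[OF F] inf_closed) (auto simp: fup_def intro: inf_antimono)
  show "\<Sqinter>\<^bsub>L\<^esub> A \<sqsubseteq>\<^bsub>L\<^esub> flim L (fup (carrier L) A)" using A by (intro flim_upper[OF F]) (auto simp: fup_def)
qed (auto intro: inf_closed flim_closed filt_fup)

lemma flim_fprin: "x \<in> carrier L \<Longrightarrow> flim L (fprin (carrier L) x) = x"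
  by (simp add: fprin_fup flim_fup)

lemma filt_tails: "directed_in L D \<Longrightarrow> filt (carrier L) (tails L D)"
  unfolding tails_def
proof (rule filt_fgen)
  assume D: "directed_in L D"
  let ?t = "\<lambda>d. {e\<in>D. d \<sqsubseteq>\<^bsub>L\<^esub> e}"
  show "?t ` D \<noteq> {}" using directed_inD(2)[OF D] by blast
  show "A \<in> ?t ` D \<Longrightarrow> A \<subseteq> carrier L" for A using directed_inD(1)[OF D] by auto
  fix A B assume "A \<in> ?t ` D" "B \<in> ?t ` D"
  then obtain a b where ab: "a \<in> D" "b \<in> D" "A = ?t a" "B = ?t b" by auto
  obtain c where c: "c \<in> D" "a \<sqsubseteq>\<^bsub>L\<^esub> c" "b \<sqsubseteq>\<^bsub>L\<^esub> c" using directed_inD(3)[OF D ab(1,2)] by auto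
  have "?t c \<subseteq> A \<inter> B" unfolding ab(3,4)
    using c ab(1,2) directed_inD(1)[OF D] by (auto intro: le_trans[OF _ _ _ subsetD])
  then show "\<exists>C\<in>?t ` D. C \<subseteq> A \<inter> B" using c(1) by (intro bexI[of _ "?t c"]) auto
qed

text \<open>A member of the image filter contains some \<open>f d\<close>, which bounds its meet by
  the join. Conversely, by monotonicity \<open>f d\<close> lies below the meet of all
  \<open>f e\<close> with e in the tail of d. The identity gives \<open>flim_tails\<close>;
  homomorphisms need general f.\<close>

lemma flim_image_tails:
  assumes K: "complete_lattice K" and D: "directed_in K D" and f: "f ` carrier K \<subseteq> carrier L"
    and mono: "\<And>x y. x \<in> D \<Longrightarrow> y \<in> D \<Longrightarrow> x \<sqsubseteq>\<^bsub>K\<^esub> y \<Longrightarrow> f x \<sqsubseteq>\<^bsub>L\<^esub> f y"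
  shows "flim L (fimage (carrier L) (carrier K) f (tails K D)) = \<Squnion>\<^bsub>L\<^esub> (f ` D)"
proof -
  interpret K: gorder_lattice K by (rule gorder_lattice.intro[OF K])
  let ?F = "fimage (carrier L) (carrier K) f (tails K D)"
  note DK = directed_inD(1)[OF D]
  have fD: "f ` D \<subseteq> carrier L" using f DK by blast
  have F: "filt (carrier L) ?F" by (rule filt_fimage[OF K.filt_tails[OF D] f])
  show ?thesis
  proof (rule le_antisym)
    show "flim L ?F \<sqsubseteq>\<^bsub>L\<^esub> \<Squnion>\<^bsub>L\<^esub> (f ` D)"
    proof (rule flim_least[OF F sup_closed[OF fD]])
      fix B assume B: "B \<in> ?F"
      then have BL: "B \<subseteq> carrier L" and "{x \<in> carrier K. f x \<in> B} \<in> tails K D" by (simp_all add: fimage_def)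
      then obtain d where d: "d \<in> D" "{e \<in> D. d \<sqsubseteq>\<^bsub>K\<^esub> e} \<subseteq> {x \<in> carrier K. f x \<in> B}"
        unfolding tails_def by (elim fgenE) auto
      moreover have "d \<in> {e \<in> D. d \<sqsubseteq>\<^bsub>K\<^esub> e}" using d(1) DK K.le_refl by auto
      ultimately have fd: "f d \<in> B" by auto
      show "\<Sqinter>\<^bsub>L\<^esub> B \<sqsubseteq>\<^bsub>L\<^esub> \<Squnion>\<^bsub>L\<^esub> (f ` D)"
        by (rule le_trans[OF inf_lower[OF BL fd] sup_upper[OF fD]])
          (use BL fd fD d(1) in \<open>auto intro: inf_closed sup_closed\<close>)
    qed
    show "\<Squnion>\<^bsub>L\<^esub> (f ` D) \<sqsubseteq>\<^bsub>L\<^esub> flim L ?F"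
    proof (rule sup_least[OF fD flim_closed[OF F]])
      fix x assume "x \<in> f ` D"
      then obtain d where d: "d \<in> D" "x = f d" by auto
      let ?B = "f ` {e \<in> D. d \<sqsubseteq>\<^bsub>K\<^esub> e}"
      have BL: "?B \<subseteq> carrier L" using fD by auto
      have "{x \<in> carrier K. f x \<in> ?B} \<in> tails K D" unfolding tails_def
        using d(1) DK by (intro fgenI[of _ _ "{e \<in> D. d \<sqsubseteq>\<^bsub>K\<^esub> e}"]) auto
      then have "?B \<in> ?F" using BL by (simp add: fimage_def)
      then have u: "\<Sqinter>\<^bsub>L\<^esub> ?B \<sqsubseteq>\<^bsub>L\<^esub> flim L ?F" by (rule flim_upper[OF F])
      have xL: "x \<in> carrier L" using d fD by auto
      have "x \<sqsubseteq>\<^bsub>L\<^esub> \<Sqinter>\<^bsub>L\<^esub> ?B" by (rule inf_greatest[OF BL xL]) (use d mono in auto)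
      then show "x \<sqsubseteq>\<^bsub>L\<^esub> flim L ?F" using u xL by (rule le_trans) (simp_all add: inf_closed[OF BL] flim_closed[OF F])
    qed
  qed (simp_all add: flim_closed[OF F] sup_closed[OF fD])
qed

lemma flim_tails: "directed_in L D \<Longrightarrow> flim L (tails L D) = \<Squnion>\<^bsub>L\<^esub> D"
  using flim_image_tails[OF complete_lattice_axioms, of D "\<lambda>x. x"] by (simp add: fimage_id filt_tails)

lemma inf_upset: "x \<in> carrier L \<Longrightarrow> \<Sqinter>\<^bsub>L\<^esub> {z \<in> carrier L. x \<sqsubseteq>\<^bsub>L\<^esub> z} = x"
  by (rule le_antisym) (auto intro: inf_lower inf_greatest inf_closed)

text \<open>The meets of members of F are directed with join \<open>flim L F\<close>, so x lies
  below the meet of some member, and that member is contained in the upper set of x.\<close>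

lemma way_below_flim:
  assumes F: "filt (carrier L) F" and x: "way_below L x y" and y: "y \<sqsubseteq>\<^bsub>L\<^esub> flim L F"
  shows "{z \<in> carrier L. x \<sqsubseteq>\<^bsub>L\<^esub> z} \<in> F"
proof -
  obtain A where A: "A \<in> F" "x \<sqsubseteq>\<^bsub>L\<^esub> \<Sqinter>\<^bsub>L\<^esub> A"
    using way_belowD(3)[OF x directed_infs[OF F]] y unfolding flim_def by auto
  note AL = filtD(1)[OF F A(1)]
  show ?thesis
  proof (rule filtD(4)[OF F A(1)])
    show "A \<subseteq> {z \<in> carrier L. x \<sqsubseteq>\<^bsub>L\<^esub> z}"
      using AL le_trans[OF A(2) inf_lower[OF AL]] way_belowD(1)[OF x] inf_closed[OF AL] by auto
  qed auto
qed

lemma upset_flim: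
  assumes F: "filt (carrier L) F" and x: "x \<in> carrier L" and u: "{z \<in> carrier L. x \<sqsubseteq>\<^bsub>L\<^esub> z} \<in> F"
  shows "x \<sqsubseteq>\<^bsub>L\<^esub> flim L F"
  using flim_upper[OF F u] by (simp add: inf_upset[OF x])

end

text \<open>For the first inequality, if A belongs to \<open>k i\<close> then the limit of
  \<open>k i\<close> lies above the meet of A. The converse uses continuity: a limit above the meet
  of A need not make A a member of \<open>k i\<close>, but the upper set of each x way below that
  meet is one, and such x have that meet as their join.\<close>

lemma flim_fbind:
  assumes L: "continuous_lattice L" and G: "filt I G" and k: "\<And>i. i \<in> I \<Longrightarrow> filt (carrier L) (k i)"
  shows "flim L (fbind (carrier L) I k G) = flim L (fimage (carrier L) I (\<lambda>i. flim L (k i)) G)"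
proof -
  interpret gorder_lattice L using L by (simp add: continuous_lattice_def gorder_lattice_def)
  let ?C = "carrier L"
  have h: "(\<lambda>i. flim L (k i)) ` I \<subseteq> ?C" using flim_closed[OF k] by blast
  have B: "filt ?C (fbind ?C I k G)" by (rule filt_fbind[OF G k])
  note R = filt_fimage[OF G h]
  note c = flim_closed[OF B] flim_closed[OF R]
  show ?thesis
  proof (rule le_antisym)
    show "flim L (fbind ?C I k G) \<sqsubseteq>\<^bsub>L\<^esub> flim L (fimage ?C I (\<lambda>i. flim L (k i)) G)"
    proof (rule flim_least[OF B c(2)])
      fix A assume "A \<in> fbind ?C I k G"
      then have A: "A \<subseteq> ?C" "{i \<in> I. A \<in> k i} \<in> G" by (simp_all add: fbind_def)
      have "{i \<in> I. flim L (k i) \<in> {z \<in> ?C. \<Sqinter>\<^bsub>L\<^esub> A \<sqsubseteq>\<^bsub>L\<^esub> z}} \<in> G"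
        by (rule filtD(4)[OF G A(2)]) (auto intro: flim_closed flim_upper k)
      then show "\<Sqinter>\<^bsub>L\<^esub> A \<sqsubseteq>\<^bsub>L\<^esub> flim L (fimage ?C I (\<lambda>i. flim L (k i)) G)"
        by (intro upset_flim[OF R inf_closed[OF A(1)]]) (auto simp: fimage_def)
    qed
    show "flim L (fimage ?C I (\<lambda>i. flim L (k i)) G) \<sqsubseteq>\<^bsub>L\<^esub> flim L (fbind ?C I k G)"
    proof (rule flim_least[OF R c(1)])
      fix A assume "A \<in> fimage ?C I (\<lambda>i. flim L (k i)) G"
      then have A: "A \<subseteq> ?C" "{i \<in> I. flim L (k i) \<in> A} \<in> G" by (simp_all add: fimage_def)
      let ?y = "\<Sqinter>\<^bsub>L\<^esub> A"
      have y: "?y \<in> ?C" using A(1) by (rule inf_closed)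
      have sup: "\<Squnion>\<^bsub>L\<^esub> {x. way_below L x ?y} = ?y" using L y by (simp add: continuous_lattice_def)
      have "\<Squnion>\<^bsub>L\<^esub> {x. way_below L x ?y} \<sqsubseteq>\<^bsub>L\<^esub> flim L (fbind ?C I k G)"
      proof (rule sup_least[OF _ c(1)])
        show "{x. way_below L x ?y} \<subseteq> ?C" using way_belowD(1) by auto
        fix x assume "x \<in> {x. way_below L x ?y}"
        then have x: "way_below L x ?y" by simp
        have "{i \<in> I. {z \<in> ?C. x \<sqsubseteq>\<^bsub>L\<^esub> z} \<in> k i} \<in> G"
          by (rule filtD(4)[OF G A(2)]) (auto intro!: way_below_flim[OF k x] inf_lower[OF A(1)])
        then show "x \<sqsubseteq>\<^bsub>L\<^esub> flim L (fbind ?C I k G)"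
          by (intro upset_flim[OF B way_belowD(1)[OF x]]) (auto simp: fbind_def)
      qed
      then show "?y \<sqsubseteq>\<^bsub>L\<^esub> flim L (fbind ?C I k G)" by (simp add: sup)
    qed
  qed (use c in auto)
qed

text \<open>\<open>flim\<close> is a directed join of meets, so preserving both gives preservation
  of limits. Conversely, meets are limits of principal filters and directed joins are limits of
  \<open>tails\<close>.\<close>

lemma contlat_hom_iff:
  assumes L: "complete_lattice L" and K: "complete_lattice K" and f: "f ` carrier L \<subseteq> carrier K"
  shows "((\<forall>D. directed_in L D \<longrightarrow> f (\<Squnion>\<^bsub>L\<^esub> D) = \<Squnion>\<^bsub>K\<^esub> (f ` D)) \<and>
      (\<forall>A. A \<subseteq> carrier L \<longrightarrow> f (\<Sqinter>\<^bsub>L\<^esub> A) = \<Sqinter>\<^bsub>K\<^esub> (f ` A))) \<longleftrightarrow>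
    (\<forall>F. filt (carrier L) F \<longrightarrow> f (flim L F) = flim K (fimage (carrier K) (carrier L) f F))"
    (is "?sup \<and> ?inf \<longleftrightarrow> ?lim")
proof (rule iffI)
  interpret L: gorder_lattice L by (rule gorder_lattice.intro[OF L])
  interpret K: gorder_lattice K by (rule gorder_lattice.intro[OF K])
  {
    assume "?sup \<and> ?inf"
    then have s: "\<And>D. directed_in L D \<Longrightarrow> f (\<Squnion>\<^bsub>L\<^esub> D) = \<Squnion>\<^bsub>K\<^esub> (f ` D)"
      and i: "\<And>A. A \<subseteq> carrier L \<Longrightarrow> f (\<Sqinter>\<^bsub>L\<^esub> A) = \<Sqinter>\<^bsub>K\<^esub> (f ` A)" by auto
    show ?lim
    proof (intro allI impI)
      fix F assume F: "filt (carrier L) F"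
      let ?G = "fimage (carrier K) (carrier L) f F" and ?S = "(\<lambda>A. f (\<Sqinter>\<^bsub>L\<^esub> A)) ` F"
      note G = filt_fimage[OF F f]
      have FL: "A \<subseteq> carrier L" if "A \<in> F" for A using filtD(1)[OF F that] .
      have S: "?S \<subseteq> carrier K" using f FL by (auto intro!: L.inf_closed)
      have e: "f (flim L F) = \<Squnion>\<^bsub>K\<^esub> ?S"
        unfolding flim_def by (simp add: s[OF L.directed_infs[OF F]] image_image)
      have "\<Squnion>\<^bsub>K\<^esub> ?S = flim K ?G"
      proof (rule K.le_antisym)
        show "\<Squnion>\<^bsub>K\<^esub> ?S \<sqsubseteq>\<^bsub>K\<^esub> flim K ?G"
        proof (rule K.sup_least[OF S K.flim_closed[OF G]])
          fix x assume "x \<in> ?S"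
          then obtain A where A: "A \<in> F" "x = \<Sqinter>\<^bsub>K\<^esub> (f ` A)" using i FL by auto
          have "{x \<in> carrier L. f x \<in> f ` A} \<in> F" by (rule filtD(4)[OF F A(1)]) (use FL[OF A(1)] in auto)
          moreover have "f ` A \<subseteq> carrier K" using f FL[OF A(1)] by blast
          ultimately have "f ` A \<in> ?G" by (simp add: fimage_def)
          then show "x \<sqsubseteq>\<^bsub>K\<^esub> flim K ?G" unfolding A(2) by (rule K.flim_upper[OF G])
        qed
        show "flim K ?G \<sqsubseteq>\<^bsub>K\<^esub> \<Squnion>\<^bsub>K\<^esub> ?S"
        proof (rule K.flim_least[OF G K.sup_closed[OF S]])
          fix B assume "B \<in> ?G"
          then have B: "B \<subseteq> carrier K" "{x \<in> carrier L. f x \<in> B} \<in> F" by (simp_all add: fimage_def)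
          let ?A = "{x \<in> carrier L. f x \<in> B}"
          have 1: "\<Sqinter>\<^bsub>K\<^esub> B \<sqsubseteq>\<^bsub>K\<^esub> \<Sqinter>\<^bsub>K\<^esub> (f ` ?A)" by (rule K.inf_antimono[OF B(1)]) auto
          have "f (\<Sqinter>\<^bsub>L\<^esub> ?A) = \<Sqinter>\<^bsub>K\<^esub> (f ` ?A)" by (rule i) auto
          then have 2: "\<Sqinter>\<^bsub>K\<^esub> (f ` ?A) \<in> ?S" by - (rule image_eqI[OF _ B(2)], rule sym)
          show "\<Sqinter>\<^bsub>K\<^esub> B \<sqsubseteq>\<^bsub>K\<^esub> \<Squnion>\<^bsub>K\<^esub> ?S"
            by (rule K.le_trans[OF 1 K.sup_upper[OF S 2]]) (use B(1) S 2 in \<open>auto intro: K.inf_closed K.sup_closed\<close>)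
        qed
      qed (simp_all add: K.sup_closed[OF S] K.flim_closed[OF G])
      then show "f (flim L F) = flim K ?G" using e by simp
    qed
  }
  assume ?lim
  then have l: "\<And>F. filt (carrier L) F \<Longrightarrow> f (flim L F) = flim K (fimage (carrier K) (carrier L) f F)" by blast
  have i: "f (\<Sqinter>\<^bsub>L\<^esub> A) = \<Sqinter>\<^bsub>K\<^esub> (f ` A)" if A: "A \<subseteq> carrier L" for A
  proof -
    have fA: "f ` A \<subseteq> carrier K" using A f by blast
    show ?thesis using l[OF filt_fup[OF A]] by (simp add: L.flim_fup[OF A] fimage_fup[OF A f] K.flim_fup[OF fA])
  qed
  \<comment> \<open>\<open>flim_image_tails\<close> needs monotonicity, which comes from
    preservation of binary meets.\<close>
  have mono: "f x \<sqsubseteq>\<^bsub>K\<^esub> f y" if xy: "x \<in> carrier L" "y \<in> carrier L" "x \<sqsubseteq>\<^bsub>L\<^esub> y" for x y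
  proof -
    have "\<Sqinter>\<^bsub>L\<^esub> {x, y} = x" by (rule L.le_antisym) (use xy in \<open>auto intro: L.inf_lower L.inf_greatest L.inf_closed\<close>)
    then have "f x = \<Sqinter>\<^bsub>K\<^esub> {f x, f y}" using i[of "{x, y}"] xy by simp
    moreover have "\<Sqinter>\<^bsub>K\<^esub> {f x, f y} \<sqsubseteq>\<^bsub>K\<^esub> f y" by (rule K.inf_lower) (use xy f in auto)
    ultimately show ?thesis by simp
  qed
  have "f (\<Squnion>\<^bsub>L\<^esub> D) = \<Squnion>\<^bsub>K\<^esub> (f ` D)" if D: "directed_in L D" for D
  proof -
    have DL: "\<And>x. x \<in> D \<Longrightarrow> x \<in> carrier L" using directed_inD(1)[OF D] by blast
    have "f (\<Squnion>\<^bsub>L\<^esub> D) = flim K (fimage (carrier K) (carrier L) f (tails L D))"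
      using l[OF L.filt_tails[OF D]] by (simp add: L.flim_tails[OF D])
    also have "\<dots> = \<Squnion>\<^bsub>K\<^esub> (f ` D)" by (rule K.flim_image_tails[OF L D f]) (rule mono[OF DL DL])
    finally show ?thesis .
  qed
  then show "?sup \<and> ?inf" using i by blast
qed

section \<open>From filter algebras to continuous lattices\<close>

locale filter_algebra =
  fixes X :: "'a set" and \<xi> :: "'a set set \<Rightarrow> 'a"
  assumes mem: "filt X F \<Longrightarrow> \<xi> F \<in> X"
    and unit: "x \<in> X \<Longrightarrow> \<xi> (fprin X x) = x"
    and assoc: "filt {F. filt X F} \<Phi> \<Longrightarrow>
      \<xi> (fbind X {F. filt X F} (\<lambda>F. F) \<Phi>) = \<xi> (fimage X {F. filt X F} \<xi> \<Phi>)"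
begin

text \<open>Associativity in Kleisli form: pushing G forward along k reduces an arbitrary index set
  to a set of filters.\<close>

lemma bind:
  assumes G: "filt I G" and k: "\<And>i. i \<in> I \<Longrightarrow> filt X (k i)"
  shows "\<xi> (fbind X I k G) = \<xi> (fimage X I (\<lambda>i. \<xi> (k i)) G)"
proof -
  have k': "k ` I \<subseteq> {F. filt X F}" using k by auto
  show ?thesis using assoc[OF filt_fimage[OF G k']] by (simp add: fbind_fimage[OF k'] fimage_fimage[OF k'])
qed

definition fmeet :: "'a set \<Rightarrow> 'a"
  where "fmeet A = \<xi> (fup X A)"

lemma meet_closed: "A \<subseteq> X \<Longrightarrow> fmeet A \<in> X"
  unfolding fmeet_def by (rule mem[OF filt_fup])

lemma meet_singleton: "x \<in> X \<Longrightarrow> fmeet {x} = x"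
  using unit[of x] by (simp add: fmeet_def fprin_fup)

text \<open>The intersection of a set of filters is its sum along the principal filter of the whole
  set, so \<open>bind\<close> turns intersections of filters into meets of their values.\<close>

lemma meet_filters:
  assumes S: "\<And>F. F \<in> \<S> \<Longrightarrow> filt X F"
  shows "\<xi> {B. B \<subseteq> X \<and> (\<forall>F\<in>\<S>. B \<in> F)} = fmeet (\<xi> ` \<S>)"
proof -
  have "{F \<in> \<S>. B \<in> F} \<in> fup \<S> \<S> \<longleftrightarrow> (\<forall>F\<in>\<S>. B \<in> F)" for B by (auto simp: fup_def)
  then have "fbind X \<S> (\<lambda>F. F) (fup \<S> \<S>) = {B. B \<subseteq> X \<and> (\<forall>F\<in>\<S>. B \<in> F)}" by (simp add: fbind_def)
  moreover have "fimage X \<S> \<xi> (fup \<S> \<S>) = fup X (\<xi> ` \<S>)"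
    by (rule fimage_fup[OF subset_refl]) (rule image_subsetI, rule mem[OF S])
  ultimately show ?thesis using bind[OF filt_fup[OF subset_refl], of \<S> "\<lambda>F. F"] S by (simp add: fmeet_def)
qed

lemma meet_meets:
  assumes A: "\<And>A. A \<in> \<A> \<Longrightarrow> A \<subseteq> X"
  shows "fmeet (\<Union>\<A>) = fmeet (fmeet ` \<A>)"
proof -
  have "{B. B \<subseteq> X \<and> (\<forall>F\<in>fup X ` \<A>. B \<in> F)} = fup X (\<Union>\<A>)"
    using A unfolding fup_def by auto
  moreover have "filt X F" if "F \<in> fup X ` \<A>" for F using that A by (auto intro: filt_fup)
  ultimately show ?thesis using meet_filters[of "fup X ` \<A>"] by (simp add: fmeet_def image_image)
qed

lemma meet_insert: "x \<in> X \<Longrightarrow> A \<subseteq> X \<Longrightarrow> fmeet {x, fmeet A} = fmeet (insert x A)"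
proof -
  assume x: "x \<in> X" and A: "A \<subseteq> X"
  then have "B \<subseteq> X" if "B \<in> {{x}, A}" for B using that by auto
  from meet_meets[of "{{x}, A}", OF this] show ?thesis using x by (simp add: meet_singleton)
qed

definition lat :: "'a gorder"
  where "lat = \<lparr>carrier = X, eq = (=), le = (\<lambda>x y. fmeet {x, y} = x)\<rparr>"

lemma lat_simps [simp]: "carrier lat = X" "eq lat = (=)" "x \<sqsubseteq>\<^bsub>lat\<^esub> y \<longleftrightarrow> fmeet {x, y} = x"
  by (simp_all add: lat_def)

lemma partial_order_lat: "partial_order lat"
proof
  fix x y z assume "x \<sqsubseteq>\<^bsub>lat\<^esub> y" "y \<sqsubseteq>\<^bsub>lat\<^esub> z" "x \<in> carrier lat" "y \<in> carrier lat" "z \<in> carrier lat"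
  then have h: "fmeet {x, y} = x" "fmeet {y, z} = y" "x \<in> X" "y \<in> X" "z \<in> X" by simp_all
  have "fmeet {x, z} = fmeet {z, fmeet {x, y}}" using h by (simp add: insert_commute)
  also have "\<dots> = fmeet {x, fmeet {y, z}}" using h(3-5) by (simp add: meet_insert insert_commute)
  also have "\<dots> = x" using h by simp
  finally show "x \<sqsubseteq>\<^bsub>lat\<^esub> z" by simp
next
  fix x y assume "x \<sqsubseteq>\<^bsub>lat\<^esub> y" "y \<sqsubseteq>\<^bsub>lat\<^esub> x"
  then have "fmeet {x, y} = x" "fmeet {x, y} = y" by (simp_all add: insert_commute)
  then show "x .=\<^bsub>lat\<^esub> y" by simp
qed (auto simp: meet_singleton)

lemma greatest_meet: "A \<subseteq> X \<Longrightarrow> greatest lat (fmeet A) (Lower lat A)"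
proof (rule greatest_LowerI)
  assume A: "A \<subseteq> X"
  show "fmeet A \<sqsubseteq>\<^bsub>lat\<^esub> x" if x: "x \<in> A" for x
  proof -
    have "fmeet {x, fmeet A} = fmeet (insert x A)" using A x by (intro meet_insert) auto
    moreover have "insert x A = A" using x by auto
    moreover have "{x, fmeet A} = {fmeet A, x}" by auto
    ultimately show ?thesis by simp
  qed
  fix y assume "y \<in> Lower lat A"
  then have y: "y \<in> X" "\<And>a. a \<in> A \<Longrightarrow> fmeet {y, a} = y" using A by (auto simp: Lower_def)
  \<comment> \<open>Each pair {y, a} has meet y, and the union of the pairs is
    \<open>insert y A\<close>; the extra {y} keeps this true when A is empty.\<close>
  let ?\<A> = "insert {y} ((\<lambda>a. {y, a}) ` A)"
  have "fmeet {y, fmeet A} = fmeet (insert y A)" using y(1) A by (rule meet_insert)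
  also have "insert y A = \<Union>?\<A>" by auto
  also have "fmeet (\<Union>?\<A>) = fmeet (fmeet ` ?\<A>)" by (rule meet_meets) (use y A in auto)
  also have "fmeet ` ?\<A> = {y}" using y by (auto simp: meet_singleton)
  also have "fmeet {y} = y" using y(1) by (rule meet_singleton)
  finally show "y \<sqsubseteq>\<^bsub>lat\<^esub> fmeet A" by simp
qed (simp_all add: meet_closed)

lemma complete_lattice_lat: "complete_lattice lat"
proof (rule partial_order.complete_lattice_criterion1[OF partial_order_lat])
  have "Lower lat {} = carrier lat" by (auto simp: Lower_def)
  then show "\<exists>g. greatest lat g (carrier lat)" using greatest_meet[of "{}"] by auto
qed (use greatest_meet in auto)

sublocale lat: gorder_lattice lat
  by (rule gorder_lattice.intro[OF complete_lattice_lat])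

lemma inf_lat: "A \<subseteq> X \<Longrightarrow> \<Sqinter>\<^bsub>lat\<^esub> A = fmeet A"
  using lat.inf_glb[of A] greatest_meet[of A] lat.weak_greatest_unique[of "\<Sqinter>\<^bsub>lat\<^esub> A" "Lower lat A" "fmeet A"] by simp

text \<open>The intersection of F and G is F, so \<open>meet_filters\<close> makes the value of F
  the meet of both values.\<close>

lemma \<xi>_mono: "filt X F \<Longrightarrow> filt X G \<Longrightarrow> F \<subseteq> G \<Longrightarrow> \<xi> F \<sqsubseteq>\<^bsub>lat\<^esub> \<xi> G"
proof -
  assume F: "filt X F" and G: "filt X G" and "F \<subseteq> G"
  then have "{B. B \<subseteq> X \<and> (\<forall>H\<in>{F, G}. B \<in> H)} = F" using filtD(1)[OF F] by auto
  moreover have "filt X H" if "H \<in> {F, G}" for H using that F G by auto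
  note meet_filters[of "{F, G}", OF this]
  ultimately show ?thesis by simp
qed

text \<open>The structure map is recovered from the order it induces. One inequality is
  monotonicity, because F contains \<open>fup X A\<close> for each of its members A; the other uses
  associativity twice.\<close>

lemma flim_lat: "filt X F \<Longrightarrow> flim lat F = \<xi> F"
proof (rule lat.le_antisym)
  assume F: "filt X F"
  have FX: "A \<subseteq> X" if "A \<in> F" for A using filtD(1)[OF F that] .
  show "flim lat F \<sqsubseteq>\<^bsub>lat\<^esub> \<xi> F"
  proof (rule lat.flim_least)
    fix A assume A: "A \<in> F"
    have "fup X A \<subseteq> F" using filtD(4)[OF F A] by (auto simp: fup_def)
    then have "\<xi> (fup X A) \<sqsubseteq>\<^bsub>lat\<^esub> \<xi> F" by (rule \<xi>_mono[OF filt_fup[OF FX[OF A]] F])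
    then show "\<Sqinter>\<^bsub>lat\<^esub> A \<sqsubseteq>\<^bsub>lat\<^esub> \<xi> F" by (simp only: inf_lat[OF FX[OF A]] fmeet_def)
  qed (use F mem in auto)
  (* F is the product of the filter of principal filters fup X B along F. As ?y is above each
     fmeet B, replacing B by {fmeet B, ?y} does not change the limits, but makes the product a
     subfilter of the principal filter at ?y. *)
  let ?y = "flim lat F" and ?b = "\<lambda>A. {B \<in> F. B \<subseteq> A}"
  have y: "?y \<in> X" using lat.flim_closed[of F] F by simp
  \<comment> \<open>The index set is F itself, directed by shrinking: G is generated by the
    collections of all members of F contained in a given member.\<close>
  define G where "G = fgen F (?b ` F)"
  have G: "filt F G" unfolding G_def
  proof (rule filt_fgen)
    show "?b ` F \<noteq> {}" using filtD(2)[OF F] by auto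
    show "\<A> \<in> ?b ` F \<Longrightarrow> \<A> \<subseteq> F" for \<A> by auto
    fix \<A> \<B> assume "\<A> \<in> ?b ` F" "\<B> \<in> ?b ` F"
    then obtain A B where AB: "A \<in> F" "B \<in> F" "\<A> = ?b A" "\<B> = ?b B" by auto
    show "\<exists>\<C>\<in>?b ` F. \<C> \<subseteq> \<A> \<inter> \<B>"
    proof
      show "?b (A \<inter> B) \<subseteq> \<A> \<inter> \<B>" unfolding AB(3,4) by auto
      show "?b (A \<inter> B) \<in> ?b ` F" by (rule imageI[OF filtD(3)[OF F AB(1,2)]])
    qed
  qed
  have 1: "fbind X F (fup X) G = F"
  proof (intro equalityI subsetI)
    fix C assume "C \<in> fbind X F (fup X) G"
    then have C: "C \<subseteq> X" "{B \<in> F. C \<in> fup X B} \<in> G" by (simp_all add: fbind_def)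
    obtain A where "A \<in> F" "?b A \<subseteq> {B \<in> F. C \<in> fup X B}" using C(2) unfolding G_def by (elim fgenE) auto
    then have "A \<in> F" "A \<subseteq> C" by (auto simp: fup_def)
    then show "C \<in> F" using filtD(4)[OF F] C(1) by blast
  next
    fix C assume C: "C \<in> F"
    have "{B \<in> F. C \<in> fup X B} \<in> G" unfolding G_def
      by (rule fgenI[of _ _ "?b C"]) (use C FX in \<open>auto simp: fup_def\<close>)
    then show "C \<in> fbind X F (fup X) G" using FX[OF C] by (simp add: fbind_def)
  qed
  have 2: "\<xi> F = \<xi> (fimage X F fmeet G)"
  proof -
    have "\<xi> (fbind X F (fup X) G) = \<xi> (fimage X F (\<lambda>A. \<xi> (fup X A)) G)"
      by (rule bind[OF G]) (rule filt_fup[OF FX])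
    then show ?thesis unfolding 1 fmeet_def .
  qed
  let ?k = "\<lambda>B. fup X {fmeet B, ?y}"
  have k: "filt X (?k B)" if "B \<in> F" for B using y meet_closed[OF FX[OF that]] by (intro filt_fup) auto
  have kb: "\<xi> (?k B) = fmeet B" if B: "B \<in> F" for B
    using lat.flim_upper[of F B] F B by (simp add: inf_lat[OF FX[OF B]] fmeet_def)
  have 3: "fimage X F fmeet G = fimage X F (\<lambda>B. \<xi> (?k B)) G" by (rule fimage_cong) (simp add: kb)
  have 4: "\<xi> F = \<xi> (fbind X F ?k G)" unfolding 2 3 by (rule sym, rule bind[OF G]) (rule k)
  have "fbind X F ?k G \<subseteq> fprin X ?y"
  proof
    fix C assume "C \<in> fbind X F ?k G"
    then have C: "C \<subseteq> X" "{B \<in> F. C \<in> ?k B} \<in> G" by (simp_all add: fbind_def)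
    obtain A where "A \<in> F" "?b A \<subseteq> {B \<in> F. C \<in> ?k B}" using C(2) unfolding G_def by (elim fgenE) auto
    then have "C \<in> ?k A" by blast
    then show "C \<in> fprin X ?y" by (simp add: fup_def fprin_def)
  qed
  moreover have "filt X (fbind X F ?k G)" by (rule filt_fbind[OF G]) (rule k)
  ultimately have "\<xi> (fbind X F ?k G) \<sqsubseteq>\<^bsub>lat\<^esub> \<xi> (fprin X ?y)"
    using \<xi>_mono[OF _ filt_fprin[OF y]] by blast
  then show "\<xi> F \<sqsubseteq>\<^bsub>lat\<^esub> ?y" by (simp only: 4[symmetric] unit[OF y])
qed (use lat.flim_closed mem in auto)

text \<open>If the join of a directed D is above y, the filter of tails of D has its limit above y
  and therefore contains A. So A contains a tail of D, in particular an element of D, and this lies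
  above the meet of A.\<close>

lemma way_below_meet:
  assumes y: "y \<in> X" and A: "\<And>F. filt X F \<Longrightarrow> y \<sqsubseteq>\<^bsub>lat\<^esub> \<xi> F \<Longrightarrow> A \<in> F" and AX: "A \<subseteq> X"
  shows "way_below lat (fmeet A) y"
  unfolding way_below_def
proof (intro conjI allI impI)
  fix D assume D: "directed_in lat D \<and> y \<sqsubseteq>\<^bsub>lat\<^esub> \<Squnion>\<^bsub>lat\<^esub> D"
  then have t: "filt X (tails lat D)" using lat.filt_tails[of D] by simp
  have "\<xi> (tails lat D) = \<Squnion>\<^bsub>lat\<^esub> D" using D flim_lat[OF t] lat.flim_tails[of D] by simp
  then have "A \<in> tails lat D" using A[OF t] D by simp
  then obtain d where d: "d \<in> D" "{e \<in> D. d \<sqsubseteq>\<^bsub>lat\<^esub> e} \<subseteq> A" unfolding tails_def by (elim fgenE) auto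
  have "d \<in> X" using D d(1) directed_inD(1)[of lat D] by auto
  then have "d \<in> A" using d lat.le_refl[of d] by auto
  then have "fmeet A \<sqsubseteq>\<^bsub>lat\<^esub> d" using lat.inf_lower[of A d] AX by (simp add: inf_lat[OF AX])
  then show "\<exists>d\<in>D. fmeet A \<sqsubseteq>\<^bsub>lat\<^esub> d" using d(1) by blast
qed (use y AX meet_closed in auto)

text \<open>The filters with limit above y have a least one because \<open>meet_filters\<close>
  makes the limit of an intersection the meet of the limits. Then y is below the limit of that least
  filter, that is, below the directed join of the meets of its members.\<close>

lemma continuous_lattice_lat: "continuous_lattice lat"
  unfolding continuous_lattice_def
proof (intro conjI ballI complete_lattice_lat)
  fix y assume "y \<in> carrier lat"
  then have y: "y \<in> X" by simp
  let ?W = "{x. way_below lat x y}"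
  (* N is the smallest filter whose limit is above y, so the meets of its members are way below y *)
  define \<S> where "\<S> = {F. filt X F \<and> y \<sqsubseteq>\<^bsub>lat\<^esub> \<xi> F}"
  define N where "N = {B. B \<subseteq> X \<and> (\<forall>F\<in>\<S>. B \<in> F)}"
  have S: "\<And>F. F \<in> \<S> \<Longrightarrow> filt X F" by (simp add: \<S>_def)
  have N: "filt X N" unfolding N_def
    by (rule filtI) (use filtD(2,3,4)[OF S] in auto)
  have SX: "\<xi> ` \<S> \<subseteq> X" using S mem by auto
  have "y \<sqsubseteq>\<^bsub>lat\<^esub> \<Sqinter>\<^bsub>lat\<^esub> (\<xi> ` \<S>)" by (rule lat.inf_greatest) (use SX y in \<open>auto simp: \<S>_def\<close>)
  moreover have "flim lat N = fmeet (\<xi> ` \<S>)"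
    unfolding flim_lat[OF N] unfolding N_def by (rule meet_filters[OF S])
  ultimately have yN: "y \<sqsubseteq>\<^bsub>lat\<^esub> flim lat N" by (simp only: inf_lat[OF SX])
  have wb: "way_below lat (fmeet A) y" if "A \<in> N" for A
  proof (rule way_below_meet[OF y])
    show "A \<subseteq> X" using that by (simp add: N_def)
    show "A \<in> F" if "filt X F" "y \<sqsubseteq>\<^bsub>lat\<^esub> \<xi> F" for F
      using \<open>A \<in> N\<close> that unfolding N_def \<S>_def by blast
  qed
  have WX: "?W \<subseteq> carrier lat" using way_belowD(1)[of lat _ y] by auto
  \<comment> \<open>Conversely each element way below y is under the meet of some member of N. The
    meets of members are thus cofinal among the elements way below y, and directedness is inherited
    from N.\<close>
  have W: "\<exists>A\<in>N. x \<sqsubseteq>\<^bsub>lat\<^esub> fmeet A" if x: "way_below lat x y" for x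
  proof -
    have "directed_in lat ((\<lambda>A. \<Sqinter>\<^bsub>lat\<^esub> A) ` N)" using N by (intro lat.directed_infs) simp
    from way_belowD(3)[OF x this yN[unfolded flim_def]]
    obtain A where A: "A \<in> N" "x \<sqsubseteq>\<^bsub>lat\<^esub> \<Sqinter>\<^bsub>lat\<^esub> A" by (elim bexE imageE) (simp only: that)
    show ?thesis using A(2) unfolding inf_lat[OF filtD(1)[OF N A(1)]] by (rule bexI[OF _ A(1)])
  qed
  show "directed_in lat ?W"
  proof (rule directed_inI[OF WX])
    show "?W \<noteq> {}" using wb[OF filtD(2)[OF N]] by blast
    fix u v assume "u \<in> ?W" "v \<in> ?W"
    then have uv: "u \<in> X" "v \<in> X" and "\<exists>A\<in>N. u \<sqsubseteq>\<^bsub>lat\<^esub> fmeet A" "\<exists>A\<in>N. v \<sqsubseteq>\<^bsub>lat\<^esub> fmeet A"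
      using W WX by auto
    then obtain A B where A: "A \<in> N" "u \<sqsubseteq>\<^bsub>lat\<^esub> fmeet A" and B: "B \<in> N" "v \<sqsubseteq>\<^bsub>lat\<^esub> fmeet B" by blast
    note AB = filtD(3)[OF N A(1) B(1)]
    note c = filtD(1)[OF N A(1)] filtD(1)[OF N B(1)] filtD(1)[OF N AB]
    have "fmeet A \<sqsubseteq>\<^bsub>lat\<^esub> fmeet (A \<inter> B)" "fmeet B \<sqsubseteq>\<^bsub>lat\<^esub> fmeet (A \<inter> B)"
      using lat.inf_antimono[of A "A \<inter> B"] lat.inf_antimono[of B "A \<inter> B"] c
      by (simp_all only: inf_lat lat_simps(1) Int_lower1 Int_lower2)
    then have "u \<sqsubseteq>\<^bsub>lat\<^esub> fmeet (A \<inter> B)" "v \<sqsubseteq>\<^bsub>lat\<^esub> fmeet (A \<inter> B)"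
      using lat.le_trans[OF A(2)] lat.le_trans[OF B(2)] uv meet_closed[OF c(1)] meet_closed[OF c(2)] meet_closed[OF c(3)]
      unfolding lat_simps(1) by blast+
    then show "\<exists>z\<in>?W. u \<sqsubseteq>\<^bsub>lat\<^esub> z \<and> v \<sqsubseteq>\<^bsub>lat\<^esub> z" using wb[OF AB] by blast
  qed
  have Wsup: "\<Squnion>\<^bsub>lat\<^esub> ?W \<in> carrier lat" using WX by (rule lat.sup_closed)
  show "\<Squnion>\<^bsub>lat\<^esub> ?W = y"
  proof (rule lat.le_antisym)
    show "\<Squnion>\<^bsub>lat\<^esub> ?W \<sqsubseteq>\<^bsub>lat\<^esub> y"
    proof (rule lat.sup_least[OF WX])
      fix x assume "x \<in> ?W"
      then have x: "way_below lat x y" by simp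
      have yc: "y \<in> carrier lat" using y by simp
      have "directed_in lat {y}" by (rule directed_inI) (use yc in \<open>auto intro: lat.le_refl simp del: lat_simps\<close>)
      moreover have "y \<sqsubseteq>\<^bsub>lat\<^esub> \<Squnion>\<^bsub>lat\<^esub> {y}" by (rule lat.sup_upper) (use y in auto)
      ultimately show "x \<sqsubseteq>\<^bsub>lat\<^esub> y" using way_belowD(3)[OF x, of "{y}"] by blast
    qed (use y in simp)
    have fW: "flim lat N \<sqsubseteq>\<^bsub>lat\<^esub> \<Squnion>\<^bsub>lat\<^esub> ?W"
    proof (rule lat.flim_least[OF _ Wsup])
      fix A assume A: "A \<in> N"
      show "\<Sqinter>\<^bsub>lat\<^esub> A \<sqsubseteq>\<^bsub>lat\<^esub> \<Squnion>\<^bsub>lat\<^esub> ?W" unfolding inf_lat[OF filtD(1)[OF N A]]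
        by (rule lat.sup_upper[OF WX]) (use wb[OF A] in simp)
    qed (use N in simp)
    show "y \<sqsubseteq>\<^bsub>lat\<^esub> \<Squnion>\<^bsub>lat\<^esub> ?W"
      by (rule lat.le_trans[OF yN fW _ _ Wsup]) (use y N lat.flim_closed[of N] in simp_all)
  qed (use y Wsup in simp_all)
qed

end

section \<open>Equivalences with categories of algebras\<close>

lemma hom_em: "m \<in> hom_set (em_category C T) p q \<longleftrightarrow> (\<exists>f. m = (p, f, q) \<and> p \<in> em_algebras C T \<and>
    q \<in> em_algebras C T \<and> f \<in> hom_set C (fst p) (fst q) \<and> f \<cdot>\<^bsub>C\<^esub> snd p = snd q \<cdot>\<^bsub>C\<^esub> far (mfun T) f)"
  unfolding hom_set_def[of "em_category C T"] unfolding em_category_def by (cases p; cases q) auto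

lemma em_simps: "obj (em_category C T) = em_algebras C T"
  "idt (em_category C T) p = (p, idt C (fst p), p)"
  "(q', g, r) \<cdot>\<^bsub>em_category C T\<^esub> (p, f, q) = (p, g \<cdot>\<^bsub>C\<^esub> f, r)"
  "src (em_category C T) (p, f, q) = p" "trg (em_category C T) (p, f, q) = q"
  by (auto simp: em_category_def split: prod.split)

lemma hom_concrete: "m \<in> hom_set (concrete_cat Obs U P) A B \<longleftrightarrow>
    (\<exists>f. m = (A, f, B) \<and> A \<in> Obs \<and> B \<in> Obs \<and> f \<in> U A \<rightarrow>\<^sub>E U B \<and> P A B f)"
  unfolding hom_set_def concrete_cat_def by auto

lemma concrete_simps: "obj (concrete_cat Obs U P) = Obs"
  "idt (concrete_cat Obs U P) A = (A, \<lambda>x\<in>U A. x, A)"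
  "(B', g, C) \<cdot>\<^bsub>concrete_cat Obs U P\<^esub> (A, f, B) = (A, compose (U A) g f, C)"
  "src (concrete_cat Obs U P) (A, f, B) = A" "trg (concrete_cat Obs U P) (A, f, B) = B"
  by (auto simp: concrete_cat_def)

lemma compose_in_PiE: "f \<in> A \<rightarrow>\<^sub>E B \<Longrightarrow> g \<in> B \<rightarrow>\<^sub>E C \<Longrightarrow> compose A g f \<in> A \<rightarrow>\<^sub>E C"
  by (auto simp: compose_def PiE_iff)

lemma category_concrete:
  assumes id: "\<And>A. A \<in> Obs \<Longrightarrow> P A A (\<lambda>x\<in>U A. x)"
    and comp: "\<And>A B C f g. \<lbrakk>A \<in> Obs; B \<in> Obs; C \<in> Obs; f \<in> U A \<rightarrow>\<^sub>E U B; g \<in> U B \<rightarrow>\<^sub>E U C; P A B f; P B C g\<rbrakk>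
      \<Longrightarrow> P A C (compose (U A) g f)"
  shows "category (concrete_cat Obs U P)"
proof
  fix f assume "f \<in> arr (concrete_cat Obs U P)"
  then show "src (concrete_cat Obs U P) f \<in> obj (concrete_cat Obs U P)"
    "trg (concrete_cat Obs U P) f \<in> obj (concrete_cat Obs U P)" by (auto simp: concrete_cat_def)
next
  fix A assume "A \<in> obj (concrete_cat Obs U P)"
  then show "idt (concrete_cat Obs U P) A \<in> hom_set (concrete_cat Obs U P) A A"
    by (auto simp: hom_concrete concrete_simps id)
next
  fix f A B g C
  assume "f \<in> hom_set (concrete_cat Obs U P) A B" "g \<in> hom_set (concrete_cat Obs U P) B C"
  then show "g \<cdot>\<^bsub>concrete_cat Obs U P\<^esub> f \<in> hom_set (concrete_cat Obs U P) A C"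
    by (auto simp: hom_concrete concrete_simps intro!: comp compose_in_PiE[where B = "U B"])
next
  fix f A B assume "f \<in> hom_set (concrete_cat Obs U P) A B"
  then obtain f' where f: "f = (A, f', B)" "f' \<in> U A \<rightarrow>\<^sub>E U B" by (auto simp: hom_concrete)
  show "f \<cdot>\<^bsub>concrete_cat Obs U P\<^esub> idt (concrete_cat Obs U P) A = f"
    unfolding f(1) concrete_simps using f(2) by (auto simp: compose_def PiE_iff extensional_def)
  have "compose (U A) (\<lambda>x\<in>U B. x) f' = f'"
    by (rule PiE_ext[of _ "U A" "\<lambda>_. U B"]) (use f(2) in \<open>auto simp: compose_def\<close>)
  then show "idt (concrete_cat Obs U P) B \<cdot>\<^bsub>concrete_cat Obs U P\<^esub> f = f"
    unfolding f(1) concrete_simps by simp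
next
  fix f g h W X Y Z
  assume "f \<in> hom_set (concrete_cat Obs U P) W X" "g \<in> hom_set (concrete_cat Obs U P) X Y"
    "h \<in> hom_set (concrete_cat Obs U P) Y Z"
  then show "(h \<cdot>\<^bsub>concrete_cat Obs U P\<^esub> g) \<cdot>\<^bsub>concrete_cat Obs U P\<^esub> f =
      h \<cdot>\<^bsub>concrete_cat Obs U P\<^esub> (g \<cdot>\<^bsub>concrete_cat Obs U P\<^esub> f)"
    by (auto simp: hom_concrete concrete_simps compose_def PiE_iff intro!: restrict_ext)
qed

lemma category_em:
  assumes "monad_on C T" shows "category (em_category C T)"
proof -
  interpret monad_on C T by fact
  let ?E = "em_category C T" and ?T = "mfun T"
  have alg: "fst p \<in> obj C" "snd p \<in> hom_set C (fob ?T (fst p)) (fst p)" if "p \<in> em_algebras C T" for p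
    using that by (auto simp: em_algebras_def)
  show ?thesis
  proof
    fix f assume "f \<in> arr ?E"
    then show "src ?E f \<in> obj ?E" "trg ?E f \<in> obj ?E" by (auto simp: em_category_def)
  next
    fix p assume "p \<in> obj ?E"
    then have p: "p \<in> em_algebras C T" by (simp add: em_simps)
    show "idt ?E p \<in> hom_set ?E p p"
      using p alg[OF p] C.idt_hom[OF alg(1)[OF p]]
      by (simp add: hom_em em_simps unit.G.far_idt C.cmp_idt_left C.cmp_idt_right)
  next
    fix f p q g r assume "f \<in> hom_set ?E p q" "g \<in> hom_set ?E q r"
    then obtain f' g' where f: "f = (p, f', q)" "p \<in> em_algebras C T" "q \<in> em_algebras C T"
        "f' \<in> hom_set C (fst p) (fst q)" "f' \<cdot>\<^bsub>C\<^esub> snd p = snd q \<cdot>\<^bsub>C\<^esub> far ?T f'"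
      and g: "g = (q, g', r)" "r \<in> em_algebras C T" "g' \<in> hom_set C (fst q) (fst r)"
        "g' \<cdot>\<^bsub>C\<^esub> snd q = snd r \<cdot>\<^bsub>C\<^esub> far ?T g'" by (auto simp: hom_em)
    note a = alg(2)[OF f(2)] alg(2)[OF f(3)] alg(2)[OF g(2)]
    have "(g' \<cdot>\<^bsub>C\<^esub> f') \<cdot>\<^bsub>C\<^esub> snd p = (g' \<cdot>\<^bsub>C\<^esub> snd q) \<cdot>\<^bsub>C\<^esub> far ?T f'"
      by (simp add: C.cmp_assoc[OF a(1) f(4) g(3)] f(5) C.cmp_assoc[OF unit.G.far_hom[OF f(4)] a(2) g(3)])
    also have "\<dots> = snd r \<cdot>\<^bsub>C\<^esub> far ?T (g' \<cdot>\<^bsub>C\<^esub> f')"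
      by (simp add: g(4) C.cmp_assoc[OF unit.G.far_hom[OF f(4)] unit.G.far_hom[OF g(3)] a(3)] unit.G.far_cmp[OF f(4) g(3)])
    finally show "g \<cdot>\<^bsub>?E\<^esub> f \<in> hom_set ?E p r"
      using f g C.cmp_hom[OF f(4) g(3)] by (simp add: hom_em em_simps)
  next
    fix f p q assume "f \<in> hom_set ?E p q"
    then show "f \<cdot>\<^bsub>?E\<^esub> idt ?E p = f" "idt ?E q \<cdot>\<^bsub>?E\<^esub> f = f"
      by (auto simp: hom_em em_simps C.cmp_idt_left C.cmp_idt_right)
  next
    fix f g h w x y z assume "f \<in> hom_set ?E w x" "g \<in> hom_set ?E x y" "h \<in> hom_set ?E y z"
    then show "(h \<cdot>\<^bsub>?E\<^esub> g) \<cdot>\<^bsub>?E\<^esub> f = h \<cdot>\<^bsub>?E\<^esub> (g \<cdot>\<^bsub>?E\<^esub> f)"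
      by (auto simp: hom_em em_simps C.cmp_assoc)
  qed
qed

text \<open>Every algebra comes from an object exactly, but several objects may give the same
  algebra, as orders that differ off their carrier do. A preimage is therefore chosen, and one round
  trip is the identity while the other is only isomorphic to it, through identity functions.\<close>

lemma equivalent_em_concrete:
  fixes Obs :: "'o set" and U :: "'o \<Rightarrow> 'u::zf_universe set" and str :: "'o \<Rightarrow> 'u set_arr"
  assumes S: "monad_on Set_cat S"
    and alg: "\<And>A. A \<in> Obs \<Longrightarrow> (U A, str A) \<in> em_algebras Set_cat S"
    and hom: "\<And>A B f. \<lbrakk>A \<in> Obs; B \<in> Obs; f \<in> U A \<rightarrow>\<^sub>E U B\<rbrakk> \<Longrightarrow>
      P A B f \<longleftrightarrow> (U A, f, U B) \<odot> str A = str B \<odot> far (mfun S) (U A, f, U B)"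
    and surj: "\<And>X a. (X, a) \<in> em_algebras Set_cat S \<Longrightarrow> \<exists>A\<in>Obs. U A = X \<and> str A = a"
  shows "equivalent_categories (em_category Set_cat S) (concrete_cat Obs U P)"
proof -
  let ?E = "em_category Set_cat S" and ?D = "concrete_cat Obs U P"
  interpret E: category ?E by (rule category_em[OF S])
  define \<Psi> where "\<Psi> A = (U A, str A)" for A
  define \<Phi> where "\<Phi> p = (SOME A. A \<in> Obs \<and> \<Psi> A = p)" for p
  have \<Psi>: "\<Psi> A \<in> em_algebras Set_cat S" if "A \<in> Obs" for A using alg[OF that] by (simp add: \<Psi>_def)
  have \<Phi>: "\<Phi> p \<in> Obs" "\<Psi> (\<Phi> p) = p" if p: "p \<in> em_algebras Set_cat S" for p
  proof -
    have "\<exists>A. A \<in> Obs \<and> \<Psi> A = p" using surj[of "fst p" "snd p"] p by (auto simp: \<Psi>_def)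
    from someI_ex[OF this] show "\<Phi> p \<in> Obs" "\<Psi> (\<Phi> p) = p" by (simp_all add: \<Phi>_def)
  qed
  have sm: "small (U A)" if "A \<in> Obs" for A using alg[OF that] by (simp add: em_algebras_def)
  have arrow: "(X, f, Y) \<in> Hom X Y \<longleftrightarrow> small X \<and> small Y \<and> f \<in> X \<rightarrow>\<^sub>E Y" for X Y f
    by (simp add: hom_iff dm_def cd_def fn_def)
  have hom': "P A B f \<longleftrightarrow> (\<Psi> A, (U A, f, U B), \<Psi> B) \<in> hom_set ?E (\<Psi> A) (\<Psi> B)"
    if "A \<in> Obs" "B \<in> Obs" "f \<in> U A \<rightarrow>\<^sub>E U B" for A B f
    using hom[OF that] \<Psi> that sm by (simp add: hom_em) (simp add: \<Psi>_def arrow)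
  have id: "idt ?E (\<Psi> A) = (\<Psi> A, (U A, \<lambda>x\<in>U A. x, U A), \<Psi> A)" for A
    by (simp add: em_simps \<Psi>_def sid_mk_arr mk_arr_def)
  \<comment> \<open>Closure of P under identities and composition is inherited from the category of
    algebras through \<open>hom'\<close>.\<close>
  have D: "category ?D"
  proof (rule category_concrete)
    fix A assume A: "A \<in> Obs"
    show "P A A (\<lambda>x\<in>U A. x)"
      using hom'[OF A A, of "\<lambda>x\<in>U A. x"] E.idt_hom[of "\<Psi> A"] \<Psi>[OF A] id[of A] by (simp add: em_simps(1))
  next
    fix A B C f g
    assume A: "A \<in> Obs" "B \<in> Obs" "C \<in> Obs" and f: "f \<in> U A \<rightarrow>\<^sub>E U B" and g: "g \<in> U B \<rightarrow>\<^sub>E U C" and P: "P A B f" "P B C g"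
    have "compose (U A) g f \<in> U A \<rightarrow>\<^sub>E U C" using f g by (rule compose_in_PiE)
    then show "P A C (compose (U A) g f)"
      using E.cmp_hom[OF P(1)[unfolded hom'[OF A(1,2) f]] P(2)[unfolded hom'[OF A(2,3) g]]] hom'[OF A(1,3)]
      by (simp add: em_simps scmp_triple)
  qed
  interpret D: category ?D by (rule D)
  define F :: "('u set \<times> 'u set_arr, ('u set \<times> 'u set_arr) \<times> 'u set_arr \<times> ('u set \<times> 'u set_arr), 'o, 'o \<times> ('u \<Rightarrow> 'u) \<times> 'o) ftor"
    where "F = \<lparr>fob = \<Phi>, far = (\<lambda>(p, m, q). (\<Phi> p, fn m, \<Phi> q))\<rparr>"
  define G :: "('o, 'o \<times> ('u \<Rightarrow> 'u) \<times> 'o, 'u set \<times> 'u set_arr, ('u set \<times> 'u set_arr) \<times> 'u set_arr \<times> ('u set \<times> 'u set_arr)) ftor"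
    where "G = \<lparr>fob = \<Psi>, far = (\<lambda>(A, f, B). (\<Psi> A, (U A, f, U B), \<Psi> B))\<rparr>"
  have FG [simp]: "fob F p = \<Phi> p" "far F (p, m, q) = (\<Phi> p, fn m, \<Phi> q)" "fob G A = \<Psi> A"
    "far G (A, f, B) = (\<Psi> A, (U A, f, U B), \<Psi> B)" for p m q A f B by (simp_all add: F_def G_def)
  have homE: "\<exists>f. m = (p, (fst p, f, fst q), q) \<and> p \<in> em_algebras Set_cat S \<and> q \<in> em_algebras Set_cat S \<and> f \<in> fst p \<rightarrow>\<^sub>E fst q"
    if hom_m: "m \<in> hom_set ?E p q" for m p q
  proof -
    obtain m' where m: "m = (p, m', q)" "p \<in> em_algebras Set_cat S" "q \<in> em_algebras Set_cat S" "m' \<in> Hom (fst p) (fst q)"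
      using hom_m unfolding hom_em by blast
    then show ?thesis using hom_arr[OF m(4)] m(4) by (intro exI[of _ "fn m'"]) (simp add: hom_iff)
  qed
  have U\<Phi>: "U (\<Phi> p) = fst p" if "p \<in> em_algebras Set_cat S" for p
    using arg_cong[OF \<Phi>(2)[OF that], of fst] by (simp add: \<Psi>_def)
  have Ffun: "cat_functor ?E ?D F"
  proof (rule cat_functorI[OF E.category_axioms D])
    fix p assume "p \<in> obj ?E"
    then have p: "p \<in> em_algebras Set_cat S" by (simp add: em_simps)
    then show "fob F p \<in> obj ?D" by (simp add: concrete_simps \<Phi>)
    show "far F (idt ?E p) = idt ?D (fob F p)"
      by (simp add: em_simps concrete_simps U\<Phi>[OF p] sid_mk_arr mk_arr_def) (simp add: fn_def)
  next
    fix m p q assume m: "m \<in> hom_set ?E p q"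
    obtain f where f: "m = (p, (fst p, f, fst q), q)" "p \<in> em_algebras Set_cat S" "q \<in> em_algebras Set_cat S" "f \<in> fst p \<rightarrow>\<^sub>E fst q"
      using homE[OF m] by blast
    have "P (\<Phi> p) (\<Phi> q) f" using m f hom'[OF \<Phi>(1)[OF f(2)] \<Phi>(1)[OF f(3)], of f] by (simp add: U\<Phi> \<Phi>(2))
    then show "far F m \<in> hom_set ?D (fob F p) (fob F q)"
      using f by (simp add: hom_concrete U\<Phi> \<Phi>(1) fn_def)
  next
    fix m n p q r assume m: "m \<in> hom_set ?E p q" and n: "n \<in> hom_set ?E q r"
    obtain f where f: "m = (p, (fst p, f, fst q), q)" "p \<in> em_algebras Set_cat S" "q \<in> em_algebras Set_cat S" "f \<in> fst p \<rightarrow>\<^sub>E fst q"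
      using homE[OF m] by blast
    obtain g where g: "n = (q, (fst q, g, fst r), r)" "r \<in> em_algebras Set_cat S" "g \<in> fst q \<rightarrow>\<^sub>E fst r"
      using homE[OF n] by blast
    show "far F (n \<cdot>\<^bsub>?E\<^esub> m) = far F n \<cdot>\<^bsub>?D\<^esub> far F m"
      unfolding f(1) g(1) em_simps scmp_triple FG concrete_simps by (simp add: fn_def U\<Phi>[OF f(2)])
  qed
  have Gfun: "cat_functor ?D ?E G"
  proof (rule cat_functorI[OF D E.category_axioms])
    fix A assume "A \<in> obj ?D"
    then have A: "A \<in> Obs" by (simp add: concrete_simps)
    then show "fob G A \<in> obj ?E" by (simp add: em_simps \<Psi>)
    show "far G (idt ?D A) = idt ?E (fob G A)" by (simp add: concrete_simps id)
  next
    fix m A B assume "m \<in> hom_set ?D A B"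
    then show "far G m \<in> hom_set ?E (fob G A) (fob G B)" using hom' by (auto simp: hom_concrete)
  next
    fix m n A B C assume "m \<in> hom_set ?D A B" "n \<in> hom_set ?D B C"
    then show "far G (n \<cdot>\<^bsub>?D\<^esub> m) = far G n \<cdot>\<^bsub>?E\<^esub> far G m"
      by (auto simp: hom_concrete concrete_simps em_simps scmp_triple)
  qed
  have "nat_isomorphic ?E ?E (G \<circ>\<^sub>F F) id_ftor"
    unfolding nat_isomorphic_def
  proof (intro exI conjI ballI)
    show "nat_trans ?E ?E (G \<circ>\<^sub>F F) id_ftor (idt ?E)"
    proof (rule nat_transI[OF cat_functor_comp[OF Ffun Gfun] cat_functor_id[OF E.category_axioms]])
      fix p assume "p \<in> obj ?E"
      then show "idt ?E p \<in> hom_set ?E (fob (G \<circ>\<^sub>F F) p) (fob id_ftor p)"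
        using E.idt_hom[of p] by (simp add: em_simps \<Phi>)
    next
      fix m p q assume m: "m \<in> hom_set ?E p q"
      obtain f where f: "m = (p, (fst p, f, fst q), q)" "p \<in> em_algebras Set_cat S" "q \<in> em_algebras Set_cat S" "f \<in> fst p \<rightarrow>\<^sub>E fst q"
        using homE[OF m] by blast
      then have "far (G \<circ>\<^sub>F F) m = m" by (simp add: \<Phi> U\<Phi> fn_def)
      then show "idt ?E q \<cdot>\<^bsub>?E\<^esub> far (G \<circ>\<^sub>F F) m = far id_ftor m \<cdot>\<^bsub>?E\<^esub> idt ?E p"
        using E.cmp_idt_left[OF m] E.cmp_idt_right[OF m] by simp
    qed
    fix p assume "p \<in> obj ?E"
    then have i: "idt ?E p \<in> hom_set ?E p p" by (rule E.idt_hom)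
    then have "idt ?E p \<in> arr ?E" "src ?E (idt ?E p) = p" "trg ?E (idt ?E p) = p" by (simp_all add: hom_set_def)
    then show "iso_arr ?E (idt ?E p)" unfolding iso_arr_def
      using E.cmp_idt_left[OF i] i by (intro conjI bexI[of _ "idt ?E p"]) simp_all
  qed
  moreover have "nat_isomorphic ?D ?D (F \<circ>\<^sub>F G) id_ftor"
    unfolding nat_isomorphic_def
  proof (intro exI conjI ballI)
    let ?i = "\<lambda>A. (\<lambda>x\<in>U A. x)"
    have U: "U (\<Phi> (\<Psi> A)) = U A" if "A \<in> Obs" for A using U\<Phi>[OF \<Psi>[OF that]] by (simp add: \<Psi>_def)
    \<comment> \<open>Two objects with the same algebra: the identity function is an arrow between
      them, since it is an identity arrow of algebras.\<close>
    have P: "P A B (?i A)" if A: "A \<in> Obs" "B \<in> Obs" "\<Psi> A = \<Psi> B" for A B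
    proof -
      have e: "U A = U B" using A(3) by (simp add: \<Psi>_def)
      then have i: "?i A \<in> U A \<rightarrow>\<^sub>E U B" by auto
      show ?thesis using hom'[OF A(1,2) i] E.idt_hom[of "\<Psi> A"] \<Psi>[OF A(1)] id[of A] A(3) e by (simp add: em_simps(1))
    qed
    have h: "(\<Phi> (\<Psi> A), ?i A, A) \<in> hom_set ?D (\<Phi> (\<Psi> A)) A" "(A, ?i A, \<Phi> (\<Psi> A)) \<in> hom_set ?D A (\<Phi> (\<Psi> A))" if A: "A \<in> Obs" for A
      using A \<Phi>[OF \<Psi>[OF A]] P[of "\<Phi> (\<Psi> A)" A] P[of A "\<Phi> (\<Psi> A)"] by (auto simp: hom_concrete U)
    show "nat_trans ?D ?D (F \<circ>\<^sub>F G) id_ftor (\<lambda>A. (\<Phi> (\<Psi> A), ?i A, A))"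
    proof (rule nat_transI[OF cat_functor_comp[OF Gfun Ffun] cat_functor_id[OF D]])
      fix A assume "A \<in> obj ?D"
      then show "(\<Phi> (\<Psi> A), ?i A, A) \<in> hom_set ?D (fob (F \<circ>\<^sub>F G) A) (fob id_ftor A)"
        using h by (simp add: concrete_simps)
    next
      fix m A B assume "m \<in> hom_set ?D A B"
      then obtain f where f: "m = (A, f, B)" "A \<in> Obs" "B \<in> Obs" "f \<in> U A \<rightarrow>\<^sub>E U B" by (auto simp: hom_concrete)
      have "compose (U A) (?i B) f = f" "compose (U A) f (?i A) = f"
        by (rule PiE_ext[of _ "U A" "\<lambda>_. U B"]; use f(4) in \<open>auto simp: compose_def\<close>)+
      then show "(\<Phi> (\<Psi> B), ?i B, B) \<cdot>\<^bsub>?D\<^esub> far (F \<circ>\<^sub>F G) m = far id_ftor m \<cdot>\<^bsub>?D\<^esub> (\<Phi> (\<Psi> A), ?i A, A)"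
        unfolding f(1) by (simp add: concrete_simps U[OF f(2)] fn_def)
    qed
    fix A assume "A \<in> obj ?D"
    then have A: "A \<in> Obs" by (simp add: concrete_simps)
    have "compose (U A) (?i A) (?i A) = ?i A" by (auto simp: compose_def)
    then show "iso_arr ?D (\<Phi> (\<Psi> A), ?i A, A)" unfolding iso_arr_def
      using h[OF A] A by (intro conjI bexI[of _ "(A, ?i A, \<Phi> (\<Psi> A))"]) (simp_all add: concrete_simps U hom_set_def)
  qed
  ultimately show ?thesis unfolding equivalent_categories_def using Ffun Gfun by blast
qed

context finset_pushforward
begin

text \<open>The arrow equations for algebras and homomorphisms are restated on elements, which is
  the form that the descriptions of \<open>Po X\<close> by filters deliver.\<close>

theorem equivalent_em_concreteI:
  fixes Obs :: "'o set" and U :: "'o \<Rightarrow> 'u set" and \<alpha> :: "'o \<Rightarrow> 'u \<Rightarrow> 'u"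
  assumes sm: "\<And>A. A \<in> Obs \<Longrightarrow> small (U A)"
    and mem: "\<And>A s. A \<in> Obs \<Longrightarrow> s \<in> Po (U A) \<Longrightarrow> \<alpha> A s \<in> U A"
    and unit: "\<And>A x. A \<in> Obs \<Longrightarrow> x \<in> U A \<Longrightarrow> \<alpha> A (fn (P\<eta> (U A)) x) = x"
    and mult: "\<And>A \<Phi>. A \<in> Obs \<Longrightarrow> \<Phi> \<in> Po (Po (U A)) \<Longrightarrow>
      \<alpha> A (fn (P\<mu> (U A)) \<Phi>) = \<alpha> A (fn (Pm (mk_arr (Po (U A)) (\<alpha> A) (U A))) \<Phi>)"
    and hom: "\<And>A B f. A \<in> Obs \<Longrightarrow> B \<in> Obs \<Longrightarrow> f \<in> U A \<rightarrow>\<^sub>E U B \<Longrightarrow>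
      P A B f \<longleftrightarrow> (\<forall>s\<in>Po (U A). f (\<alpha> A s) = \<alpha> B (fn (Pm (mk_arr (U A) f (U B))) s))"
    and surj: "\<And>X a. small X \<Longrightarrow> a \<in> Hom (Po X) X \<Longrightarrow> (\<And>x. x \<in> X \<Longrightarrow> fn a (fn (P\<eta> X) x) = x) \<Longrightarrow>
      (\<And>\<Phi>. \<Phi> \<in> Po (Po X) \<Longrightarrow> fn a (fn (P\<mu> X) \<Phi>) = fn a (fn (Pm a) \<Phi>)) \<Longrightarrow>
      \<exists>A\<in>Obs. U A = X \<and> (\<forall>s\<in>Po X. \<alpha> A s = fn a s)"
  shows "equivalent_categories (em_category Set_cat S) (concrete_cat Obs U P)"
proof -
  define str where "str A = mk_arr (Po (U A)) (\<alpha> A) (U A)" for A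
  have str: "str A \<in> Hom (Po (U A)) (U A)" if "A \<in> Obs" for A
    using that mem sm P_small by (auto simp: str_def)
  have fstr: "fn (str A) s = \<alpha> A s" if "s \<in> Po (U A)" for A s using that by (simp add: str_def)
  show ?thesis
  proof (rule equivalent_em_concrete[OF S_monad, where str = str])
    fix A assume A: "A \<in> Obs"
    note X = sm[OF A] and a = str[OF A]
    note \<eta>X = P\<eta>_hom[OF X] and \<mu>X = P\<mu>_hom[OF X] and Pa = Pm_hom[OF a]
    have "str A \<odot> P\<eta> (U A) = sid (U A)"
      by (rule arr_eqI[OF scmp_hom[OF \<eta>X a] sid_hom[OF X]])
        (simp add: fn_scmp[OF \<eta>X] fn_mem[OF \<eta>X] fstr unit[OF A])
    moreover have "str A \<odot> P\<mu> (U A) = str A \<odot> Pm (str A)"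
      by (rule arr_eqI[OF scmp_hom[OF \<mu>X a] scmp_hom[OF Pa a]])
        (simp add: fn_scmp[OF \<mu>X] fn_scmp[OF Pa] fn_mem[OF \<mu>X] fn_mem[OF Pa] fstr mult[OF A],
          simp add: str_def)
    ultimately show "(U A, str A) \<in> em_algebras Set_cat S" using X a by (simp add: em_algebras_def)
  next
    fix A B f assume A: "A \<in> Obs" and B: "B \<in> Obs" and f: "f \<in> U A \<rightarrow>\<^sub>E U B"
    let ?m = "mk_arr (U A) f (U B)"
    have m: "?m \<in> Hom (U A) (U B)" using sm A B f by auto
    have e: "(U A, f, U B) = ?m" using f by (simp add: mk_arr_def extensional_restrict PiE_iff)
    note a = str[OF A] and b = str[OF B] and Pf = Pm_hom[OF m]
    have "?m \<odot> str A = str B \<odot> Pm ?m \<longleftrightarrow> (\<forall>s\<in>Po (U A). f (\<alpha> A s) = \<alpha> B (fn (Pm ?m) s))"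
    proof
      assume eq: "?m \<odot> str A = str B \<odot> Pm ?m"
      show "\<forall>s\<in>Po (U A). f (\<alpha> A s) = \<alpha> B (fn (Pm ?m) s)"
      proof
        fix s assume s: "s \<in> Po (U A)"
        have "fn (?m \<odot> str A) s = fn (str B \<odot> Pm ?m) s" using eq by simp
        then show "f (\<alpha> A s) = \<alpha> B (fn (Pm ?m) s)"
          using s mem[OF A s] fn_mem[OF Pf s] by (simp add: fn_scmp[OF a] fn_scmp[OF Pf] fstr)
      qed
    next
      assume eq: "\<forall>s\<in>Po (U A). f (\<alpha> A s) = \<alpha> B (fn (Pm ?m) s)"
      show "?m \<odot> str A = str B \<odot> Pm ?m"
        by (rule arr_eqI[OF scmp_hom[OF a m] scmp_hom[OF Pf b]])
          (simp add: fn_scmp[OF a] fn_scmp[OF Pf] fstr mem[OF A] fn_mem[OF Pf] eq)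
    qed
    then show "P A B f \<longleftrightarrow> (U A, f, U B) \<odot> str A = str B \<odot> Pm (U A, f, U B)"
      unfolding e using hom[OF A B f] by simp
  next
    fix X a assume "(X, a) \<in> em_algebras Set_cat S"
    then have X: "small X" and a: "a \<in> Hom (Po X) X" and u: "a \<odot> P\<eta> X = sid X" and m: "a \<odot> P\<mu> X = a \<odot> Pm a"
      by (simp_all add: em_algebras_def)
    have "fn a (fn (P\<eta> X) x) = x" if "x \<in> X" for x
      using fn_scmp[OF P\<eta>_hom[OF X] that, of a] that by (simp add: u)
    moreover have "fn a (fn (P\<mu> X) \<Phi>) = fn a (fn (Pm a) \<Phi>)" if "\<Phi> \<in> Po (Po X)" for \<Phi>
      using fn_scmp[OF P\<mu>_hom[OF X] that, of a] fn_scmp[OF Pm_hom[OF a] that, of a] by (simp add: m)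
    ultimately obtain A where A: "A \<in> Obs" "U A = X" "\<forall>s\<in>Po X. \<alpha> A s = fn a s"
      using surj[OF X a] by blast
    have "str A = a" by (rule arr_eqI[OF _ a]) (use str[OF A(1)] A fstr in auto)
    then show "\<exists>A\<in>Obs. U A = X \<and> str A = a" using A by blast
  qed
qed

end

section \<open>The three monads on finite sets\<close>

lemma sum_setE: "z \<in> sum_set X E \<Longrightarrow> (\<And>x. z = inl x \<Longrightarrow> x \<in> X \<Longrightarrow> P) \<Longrightarrow> (\<And>e. z = inr e \<Longrightarrow> e \<in> E \<Longrightarrow> P) \<Longrightarrow> P"
  unfolding sum_set_def by blast

lemma sum_set_iff [simp]: "inl x \<in> sum_set X E \<longleftrightarrow> x \<in> X" "inr e \<in> sum_set X E \<longleftrightarrow> e \<in> E"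
  by (auto simp: sum_set_def)

lemma prod_setE: "z \<in> prod_set A X \<Longrightarrow> (\<And>a x. z = opair a x \<Longrightarrow> a \<in> A \<Longrightarrow> x \<in> X \<Longrightarrow> P) \<Longrightarrow> P"
  unfolding prod_set_def by auto

lemma prod_set_iff [simp]: "opair a x \<in> prod_set A X \<longleftrightarrow> a \<in> A \<and> x \<in> X"
  by (auto simp: prod_set_def)

lemma power_set_iff: "y \<in> power_set X \<longleftrightarrow> elts y \<subseteq> X"
  by (simp add: power_set_def)

lemma power_set_mem: "z \<in> power_set Y \<Longrightarrow> y \<in> elts z \<Longrightarrow> y \<in> Y"
  by (auto simp: power_set_def)

lemma Union_power_set: "z \<in> power_set (power_set X) \<Longrightarrow> (\<Union>y\<in>elts z. elts y) \<subseteq> X"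
  by (auto dest!: power_set_mem)

lemma finite_sum_set: "finite X \<Longrightarrow> finite E \<Longrightarrow> finite (sum_set X E)"
  by (simp add: sum_set_def)

lemma finite_prod_set: "finite A \<Longrightarrow> finite X \<Longrightarrow> finite (prod_set A X)"
  by (simp add: prod_set_def)

lemma exception_far: "m \<in> Hom X Y \<Longrightarrow> far (mfun (exception_monad E)) m =
    mk_arr (sum_set X E) (copair (\<lambda>x. inl (fn m x)) inr) (sum_set Y E)"
  by (subst hom_arr[of m X Y], assumption)
    (auto simp: exception_monad_def mk_arr_def fn_def comp_def)

lemma exception_simps:
  "fob (mfun (exception_monad E)) X = sum_set X E"
  "munit (exception_monad E) X = mk_arr X inl (sum_set X E)"
  "mmult (exception_monad E) X = mk_arr (sum_set (sum_set X E) E) (copair (\<lambda>w. w) inr) (sum_set X E)"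
  by (auto simp: exception_monad_def mk_arr_def)

text \<open>Equations between arrows become pointwise equations, so that only computations with
  elements remain for each of the three monads.\<close>

lemma finset_monadI:
  fixes T :: "('u::zf_universe set, 'u set_arr) mnd"
  defines "To \<equiv> fob (mfun T)" and "Tm \<equiv> far (mfun T)"
  assumes fin: "\<And>X. finite X \<Longrightarrow> finite (To X)"
    and far: "\<And>X Y m. finite X \<Longrightarrow> finite Y \<Longrightarrow> m \<in> Hom X Y \<Longrightarrow> Tm m \<in> Hom (To X) (To Y)"
    and \<eta>: "\<And>X. finite X \<Longrightarrow> munit T X \<in> Hom X (To X)"
    and \<mu>: "\<And>X. finite X \<Longrightarrow> mmult T X \<in> Hom (To (To X)) (To X)"
    and id: "\<And>X z. finite X \<Longrightarrow> z \<in> To X \<Longrightarrow> fn (Tm (sid X)) z = z"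
    and comp: "\<And>X Y Z f g z. \<lbrakk>finite X; finite Y; finite Z; f \<in> Hom X Y; g \<in> Hom Y Z; z \<in> To X\<rbrakk> \<Longrightarrow>
      fn (Tm (g \<odot> f)) z = fn (Tm g) (fn (Tm f) z)"
    and \<eta>n: "\<And>X Y f x. \<lbrakk>finite X; finite Y; f \<in> Hom X Y; x \<in> X\<rbrakk> \<Longrightarrow>
      fn (munit T Y) (fn f x) = fn (Tm f) (fn (munit T X) x)"
    and \<mu>n: "\<And>X Y f z. \<lbrakk>finite X; finite Y; f \<in> Hom X Y; z \<in> To (To X)\<rbrakk> \<Longrightarrow>
      fn (mmult T Y) (fn (Tm (Tm f)) z) = fn (Tm f) (fn (mmult T X) z)"
    and l: "\<And>X z. finite X \<Longrightarrow> z \<in> To X \<Longrightarrow> fn (mmult T X) (fn (munit T (To X)) z) = z"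
    and r: "\<And>X z. finite X \<Longrightarrow> z \<in> To X \<Longrightarrow> fn (mmult T X) (fn (Tm (munit T X)) z) = z"
    and a: "\<And>X z. finite X \<Longrightarrow> z \<in> To (To (To X)) \<Longrightarrow>
      fn (mmult T X) (fn (mmult T (To X)) z) = fn (mmult T X) (fn (Tm (mmult T X)) z)"
  shows "finset_monad T"
proof -
  have TF: "cat_functor FinSet_cat FinSet_cat (mfun T)"
  proof (rule cat_functorI[OF category_FinSet category_FinSet])
    fix X :: "'u set" assume "X \<in> obj FinSet_cat"
    then have X: "finite X" by simp
    then show "fob (mfun T) X \<in> obj FinSet_cat" using fin by (simp add: To_def)
    note TX = small_finite[OF fin[OF X]] and i = sid_hom[OF small_finite[OF X]]
    have "Tm (sid X) = sid (To X)"
      by (rule arr_eqI[OF far[OF X X i] sid_hom[OF TX]]) (simp add: id[OF X])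
    then show "far (mfun T) (idt FinSet_cat X) = idt FinSet_cat (fob (mfun T) X)"
      by (simp add: To_def Tm_def)
  next
    fix m and X Y :: "'u set" assume "m \<in> hom_set FinSet_cat X Y"
    then show "far (mfun T) m \<in> hom_set FinSet_cat (fob (mfun T) X) (fob (mfun T) Y)"
      using far[of X Y m] fin by (simp add: hom_FinSet To_def Tm_def)
  next
    fix f g and X Y Z :: "'u set" assume "f \<in> hom_set FinSet_cat X Y" "g \<in> hom_set FinSet_cat Y Z"
    then have X: "finite X" "finite Y" "finite Z" and f: "f \<in> Hom X Y" and g: "g \<in> Hom Y Z" by (simp_all add: hom_FinSet)
    have "Tm (g \<odot> f) = Tm g \<odot> Tm f"
      by (rule arr_eqI[OF far[OF X(1,3) scmp_hom[OF f g]] scmp_hom[OF far[OF X(1,2) f] far[OF X(2,3) g]]])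
        (simp add: fn_scmp[OF far[OF X(1,2) f]] comp[OF X f g])
    then show "far (mfun T) (g \<cdot>\<^bsub>FinSet_cat\<^esub> f) = far (mfun T) g \<cdot>\<^bsub>FinSet_cat\<^esub> far (mfun T) f"
      by (simp add: Tm_def)
  qed
  have U: "nat_trans FinSet_cat FinSet_cat id_ftor (mfun T) (munit T)"
  proof (rule nat_transI[OF cat_functor_id[OF category_FinSet] TF])
    fix X :: "'u set" assume "X \<in> obj FinSet_cat"
    then show "munit T X \<in> hom_set FinSet_cat (fob id_ftor X) (fob (mfun T) X)"
      using \<eta>[of X] fin[of X] by (simp add: hom_FinSet To_def)
  next
    fix f and X Y :: "'u set" assume "f \<in> hom_set FinSet_cat X Y"
    then have X: "finite X" "finite Y" and f: "f \<in> Hom X Y" by (simp_all add: hom_FinSet)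
    have "munit T Y \<odot> f = Tm f \<odot> munit T X"
      by (rule arr_eqI[OF scmp_hom[OF f \<eta>[OF X(2)]] scmp_hom[OF \<eta>[OF X(1)] far[OF X f]]])
        (simp add: fn_scmp[OF f] fn_scmp[OF \<eta>[OF X(1)]] \<eta>n[OF X f])
    then show "munit T Y \<cdot>\<^bsub>FinSet_cat\<^esub> far id_ftor f = far (mfun T) f \<cdot>\<^bsub>FinSet_cat\<^esub> munit T X"
      by (simp add: Tm_def)
  qed
  have M: "nat_trans FinSet_cat FinSet_cat (mfun T \<circ>\<^sub>F mfun T) (mfun T) (mmult T)"
  proof (rule nat_transI[OF cat_functor_comp[OF TF TF] TF])
    fix X :: "'u set" assume "X \<in> obj FinSet_cat"
    then show "mmult T X \<in> hom_set FinSet_cat (fob (mfun T \<circ>\<^sub>F mfun T) X) (fob (mfun T) X)"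
      using \<mu>[of X] fin[of X] fin[of "To X"] by (simp add: hom_FinSet To_def)
  next
    fix f and X Y :: "'u set" assume "f \<in> hom_set FinSet_cat X Y"
    then have X: "finite X" "finite Y" and f: "f \<in> Hom X Y" by (simp_all add: hom_FinSet)
    note TTf = far[OF fin[OF X(1)] fin[OF X(2)] far[OF X f]]
    have "mmult T Y \<odot> Tm (Tm f) = Tm f \<odot> mmult T X"
      by (rule arr_eqI[OF scmp_hom[OF TTf \<mu>[OF X(2)]] scmp_hom[OF \<mu>[OF X(1)] far[OF X f]]])
        (simp add: fn_scmp[OF TTf] fn_scmp[OF \<mu>[OF X(1)]] \<mu>n[OF X f])
    then show "mmult T Y \<cdot>\<^bsub>FinSet_cat\<^esub> far (mfun T \<circ>\<^sub>F mfun T) f = far (mfun T) f \<cdot>\<^bsub>FinSet_cat\<^esub> mmult T X"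
      by (simp add: Tm_def)
  qed
  have L: "mmult T X \<odot> munit T (To X) = sid (To X)" if X: "finite X" for X
  proof -
    note TX = fin[OF X] note s = sid_hom[OF small_finite[OF TX]]
    show ?thesis by (rule arr_eqI[OF scmp_hom[OF \<eta>[OF TX] \<mu>[OF X]] s]) (simp add: fn_scmp[OF \<eta>[OF TX]] l[OF X])
  qed
  have R: "mmult T X \<odot> Tm (munit T X) = sid (To X)" if X: "finite X" for X
  proof -
    note TX = fin[OF X] note s = sid_hom[OF small_finite[OF TX]] and t = far[OF X TX \<eta>[OF X]]
    show ?thesis by (rule arr_eqI[OF scmp_hom[OF t \<mu>[OF X]] s]) (simp add: fn_scmp[OF t] r[OF X])
  qed
  have A: "mmult T X \<odot> mmult T (To X) = mmult T X \<odot> Tm (mmult T X)" if X: "finite X" for X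
  proof -
    note TX = fin[OF X] note TTX = fin[OF TX] note t = far[OF TTX TX \<mu>[OF X]]
    show ?thesis
      by (rule arr_eqI[OF scmp_hom[OF \<mu>[OF TX] \<mu>[OF X]] scmp_hom[OF t \<mu>[OF X]]])
        (simp add: fn_scmp[OF t] fn_scmp[OF \<mu>[OF TX]] a[OF X])
  qed
  show ?thesis
    unfolding finset_monad_def monad_on_def monad_on_axioms_def
    using category_FinSet U M L R A by (simp add: To_def Tm_def)
qed

lemma exception_finset_monad:
  assumes E: "finite E" shows "finset_monad (exception_monad E)"
proof (rule finset_monadI; (unfold exception_simps)?)
  fix X Y :: "'a set" and m z assume X: "finite X" "finite Y" and m: "m \<in> Hom X Y"
  show "far (mfun (exception_monad E)) m \<in> Hom (sum_set X E) (sum_set Y E)"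
    unfolding exception_far[OF m] using X E fn_mem[OF m]
    by (auto simp: small_finite finite_sum_set elim!: sum_setE)
  show "fn (mk_arr (sum_set (sum_set Y E) E) (copair (\<lambda>w. w) inr) (sum_set Y E))
     (fn (far (mfun (exception_monad E)) (far (mfun (exception_monad E)) m)) z) =
    fn (far (mfun (exception_monad E)) m) (fn (mk_arr (sum_set (sum_set X E) E) (copair (\<lambda>w. w) inr) (sum_set X E)) z)"
    if "z \<in> sum_set (sum_set X E) E"
  proof -
    have "far (mfun (exception_monad E)) m \<in> Hom (sum_set X E) (sum_set Y E)"
      unfolding exception_far[OF m] using X E fn_mem[OF m]
      by (auto simp: small_finite finite_sum_set elim!: sum_setE)
    note e = exception_far[OF this]
    show ?thesis unfolding e using that fn_mem[OF m] by (auto simp: exception_far[OF m] elim!: sum_setE)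
  qed
next
  fix X Y Z :: "'a set" and f g z assume f: "f \<in> Hom X Y" and g: "g \<in> Hom Y Z" and z: "z \<in> sum_set X E"
  show "fn (far (mfun (exception_monad E)) (g \<odot> f)) z =
      fn (far (mfun (exception_monad E)) g) (fn (far (mfun (exception_monad E)) f) z)"
    using z fn_mem[OF f] by (auto simp: exception_far[OF f] exception_far[OF g] exception_far[OF scmp_hom[OF f g]] fn_scmp[OF f] elim!: sum_setE)
next
  fix X :: "'a set" and z assume X: "finite X"
  have h: "mk_arr X inl (sum_set X E) \<in> Hom X (sum_set X E)"
    "mk_arr (sum_set (sum_set X E) E) (copair (\<lambda>w. w) inr) (sum_set X E) \<in> Hom (sum_set (sum_set X E) E) (sum_set X E)"
    using X E by (auto simp: small_finite finite_sum_set elim!: sum_setE)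
  then show "mk_arr X inl (sum_set X E) \<in> Hom X (sum_set X E)"
    "mk_arr (sum_set (sum_set X E) E) (copair (\<lambda>w. w) inr) (sum_set X E) \<in> Hom (sum_set (sum_set X E) E) (sum_set X E)" .
  show "z \<in> sum_set X E \<Longrightarrow> fn (far (mfun (exception_monad E)) (sid X)) z = z"
    using exception_far[OF sid_hom[OF small_finite[OF X]], of E] by (auto elim!: sum_setE)
  show "z \<in> sum_set X E \<Longrightarrow> fn (mk_arr (sum_set (sum_set X E) E) (copair (\<lambda>w. w) inr) (sum_set X E))
            (fn (far (mfun (exception_monad E)) (mk_arr X inl (sum_set X E))) z) = z"
    unfolding exception_far[OF h(1)] by (auto elim!: sum_setE)
  show "z \<in> sum_set (sum_set (sum_set X E) E) E \<Longrightarrow>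
      fn (mk_arr (sum_set (sum_set X E) E) (copair (\<lambda>w. w) inr) (sum_set X E))
        (fn (mk_arr (sum_set (sum_set (sum_set X E) E) E) (copair (\<lambda>w. w) inr) (sum_set (sum_set X E) E)) z) =
      fn (mk_arr (sum_set (sum_set X E) E) (copair (\<lambda>w. w) inr) (sum_set X E))
        (fn (far (mfun (exception_monad E)) (mk_arr (sum_set (sum_set X E) E) (copair (\<lambda>w. w) inr) (sum_set X E))) z)"
    unfolding exception_far[OF h(2)] by (auto elim!: sum_setE)
next
  fix X Y :: "'a set" and f x assume f: "f \<in> Hom X Y" and x: "x \<in> X"
  show "fn (mk_arr Y inl (sum_set Y E)) (fn f x) =
       fn (far (mfun (exception_monad E)) f) (fn (mk_arr X inl (sum_set X E)) x)"
    using x fn_mem[OF f x] by (simp add: exception_far[OF f])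
qed (auto simp: finite_sum_set E)

lemma action_far: "m \<in> Hom X Y \<Longrightarrow> far (mfun (action_monad M)) m =
    mk_arr (prod_set (carrier M) X) (\<lambda>z. opair (ofst z) (fn m (osnd z))) (prod_set (carrier M) Y)"
  by (subst hom_arr[of m X Y], assumption) (auto simp: action_monad_def mk_arr_def fn_def)

lemma action_simps:
  "fob (mfun (action_monad M)) X = prod_set (carrier M) X"
  "munit (action_monad M) X = mk_arr X (opair \<one>\<^bsub>M\<^esub>) (prod_set (carrier M) X)"
  "mmult (action_monad M) X = mk_arr (prod_set (carrier M) (prod_set (carrier M) X))
     (\<lambda>z. opair (ofst z \<otimes>\<^bsub>M\<^esub> ofst (osnd z)) (osnd (osnd z))) (prod_set (carrier M) X)"
  by (auto simp: action_monad_def mk_arr_def)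

lemma action_finset_monad:
  fixes M :: "('u::zf_universe, 'b) monoid_scheme"
  assumes "monoid M" and M: "finite (carrier M)" shows "finset_monad (action_monad M)"
proof (rule finset_monadI; (unfold action_simps)?)
  interpret monoid M by fact
  let ?P = "prod_set (carrier M)"
  {
    fix X Y :: "'u set" and m z assume X: "finite X" "finite Y" and m: "m \<in> Hom X Y"
    show "far (mfun (action_monad M)) m \<in> Hom (?P X) (?P Y)"
      unfolding action_far[OF m] using X M fn_mem[OF m]
      by (auto simp: small_finite finite_prod_set elim!: prod_setE)
    note e = action_far[OF this, of M]
    show "fn (mk_arr (?P (?P Y)) (\<lambda>z. opair (ofst z \<otimes>\<^bsub>M\<^esub> ofst (osnd z)) (osnd (osnd z))) (?P Y))
       (fn (far (mfun (action_monad M)) (far (mfun (action_monad M)) m)) z) =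
      fn (far (mfun (action_monad M)) m) (fn (mk_arr (?P (?P X)) (\<lambda>z. opair (ofst z \<otimes>\<^bsub>M\<^esub> ofst (osnd z)) (osnd (osnd z))) (?P X)) z)"
      if "z \<in> ?P (?P X)"
      unfolding e using that fn_mem[OF m] by (auto simp: action_far[OF m] elim!: prod_setE)
  next
    fix X Y Z :: "'u set" and f g z assume f: "f \<in> Hom X Y" and g: "g \<in> Hom Y Z" and z: "z \<in> ?P X"
    show "fn (far (mfun (action_monad M)) (g \<odot> f)) z =
        fn (far (mfun (action_monad M)) g) (fn (far (mfun (action_monad M)) f) z)"
      using z fn_mem[OF f] by (auto simp: action_far[OF f] action_far[OF g] action_far[OF scmp_hom[OF f g]] fn_scmp[OF f] elim!: prod_setE)
  next
    let ?m = "\<lambda>X. mk_arr (?P (?P X)) (\<lambda>z. opair (ofst z \<otimes>\<^bsub>M\<^esub> ofst (osnd z)) (osnd (osnd z))) (?P X)"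
    fix X :: "'u set" and z assume X: "finite X"
    have h: "mk_arr X (opair \<one>\<^bsub>M\<^esub>) (?P X) \<in> Hom X (?P X)" "?m X \<in> Hom (?P (?P X)) (?P X)"
      using X M by (auto simp: small_finite finite_prod_set elim!: prod_setE)
    then show "mk_arr X (opair \<one>\<^bsub>M\<^esub>) (?P X) \<in> Hom X (?P X)" "?m X \<in> Hom (?P (?P X)) (?P X)" .
    show "z \<in> ?P X \<Longrightarrow> fn (far (mfun (action_monad M)) (sid X)) z = z"
      using action_far[OF sid_hom[OF small_finite[OF X]], of M] by (auto elim!: prod_setE)
    show "z \<in> ?P X \<Longrightarrow> fn (?m X) (fn (far (mfun (action_monad M)) (mk_arr X (opair \<one>\<^bsub>M\<^esub>) (?P X))) z) = z"
      unfolding action_far[OF h(1)] by (auto elim!: prod_setE)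
    show "z \<in> ?P X \<Longrightarrow> fn (?m X) (fn (mk_arr (?P X) (opair \<one>\<^bsub>M\<^esub>) (?P (?P X))) z) = z"
      by (auto elim!: prod_setE)
    show "z \<in> ?P (?P (?P X)) \<Longrightarrow> fn (?m X) (fn (?m (?P X)) z) = fn (?m X) (fn (far (mfun (action_monad M)) (?m X)) z)"
      unfolding action_far[OF h(2)] by (auto simp: m_assoc elim!: prod_setE)
  next
    fix X Y :: "'u set" and f x assume f: "f \<in> Hom X Y" and x: "x \<in> X"
    show "fn (mk_arr Y (opair \<one>\<^bsub>M\<^esub>) (?P Y)) (fn f x) =
         fn (far (mfun (action_monad M)) f) (fn (mk_arr X (opair \<one>\<^bsub>M\<^esub>) (?P X)) x)"
      using x fn_mem[OF f x] by (simp add: action_far[OF f])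
  }
qed (auto simp: finite_prod_set M)

lemma powerset_far: "m \<in> Hom X Y \<Longrightarrow> far (mfun powerset_monad) m =
    mk_arr (power_set X) (\<lambda>y. mk_set (fn m ` elts y)) (power_set Y)"
  by (subst hom_arr[of m X Y], assumption) (auto simp: powerset_monad_def mk_arr_def fn_def)

lemma powerset_simps:
  "fob (mfun powerset_monad) X = power_set X"
  "munit powerset_monad X = mk_arr X (\<lambda>x. mk_set {x}) (power_set X)"
  "mmult powerset_monad X = mk_arr (power_set (power_set X)) (\<lambda>z. mk_set (\<Union>y\<in>elts z. elts y)) (power_set X)"
  by (auto simp: powerset_monad_def mk_arr_def)

lemma powerset_finset_monad: "finset_monad (powerset_monad :: ('u::zf_universe set, 'u set_arr) mnd)"
proof (rule finset_monadI; (unfold powerset_simps)?)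
  let ?T = "powerset_monad :: ('u set, 'u set_arr) mnd"
  let ?m = "\<lambda>X :: 'u set. mk_arr (power_set (power_set X)) (\<lambda>z. mk_set (\<Union>y\<in>elts z. elts y)) (power_set X)"
  let ?u = "\<lambda>X :: 'u set. mk_arr X (\<lambda>x. mk_set {x}) (power_set X)"
  have fp: "finite (power_set X)" if "finite X" for X :: "'u set" using that by (rule finite_power_set)
  have sU: "small (\<Union>y\<in>elts z. elts y)" for z :: 'u by (rule small_UN) simp_all
  {
    fix X Y :: "'u set" and m z assume X: "finite X" "finite Y" and m: "m \<in> Hom X Y"
    show "far (mfun ?T) m \<in> Hom (power_set X) (power_set Y)"
      unfolding powerset_far[OF m] using X
      by (auto simp: small_finite fp power_set_iff intro!: fn_mem[OF m] elim: subsetD)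
    note e = powerset_far[OF this]
    show "fn (?m Y) (fn (far (mfun ?T) (far (mfun ?T) m)) z) = fn (far (mfun ?T) m) (fn (?m X) z)"
      if z: "z \<in> power_set (power_set X)"
    proof -
      have 1: "y \<in> power_set X" if "y \<in> elts z" for y using z that by (rule power_set_mem)
      have 2: "fn (far (mfun ?T) m) ` elts z = (\<lambda>y. mk_set (fn m ` elts y)) ` elts z"
        using 1 by (intro image_cong) (simp_all add: powerset_far[OF m])
      have 3: "mk_set (fn (far (mfun ?T) m) ` elts z) \<in> power_set (power_set Y)"
        unfolding 2 using 1 fn_mem[OF m] by (force simp: power_set_iff)
      have 4: "mk_set (\<Union>y\<in>elts z. elts y) \<in> power_set X" using 1 sU by (auto simp: power_set_iff)
      have 5: "(\<Union>y\<in>(\<lambda>y. mk_set (fn m ` elts y)) ` elts z. elts y) = fn m ` (\<Union>y\<in>elts z. elts y)" by auto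
      have "fn (?m Y) (fn (far (mfun ?T) (far (mfun ?T) m)) z) = mk_set (fn m ` (\<Union>y\<in>elts z. elts y))"
        unfolding e using z 3 by (simp add: 2 image_UN)
      moreover have "fn (far (mfun ?T) m) (fn (?m X) z) = mk_set (fn m ` (\<Union>y\<in>elts z. elts y))"
        using z 4 sU by (simp add: powerset_far[OF m])
      ultimately show ?thesis by simp
    qed
  next
    fix X Y Z :: "'u set" and f g z assume f: "f \<in> Hom X Y" and g: "g \<in> Hom Y Z" and z: "z \<in> power_set X"
    have "mk_set (fn f ` elts z) \<in> power_set Y"
      using z by (auto simp: power_set_iff intro!: fn_mem[OF f] elim: subsetD)
    moreover have "fn (g \<odot> f) ` elts z = fn g ` fn f ` elts z"
      unfolding image_image by (rule image_cong) (use z in \<open>auto simp: fn_scmp[OF f] power_set_iff\<close>)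
    ultimately show "fn (far (mfun ?T) (g \<odot> f)) z = fn (far (mfun ?T) g) (fn (far (mfun ?T) f) z)"
      using z by (simp add: powerset_far[OF f] powerset_far[OF g] powerset_far[OF scmp_hom[OF f g]])
  next
    fix X :: "'u set" and z assume X: "finite X"
    have h1: "?u X \<in> Hom X (power_set X)" using X by (auto simp: small_finite fp power_set_iff)
    have h2: "?m X \<in> Hom (power_set (power_set X)) (power_set X)"
      unfolding mk_arr_hom
    proof (intro conjI funcsetI)
      show "z \<in> power_set (power_set X) \<Longrightarrow> mk_set (\<Union>y\<in>elts z. elts y) \<in> power_set X" for z
        by (simp add: sU Union_power_set power_set_iff[of "mk_set _"])
    qed (simp_all add: small_finite fp X)
    note h = h1 h2
    then show "?u X \<in> Hom X (power_set X)" "?m X \<in> Hom (power_set (power_set X)) (power_set X)" .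
    show "z \<in> power_set X \<Longrightarrow> fn (far (mfun ?T) (sid X)) z = z"
    proof -
      assume z: "z \<in> power_set X"
      then have "fn (sid X) ` elts z = elts z" using fn_sid[of _ X] by (force simp: power_set_iff)
      then show ?thesis using z powerset_far[OF sid_hom[OF small_finite[OF X]]] by simp
    qed
    show "z \<in> power_set X \<Longrightarrow> fn (?m X) (fn (far (mfun ?T) (?u X)) z) = z"
    proof -
      assume z: "z \<in> power_set X"
      then have 1: "fn (?u X) ` elts z = (\<lambda>x. mk_set {x}) ` elts z" by (intro image_cong) (auto simp: power_set_iff)
      have "mk_set ((\<lambda>x. mk_set {x}) ` elts z) \<in> power_set (power_set X)" using z by (auto simp: power_set_iff)
      moreover have "(\<Union>y\<in>(\<lambda>x. mk_set {x}) ` elts z. elts y) = elts z" by auto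
      ultimately show ?thesis using z by (simp add: powerset_far[OF h(1)] 1)
    qed
    show "z \<in> power_set X \<Longrightarrow> fn (?m X) (fn (?u (power_set X)) z) = z"
      by (simp add: power_set_iff)
    show "z \<in> power_set (power_set (power_set X)) \<Longrightarrow> fn (?m X) (fn (?m (power_set X)) z) = fn (?m X) (fn (far (mfun ?T) (?m X)) z)"
    proof -
      assume z: "z \<in> power_set (power_set (power_set X))"
      have y: "y \<in> power_set (power_set X)" if "y \<in> elts z" for y using z that by (rule power_set_mem)
      have 1: "fn (?m X) ` elts z = (\<lambda>y. mk_set (\<Union>v\<in>elts y. elts v)) ` elts z" using y by (intro image_cong) auto
      have 2: "mk_set ((\<lambda>y. mk_set (\<Union>v\<in>elts y. elts v)) ` elts z) \<in> power_set (power_set X)"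
      proof -
        have "(\<lambda>y. mk_set (\<Union>v\<in>elts y. elts v)) ` elts z \<subseteq> power_set X"
          using Union_power_set[OF y] by (auto simp: power_set_iff[of "mk_set _"] sU)
        then show ?thesis by (simp add: power_set_iff[of "mk_set _"])
      qed
      have 3: "mk_set (\<Union>y\<in>elts z. elts y) \<in> power_set (power_set X)"
        using Union_power_set[OF z] by (simp add: power_set_iff[of "mk_set _"] sU)
      show ?thesis using z 2 3 by (simp add: powerset_far[OF h(2)] 1 sU)
    qed
  next
    fix X Y :: "'u set" and f x assume f: "f \<in> Hom X Y" and x: "x \<in> X"
    show "fn (?u Y) (fn f x) = fn (far (mfun ?T) f) (fn (?u X) x)"
      using x fn_mem[OF f x] by (simp add: powerset_far[OF f] power_set_iff)
  }
qed (auto simp: finite_power_set)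

section \<open>Natural families of finite sets and filters\<close>

definition two :: "'u::zf_universe set"
  where "two = {nat_code 0, nat_code 1}"

text \<open>\<open>nat_code 0\<close> stands for truth: a set of values inside {nat_code 0} will say
  that B belongs to the filter.\<close>

definition chi :: "'u::zf_universe set \<Rightarrow> 'u set \<Rightarrow> 'u set_arr"
  where "chi X B = mk_arr X (\<lambda>x. if x \<in> B then nat_code 0 else nat_code 1) two"

text \<open>The map to a one-point set sees only the part of an element that does not involve X: its
  exception, or its monoid element.\<close>

definition bang :: "'u::zf_universe set \<Rightarrow> 'u set_arr"
  where "bang X = mk_arr X (\<lambda>x. nat_code 0) {nat_code 0}"

lemma nat_code_eq [simp]: "(nat_code i :: 'u::zf_universe) = nat_code j \<longleftrightarrow> i = j"
  using nat_code(1) by (rule inj_eq)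

lemma finite_two [simp]: "finite two" by (simp add: two_def)

lemma chi_hom: "small X \<Longrightarrow> chi X B \<in> Hom X two"
  by (auto simp: chi_def small_finite) (simp_all add: two_def)

lemma fn_chi: "x \<in> X \<Longrightarrow> fn (chi X B) x = (if x \<in> B then nat_code 0 else nat_code 1)"
  by (simp add: chi_def)

lemma chi_cmp: "f \<in> Hom X Y \<Longrightarrow> chi Y B \<odot> f = chi X {x \<in> X. fn f x \<in> B}"
proof -
  assume f: "f \<in> Hom X Y"
  note c = chi_hom[OF hom_small(2)[OF f]] and X = hom_small(1)[OF f]
  show ?thesis
    by (rule arr_eqI[OF scmp_hom[OF f c] chi_hom[OF X]]) (simp add: fn_scmp[OF f] fn_chi fn_mem[OF f])
qed

lemma bang_hom: "small X \<Longrightarrow> bang X \<in> Hom X {nat_code 0}"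
  by (simp add: bang_def)

lemma bang_cmp: "f \<in> Hom X Y \<Longrightarrow> bang Y \<odot> f = bang X"
proof -
  assume f: "f \<in> Hom X Y"
  note b = bang_hom[OF hom_small(2)[OF f]] and X = hom_small(1)[OF f]
  show ?thesis
    by (rule arr_eqI[OF scmp_hom[OF f b] bang_hom[OF X]]) (simp add: fn_scmp[OF f] fn_mem[OF f], simp add: bang_def fn_mem[OF f])
qed

text \<open>Families of sets are treated apart from the powerset monad, so that the point-valued
  families of the other two monads can enter as singletons.\<close>

locale subset_family =
  fixes X :: "'u::zf_universe set" and k :: "'u set_arr \<Rightarrow> 'u set"
  assumes small: "small X"
    and mem: "f \<in> Hom X A \<Longrightarrow> finite A \<Longrightarrow> k f \<subseteq> A"
    and nat: "f \<in> Hom X A \<Longrightarrow> g \<in> Hom A B \<Longrightarrow> finite A \<Longrightarrow> finite B \<Longrightarrow> k (g \<odot> f) = fn g ` k f"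
begin

definition fam_filter :: "'u set set"
  where "fam_filter = {B. B \<subseteq> X \<and> k (chi X B) \<subseteq> {nat_code 0}}"

text \<open>Naturality along the characteristic map of C. It shows that the filter determines the
  family: \<open>k f\<close> is the least subset of A whose preimage is in the filter.\<close>

lemma preimage_fam_filter:
  assumes f: "f \<in> Hom X A" and A: "finite A"
  shows "{x \<in> X. fn f x \<in> C} \<in> fam_filter \<longleftrightarrow> k f \<subseteq> C"
proof -
  have "k (chi X {x \<in> X. fn f x \<in> C}) = fn (chi A C) ` k f"
    unfolding chi_cmp[OF f, symmetric] by (rule nat[OF f chi_hom[OF small_finite[OF A]] A finite_two])
  moreover have "fn (chi A C) ` k f \<subseteq> {nat_code 0} \<longleftrightarrow> k f \<subseteq> C"
  proof -
    have "fn (chi A C) y = nat_code 0 \<longleftrightarrow> y \<in> C" if "y \<in> k f" for y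
      using mem[OF f A] that by (simp add: fn_chi subsetD)
    then show ?thesis by (auto simp: image_subset_iff)
  qed
  ultimately show ?thesis by (simp add: fam_filter_def)
qed

lemma filt_fam_filter: "filt X fam_filter"
proof (rule filtI)
  show "fam_filter \<subseteq> Pow X" by (auto simp: fam_filter_def)
  have "{x \<in> X. fn (bang X) x \<in> {nat_code 0}} \<in> fam_filter"
    by (rule iffD2[OF preimage_fam_filter[OF bang_hom[OF small]]]) (simp_all add: mem[OF bang_hom[OF small]])
  moreover have "{x \<in> X. fn (bang X) x \<in> {nat_code 0}} = X" by (auto simp: bang_def)
  ultimately show "X \<in> fam_filter" by simp
next
  fix A B assume A: "A \<in> fam_filter" and B: "B \<in> fam_filter"
  \<comment> \<open>One map separates the four Boolean cells cut out by A and B. Then A, B and their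
    intersection are preimages under the same map, and the inclusions of \<open>k ?f\<close> can be
    intersected.\<close>
  let ?n = "\<lambda>x. if x \<in> A then (if x \<in> B then 0 else 1) else (if x \<in> B then 2 else 3) :: nat"
  let ?C = "nat_code ` {..<4} :: 'u set" let ?f = "mk_arr X (\<lambda>x. nat_code (?n x)) ?C"
  have f: "?f \<in> Hom X ?C" using small by (auto simp: small_finite)
  have AX: "A \<subseteq> X" "B \<subseteq> X" using A B by (auto simp: fam_filter_def)
  have e: "{x \<in> X. fn ?f x \<in> {nat_code 0, nat_code 1}} = A" "{x \<in> X. fn ?f x \<in> {nat_code 0, nat_code 2}} = B"
    "{x \<in> X. fn ?f x \<in> {nat_code 0}} = A \<inter> B" using AX by (auto split: if_splits)
  have fC: "finite ?C" by simp
  note p = preimage_fam_filter[OF f fC]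
  have "{x \<in> X. fn ?f x \<in> {nat_code 0, nat_code 1}} \<in> fam_filter" unfolding e(1) by (rule A)
  then have 1: "k ?f \<subseteq> {nat_code 0, nat_code 1}" by (rule iffD1[OF p])
  have "{x \<in> X. fn ?f x \<in> {nat_code 0, nat_code 2}} \<in> fam_filter" unfolding e(2) by (rule B)
  then have 2: "k ?f \<subseteq> {nat_code 0, nat_code 2}" by (rule iffD1[OF p])
  have "k ?f \<subseteq> {nat_code 0, nat_code 1} \<inter> {nat_code 0, nat_code 2}" using 1 2 by (rule Int_greatest)
  also have "\<dots> = {nat_code 0}" by simp
  finally have "{x \<in> X. fn ?f x \<in> {nat_code 0}} \<in> fam_filter" by (rule iffD2[OF p])
  then show "A \<inter> B \<in> fam_filter" unfolding e(3) .
next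
  fix A B assume A: "A \<in> fam_filter" and AB: "A \<subseteq> B" "B \<subseteq> X"
  \<comment> \<open>The chain of A inside B inside X has three cells, and both A and B are preimages
    under the map that separates them.\<close>
  let ?n = "\<lambda>x. if x \<in> A then 0 else (if x \<in> B then 1 else 2) :: nat"
  let ?C = "nat_code ` {..<3} :: 'u set" let ?f = "mk_arr X (\<lambda>x. nat_code (?n x)) ?C"
  have f: "?f \<in> Hom X ?C" using small by (auto simp: small_finite)
  have AX: "A \<subseteq> X" using A by (auto simp: fam_filter_def)
  have e: "{x \<in> X. fn ?f x \<in> {nat_code 0}} = A" "{x \<in> X. fn ?f x \<in> {nat_code 0, nat_code 1}} = B"
    using AX AB by (auto split: if_splits)
  have fC: "finite ?C" by simp
  note p = preimage_fam_filter[OF f fC]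
  have "{x \<in> X. fn ?f x \<in> {nat_code 0}} \<in> fam_filter" unfolding e(1) by (rule A)
  then have "k ?f \<subseteq> {nat_code 0}" by (rule iffD1[OF p])
  then have "k ?f \<subseteq> {nat_code 0, nat_code 1}" by blast
  then have "{x \<in> X. fn ?f x \<in> {nat_code 0, nat_code 1}} \<in> fam_filter" by (rule iffD2[OF p])
  then show "B \<in> fam_filter" unfolding e(2) .
qed

end

text \<open>A point is dropped when the filter already lives on the preimage of its complement. For
  finite codomain the remaining points form the least subset whose preimage is in F, as
  \<open>filter_kernel_subset\<close> shows.\<close>

definition filter_kernel :: "'u::zf_universe set set \<Rightarrow> 'u set_arr \<Rightarrow> 'u set"
  where "filter_kernel F f = {y \<in> cd f. {x \<in> dm f. fn f x \<in> cd f - {y}} \<notin> F}"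

lemma filter_kernel_subset:
  assumes F: "filt X F" and f: "f \<in> Hom X A" and A: "finite A"
  shows "filter_kernel F f \<subseteq> C \<longleftrightarrow> {x \<in> X. fn f x \<in> C} \<in> F"
proof
  let ?pre = "\<lambda>C. {x \<in> X. fn f x \<in> C}"
  have k: "filter_kernel F f = {y \<in> A. ?pre (A - {y}) \<notin> F}" by (simp add: filter_kernel_def dm_cd[OF f])
  {
    assume sub: "filter_kernel F f \<subseteq> C"
    \<comment> \<open>The points outside the kernel are removed one at a time. Each removal is an
      intersection with a member of F, and finiteness of A makes finitely many of them
      suffice.\<close>
    have "?pre (A - D) \<in> F" if "finite D" "D \<inter> filter_kernel F f = {}" "D \<subseteq> A" for D
      using that
    proof (induction rule: finite_induct)
      case empty
      have "?pre (A - {}) = X" using fn_mem[OF f] by auto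
      then show ?case using filtD(2)[OF F] by simp
    next
      case (insert y D)
      then have "?pre (A - D) \<in> F" "?pre (A - {y}) \<in> F" by (auto simp: k)
      then have "?pre (A - D) \<inter> ?pre (A - {y}) \<in> F" by (rule filtD(3)[OF F])
      moreover have "?pre (A - D) \<inter> ?pre (A - {y}) = ?pre (A - insert y D)" by auto
      ultimately show ?case by simp
    qed
    from this[of "A - C"] have "?pre (A - (A - C)) \<in> F" using sub A by auto
    moreover have "?pre (A - (A - C)) = ?pre C" using fn_mem[OF f] by auto
    ultimately show "?pre C \<in> F" by simp
  next
    assume C: "?pre C \<in> F"
    show "filter_kernel F f \<subseteq> C"
    proof
      fix y assume "y \<in> filter_kernel F f"
      then have y: "y \<in> A" "?pre (A - {y}) \<notin> F" by (simp_all add: k)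
      show "y \<in> C"
      proof (rule ccontr)
        assume "y \<notin> C"
        then have "?pre C \<subseteq> ?pre (A - {y})" using fn_mem[OF f] by auto
        then show False using y(2) filtD(4)[OF F C, of "?pre (A - {y})"] by auto
      qed
    qed
  }
qed

lemma filter_kernel_mem: "f \<in> Hom X A \<Longrightarrow> filter_kernel F f \<subseteq> A"
  by (auto simp: filter_kernel_def dm_cd)

text \<open>Two sets with the same supersets are equal, and supersets of kernels are described by
  preimages, which compose.\<close>

lemma filter_kernel_nat:
  assumes F: "filt X F" and f: "f \<in> Hom X A" and g: "g \<in> Hom A B" and A: "finite A" and B: "finite B"
  shows "filter_kernel F (g \<odot> f) = fn g ` filter_kernel F f"
proof -
  have "filter_kernel F (g \<odot> f) \<subseteq> C \<longleftrightarrow> fn g ` filter_kernel F f \<subseteq> C" for C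
  proof -
    have "{x \<in> X. fn (g \<odot> f) x \<in> C} = {x \<in> X. fn f x \<in> {y \<in> A. fn g y \<in> C}}"
      using fn_mem[OF f] by (auto simp: fn_scmp[OF f])
    then have "filter_kernel F (g \<odot> f) \<subseteq> C \<longleftrightarrow> filter_kernel F f \<subseteq> {y \<in> A. fn g y \<in> C}"
      unfolding filter_kernel_subset[OF F scmp_hom[OF f g] B] filter_kernel_subset[OF F f A] by simp
    also have "\<dots> \<longleftrightarrow> fn g ` filter_kernel F f \<subseteq> C" using filter_kernel_mem[OF f, of F] by auto
    finally show ?thesis .
  qed
  then show ?thesis by (meson equalityI order_refl)
qed

definition ultra_point :: "'u::zf_universe set set \<Rightarrow> 'u set_arr \<Rightarrow> 'u"
  where "ultra_point U f = (THE y. filter_kernel U f = {y})"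

text \<open>The kernel is nonempty because the empty set is not in U. For y in it, the complement of
  the fibre over y is not in U, so the fibre is, and the kernel shrinks to {y}.\<close>

lemma ultra_point:
  assumes U: "ultra X U" and f: "f \<in> Hom X A" and A: "finite A"
  shows "filter_kernel U f = {ultra_point U f}"
proof -
  note F = ultra_filt[OF U]
  have ne: "filter_kernel U f \<noteq> {}"
    using filter_kernel_subset[OF F f A, of "{}"] U by (auto simp: ultra_def)
  then obtain y where y: "y \<in> filter_kernel U f" by blast
  then have yA: "y \<in> A" "{x \<in> X. fn f x \<in> A - {y}} \<notin> U" by (simp_all add: filter_kernel_def dm_cd[OF f])
  have "X - {x \<in> X. fn f x \<in> A - {y}} \<in> U" using ultra_compl[OF U, of "{x \<in> X. fn f x \<in> A - {y}}"] yA(2) by auto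
  moreover have "X - {x \<in> X. fn f x \<in> A - {y}} = {x \<in> X. fn f x \<in> {y}}" using fn_mem[OF f] by auto
  ultimately have "filter_kernel U f \<subseteq> {y}" using filter_kernel_subset[OF F f A, of "{y}"] by simp
  then have "filter_kernel U f = {y}" using y by blast
  then show ?thesis unfolding ultra_point_def by simp
qed

lemma ultra_point_iff:
  "ultra X U \<Longrightarrow> f \<in> Hom X A \<Longrightarrow> finite A \<Longrightarrow> ultra_point U f \<in> C \<longleftrightarrow> {x \<in> X. fn f x \<in> C} \<in> U"
  using filter_kernel_subset[OF ultra_filt, of X U f A C] ultra_point[of X U f A] by simp

lemma ultra_point_mem: "ultra X U \<Longrightarrow> f \<in> Hom X A \<Longrightarrow> finite A \<Longrightarrow> ultra_point U f \<in> A"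
  using filter_kernel_mem[of f X A U] ultra_point[of X U f A] by simp

lemma ultra_point_nat:
  assumes U: "ultra X U" and f: "f \<in> Hom X A" and g: "g \<in> Hom A B" and A: "finite A" and B: "finite B"
  shows "ultra_point U (g \<odot> f) = fn g (ultra_point U f)"
  using filter_kernel_nat[OF ultra_filt[OF U] f g A B] ultra_point[OF U f A] ultra_point[OF U scmp_hom[OF f g] B] by simp

section \<open>The pushforward of the powerset monad\<close>

locale powerset_pushforward = finset_pushforward "powerset_monad :: ('u::zf_universe set, 'u set_arr) mnd" S \<epsilon>
  for S :: "('u::zf_universe set, 'u set_arr) mnd" and \<epsilon>
begin

definition Fil :: "'u set \<Rightarrow> 'u \<Rightarrow> 'u set set"
  where "Fil X s = {B. B \<subseteq> X \<and> elts (val (chi X B) s) \<subseteq> {nat_code 0}}"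

lemma val_power: "f \<in> Hom X A \<Longrightarrow> finite A \<Longrightarrow> s \<in> Po X \<Longrightarrow> val f s \<in> power_set A"
  using val_mem[of f X A s] by (simp add: powerset_simps)

lemma elts_val_cmp:
  assumes "s \<in> Po X" "f \<in> Hom X A" "g \<in> Hom A B" "finite A" "finite B"
  shows "elts (val (g \<odot> f) s) = fn g ` elts (val f s)"
  using val_cmp[OF assms] val_power[OF assms(2,4,1)] by (simp add: powerset_far[OF assms(3)])

lemma subset_family_val: "small X \<Longrightarrow> s \<in> Po X \<Longrightarrow> subset_family X (\<lambda>f. elts (val f s))"
  by unfold_locales (use val_power in \<open>auto simp: elts_val_cmp power_set_def\<close>)

lemma Fil_eq: "small X \<Longrightarrow> s \<in> Po X \<Longrightarrow> Fil X s = subset_family.fam_filter X (\<lambda>f. elts (val f s))"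
  using subset_family.fam_filter_def[OF subset_family_val] by (simp add: Fil_def)

lemma filt_Fil: "small X \<Longrightarrow> s \<in> Po X \<Longrightarrow> filt X (Fil X s)"
  using subset_family.filt_fam_filter[OF subset_family_val] by (simp add: Fil_eq)

lemma preimage_Fil: "s \<in> Po X \<Longrightarrow> f \<in> Hom X A \<Longrightarrow> finite A \<Longrightarrow>
    {x \<in> X. fn f x \<in> C} \<in> Fil X s \<longleftrightarrow> elts (val f s) \<subseteq> C"
  using subset_family.preimage_fam_filter[OF subset_family_val, of X s f A C]
  by (simp add: Fil_eq hom_small(1))

lemma Fil_Pm: "s \<in> Po X \<Longrightarrow> g \<in> Hom X Y \<Longrightarrow> Fil Y (fn (Pm g) s) = fimage Y X (fn g) (Fil X s)"
  unfolding fimage_def Fil_def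
  by (intro Collect_cong conj_cong) (auto simp: val_Pm[OF _ _ chi_hom[OF hom_small(2)] finite_two] chi_cmp)

lemma Fil_unit: "small X \<Longrightarrow> x \<in> X \<Longrightarrow> Fil X (fn (P\<eta> X) x) = fprin X x"
proof -
  assume X: "small X" and x: "x \<in> X"
  have "val (chi X B) (fn (P\<eta> X) x) = mk_set {fn (chi X B) x}" for B
    using fn_mem[OF chi_hom[OF X] x] by (simp add: val_unit[OF x chi_hom[OF X] finite_two] powerset_simps)
  then show ?thesis unfolding Fil_def fprin_def by (auto simp: fn_chi[OF x] split: if_splits)
qed

text \<open>A union lies inside {nat_code 0} exactly when every set of the union does. Applied to
  \<open>eval (chi X B)\<close>, again a map into a finite set, \<open>preimage_Fil\<close> turns
  this into membership of a preimage in the filter of \<Phi>.\<close>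

lemma Fil_mult: "small X \<Longrightarrow> \<Phi> \<in> Po (Po X) \<Longrightarrow> Fil X (fn (P\<mu> X) \<Phi>) = fbind X (Po X) (Fil X) (Fil (Po X) \<Phi>)"
proof -
  assume X: "small X" and \<Phi>: "\<Phi> \<in> Po (Po X)"
  have "elts (val (chi X B) (fn (P\<mu> X) \<Phi>)) \<subseteq> {nat_code 0} \<longleftrightarrow> {s \<in> Po X. B \<in> Fil X s} \<in> Fil (Po X) \<Phi>"
    if B: "B \<subseteq> X" for B
  proof -
    note c = chi_hom[OF X, of B] note e = eval_hom[OF c finite_two]
    note t2 = T_finite[OF finite_two]
    let ?t = "val (eval (chi X B)) \<Phi>"
    have t: "?t \<in> power_set (power_set two)" using val_mem[OF e t2 \<Phi>] by (simp add: powerset_simps)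
    have "elts (val (chi X B) (fn (P\<mu> X) \<Phi>)) = (\<Union>y\<in>elts ?t. elts y)"
      using t by (simp add: val_mult[OF \<Phi> c finite_two] powerset_simps small_UN)
    then have "elts (val (chi X B) (fn (P\<mu> X) \<Phi>)) \<subseteq> {nat_code 0} \<longleftrightarrow> elts ?t \<subseteq> {y. elts y \<subseteq> {nat_code 0}}" by auto
    also have "\<dots> \<longleftrightarrow> {s \<in> Po X. fn (eval (chi X B)) s \<in> {y. elts y \<subseteq> {nat_code 0}}} \<in> Fil (Po X) \<Phi>"
      by (rule preimage_Fil[OF \<Phi> e t2, symmetric])
    also have "{s \<in> Po X. fn (eval (chi X B)) s \<in> {y. elts y \<subseteq> {nat_code 0}}} = {s \<in> Po X. B \<in> Fil X s}"
      using B by (simp add: Fil_def val_def)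
    finally show ?thesis .
  qed
  then show ?thesis unfolding Fil_def[of X "fn (P\<mu> X) \<Phi>"] fbind_def by auto
qed

text \<open>A value is determined by its supersets, and these are read off from the filter.\<close>

lemma Fil_inj: "small X \<Longrightarrow> s \<in> Po X \<Longrightarrow> t \<in> Po X \<Longrightarrow> Fil X s = Fil X t \<Longrightarrow> s = t"
proof (rule val_eqI)
  fix f A assume X: "small X" and s: "s \<in> Po X" and t: "t \<in> Po X" and eq: "Fil X s = Fil X t"
    and f: "f \<in> Hom X A" and A: "finite A"
  have "elts (val f s) \<subseteq> C \<longleftrightarrow> elts (val f t) \<subseteq> C" for C
    using preimage_Fil[OF s f A, of C] preimage_Fil[OF t f A, of C] eq by simp
  then show "val f s = val f t" by (intro elts_ext equalityI) auto
qed

text \<open>The kernels of F form a natural family by \<open>filter_kernel_nat\<close>, and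
  \<open>val_surj\<close> realises it by an element.\<close>

lemma Fil_surj:
  assumes X: "small X" and F: "filt X F"
  obtains s where "s \<in> Po X" "Fil X s = F"
proof -
  let ?\<phi> = "\<lambda>f. mk_set (filter_kernel F f)"
  have sm: "small (filter_kernel F f)" if "f \<in> Hom X A" "finite A" for f A
    by (rule small_finite, rule finite_subset[OF filter_kernel_mem[OF that(1)] that(2)])
  have "restrict ?\<phi> (finarr X) \<in> Fam X"
  proof (rule nat_familiesI)
    fix f A assume f: "f \<in> Hom X A" and A: "finite A"
    show p: "?\<phi> f \<in> fob (mfun powerset_monad) A"
      using filter_kernel_mem[OF f] sm[OF f A] by (simp add: powerset_simps power_set_iff)
    fix g B assume g: "g \<in> Hom A B" and B: "finite B"
    show "?\<phi> (g \<odot> f) = fn (Tm g) (?\<phi> f)"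
      using p sm[OF f A] by (simp add: filter_kernel_nat[OF F f g A B] powerset_far[OF g] powerset_simps)
  qed
  then obtain s where s: "s \<in> Po X" and v: "\<And>f A. f \<in> Hom X A \<Longrightarrow> finite A \<Longrightarrow> val f s = restrict ?\<phi> (finarr X) f"
    using val_surj[OF X] by metis
  have "Fil X s = F"
  proof -
    note c = chi_hom[OF X]
    have "elts (val (chi X B) s) = filter_kernel F (chi X B)" for B
      using v[OF c finite_two] sm[OF c finite_two] finarrI[OF c finite_two] by simp
    then have "elts (val (chi X B) s) \<subseteq> {nat_code 0} \<longleftrightarrow> B \<in> F" if "B \<subseteq> X" for B
    proof -
      have "{x \<in> X. fn (chi X B) x \<in> {nat_code 0}} = B" using that by (auto simp: fn_chi split: if_splits)
      then show ?thesis using filter_kernel_subset[OF F c finite_two, of B "{nat_code 0}"]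
          \<open>\<And>B. elts (val (chi X B) s) = filter_kernel F (chi X B)\<close> by simp
    qed
    then show ?thesis using filtD(1)[OF F] unfolding Fil_def by auto
  qed
  then show ?thesis using s that by blast
qed

theorem em_continuous_lattices:
  "equivalent_categories (em_category Set_cat S) (ContLat_cat :: ('u gorder, 'u gorder \<times> ('u \<Rightarrow> 'u) \<times> 'u gorder) cat)"
  unfolding ContLat_cat_def
proof (rule equivalent_em_concreteI[where \<alpha> = "\<lambda>L s. flim L (Fil (carrier L) s)"])
  fix L :: "'u gorder" assume "L \<in> {L. small (carrier L) \<and> continuous_lattice L}"
  then have X: "small (carrier L)" and L: "continuous_lattice L" by simp_all
  then interpret L: gorder_lattice L by (simp add: continuous_lattice_def gorder_lattice_def)
  show "small (carrier L)" by (rule X)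
  show mem: "flim L (Fil (carrier L) s) \<in> carrier L" if "s \<in> Po (carrier L)" for s
    by (rule L.flim_closed[OF filt_Fil[OF X that]])
  show "flim L (Fil (carrier L) (fn (P\<eta> (carrier L)) x)) = x" if "x \<in> carrier L" for x
    using that by (simp add: Fil_unit[OF X that] L.flim_fprin)
  fix \<Phi> assume \<Phi>: "\<Phi> \<in> Po (Po (carrier L))"
  let ?a = "\<lambda>s. flim L (Fil (carrier L) s)"
  let ?m = "mk_arr (Po (carrier L)) ?a (carrier L)"
  have m: "?m \<in> Hom (Po (carrier L)) (carrier L)" using X P_small mem by auto
  have "fimage (carrier L) (Po (carrier L)) (fn ?m) (Fil (Po (carrier L)) \<Phi>) =
      fimage (carrier L) (Po (carrier L)) ?a (Fil (Po (carrier L)) \<Phi>)" by (rule fimage_cong) simp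
  moreover have "flim L (fbind (carrier L) (Po (carrier L)) (Fil (carrier L)) (Fil (Po (carrier L)) \<Phi>)) =
    flim L (fimage (carrier L) (Po (carrier L)) ?a (Fil (Po (carrier L)) \<Phi>))"
    by (rule flim_fbind[OF L filt_Fil[OF P_small[OF X] \<Phi>]]) (rule filt_Fil[OF X])
  ultimately show "?a (fn (P\<mu> (carrier L)) \<Phi>) = ?a (fn (Pm ?m) \<Phi>)"
    by (simp add: Fil_mult[OF X \<Phi>] Fil_Pm[OF \<Phi> m])
next
  fix L K :: "'u gorder" and f
  assume "L \<in> {L. small (carrier L) \<and> continuous_lattice L}" "K \<in> {L. small (carrier L) \<and> continuous_lattice L}"
    and f: "f \<in> carrier L \<rightarrow>\<^sub>E carrier K"
  then have X: "small (carrier L)" "small (carrier K)" and L: "complete_lattice L" "complete_lattice K"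
    by (simp_all add: continuous_lattice_def)
  have f': "f ` carrier L \<subseteq> carrier K" using f by auto
  let ?m = "mk_arr (carrier L) f (carrier K)"
  have m: "?m \<in> Hom (carrier L) (carrier K)" using X f by auto
  have e: "fimage (carrier K) (carrier L) (fn ?m) F = fimage (carrier K) (carrier L) f F" for F
    by (rule fimage_cong) simp
  show "((\<forall>D. directed_in L D \<longrightarrow> f (\<Squnion>\<^bsub>L\<^esub> D) = \<Squnion>\<^bsub>K\<^esub> (f ` D)) \<and>
      (\<forall>A. A \<subseteq> carrier L \<longrightarrow> f (\<Sqinter>\<^bsub>L\<^esub> A) = \<Sqinter>\<^bsub>K\<^esub> (f ` A))) \<longleftrightarrow>
    (\<forall>s\<in>Po (carrier L). f (flim L (Fil (carrier L) s)) = flim K (Fil (carrier K) (fn (Pm ?m) s)))"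
    unfolding contlat_hom_iff[OF L f']
  proof (intro iffI ballI allI impI)
    fix s assume h: "\<forall>F. filt (carrier L) F \<longrightarrow> f (flim L F) = flim K (fimage (carrier K) (carrier L) f F)"
      and s: "s \<in> Po (carrier L)"
    show "f (flim L (Fil (carrier L) s)) = flim K (Fil (carrier K) (fn (Pm ?m) s))"
      using h filt_Fil[OF X(1) s] by (simp add: Fil_Pm[OF s m] e)
  next
    fix F assume h: "\<forall>s\<in>Po (carrier L). f (flim L (Fil (carrier L) s)) = flim K (Fil (carrier K) (fn (Pm ?m) s))"
      and F: "filt (carrier L) F"
    obtain s where s: "s \<in> Po (carrier L)" "Fil (carrier L) s = F" by (rule Fil_surj[OF X(1) F])
    show "f (flim L F) = flim K (fimage (carrier K) (carrier L) f F)"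
      using bspec[OF h s(1)] by (simp add: Fil_Pm[OF s(1) m] e s(2))
  qed
next
  fix X a assume X: "small X" and a: "a \<in> Hom (Po X) X" and unit: "\<And>x. x \<in> X \<Longrightarrow> fn a (fn (P\<eta> X) x) = x"
    and mult: "\<And>\<Phi>. \<Phi> \<in> Po (Po X) \<Longrightarrow> fn a (fn (P\<mu> X) \<Phi>) = fn a (fn (Pm a) \<Phi>)"
  \<comment> \<open>The inverse of \<open>Fil X\<close>, by which the structure map becomes a
    function on filters.\<close>
  define j where "j F = (SOME s. s \<in> Po X \<and> Fil X s = F)" for F
  have j: "j F \<in> Po X" "Fil X (j F) = F" if F: "filt X F" for F
  proof -
    obtain s where "s \<in> Po X" "Fil X s = F" by (rule Fil_surj[OF X F])
    then have "\<exists>s. s \<in> Po X \<and> Fil X s = F" by blast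
    from someI_ex[OF this] show "j F \<in> Po X" "Fil X (j F) = F" by (simp_all add: j_def)
  qed
  have jF: "j (Fil X s) = s" if "s \<in> Po X" for s
    by (rule Fil_inj[OF X]) (use j[OF filt_Fil[OF X that]] that in auto)
  define \<xi> where "\<xi> F = fn a (j F)" for F
  let ?FX = "{F. filt X F}"
  interpret filter_algebra X \<xi>
  proof
    show "\<xi> F \<in> X" if "filt X F" for F unfolding \<xi>_def by (rule fn_mem[OF a j(1)[OF that]])
    show "\<xi> (fprin X x) = x" if x: "x \<in> X" for x
      using jF[OF fn_mem[OF P\<eta>_hom[OF X] x]] unit[OF x] by (simp add: \<xi>_def Fil_unit[OF X x])
    fix \<Phi> assume \<Phi>: "filt ?FX \<Phi>"
    have j': "j ` ?FX \<subseteq> Po X" using j by auto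
    \<comment> \<open>The law \<open>mult\<close> concerns elements of \<open>Po (Po X)\<close>. The
      filter of filters \<Phi> is pushed along j to a filter on \<open>Po X\<close>, which some
      \<theta> represents.\<close>
    obtain \<theta> where \<theta>: "\<theta> \<in> Po (Po X)" "Fil (Po X) \<theta> = fimage (Po X) ?FX j \<Phi>"
      by (rule Fil_surj[OF P_small[OF X] filt_fimage[OF \<Phi> j']])
    note m\<theta> = fn_mem[OF P\<mu>_hom[OF X] \<theta>(1)] and a\<theta> = fn_mem[OF Pm_hom[OF a] \<theta>(1)]
    have "fbind X ?FX (\<lambda>F. Fil X (j F)) \<Phi> = fbind X ?FX (\<lambda>F. F) \<Phi>" by (rule fbind_cong) (simp add: j)
    then have "Fil X (fn (P\<mu> X) \<theta>) = fbind X ?FX (\<lambda>F. F) \<Phi>"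
      by (simp add: Fil_mult[OF X \<theta>(1)] \<theta>(2) fbind_fimage[OF j'])
    then have 1: "\<xi> (fbind X ?FX (\<lambda>F. F) \<Phi>) = fn a (fn (P\<mu> X) \<theta>)" using jF[OF m\<theta>] by (simp add: \<xi>_def)
    have "Fil X (fn (Pm a) \<theta>) = fimage X ?FX \<xi> \<Phi>"
      by (simp add: Fil_Pm[OF \<theta>(1) a] \<theta>(2) fimage_fimage[OF j'] \<xi>_def[abs_def])
    then have 2: "\<xi> (fimage X ?FX \<xi> \<Phi>) = fn a (fn (Pm a) \<theta>)" using jF[OF a\<theta>] by (simp add: \<xi>_def)
    show "\<xi> (fbind X ?FX (\<lambda>F. F) \<Phi>) = \<xi> (fimage X ?FX \<xi> \<Phi>)" unfolding 1 2 by (rule mult[OF \<theta>(1)])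
  qed
  have "flim lat (Fil X s) = fn a s" if s: "s \<in> Po X" for s
    using flim_lat[OF filt_Fil[OF X s]] by (simp add: \<xi>_def jF[OF s])
  then show "\<exists>L\<in>{L. small (carrier L) \<and> continuous_lattice L}. carrier L = X \<and>
      (\<forall>s\<in>Po X. flim L (Fil (carrier L) s) = fn a s)"
    using X continuous_lattice_lat by (intro bexI[of _ lat]) simp_all
qed

end

section \<open>The pushforwards of the exception and action monads\<close>

text \<open>Both \<open>inl y\<close> and \<open>opair m y\<close> carry their point \<open>y\<close> in the second component.\<close>

lemma osnd_inl [simp]: "osnd (inl y) = y"
  by (simp add: inl_def)

context finset_pushforward
begin

definition Uf :: "'u set \<Rightarrow> 'u \<Rightarrow> 'u set set"
  where "Uf X s = {B. B \<subseteq> X \<and> osnd (val (chi X B) s) = nat_code 0}"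

text \<open>The second components form a natural family of points. This holds for all elements in
  the case of the action monad, but for an exception the second component is not a point of
  A.\<close>

definition positional :: "'u set \<Rightarrow> 'u \<Rightarrow> bool"
  where "positional X s \<longleftrightarrow> (\<forall>f A. f \<in> Hom X A \<and> finite A \<longrightarrow> osnd (val f s) \<in> A \<and>
    (\<forall>g B. g \<in> Hom A B \<and> finite B \<longrightarrow> osnd (val (g \<odot> f) s) = fn g (osnd (val f s))))"

lemma positionalD:
  assumes "positional X s" "f \<in> Hom X A" "finite A"
  shows "osnd (val f s) \<in> A" "g \<in> Hom A B \<Longrightarrow> finite B \<Longrightarrow> osnd (val (g \<odot> f) s) = fn g (osnd (val f s))"
  using assms unfolding positional_def by blast+

lemma positional_family: "small X \<Longrightarrow> positional X s \<Longrightarrow> subset_family X (\<lambda>f. {osnd (val f s)})"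
  by unfold_locales (simp_all add: positionalD)

lemma Uf_eq: "small X \<Longrightarrow> positional X s \<Longrightarrow> Uf X s = subset_family.fam_filter X (\<lambda>f. {osnd (val f s)})"
  using subset_family.fam_filter_def[OF positional_family] by (simp add: Uf_def)

lemma preimage_Uf:
  assumes p: "positional X s" and f: "f \<in> Hom X A" and A: "finite A"
  shows "{x \<in> X. fn f x \<in> C} \<in> Uf X s \<longleftrightarrow> osnd (val f s) \<in> C"
proof -
  note X = hom_small(1)[OF f]
  show ?thesis unfolding Uf_eq[OF X p]
    using subset_family.preimage_fam_filter[OF positional_family[OF X p] f A, of C] by simp
qed

text \<open>The dichotomy comes from \<open>two\<close>: the point at \<open>chi X A\<close> is one
  of its two elements. The empty set is excluded because a point cannot lie in it.\<close>

lemma ultra_Uf: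
  assumes X: "small X" and p: "positional X s"
  shows "ultra X (Uf X s)"
  unfolding ultra_def
proof (intro conjI allI impI)
  show "filt X (Uf X s)" unfolding Uf_eq[OF X p] by (rule subset_family.filt_fam_filter[OF positional_family[OF X p]])
  have "{x \<in> X. fn (bang X) x \<in> {}} \<notin> Uf X s"
    using preimage_Uf[OF p bang_hom[OF X], of "{}"] by simp
  then show "{} \<notin> Uf X s" by simp
  fix A assume A: "A \<subseteq> X"
  note c = chi_hom[OF X, of A]
  have "osnd (val (chi X A) s) \<in> two" by (rule positionalD(1)[OF p c finite_two])
  then have "osnd (val (chi X A) s) \<in> {nat_code 0} \<or> osnd (val (chi X A) s) \<in> {nat_code 1}" by (auto simp: two_def)
  then have "{x \<in> X. fn (chi X A) x \<in> {nat_code 0}} \<in> Uf X s \<or> {x \<in> X. fn (chi X A) x \<in> {nat_code 1}} \<in> Uf X s"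
    unfolding preimage_Uf[OF p c finite_two] .
  moreover have "{x \<in> X. fn (chi X A) x \<in> {nat_code 0}} = A" "{x \<in> X. fn (chi X A) x \<in> {nat_code 1}} = X - A"
    using A by (auto simp: fn_chi split: if_splits)
  ultimately show "A \<in> Uf X s \<or> X - A \<in> Uf X s" by simp
qed

lemma Uf_Pm: "s \<in> Po X \<Longrightarrow> g \<in> Hom X Y \<Longrightarrow> Uf Y (fn (Pm g) s) = fimage Y X (fn g) (Uf X s)"
  unfolding fimage_def Uf_def
  by (intro Collect_cong conj_cong) (auto simp: val_Pm[OF _ _ chi_hom[OF hom_small(2)] finite_two] chi_cmp)

lemma val_eqI_Uf:
  assumes X: "small X" and s: "s \<in> Po X" "t \<in> Po X" and p: "positional X s" "positional X t" and U: "Uf X s = Uf X t"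
    and v: "\<And>f A. f \<in> Hom X A \<Longrightarrow> finite A \<Longrightarrow> osnd (val f s) = osnd (val f t) \<Longrightarrow> val f s = val f t"
  shows "s = t"
proof (rule val_eqI[OF X s])
  fix f A assume f: "f \<in> Hom X A" and A: "finite A"
  have "osnd (val f t) \<in> {osnd (val f s)}"
    using preimage_Uf[OF p(1) f A, of "{osnd (val f s)}"] preimage_Uf[OF p(2) f A, of "{osnd (val f s)}"] U by simp
  then show "val f s = val f t" by (intro v[OF f A]) simp
qed

lemma Uf_ultra_point:
  assumes X: "small X" and U: "ultra X U" and s: "\<And>f A. f \<in> Hom X A \<Longrightarrow> finite A \<Longrightarrow> osnd (val f s) = ultra_point U f"
  shows "Uf X s = U"
proof -
  have "osnd (val (chi X B) s) = nat_code 0 \<longleftrightarrow> B \<in> U" if "B \<subseteq> X" for B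
  proof -
    have "{x \<in> X. fn (chi X B) x \<in> {nat_code 0}} = B" using that by (auto simp: fn_chi split: if_splits)
    then show ?thesis
      using ultra_point_iff[OF U chi_hom[OF X] finite_two, of B "{nat_code 0}"] s[OF chi_hom[OF X] finite_two, of B] by simp
  qed
  then show ?thesis using filtD(1)[OF ultra_filt[OF U]] unfolding Uf_def by auto
qed

end

section \<open>Exceptions: pointed compact Hausdorff spaces\<close>

locale exception_pushforward = finset_pushforward "exception_monad E" S \<epsilon>
  for E :: "'u::zf_universe set" and S :: "('u::zf_universe set, 'u set_arr) mnd" and \<epsilon> +
  assumes E: "finite E"
begin

text \<open>One test at \<open>bang X\<close> decides the summand for all values of s, because the
  functor action maps \<open>inl\<close> to \<open>inl\<close> and fixes each
  \<open>inr e\<close>.\<close>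

definition rep :: "'u set \<Rightarrow> 'u \<Rightarrow> 'u set set + 'u"
  where "rep X s = (if \<exists>e. val (bang X) s = inr e then Inr (THE e. val (bang X) s = inr e) else Inl (Uf X s))"

lemma val_sum: "f \<in> Hom X A \<Longrightarrow> finite A \<Longrightarrow> s \<in> Po X \<Longrightarrow> val f s \<in> sum_set A E"
  using val_mem[of f X A s] by (simp add: exception_simps)

lemma val_sum_cmp:
  assumes "s \<in> Po X" "f \<in> Hom X A" "g \<in> Hom A B" "finite A" "finite B"
  shows "val (g \<odot> f) s = copair (\<lambda>x. inl (fn g x)) inr (val f s)"
  using val_cmp[OF assms] val_sum[OF assms(2,4,1)] by (simp add: exception_far[OF assms(3)])

lemma val_bang:
  assumes s: "s \<in> Po X" and f: "f \<in> Hom X A" and A: "finite A"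
  shows "val (bang X) s = copair (\<lambda>x. inl (fn (bang A) x)) inr (val f s)"
  using val_sum_cmp[OF s f bang_hom[OF hom_small(2)[OF f]] A] by (simp add: bang_cmp[OF f])

lemma rep_Inr_iff:
  assumes s: "s \<in> Po X" and f: "f \<in> Hom X A" and A: "finite A"
  shows "rep X s = Inr e \<longleftrightarrow> val f s = inr e"
  using val_sum[OF f A s] val_bang[OF s f A] by (auto simp: rep_def elim!: sum_setE)

lemma rep_Inl_iff:
  assumes s: "s \<in> Po X" and f: "f \<in> Hom X A" and A: "finite A"
  shows "(\<exists>U. rep X s = Inl U) \<longleftrightarrow> val f s = inl (osnd (val f s))"
  using val_sum[OF f A s] val_bang[OF s f A] by (auto simp: rep_def elim!: sum_setE)

lemma rep_Inr: "small X \<Longrightarrow> s \<in> Po X \<Longrightarrow> rep X s = Inr e \<Longrightarrow> e \<in> E"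
  using val_sum[OF bang_hom, of X s] rep_Inr_iff[OF _ bang_hom, of s X e] by (auto elim!: sum_setE)

lemma rep_Inl_positional: "s \<in> Po X \<Longrightarrow> rep X s = Inl U \<Longrightarrow> positional X s"
  unfolding positional_def
proof (intro allI impI conjI; (elim conjE)?)
  fix f A assume s: "s \<in> Po X" and r: "rep X s = Inl U" and f: "f \<in> Hom X A" and A: "finite A"
  have v: "val f s = inl (osnd (val f s))" using rep_Inl_iff[OF s f A] r by blast
  then show "osnd (val f s) \<in> A" using val_sum[OF f A s] by (metis sum_set_iff(1))
  fix g B assume g: "g \<in> Hom A B" and B: "finite B"
  show "osnd (val (g \<odot> f) s) = fn g (osnd (val f s))"
    using val_sum_cmp[OF s f g A B] v by (metis copair_inl osnd_inl)
qed

lemma rep_Inl: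
  assumes "small X" "s \<in> Po X" "rep X s = Inl U"
  shows "U = Uf X s" "ultra X U"
proof -
  show "U = Uf X s" using assms(3) by (auto simp: rep_def split: if_splits)
  then show "ultra X U" using ultra_Uf[OF assms(1) rep_Inl_positional[OF assms(2,3)]] by simp
qed

lemma rep_cases:
  assumes "small X" "s \<in> Po X"
  obtains (Inl) U where "rep X s = Inl U" "ultra X U" | (Inr) e where "rep X s = Inr e" "e \<in> E"
  using rep_Inl(2)[OF assms] rep_Inr[OF assms] by (cases "rep X s") auto

lemma rep_Pm: "s \<in> Po X \<Longrightarrow> g \<in> Hom X Y \<Longrightarrow> rep Y (fn (Pm g) s) = map_sum (fimage Y X (fn g)) id (rep X s)"
proof -
  assume s: "s \<in> Po X" and g: "g \<in> Hom X Y"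
  note X = hom_small(1)[OF g] and Y = hom_small(2)[OF g]
  have v: "val (bang Y) (fn (Pm g) s) = val (bang X) s"
    using val_Pm[OF s g bang_hom[OF Y]] by (simp add: bang_cmp[OF g])
  show ?thesis by (simp add: rep_def v Uf_Pm[OF s g])
qed

lemma rep_unit: "small X \<Longrightarrow> x \<in> X \<Longrightarrow> rep X (fn (P\<eta> X) x) = Inl (fprin X x)"
proof -
  assume X: "small X" and x: "x \<in> X"
  have v: "val f (fn (P\<eta> X) x) = inl (fn f x)" if "f \<in> Hom X A" "finite A" for f A
    using fn_mem[OF that(1) x] by (simp add: val_unit[OF x that] exception_simps)
  have "Uf X (fn (P\<eta> X) x) = fprin X x" unfolding Uf_def fprin_def
    by (auto simp: v[OF chi_hom[OF X] finite_two] fn_chi[OF x] split: if_splits)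
  then show ?thesis by (simp add: rep_def v[OF bang_hom[OF X]])
qed

lemma val_sum_mult:
  assumes "\<Phi> \<in> Po (Po X)" "f \<in> Hom X A" "finite A"
  shows "val (eval f) \<Phi> \<in> sum_set (sum_set A E) E"
    "val f (fn (P\<mu> X) \<Phi>) = copair (\<lambda>w. w) inr (val (eval f) \<Phi>)"
proof -
  show 1: "val (eval f) \<Phi> \<in> sum_set (sum_set A E) E"
    using val_mem[OF eval_hom[OF assms(2,3)] T_finite[OF assms(3)] assms(1)] by (simp add: exception_simps)
  show "val f (fn (P\<mu> X) \<Phi>) = copair (\<lambda>w. w) inr (val (eval f) \<Phi>)"
    using val_mult[OF assms] 1 by (simp add: exception_simps)
qed

lemma rep_mult_Inr: "small X \<Longrightarrow> \<Phi> \<in> Po (Po X) \<Longrightarrow> rep (Po X) \<Phi> = Inr e \<Longrightarrow> rep X (fn (P\<mu> X) \<Phi>) = Inr e"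
proof -
  assume X: "small X" and \<Phi>: "\<Phi> \<in> Po (Po X)" and r: "rep (Po X) \<Phi> = Inr e"
  note b = bang_hom[OF X] note eb = eval_hom[OF b finite.insertI[OF finite.emptyI]]
  have "val (eval (bang X)) \<Phi> = inr e"
    by (rule iffD1[OF rep_Inr_iff[OF \<Phi> eb T_finite] r]) simp
  then show ?thesis using rep_Inr_iff[OF fn_mem[OF P\<mu>_hom[OF X] \<Phi>] b] val_sum_mult(2)[OF \<Phi> b] by simp
qed

text \<open>Here the multiplication only removes the outer \<open>inl\<close>, so the value of the
  product is the point of \<open>To A\<close> that V singles out along \<open>eval f\<close>. As C
  is arbitrary, exceptions and points are tested alike.\<close>

lemma val_eval_Inl:
  assumes X: "small X" and \<Phi>: "\<Phi> \<in> Po (Po X)" and r: "rep (Po X) \<Phi> = Inl V" and f: "f \<in> Hom X A" and A: "finite A"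
  shows "val f (fn (P\<mu> X) \<Phi>) \<in> C \<longleftrightarrow> {s \<in> Po X. val f s \<in> C} \<in> V"
proof -
  note e = eval_hom[OF f A] and TA = T_finite[OF A]
  have v: "val (eval f) \<Phi> = inl (osnd (val (eval f) \<Phi>))" using rep_Inl_iff[OF \<Phi> e TA] r by blast
  have "val f (fn (P\<mu> X) \<Phi>) = osnd (val (eval f) \<Phi>)" unfolding val_sum_mult(2)[OF \<Phi> f A] by (subst v) simp
  then show ?thesis
    using preimage_Uf[OF rep_Inl_positional[OF \<Phi> r] e TA, of C] rep_Inl(1)[OF P_small[OF X] \<Phi> r] by (simp add: val_def)
qed

text \<open>Each clause tests the product at suitable maps: at \<open>bang X\<close> for being
  \<open>inr e\<close> or of the form \<open>inl\<close>, then at \<open>chi X B\<close> for being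
  \<open>inl (nat_code 0)\<close>. By \<open>val_eval_Inl\<close> every test amounts to a set
  belonging to V.\<close>

lemma rep_mult_Inl:
  assumes X: "small X" and \<Phi>: "\<Phi> \<in> Po (Po X)" and r: "rep (Po X) \<Phi> = Inl V"
  shows "{s \<in> Po X. rep X s = Inr e} \<in> V \<Longrightarrow> rep X (fn (P\<mu> X) \<Phi>) = Inr e"
    "{s \<in> Po X. \<exists>U. rep X s = Inl U} \<in> V \<Longrightarrow>
      rep X (fn (P\<mu> X) \<Phi>) = Inl {B. B \<subseteq> X \<and> {s \<in> Po X. \<exists>U. rep X s = Inl U \<and> B \<in> U} \<in> V}"
proof -
  note b = bang_hom[OF X] and \<mu>\<Phi> = fn_mem[OF P\<mu>_hom[OF X] \<Phi>] and fb = finite.insertI[OF finite.emptyI]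
  have "{s \<in> Po X. rep X s = Inr e} = {s \<in> Po X. val (bang X) s \<in> {inr e}}"
    using rep_Inr_iff[OF _ b fb] by auto
  then show "rep X (fn (P\<mu> X) \<Phi>) = Inr e" if "{s \<in> Po X. rep X s = Inr e} \<in> V"
    using that val_eval_Inl[OF X \<Phi> r b fb, of "{inr e}"] rep_Inr_iff[OF \<mu>\<Phi> b fb] by simp
  assume *: "{s \<in> Po X. \<exists>U. rep X s = Inl U} \<in> V"
  have "{s \<in> Po X. \<exists>U. rep X s = Inl U} = {s \<in> Po X. val (bang X) s \<in> {z. z = inl (osnd z)}}"
    using rep_Inl_iff[OF _ b fb] by auto
  then have "val (bang X) (fn (P\<mu> X) \<Phi>) \<in> {z. z = inl (osnd z)}"
    using * val_eval_Inl[OF X \<Phi> r b fb, of "{z. z = inl (osnd z)}"] by simp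
  then obtain W where W: "rep X (fn (P\<mu> X) \<Phi>) = Inl W" using rep_Inl_iff[OF \<mu>\<Phi> b fb] by auto
  have "B \<in> W \<longleftrightarrow> {s \<in> Po X. \<exists>U. rep X s = Inl U \<and> B \<in> U} \<in> V" if B: "B \<subseteq> X" for B
  proof -
    note c = chi_hom[OF X, of B]
    have k: "val (chi X B) s \<in> {inl (nat_code 0)} \<longleftrightarrow> (\<exists>U. rep X s = Inl U \<and> B \<in> U)" if s: "s \<in> Po X" for s
    proof
      assume v: "val (chi X B) s \<in> {inl (nat_code 0)}"
      then obtain U where U: "rep X s = Inl U" using rep_Inl_iff[OF s c finite_two] by auto
      then show "\<exists>U. rep X s = Inl U \<and> B \<in> U" using rep_Inl(1)[OF X s U] B v by (auto simp: Uf_def)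
    next
      assume "\<exists>U. rep X s = Inl U \<and> B \<in> U"
      then obtain U where U: "rep X s = Inl U" "B \<in> U" by blast
      then have "val (chi X B) s = inl (osnd (val (chi X B) s))" using rep_Inl_iff[OF s c finite_two] by blast
      moreover have "osnd (val (chi X B) s) = nat_code 0" using rep_Inl(1)[OF X s U(1)] U(2) by (simp add: Uf_def)
      ultimately show "val (chi X B) s \<in> {inl (nat_code 0)}" by simp
    qed
    have "B \<in> W \<longleftrightarrow> val (chi X B) (fn (P\<mu> X) \<Phi>) \<in> {inl (nat_code 0)}"
    proof -
      have "val (chi X B) (fn (P\<mu> X) \<Phi>) = inl (osnd (val (chi X B) (fn (P\<mu> X) \<Phi>)))"
        using rep_Inl_iff[OF \<mu>\<Phi> c finite_two] W by blast
      then have "val (chi X B) (fn (P\<mu> X) \<Phi>) = inl (nat_code 0) \<longleftrightarrow> osnd (val (chi X B) (fn (P\<mu> X) \<Phi>)) = nat_code 0"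
        by (metis osnd_inl)
      then show ?thesis using rep_Inl(1)[OF X \<mu>\<Phi> W] B by (simp add: Uf_def)
    qed
    also have "\<dots> \<longleftrightarrow> {s \<in> Po X. val (chi X B) s \<in> {inl (nat_code 0)}} \<in> V"
      by (rule val_eval_Inl[OF X \<Phi> r c finite_two])
    also have "{s \<in> Po X. val (chi X B) s \<in> {inl (nat_code 0)}} = {s \<in> Po X. \<exists>U. rep X s = Inl U \<and> B \<in> U}"
      by (intro Collect_cong conj_cong refl) (rule k)
    finally show ?thesis .
  qed
  then have "W = {B. B \<subseteq> X \<and> {s \<in> Po X. \<exists>U. rep X s = Inl U \<and> B \<in> U} \<in> V}"
    using filtD(1)[OF ultra_filt[OF rep_Inl(2)[OF X \<mu>\<Phi> W]]] by auto
  then show "rep X (fn (P\<mu> X) \<Phi>) = Inl {B. B \<subseteq> X \<and> {s \<in> Po X. \<exists>U. rep X s = Inl U \<and> B \<in> U} \<in> V}"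
    using W by simp
qed

lemma rep_inj: "small X \<Longrightarrow> s \<in> Po X \<Longrightarrow> t \<in> Po X \<Longrightarrow> rep X s = rep X t \<Longrightarrow> s = t"
proof -
  assume X: "small X" and s: "s \<in> Po X" and t: "t \<in> Po X" and eq: "rep X s = rep X t"
  show "s = t" using X s
  proof (cases rule: rep_cases)
    case (Inl U)
    then have rt: "rep X t = Inl U" using eq by simp
    show ?thesis
    proof (rule val_eqI_Uf[OF X s t rep_Inl_positional[OF s Inl(1)] rep_Inl_positional[OF t rt]])
      show "Uf X s = Uf X t" using rep_Inl(1)[OF X s Inl(1)] rep_Inl(1)[OF X t rt] by simp
      fix f A assume f: "f \<in> Hom X A" "finite A" and "osnd (val f s) = osnd (val f t)"
      then show "val f s = val f t" using rep_Inl_iff[OF s f] rep_Inl_iff[OF t f] Inl(1) rt by (metis)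
    qed
  next
    case (Inr e)
    show ?thesis
    proof (rule val_eqI[OF X s t])
      fix f A assume f: "f \<in> Hom X A" "finite A"
      have "val f s = inr e" by (rule iffD1[OF rep_Inr_iff[OF s f] Inr(1)])
      moreover have "val f t = inr e" by (rule iffD1[OF rep_Inr_iff[OF t f]]) (simp add: eq[symmetric] Inr(1))
      ultimately show "val f s = val f t" by simp
    qed
  qed
qed

lemma rep_surj_Inr:
  assumes X: "small X" and e: "e \<in> E"
  obtains s where "s \<in> Po X" "rep X s = Inr e"
proof -
  have "restrict (\<lambda>f. inr e) (finarr X) \<in> Fam X"
    by (rule nat_familiesI) (use e in \<open>auto simp: exception_simps exception_far\<close>)
  then obtain s where s: "s \<in> Po X" and v: "\<And>f A. f \<in> Hom X A \<Longrightarrow> finite A \<Longrightarrow> val f s = restrict (\<lambda>f. inr e) (finarr X) f"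
    using val_surj[OF X] by metis
  have "val (bang X) s = inr e" using v[OF bang_hom[OF X]] finarrI[OF bang_hom[OF X]] by simp
  then have "rep X s = Inr e" using rep_Inr_iff[OF s bang_hom[OF X]] by simp
  then show ?thesis using s that by blast
qed

lemma rep_surj_Inl:
  assumes X: "small X" and U: "ultra X U"
  obtains s where "s \<in> Po X" "rep X s = Inl U"
proof -
  let ?\<phi> = "\<lambda>f. inl (ultra_point U f)"
  have "restrict ?\<phi> (finarr X) \<in> Fam X"
    by (rule nat_familiesI) (simp_all add: exception_simps exception_far ultra_point_mem[OF U] ultra_point_nat[OF U])
  then obtain s where s: "s \<in> Po X" and v: "\<And>f A. f \<in> Hom X A \<Longrightarrow> finite A \<Longrightarrow> val f s = restrict ?\<phi> (finarr X) f"
    using val_surj[OF X] by metis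
  then have v': "val f s = ?\<phi> f" if "f \<in> Hom X A" "finite A" for f A using that finarrI[OF that] by simp
  have "Uf X s = U" by (rule Uf_ultra_point[OF X U]) (simp add: v')
  then have "rep X s = Inl U" by (simp add: rep_def v'[OF bang_hom[OF X]])
  then show ?thesis using s that by blast
qed

definition alg :: "'u topology \<times> ('u \<Rightarrow> 'u) \<Rightarrow> 'u \<Rightarrow> 'u"
  where "alg = (\<lambda>(T, p) s. case rep (topspace T) s of Inl U \<Rightarrow> ulim T U | Inr e \<Rightarrow> p e)"

lemma alg_Inl: "rep (topspace T) s = Inl U \<Longrightarrow> alg (T, p) s = ulim T U"
  and alg_Inr: "rep (topspace T) s = Inr e \<Longrightarrow> alg (T, p) s = p e"
  by (simp_all add: alg_def)

theorem em_pointed: "equivalent_categories (em_category Set_cat S) (CHaus_pointed E)"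
  unfolding CHaus_pointed_def
proof (rule equivalent_em_concreteI[where \<alpha> = alg])
  let ?Obs = "{(X, p). small (topspace X) \<and> compact_space X \<and> Hausdorff_space X \<and> p \<in> E \<rightarrow>\<^sub>E topspace X}"
  fix A :: "'u topology \<times> ('u \<Rightarrow> 'u)" assume "A \<in> ?Obs"
  then obtain T p where A: "A = (T, p)" "small (topspace T)" "compact_space T" "Hausdorff_space T" "p \<in> E \<rightarrow>\<^sub>E topspace T" by auto
  interpret compact_Hausdorff T using A by unfold_locales
  let ?X = "topspace T"
  show "small (case A of (X, p) \<Rightarrow> topspace X)" by (simp add: A)
  have mem: "alg A s \<in> ?X" if s: "s \<in> Po ?X" for s
    using A(2) s by (cases rule: rep_cases) (use A(5) ulim in \<open>auto simp: alg_Inl alg_Inr A(1)\<close>)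
  then show "s \<in> Po (case A of (X, p) \<Rightarrow> topspace X) \<Longrightarrow> alg A s \<in> (case A of (X, p) \<Rightarrow> topspace X)" for s
    by (simp add: A(1))
  show "x \<in> (case A of (X, p) \<Rightarrow> topspace X) \<Longrightarrow> alg A (fn (P\<eta> (case A of (X, p) \<Rightarrow> topspace X)) x) = x" for x
    by (simp add: A(1) alg_Inl[OF rep_unit[OF A(2)]] ulim_fprin)
  let ?a = "mk_arr (Po ?X) (alg A) ?X"
  have a: "?a \<in> Hom (Po ?X) ?X" using A(2) mem by (auto simp: P_small)
  have "alg A (fn (P\<mu> ?X) \<Phi>) = alg A (fn (Pm ?a) \<Phi>)" if \<Phi>: "\<Phi> \<in> Po (Po ?X)" for \<Phi>
    using P_small[OF A(2)] \<Phi>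
  proof (cases rule: rep_cases)
    case (Inr e)
    have "rep ?X (fn (Pm ?a) \<Phi>) = Inr e" using rep_Pm[OF \<Phi> a] Inr(1) by simp
    moreover have "rep ?X (fn (P\<mu> ?X) \<Phi>) = Inr e" by (rule rep_mult_Inr[OF A(2) \<Phi> Inr(1)])
    ultimately show ?thesis by (simp add: A(1) alg_Inr)
  next
    case (Inl V)
    \<comment> \<open>An exception e is replaced by the principal ultrafilter at its base point
      \<open>p e\<close>. Then the structure map is the limit of \<open>k s\<close> for every s, and
      \<open>ulim_fbind\<close> applies without distinguishing cases.\<close>
    define k where "k s = (case rep ?X s of Inl U \<Rightarrow> U | Inr e \<Rightarrow> fprin ?X (p e))" for s
    have k: "ultra ?X (k s)" "ulim T (k s) = alg A s" if s: "s \<in> Po ?X" for s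
      using A(2) s by (cases rule: rep_cases; use A(5) in \<open>auto simp: k_def alg_Inl alg_Inr A(1) intro!: ultra_fprin ulim_fprin\<close>)+
    have "fimage ?X (Po ?X) (fn ?a) V = fimage ?X (Po ?X) (\<lambda>s. ulim T (k s)) V" by (rule fimage_cong) (simp add: k)
    moreover have "ulim T (fbind ?X (Po ?X) k V) = ulim T (fimage ?X (Po ?X) (\<lambda>s. ulim T (k s)) V)"
      by (rule ulim_fbind[OF Inl(2)]) (rule k(1))
    moreover have "alg A (fn (Pm ?a) \<Phi>) = ulim T (fimage ?X (Po ?X) (fn ?a) V)"
      using rep_Pm[OF \<Phi> a] Inl(1) by (simp add: alg_Inl alg_Inr A(1))
    ultimately have rhs: "alg A (fn (Pm ?a) \<Phi>) = ulim T (fbind ?X (Po ?X) k V)" by simp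
    let ?I = "{s \<in> Po ?X. \<exists>U. rep ?X s = Inl U}" and ?R = "\<lambda>e. {s \<in> Po ?X. rep ?X s = Inr e}"
    have uk: "ultra ?X (fbind ?X (Po ?X) k V)" by (rule ultra_fbind[OF Inl(2)]) (rule k(1))
    \<comment> \<open>E is finite, so this is a finite cover of \<open>Po ?X\<close>, and V contains
      one of its pieces: it lives on genuine ultrafilters or on a single exception.\<close>
    have "Po ?X = \<Union>(insert ?I (?R ` E))"
    proof (intro equalityI subsetI)
      fix s assume s: "s \<in> Po ?X"
      with A(2) show "s \<in> \<Union>(insert ?I (?R ` E))" by (cases rule: rep_cases) (use s in auto)
    qed auto
    then have "\<Union>(insert ?I (?R ` E)) \<in> V" using filtD(2)[OF ultra_filt[OF Inl(2)]] by simp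
    then obtain W where W: "W \<in> insert ?I (?R ` E)" "W \<in> V"
      using ultra_Union[OF Inl(2), of "insert ?I (?R ` E)"] E by blast
    then consider "?I \<in> V" | e where "e \<in> E" "?R e \<in> V" by auto
    then show ?thesis
    proof cases
      case 1
      have "{s \<in> Po ?X. B \<in> k s} \<in> V \<longleftrightarrow> {s \<in> Po ?X. \<exists>U. rep ?X s = Inl U \<and> B \<in> U} \<in> V" for B
      proof -
        have e: "{s \<in> Po ?X. \<exists>U. rep ?X s = Inl U \<and> B \<in> U} = {s \<in> Po ?X. B \<in> k s} \<inter> ?I"
          by (auto simp: k_def)
        show ?thesis unfolding e
        proof
          show "{s \<in> Po ?X. B \<in> k s} \<in> V \<Longrightarrow> {s \<in> Po ?X. B \<in> k s} \<inter> ?I \<in> V"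
            using 1 by (rule filtD(3)[OF ultra_filt[OF Inl(2)], rotated])
          show "{s \<in> Po ?X. B \<in> k s} \<inter> ?I \<in> V \<Longrightarrow> {s \<in> Po ?X. B \<in> k s} \<in> V"
            by (rule filtD(4)[OF ultra_filt[OF Inl(2)]]) auto
        qed
      qed
      then show ?thesis unfolding rhs by (simp add: A(1) alg_Inl[OF rep_mult_Inl(2)[OF A(2) \<Phi> Inl(1) 1]] fbind_def)
    next
      case 2
      have pe: "p e \<in> ?X" using A(5) 2(1) by auto
      have "fprin ?X (p e) \<subseteq> fbind ?X (Po ?X) k V"
      proof
        fix B assume B: "B \<in> fprin ?X (p e)"
        have "{s \<in> Po ?X. B \<in> k s} \<in> V"
          by (rule filtD(4)[OF ultra_filt[OF Inl(2)] 2(2)]) (use B in \<open>auto simp: k_def\<close>)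
        then show "B \<in> fbind ?X (Po ?X) k V" using B by (simp add: fbind_def fprin_def)
      qed
      then have "fprin ?X (p e) = fbind ?X (Po ?X) k V" by (rule ultra_subset_eq[OF ultra_fprin[OF pe] uk])
      then show ?thesis unfolding rhs using ulim_fprin[OF pe]
        by (simp add: A(1) alg_Inr[OF rep_mult_Inl(1)[OF A(2) \<Phi> Inl(1) 2(2)]])
    qed
  qed
  then show "\<Phi> \<in> Po (Po (case A of (X, p) \<Rightarrow> topspace X)) \<Longrightarrow>
      alg A (fn (P\<mu> (case A of (X, p) \<Rightarrow> topspace X)) \<Phi>) =
      alg A (fn (Pm (mk_arr (Po (case A of (X, p) \<Rightarrow> topspace X)) (alg A) (case A of (X, p) \<Rightarrow> topspace X))) \<Phi>)" for \<Phi>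
    by (simp add: A(1))
next
  let ?Obs = "{(X, p). small (topspace X) \<and> compact_space X \<and> Hausdorff_space X \<and> p \<in> E \<rightarrow>\<^sub>E topspace X}"
  fix A B :: "'u topology \<times> ('u \<Rightarrow> 'u)" and f assume AB: "A \<in> ?Obs" "B \<in> ?Obs"
    and f: "f \<in> (case A of (X, p) \<Rightarrow> topspace X) \<rightarrow>\<^sub>E (case B of (X, p) \<Rightarrow> topspace X)"
  obtain T p where A: "A = (T, p)" "small (topspace T)" "compact_space T" "Hausdorff_space T" "p \<in> E \<rightarrow>\<^sub>E topspace T" using AB by auto
  obtain T' q where B: "B = (T', q)" "small (topspace T')" "compact_space T'" "Hausdorff_space T'" "q \<in> E \<rightarrow>\<^sub>E topspace T'" using AB by auto
  have f': "f ` topspace T \<subseteq> topspace T'" using f by (auto simp: A(1) B(1))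
  let ?m = "mk_arr (topspace T) f (topspace T')"
  have m: "?m \<in> Hom (topspace T) (topspace T')" using A B f' by auto
  have e: "fimage (topspace T') (topspace T) (fn ?m) U = fimage (topspace T') (topspace T) f U" for U
    by (rule fimage_cong) simp
  have "continuous_map T T' f \<and> (\<forall>e\<in>E. f (p e) = q e) \<longleftrightarrow>
    (\<forall>s\<in>Po (topspace T). f (alg (T, p) s) = alg (T', q) (fn (Pm ?m) s))"
    unfolding continuous_map_iff_ulim[OF compact_Hausdorff.intro[OF A(3,4)] compact_Hausdorff.intro[OF B(3,4)] f']
  proof (intro iffI ballI conjI allI impI; (elim conjE)?)
    fix s assume c: "\<forall>U. ultra (topspace T) U \<longrightarrow> f (ulim T U) = ulim T' (fimage (topspace T') (topspace T) f U)"
      and pq: "\<forall>e\<in>E. f (p e) = q e" and s: "s \<in> Po (topspace T)"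
    show "f (alg (T, p) s) = alg (T', q) (fn (Pm ?m) s)"
      using A(2) s by (cases rule: rep_cases) (use c pq in \<open>simp_all add: alg_Inl alg_Inr rep_Pm[OF s m] e\<close>)
  next
    fix U assume h: "\<forall>s\<in>Po (topspace T). f (alg (T, p) s) = alg (T', q) (fn (Pm ?m) s)" and U: "ultra (topspace T) U"
    obtain s where s: "s \<in> Po (topspace T)" "rep (topspace T) s = Inl U" by (rule rep_surj_Inl[OF A(2) U])
    show "f (ulim T U) = ulim T' (fimage (topspace T') (topspace T) f U)"
      using bspec[OF h s(1)] by (simp add: alg_Inl alg_Inr rep_Pm[OF s(1) m] s(2) e)
  next
    fix d assume h: "\<forall>s\<in>Po (topspace T). f (alg (T, p) s) = alg (T', q) (fn (Pm ?m) s)" and d: "d \<in> E"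
    obtain s where s: "s \<in> Po (topspace T)" "rep (topspace T) s = Inr d" by (rule rep_surj_Inr[OF A(2) d])
    show "f (p d) = q d"
      using bspec[OF h s(1)] by (simp add: alg_Inl alg_Inr rep_Pm[OF s(1) m] s(2))
  qed
  then show "(case A of (X, p) \<Rightarrow> \<lambda>(Y, q) f. continuous_map X Y f \<and> (\<forall>e\<in>E. f (p e) = q e)) B f \<longleftrightarrow>
    (\<forall>s\<in>Po (case A of (X, p) \<Rightarrow> topspace X). f (alg A s) =
      alg B (fn (Pm (mk_arr (case A of (X, p) \<Rightarrow> topspace X) f (case B of (X, p) \<Rightarrow> topspace X))) s))"
    by (simp add: A(1) B(1))
next
  fix X a assume X: "small X" and a: "a \<in> Hom (Po X) X" and unit: "\<And>x. x \<in> X \<Longrightarrow> fn a (fn (P\<eta> X) x) = x"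
    and mult: "\<And>\<Phi>. \<Phi> \<in> Po (Po X) \<Longrightarrow> fn a (fn (P\<mu> X) \<Phi>) = fn a (fn (Pm a) \<Phi>)"
  define j where "j r = (SOME s. s \<in> Po X \<and> rep X s = r)" for r
  have jex: "j r \<in> Po X \<and> rep X (j r) = r" if "\<exists>s. s \<in> Po X \<and> rep X s = r" for r
    using someI_ex[OF that] by (simp add: j_def)
  have jl: "j (Inl U) \<in> Po X" "rep X (j (Inl U)) = Inl U" if U: "ultra X U" for U
  proof -
    obtain s where "s \<in> Po X" "rep X s = Inl U" by (rule rep_surj_Inl[OF X U])
    then have "\<exists>s. s \<in> Po X \<and> rep X s = Inl U" by blast
    from jex[OF this] show "j (Inl U) \<in> Po X" "rep X (j (Inl U)) = Inl U" by simp_all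
  qed
  have jr: "j (Inr e) \<in> Po X" if e: "e \<in> E" for e
  proof -
    obtain s where "s \<in> Po X" "rep X s = Inr e" by (rule rep_surj_Inr[OF X e])
    then have "\<exists>s. s \<in> Po X \<and> rep X s = Inr e" by blast
    from jex[OF this] show "j (Inr e) \<in> Po X" by simp
  qed
  have jrep: "j (rep X s) = s" if s: "s \<in> Po X" for s
    using jex[of "rep X s"] s by (intro rep_inj[OF X]) auto
  define \<xi> where "\<xi> U = fn a (j (Inl U))" for U
  let ?UX = "{U. ultra X U}"
  interpret ultrafilter_algebra X \<xi>
  proof
    show "\<xi> U \<in> X" if "ultra X U" for U unfolding \<xi>_def by (rule fn_mem[OF a jl(1)[OF that]])
    show "\<xi> (fprin X x) = x" if x: "x \<in> X" for x
      using jrep[OF fn_mem[OF P\<eta>_hom[OF X] x]] unit[OF x] by (simp add: \<xi>_def rep_unit[OF X x])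
    fix \<Phi> assume \<Phi>: "ultra ?UX \<Phi>"
    let ?j = "\<lambda>U. j (Inl U)"
    have j': "?j ` ?UX \<subseteq> Po X" using jl by auto
    \<comment> \<open>\<Phi> is transported to an ultrafilter on \<open>Po X\<close> that lives on
      elements of the form \<open>Inl\<close>, so that the second clause of
      \<open>rep_mult_Inl\<close> computes the product.\<close>
    obtain \<theta> where \<theta>: "\<theta> \<in> Po (Po X)" "rep (Po X) \<theta> = Inl (fimage (Po X) ?UX ?j \<Phi>)"
      by (rule rep_surj_Inl[OF P_small[OF X] ultra_fimage[OF \<Phi> j']])
    note m\<theta> = fn_mem[OF P\<mu>_hom[OF X] \<theta>(1)] and a\<theta> = fn_mem[OF Pm_hom[OF a] \<theta>(1)]
    have "{U \<in> ?UX. ?j U \<in> {s \<in> Po X. \<exists>U. rep X s = Inl U}} = ?UX" using jl by auto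
    then have "{s \<in> Po X. \<exists>U. rep X s = Inl U} \<in> fimage (Po X) ?UX ?j \<Phi>"
      using filtD(2)[OF ultra_filt[OF \<Phi>]] by (simp add: fimage_def)
    note r = rep_mult_Inl(2)[OF X \<theta> this]
    have "{U \<in> ?UX. ?j U \<in> {s \<in> Po X. \<exists>U. rep X s = Inl U \<and> B \<in> U}} = {U \<in> ?UX. B \<in> U}" for B
      using jl by auto
    then have "{B. B \<subseteq> X \<and> {s \<in> Po X. \<exists>U. rep X s = Inl U \<and> B \<in> U} \<in> fimage (Po X) ?UX ?j \<Phi>} =
        fbind X ?UX (\<lambda>U. U) \<Phi>"
      unfolding fimage_def fbind_def by auto
    then have "rep X (fn (P\<mu> X) \<theta>) = Inl (fbind X ?UX (\<lambda>U. U) \<Phi>)" using r by simp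
    then have 1: "\<xi> (fbind X ?UX (\<lambda>U. U) \<Phi>) = fn a (fn (P\<mu> X) \<theta>)" using jrep[OF m\<theta>] by (simp add: \<xi>_def)
    have "rep X (fn (Pm a) \<theta>) = Inl (fimage X ?UX \<xi> \<Phi>)"
      by (simp add: rep_Pm[OF \<theta>(1) a] \<theta>(2) fimage_fimage[OF j'] \<xi>_def[abs_def])
    then have 2: "\<xi> (fimage X ?UX \<xi> \<Phi>) = fn a (fn (Pm a) \<theta>)" using jrep[OF a\<theta>] by (simp add: \<xi>_def)
    show "\<xi> (fbind X ?UX (\<lambda>U. U) \<Phi>) = \<xi> (fimage X ?UX \<xi> \<Phi>)" unfolding 1 2 by (rule mult[OF \<theta>(1)])
  qed
  \<comment> \<open>The base points are the values of the structure map at the exceptions.\<close>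
  define p where "p = (\<lambda>e\<in>E. fn a (j (Inr e)))"
  have p: "p \<in> E \<rightarrow>\<^sub>E X" unfolding p_def using jr fn_mem[OF a] by auto
  have "alg (topo, p) s = fn a s" if s: "s \<in> Po X" for s
    using X s
  proof (cases rule: rep_cases)
    case (Inl U)
    then show ?thesis using jrep[OF s] ulim_topo[OF Inl(2)] by (simp add: alg_Inl alg_Inr topspace_topo \<xi>_def)
  next
    case (Inr e)
    then show ?thesis using jrep[OF s] by (simp add: alg_Inl alg_Inr topspace_topo p_def)
  qed
  then show "\<exists>A\<in>{(X, p). small (topspace X) \<and> compact_space X \<and> Hausdorff_space X \<and> p \<in> E \<rightarrow>\<^sub>E topspace X}.
      (case A of (X, p) \<Rightarrow> topspace X) = X \<and> (\<forall>s\<in>Po X. alg A s = fn a s)"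
    using X p compact_topo Hausdorff_topo by (intro bexI[of _ "(topo, p)"]) (simp_all add: topspace_topo)
qed

end

text \<open>With M discrete, a preimage in the product is the union of its slices {m} times an open
  set.\<close>

lemma continuous_map_discrete_prod:
  assumes "\<alpha> ` (M \<times> topspace X) \<subseteq> topspace Y"
  shows "continuous_map (prod_topology (discrete_topology M) X) Y \<alpha> \<longleftrightarrow>
    (\<forall>m\<in>M. continuous_map X Y (\<lambda>x. \<alpha> (m, x)))"
proof (intro iffI ballI)
  fix m assume c: "continuous_map (prod_topology (discrete_topology M) X) Y \<alpha>" and m: "m \<in> M"
  have "continuous_map X (prod_topology (discrete_topology M) X) (\<lambda>x. (m, x))"
    using m by (intro continuous_map_pairedI) simp_all
  from continuous_map_compose[OF this c] show "continuous_map X Y (\<lambda>x. \<alpha> (m, x))" by (simp add: o_def)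
next
  assume c: "\<forall>m\<in>M. continuous_map X Y (\<lambda>x. \<alpha> (m, x))"
  show "continuous_map (prod_topology (discrete_topology M) X) Y \<alpha>"
    unfolding continuous_map
  proof (intro conjI allI impI)
    show "\<alpha> ` topspace (prod_topology (discrete_topology M) X) \<subseteq> topspace Y" using assms by simp
    fix W assume W: "openin Y W"
    have "{z \<in> topspace (prod_topology (discrete_topology M) X). \<alpha> z \<in> W} =
        (\<Union>m\<in>M. {m} \<times> {x \<in> topspace X. \<alpha> (m, x) \<in> W})" by auto
    moreover have "openin (prod_topology (discrete_topology M) X) ({m} \<times> {x \<in> topspace X. \<alpha> (m, x) \<in> W})" if "m \<in> M" for m
      using that openin_continuous_map_preimage[OF bspec[OF c that] W] by (simp add: openin_prod_Times_iff)
    ultimately show "openin (prod_topology (discrete_topology M) X) {z \<in> topspace (prod_topology (discrete_topology M) X). \<alpha> z \<in> W}"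
      by auto
  qed
qed

section \<open>Monoid actions on compact Hausdorff spaces\<close>

locale action_pushforward = finset_pushforward "action_monad M" S \<epsilon>
  for M :: "('u::zf_universe, 'b) monoid_scheme" and S :: "('u::zf_universe set, 'u set_arr) mnd" and \<epsilon> +
  assumes M: "monoid M" "finite (carrier M)"
begin

text \<open>By naturality along the map to a point, all values of s have this same first component
  (\<open>mrep_eq\<close>).\<close>

definition mrep :: "'u set \<Rightarrow> 'u \<Rightarrow> 'u"
  where "mrep X s = ofst (val (bang X) s)"

lemma val_prod: "f \<in> Hom X A \<Longrightarrow> finite A \<Longrightarrow> s \<in> Po X \<Longrightarrow> val f s \<in> prod_set (carrier M) A"
  using val_mem[of f X A s] by (simp add: action_simps)

lemma val_prod_cmp:
  assumes "s \<in> Po X" "f \<in> Hom X A" "g \<in> Hom A B" "finite A" "finite B"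
  shows "val (g \<odot> f) s = opair (ofst (val f s)) (fn g (osnd (val f s)))"
  using val_cmp[OF assms] val_prod[OF assms(2,4,1)] by (simp add: action_far[OF assms(3)])

lemma mrep_eq: "s \<in> Po X \<Longrightarrow> f \<in> Hom X A \<Longrightarrow> finite A \<Longrightarrow> ofst (val f s) = mrep X s"
  using val_prod_cmp[of s X f A "bang A" "{nat_code 0}"] bang_hom[OF hom_small(2), of f X A] bang_cmp[of f X A]
  by (simp add: mrep_def)

lemma val_mrep: "s \<in> Po X \<Longrightarrow> f \<in> Hom X A \<Longrightarrow> finite A \<Longrightarrow> val f s = opair (mrep X s) (osnd (val f s))"
  using val_prod[of f X A s] mrep_eq[of s X f A] by (auto elim!: prod_setE)

lemma mrep_mem: "small X \<Longrightarrow> s \<in> Po X \<Longrightarrow> mrep X s \<in> carrier M"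
  using val_prod[OF bang_hom, of X s] by (auto simp: mrep_def elim!: prod_setE)

lemma positional_val: "s \<in> Po X \<Longrightarrow> positional X s"
  unfolding positional_def
proof (intro allI impI conjI; (elim conjE)?)
  fix f A assume s: "s \<in> Po X" and f: "f \<in> Hom X A" and A: "finite A"
  show "osnd (val f s) \<in> A" using val_prod[OF f A s] by (auto elim!: prod_setE)
  fix g B assume g: "g \<in> Hom A B" and B: "finite B"
  show "osnd (val (g \<odot> f) s) = fn g (osnd (val f s))" using val_prod_cmp[OF s f g A B] by simp
qed

lemma mrep_Pm: "s \<in> Po X \<Longrightarrow> g \<in> Hom X Y \<Longrightarrow> mrep Y (fn (Pm g) s) = mrep X s"
  unfolding mrep_def using val_Pm[of s X g Y "bang Y" "{nat_code 0}"] bang_hom[OF hom_small(2), of g X Y]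
  by (simp add: bang_cmp)

lemma val_prod_unit: "x \<in> X \<Longrightarrow> f \<in> Hom X A \<Longrightarrow> finite A \<Longrightarrow> val f (fn (P\<eta> X) x) = opair \<one>\<^bsub>M\<^esub> (fn f x)"
  using fn_mem[of f X A x] by (simp add: val_unit[of x X f A] action_simps)

lemma mrep_unit: "small X \<Longrightarrow> x \<in> X \<Longrightarrow> mrep X (fn (P\<eta> X) x) = \<one>\<^bsub>M\<^esub>"
  by (simp add: mrep_def val_prod_unit[OF _ bang_hom])

lemma Uf_unit: "small X \<Longrightarrow> x \<in> X \<Longrightarrow> Uf X (fn (P\<eta> X) x) = fprin X x"
  unfolding Uf_def fprin_def by (auto simp: val_prod_unit[OF _ chi_hom finite_two] fn_chi split: if_splits)

lemma val_prod_mult: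
  assumes "\<Phi> \<in> Po (Po X)" "f \<in> Hom X A" "finite A"
  shows "val f (fn (P\<mu> X) \<Phi>) =
    opair (mrep (Po X) \<Phi> \<otimes>\<^bsub>M\<^esub> ofst (osnd (val (eval f) \<Phi>))) (osnd (osnd (val (eval f) \<Phi>)))"
proof -
  note e = eval_hom[OF assms(2,3)] note TA = T_finite[OF assms(3)]
  have "val (eval f) \<Phi> \<in> prod_set (carrier M) (prod_set (carrier M) A)"
    using val_mem[OF e TA assms(1)] by (simp add: action_simps)
  then show ?thesis using val_mult[OF assms] mrep_eq[OF assms(1) e TA] by (simp add: action_simps)
qed

lemma preimage_eval:
  assumes X: "small X" and \<Phi>: "\<Phi> \<in> Po (Po X)" and f: "f \<in> Hom X A" and A: "finite A"
  shows "osnd (val (eval f) \<Phi>) \<in> C \<longleftrightarrow> {s \<in> Po X. val f s \<in> C} \<in> Uf (Po X) \<Phi>"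
  using preimage_Uf[OF positional_val[OF \<Phi>] eval_hom[OF f A] T_finite[OF A], of C] by (simp add: val_def)

lemma Uf_mult: "small X \<Longrightarrow> \<Phi> \<in> Po (Po X) \<Longrightarrow> Uf X (fn (P\<mu> X) \<Phi>) = fbind X (Po X) (Uf X) (Uf (Po X) \<Phi>)"
proof -
  assume X: "small X" and \<Phi>: "\<Phi> \<in> Po (Po X)"
  have "osnd (val (chi X B) (fn (P\<mu> X) \<Phi>)) = nat_code 0 \<longleftrightarrow> {s \<in> Po X. B \<in> Uf X s} \<in> Uf (Po X) \<Phi>" if B: "B \<subseteq> X" for B
  proof -
    note c = chi_hom[OF X, of B]
    have "{s \<in> Po X. B \<in> Uf X s} = {s \<in> Po X. val (chi X B) s \<in> {t. osnd t = nat_code 0}}"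
      using B by (simp add: Uf_def)
    then show ?thesis using preimage_eval[OF X \<Phi> c finite_two, of "{t. osnd t = nat_code 0}"]
      by (simp add: val_prod_mult[OF \<Phi> c finite_two])
  qed
  then show ?thesis unfolding Uf_def[of X "fn (P\<mu> X) \<Phi>"] fbind_def by auto
qed

text \<open>The monoid elements carried by the members of \<open>Po X\<close> vary, but almost all
  of them, in the sense of \<open>Uf (Po X) \<Phi>\<close>, agree: the map
  \<open>eval (bang X)\<close> has a finite codomain, so the ultrafilter picks one point of it,
  whose first component is n.\<close>

lemma mrep_mult:
  assumes X: "small X" and \<Phi>: "\<Phi> \<in> Po (Po X)"
  obtains n where "n \<in> carrier M" "{s \<in> Po X. mrep X s = n} \<in> Uf (Po X) \<Phi>"
    "mrep X (fn (P\<mu> X) \<Phi>) = mrep (Po X) \<Phi> \<otimes>\<^bsub>M\<^esub> n"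
proof -
  note b = bang_hom[OF X] and fb = finite.insertI[OF finite.emptyI]
  let ?t = "osnd (val (eval (bang X)) \<Phi>)"
  have "?t \<in> To {nat_code 0}"
    using positionalD(1)[OF positional_val[OF \<Phi>] eval_hom[OF b fb] T_finite[OF fb]] .
  then have n: "ofst ?t \<in> carrier M" by (auto simp: action_simps elim!: prod_setE)
  have "{s \<in> Po X. mrep X s = ofst ?t} = {s \<in> Po X. val (bang X) s \<in> {t. ofst t = ofst ?t}}"
    by (simp add: mrep_def)
  then have "{s \<in> Po X. mrep X s = ofst ?t} \<in> Uf (Po X) \<Phi>"
    using preimage_eval[OF X \<Phi> b fb, of "{t. ofst t = ofst ?t}"] by simp
  moreover have "mrep X (fn (P\<mu> X) \<Phi>) = mrep (Po X) \<Phi> \<otimes>\<^bsub>M\<^esub> ofst ?t"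
    unfolding mrep_def[of X] val_prod_mult[OF \<Phi> b fb] by simp
  ultimately show ?thesis using n that by blast
qed

lemma rep_eqI:
  assumes "small X" "s \<in> Po X" "t \<in> Po X" "mrep X s = mrep X t" "Uf X s = Uf X t"
  shows "s = t"
proof (rule val_eqI_Uf[OF assms(1-3) positional_val[OF assms(2)] positional_val[OF assms(3)] assms(5)])
  fix f A assume f: "f \<in> Hom X A" "finite A" and "osnd (val f s) = osnd (val f t)"
  then show "val f s = val f t" using val_mrep[OF assms(2) f] val_mrep[OF assms(3) f] assms(4) by simp
qed

lemma rep_surj:
  assumes X: "small X" and m: "m \<in> carrier M" and U: "ultra X U"
  obtains s where "s \<in> Po X" "mrep X s = m" "Uf X s = U"
proof -
  let ?\<phi> = "\<lambda>f. opair m (ultra_point U f)"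
  have "restrict ?\<phi> (finarr X) \<in> Fam X"
    by (rule nat_familiesI) (simp_all add: action_simps action_far ultra_point_mem[OF U] ultra_point_nat[OF U] m)
  then obtain s where s: "s \<in> Po X" and v: "\<And>f A. f \<in> Hom X A \<Longrightarrow> finite A \<Longrightarrow> val f s = restrict ?\<phi> (finarr X) f"
    using val_surj[OF X] by metis
  then have v': "val f s = ?\<phi> f" if "f \<in> Hom X A" "finite A" for f A using that finarrI[OF that] by simp
  have "Uf X s = U" by (rule Uf_ultra_point[OF X U]) (simp add: v')
  moreover have "mrep X s = m" by (simp add: mrep_def v'[OF bang_hom[OF X]])
  ultimately show ?thesis using s that by blast
qed

definition alg :: "'u topology \<times> ('u \<times> 'u \<Rightarrow> 'u) \<Rightarrow> 'u \<Rightarrow> 'u"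
  where "alg = (\<lambda>(T, \<alpha>) s. \<alpha> (mrep (topspace T) s, ulim T (Uf (topspace T) s)))"

lemma alg_eq: "alg (T, \<alpha>) s = \<alpha> (mrep (topspace T) s, ulim T (Uf (topspace T) s))"
  by (simp add: alg_def)

abbreviation Obs :: "('u topology \<times> ('u \<times> 'u \<Rightarrow> 'u)) set" where "Obs \<equiv> {(X, \<alpha>). small (topspace X) \<and> compact_space X \<and> Hausdorff_space X \<and>
      \<alpha> \<in> carrier M \<times> topspace X \<rightarrow>\<^sub>E topspace X \<and>
      continuous_map (prod_topology (discrete_topology (carrier M)) X) X \<alpha> \<and>
      (\<forall>x\<in>topspace X. \<alpha> (\<one>\<^bsub>M\<^esub>, x) = x) \<and>
      (\<forall>m\<in>carrier M. \<forall>n\<in>carrier M. \<forall>x\<in>topspace X. \<alpha> (m \<otimes>\<^bsub>M\<^esub> n, x) = \<alpha> (m, \<alpha> (n, x)))}"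

lemma ObsE:
  assumes "A \<in> Obs"
  obtains T \<alpha> where "A = (T, \<alpha>)" "small (topspace T)" "compact_Hausdorff T"
    "\<alpha> \<in> carrier M \<times> topspace T \<rightarrow>\<^sub>E topspace T"
    "\<forall>m\<in>carrier M. continuous_map T T (\<lambda>x. \<alpha> (m, x))"
    "\<forall>x\<in>topspace T. \<alpha> (\<one>\<^bsub>M\<^esub>, x) = x"
    "\<forall>m\<in>carrier M. \<forall>n\<in>carrier M. \<forall>x\<in>topspace T. \<alpha> (m \<otimes>\<^bsub>M\<^esub> n, x) = \<alpha> (m, \<alpha> (n, x))"
proof -
  obtain T \<alpha> where A: "A = (T, \<alpha>)" by (cases A)
  have "\<alpha> ` (carrier M \<times> topspace T) \<subseteq> topspace T" using assms by (auto simp: A)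
  from continuous_map_discrete_prod[OF this] show ?thesis
    using assms by (intro that[OF A]) (simp_all add: A compact_Hausdorff_def)
qed

theorem em_action: "equivalent_categories (em_category Set_cat S) (CHaus_action M)"
  unfolding CHaus_action_def
proof (rule equivalent_em_concreteI[where \<alpha> = alg])
  interpret monoid M by (rule M)
  fix A assume "A \<in> Obs"
  then show "small (case A of (X, \<alpha>) \<Rightarrow> topspace X)" by auto
  from \<open>A \<in> Obs\<close> obtain T \<alpha> where A: "A = (T, \<alpha>)" and X: "small (topspace T)" and T: "compact_Hausdorff T"
    and \<alpha>: "\<alpha> \<in> carrier M \<times> topspace T \<rightarrow>\<^sub>E topspace T"
    and cont: "\<forall>m\<in>carrier M. continuous_map T T (\<lambda>x. \<alpha> (m, x))"
    and one: "\<forall>x\<in>topspace T. \<alpha> (\<one>\<^bsub>M\<^esub>, x) = x"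
    and times: "\<forall>m\<in>carrier M. \<forall>n\<in>carrier M. \<forall>x\<in>topspace T. \<alpha> (m \<otimes>\<^bsub>M\<^esub> n, x) = \<alpha> (m, \<alpha> (n, x))"
    by (rule ObsE)
  interpret compact_Hausdorff T by (rule T)
  let ?X = "topspace T"
  have \<alpha>m: "\<alpha> (m, x) \<in> ?X" if "m \<in> carrier M" "x \<in> ?X" for m x using \<alpha> that by auto
  have uU: "ultra ?X (Uf ?X s)" if "s \<in> Po ?X" for s by (rule ultra_Uf[OF X positional_val[OF that]])
  have mem: "alg A s \<in> ?X" if s: "s \<in> Po ?X" for s
    unfolding A alg_eq by (rule \<alpha>m[OF mrep_mem[OF X s] ulim(1)[OF uU[OF s]]])
  then show "s \<in> Po (case A of (X, \<alpha>) \<Rightarrow> topspace X) \<Longrightarrow> alg A s \<in> (case A of (X, \<alpha>) \<Rightarrow> topspace X)" for s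
    by (simp add: A)
  show "x \<in> (case A of (X, \<alpha>) \<Rightarrow> topspace X) \<Longrightarrow> alg A (fn (P\<eta> (case A of (X, \<alpha>) \<Rightarrow> topspace X)) x) = x" for x
    by (simp add: A alg_eq Uf_unit[OF X] mrep_unit[OF X] ulim_fprin one)
  let ?a = "mk_arr (Po ?X) (alg A) ?X"
  have a: "?a \<in> Hom (Po ?X) ?X" using X mem by (auto simp: P_small)
  have "alg A (fn (P\<mu> ?X) \<Phi>) = alg A (fn (Pm ?a) \<Phi>)" if \<Phi>: "\<Phi> \<in> Po (Po ?X)" for \<Phi>
  proof -
    \<comment> \<open>The product acts as m times n on the limit of the limits, where n is the
      monoid element carried by V-most s. Continuity of the action by n moves it inside the limit;
      the other side has m acting on the limit of the structure map.\<close>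
    let ?V = "Uf (Po ?X) \<Phi>" and ?m = "mrep (Po ?X) \<Phi>"
    note PX = P_small[OF X] note V = ultra_Uf[OF PX positional_val[OF \<Phi>]] and m = mrep_mem[OF PX \<Phi>]
    obtain n where n: "n \<in> carrier M" "{s \<in> Po ?X. mrep ?X s = n} \<in> ?V" "mrep ?X (fn (P\<mu> ?X) \<Phi>) = ?m \<otimes>\<^bsub>M\<^esub> n"
      by (rule mrep_mult[OF X \<Phi>])
    let ?l = "\<lambda>s. ulim T (Uf ?X s)" let ?L = "fimage ?X (Po ?X) ?l ?V"
    have l: "?l ` Po ?X \<subseteq> ?X" using ulim(1)[OF uU] by auto
    note L = ultra_fimage[OF V l]
    have \<alpha>n: "(\<lambda>x. \<alpha> (n, x)) ` ?X \<subseteq> ?X" using \<alpha>m[OF n(1)] by auto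
    have "ulim T (Uf ?X (fn (P\<mu> ?X) \<Phi>)) = ulim T ?L"
      unfolding Uf_mult[OF X \<Phi>] by (rule ulim_fbind[OF V]) (rule uU)
    then have "alg A (fn (P\<mu> ?X) \<Phi>) = \<alpha> (?m, \<alpha> (n, ulim T ?L))"
      by (simp add: A alg_eq n(3) times m n(1) ulim(1)[OF L])
    moreover have "\<alpha> (n, ulim T ?L) = ulim T (fimage ?X ?X (\<lambda>x. \<alpha> (n, x)) ?L)"
      using continuous_map_iff_ulim[OF T T \<alpha>n] bspec[OF cont n(1)] L by simp
    moreover have "fimage ?X ?X (\<lambda>x. \<alpha> (n, x)) ?L = fimage ?X (Po ?X) (\<lambda>s. \<alpha> (n, ?l s)) ?V"
      by (rule fimage_fimage[OF l])
    \<comment> \<open>On the set of s with \<open>mrep ?X s = n\<close>, which belongs to V, the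
      structure map is n acting on the limit of s. The two images therefore agree.\<close>
    moreover have "fimage ?X (Po ?X) (\<lambda>s. \<alpha> (n, ?l s)) ?V = fimage ?X (Po ?X) (fn ?a) ?V"
    proof (rule ultra_subset_eq)
      show "ultra ?X (fimage ?X (Po ?X) (\<lambda>s. \<alpha> (n, ?l s)) ?V)"
        by (rule ultra_fimage[OF V]) (use \<alpha>m[OF n(1)] ulim(1)[OF uU] in auto)
      show "ultra ?X (fimage ?X (Po ?X) (fn ?a) ?V)" by (rule ultra_fimage[OF V]) (use mem in auto)
      show "fimage ?X (Po ?X) (\<lambda>s. \<alpha> (n, ?l s)) ?V \<subseteq> fimage ?X (Po ?X) (fn ?a) ?V"
      proof
        fix B assume "B \<in> fimage ?X (Po ?X) (\<lambda>s. \<alpha> (n, ?l s)) ?V"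
        then have B: "B \<subseteq> ?X" "{s \<in> Po ?X. \<alpha> (n, ?l s) \<in> B} \<in> ?V" by (simp_all add: fimage_def)
        have "{s \<in> Po ?X. fn ?a s \<in> B} \<in> ?V"
          by (rule filtD(4)[OF ultra_filt[OF V] filtD(3)[OF ultra_filt[OF V] B(2) n(2)]]) (auto simp: A alg_eq)
        then show "B \<in> fimage ?X (Po ?X) (fn ?a) ?V" using B(1) by (simp add: fimage_def)
      qed
    qed
    moreover have "mrep ?X (fn (Pm ?a) \<Phi>) = ?m" "Uf ?X (fn (Pm ?a) \<Phi>) = fimage ?X (Po ?X) (fn ?a) ?V"
      by (rule mrep_Pm[OF \<Phi> a], rule Uf_Pm[OF \<Phi> a])
    ultimately show ?thesis by (simp add: A alg_eq)
  qed
  then show "\<Phi> \<in> Po (Po (case A of (X, \<alpha>) \<Rightarrow> topspace X)) \<Longrightarrow>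
      alg A (fn (P\<mu> (case A of (X, \<alpha>) \<Rightarrow> topspace X)) \<Phi>) =
      alg A (fn (Pm (mk_arr (Po (case A of (X, \<alpha>) \<Rightarrow> topspace X)) (alg A) (case A of (X, \<alpha>) \<Rightarrow> topspace X))) \<Phi>)" for \<Phi>
    by (simp add: A)
next
  interpret monoid M by (rule M)
  fix A B f assume "A \<in> Obs" "B \<in> Obs"
    and f: "f \<in> (case A of (X, \<alpha>) \<Rightarrow> topspace X) \<rightarrow>\<^sub>E (case B of (X, \<alpha>) \<Rightarrow> topspace X)"
  from \<open>A \<in> Obs\<close> obtain T \<alpha> where A: "A = (T, \<alpha>)" "small (topspace T)" "compact_Hausdorff T"
    "\<forall>x\<in>topspace T. \<alpha> (\<one>\<^bsub>M\<^esub>, x) = x" by (elim ObsE) (rule that, assumption+)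
  from \<open>B \<in> Obs\<close> obtain T' \<beta> where B: "B = (T', \<beta>)" "small (topspace T')" "compact_Hausdorff T'"
    "\<forall>x\<in>topspace T'. \<beta> (\<one>\<^bsub>M\<^esub>, x) = x" by (elim ObsE) (rule that, assumption+)
  interpret T: compact_Hausdorff T by (rule A(3))
  interpret T': compact_Hausdorff T' by (rule B(3))
  have f': "f ` topspace T \<subseteq> topspace T'" using f by (auto simp: A(1) B(1))
  let ?m = "mk_arr (topspace T) f (topspace T')"
  have m: "?m \<in> Hom (topspace T) (topspace T')" using A B f' by auto
  have e: "fimage (topspace T') (topspace T) (fn ?m) U = fimage (topspace T') (topspace T) f U" for U
    by (rule fimage_cong) simp
  have r: "alg (T', \<beta>) (fn (Pm ?m) s) =
      \<beta> (mrep (topspace T) s, ulim T' (fimage (topspace T') (topspace T) f (Uf (topspace T) s)))"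
    if "s \<in> Po (topspace T)" for s by (simp add: alg_eq mrep_Pm[OF that m] Uf_Pm[OF that m] e)
  have "continuous_map T T' f \<and> (\<forall>m\<in>carrier M. \<forall>x\<in>topspace T. f (\<alpha> (m, x)) = \<beta> (m, f x)) \<longleftrightarrow>
    (\<forall>s\<in>Po (topspace T). f (alg (T, \<alpha>) s) = alg (T', \<beta>) (fn (Pm ?m) s))"
    unfolding continuous_map_iff_ulim[OF A(3) B(3) f']
  proof (intro iffI ballI conjI allI impI; (elim conjE)?)
    fix s assume c: "\<forall>U. ultra (topspace T) U \<longrightarrow> f (ulim T U) = ulim T' (fimage (topspace T') (topspace T) f U)"
      and eq: "\<forall>m\<in>carrier M. \<forall>x\<in>topspace T. f (\<alpha> (m, x)) = \<beta> (m, f x)" and s: "s \<in> Po (topspace T)"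
    note U = ultra_Uf[OF A(2) positional_val[OF s]]
    show "f (alg (T, \<alpha>) s) = alg (T', \<beta>) (fn (Pm ?m) s)"
      using eq mrep_mem[OF A(2) s] T.ulim(1)[OF U] c U by (simp add: r[OF s] alg_eq[of T])
  next
    \<comment> \<open>The monoid unit isolates continuity from the homomorphism condition; below,
      principal ultrafilters isolate equivariance.\<close>
    fix U assume h: "\<forall>s\<in>Po (topspace T). f (alg (T, \<alpha>) s) = alg (T', \<beta>) (fn (Pm ?m) s)" and U: "ultra (topspace T) U"
    obtain s where s: "s \<in> Po (topspace T)" "mrep (topspace T) s = \<one>\<^bsub>M\<^esub>" "Uf (topspace T) s = U"
      by (rule rep_surj[OF A(2) one_closed U])
    show "f (ulim T U) = ulim T' (fimage (topspace T') (topspace T) f U)"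
      using bspec[OF h s(1)] T.ulim(1)[OF U] T'.ulim(1)[OF ultra_fimage[OF U f']]
      by (simp add: r[OF s(1)] alg_eq[of T] s(2,3) A(4) B(4))
  next
    fix n x assume h: "\<forall>s\<in>Po (topspace T). f (alg (T, \<alpha>) s) = alg (T', \<beta>) (fn (Pm ?m) s)"
      and n: "n \<in> carrier M" and x: "x \<in> topspace T"
    have fx: "f x \<in> topspace T'" using f' x by auto
    obtain s where s: "s \<in> Po (topspace T)" "mrep (topspace T) s = n" "Uf (topspace T) s = fprin (topspace T) x"
      by (rule rep_surj[OF A(2) n ultra_fprin[OF x]])
    show "f (\<alpha> (n, x)) = \<beta> (n, f x)"
      using bspec[OF h s(1)]
      by (simp add: r[OF s(1)] alg_eq[of T] s(2,3) T.ulim_fprin[OF x] fimage_fprin[OF x f'] T'.ulim_fprin[OF fx])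
  qed
  then show "(case A of (X, \<alpha>) \<Rightarrow> \<lambda>(Y, \<beta>) f. continuous_map X Y f \<and>
      (\<forall>m\<in>carrier M. \<forall>x\<in>topspace X. f (\<alpha> (m, x)) = \<beta> (m, f x))) B f \<longleftrightarrow>
    (\<forall>s\<in>Po (case A of (X, \<alpha>) \<Rightarrow> topspace X). f (alg A s) =
      alg B (fn (Pm (mk_arr (case A of (X, \<alpha>) \<Rightarrow> topspace X) f (case B of (X, \<alpha>) \<Rightarrow> topspace X))) s))"
    by (simp add: A(1) B(1))
next
  interpret monoid M by (rule M)
  fix X a assume X: "small X" and a: "a \<in> Hom (Po X) X" and unit: "\<And>x. x \<in> X \<Longrightarrow> fn a (fn (P\<eta> X) x) = x"
    and mult: "\<And>\<Phi>. \<Phi> \<in> Po (Po X) \<Longrightarrow> fn a (fn (P\<mu> X) \<Phi>) = fn a (fn (Pm a) \<Phi>)"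
  define j where "j m U = (SOME s. s \<in> Po X \<and> mrep X s = m \<and> Uf X s = U)" for m U
  have j: "j m U \<in> Po X" "mrep X (j m U) = m" "Uf X (j m U) = U" if mU: "m \<in> carrier M" "ultra X U" for m U
  proof -
    obtain s where "s \<in> Po X" "mrep X s = m" "Uf X s = U" by (rule rep_surj[OF X mU])
    then have "\<exists>s. s \<in> Po X \<and> mrep X s = m \<and> Uf X s = U" by blast
    from someI_ex[OF this] show "j m U \<in> Po X" "mrep X (j m U) = m" "Uf X (j m U) = U" by (simp_all add: j_def)
  qed
  have uU: "ultra X (Uf X s)" if "s \<in> Po X" for s by (rule ultra_Uf[OF X positional_val[OF that]])
  have jeq: "s = j m U" if "s \<in> Po X" "mrep X s = m" "Uf X s = U" for s m U
  proof -
    have mU: "m \<in> carrier M" "ultra X U"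
      using mrep_mem[OF X that(1)] uU[OF that(1)] that(2,3) by simp_all
    show ?thesis
      by (rule rep_eqI[OF X that(1) j(1)[OF mU]]) (simp_all add: j(2,3)[OF mU] that(2,3))
  qed
  define b where "b m U = fn a (j m U)" for m U
  have b: "b m U \<in> X" if "m \<in> carrier M" "ultra X U" for m U
    unfolding b_def by (rule fn_mem[OF a j(1)[OF that]])
  \<comment> \<open>The whole associativity law in terms of pairs (m, U). Its instances are the
    ultrafilter algebra law (both factors one), the action law (principal ultrafilters), and two
    mixed laws, with one factor equal to one, that link action and limits.\<close>
  have b_bind: "b (m \<otimes>\<^bsub>M\<^esub> n) (fbind X I k G) = b m (fimage X I (\<lambda>i. b n (k i)) G)"
    if m: "m \<in> carrier M" and n: "n \<in> carrier M" and G: "ultra I G" and k: "\<And>i. i \<in> I \<Longrightarrow> ultra X (k i)"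
    for m n and I :: "'i set" and k G
  proof -
    let ?j = "\<lambda>i. j n (k i)"
    have j': "?j ` I \<subseteq> Po X" using j(1)[OF n k] by auto
    note G' = ultra_fimage[OF G j']
    obtain \<theta> where \<theta>: "\<theta> \<in> Po (Po X)" "mrep (Po X) \<theta> = m" "Uf (Po X) \<theta> = fimage (Po X) I ?j G"
      by (rule rep_surj[OF P_small[OF X] m G'])
    note m\<theta> = fn_mem[OF P\<mu>_hom[OF X] \<theta>(1)] and a\<theta> = fn_mem[OF Pm_hom[OF a] \<theta>(1)]
    have "Uf X (fn (P\<mu> X) \<theta>) = fbind X I (\<lambda>i. Uf X (?j i)) G"
      by (simp add: Uf_mult[OF X \<theta>(1)] \<theta>(3) fbind_fimage[OF j'])
    also have "\<dots> = fbind X I k G" by (rule fbind_cong) (simp add: j n k)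
    finally have U1: "Uf X (fn (P\<mu> X) \<theta>) = fbind X I k G" .
    have m1: "mrep X (fn (P\<mu> X) \<theta>) = m \<otimes>\<^bsub>M\<^esub> n"
    proof -
      \<comment> \<open>\<open>mrep_mult\<close> only yields some n' shared by almost all elements.
        Every element in the image of \<open>?j\<close> carries n, and a set belonging to an
        ultrafilter is nonempty, so n' is n.\<close>
      obtain n' where n': "{s \<in> Po X. mrep X s = n'} \<in> Uf (Po X) \<theta>" "mrep X (fn (P\<mu> X) \<theta>) = mrep (Po X) \<theta> \<otimes>\<^bsub>M\<^esub> n'"
        by (rule mrep_mult[OF X \<theta>(1)])
      have "{i \<in> I. ?j i \<in> {s \<in> Po X. mrep X s = n'}} \<in> G" using n'(1) by (simp add: \<theta>(3) fimage_def)
      then obtain i where "i \<in> I" "mrep X (?j i) = n'" using ultra_Int_nonempty[OF G, of _ I] filtD(2)[OF ultra_filt[OF G]] by auto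
      then show ?thesis using j(2)[OF n k] n'(2) \<theta>(2) by simp
    qed
    have "mrep X (fn (Pm a) \<theta>) = m" using mrep_Pm[OF \<theta>(1) a] \<theta>(2) by simp
    moreover have "Uf X (fn (Pm a) \<theta>) = fimage X I (\<lambda>i. b n (k i)) G"
      by (simp add: Uf_Pm[OF \<theta>(1) a] \<theta>(3) fimage_fimage[OF j'] b_def)
    ultimately have "fn (Pm a) \<theta> = j m (fimage X I (\<lambda>i. b n (k i)) G)" by (rule jeq[OF a\<theta>])
    moreover have "fn (P\<mu> X) \<theta> = j (m \<otimes>\<^bsub>M\<^esub> n) (fbind X I k G)" using jeq[OF m\<theta> m1 U1] .
    ultimately show ?thesis using mult[OF \<theta>(1)] by (simp add: b_def)
  qed
  define \<xi> where "\<xi> U = b \<one>\<^bsub>M\<^esub> U" for U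
  let ?UX = "{U. ultra X U}"
  interpret ultrafilter_algebra X \<xi>
  proof
    show "\<xi> U \<in> X" if "ultra X U" for U unfolding \<xi>_def by (rule b[OF one_closed that])
    show "\<xi> (fprin X x) = x" if x: "x \<in> X" for x
      using jeq[OF fn_mem[OF P\<eta>_hom[OF X] x] mrep_unit[OF X x] Uf_unit[OF X x]] unit[OF x] by (simp add: \<xi>_def b_def)
    fix \<Phi> assume \<Phi>: "ultra ?UX \<Phi>"
    show "\<xi> (fbind X ?UX (\<lambda>U. U) \<Phi>) = \<xi> (fimage X ?UX \<xi> \<Phi>)"
      using b_bind[OF one_closed one_closed \<Phi>, of "\<lambda>U. U"] by (simp add: \<xi>_def[abs_def])
  qed
  define \<alpha> where "\<alpha> = (\<lambda>z\<in>carrier M \<times> X. b (fst z) (fprin X (snd z)))"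
  have \<alpha>: "\<alpha> \<in> carrier M \<times> X \<rightarrow>\<^sub>E X" unfolding \<alpha>_def by (auto intro!: b ultra_fprin)
  have \<alpha>_eq: "\<alpha> (m, x) = b m (fprin X x)" if "m \<in> carrier M" "x \<in> X" for m x using that by (simp add: \<alpha>_def)
  have \<xi>\<alpha>: "\<alpha> (m, \<xi> U) = b m U" if m: "m \<in> carrier M" and U: "ultra X U" for m U
  proof -
    \<comment> \<open>The first mixed instance: a one-point index set with its principal ultrafilter
      makes the sum U itself and the image the principal ultrafilter at
      \<open>\<xi> U\<close>.\<close>
    have "b (m \<otimes>\<^bsub>M\<^esub> \<one>\<^bsub>M\<^esub>) (fbind X {U} (\<lambda>U. U) (fprin {U} U)) = b m (fimage X {U} (\<lambda>U. b \<one>\<^bsub>M\<^esub> U) (fprin {U} U))"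
      by (rule b_bind[OF m one_closed ultra_fprin]) (use U in auto)
    moreover have "fbind X {U} (\<lambda>U. U) (fprin {U} U) = U"
      by (rule fbind_fprin) (use filtD(1)[OF ultra_filt[OF U]] in auto)
    moreover have "fimage X {U} (\<lambda>U. b \<one>\<^bsub>M\<^esub> U) (fprin {U} U) = fprin X (\<xi> U)"
      unfolding \<xi>_def by (rule fimage_fprin) (use b[OF one_closed U] in auto)
    ultimately show ?thesis using m \<alpha>_eq[OF m mem[OF U]] by simp
  qed
  have one: "\<alpha> (\<one>\<^bsub>M\<^esub>, x) = x" if x: "x \<in> X" for x
    using unit[OF x] local.unit[OF x] \<alpha>_eq[OF one_closed x] by (simp add: \<xi>_def)
  have times: "\<alpha> (m \<otimes>\<^bsub>M\<^esub> n, x) = \<alpha> (m, \<alpha> (n, x))" if m: "m \<in> carrier M" and n: "n \<in> carrier M" and x: "x \<in> X" for m n x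
  proof -
    have u: "ultra X (fprin X x)" by (rule ultra_fprin[OF x])
    have "b (m \<otimes>\<^bsub>M\<^esub> n) (fbind X X (fprin X) (fprin X x)) = b m (fimage X X (\<lambda>x. b n (fprin X x)) (fprin X x))"
      by (rule b_bind[OF m n u]) (rule ultra_fprin)
    moreover have "fimage X X (\<lambda>x. b n (fprin X x)) (fprin X x) = fprin X (b n (fprin X x))"
      by (rule fimage_fprin[OF x]) (use b[OF n ultra_fprin] in auto)
    ultimately show ?thesis
      using \<alpha>_eq[OF m_closed[OF m n] x] \<alpha>_eq[OF n x] \<alpha>_eq[OF m b[OF n u]] by (simp add: fbind_unit[OF ultra_filt[OF u]])
  qed
  have cont: "continuous_map topo topo (\<lambda>x. \<alpha> (m, x))" if m: "m \<in> carrier M" for m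
  proof -
    have sub: "(\<lambda>x. \<alpha> (m, x)) ` topspace topo \<subseteq> topspace topo" using \<alpha> m by (auto simp: topspace_topo)
    have CH: "compact_Hausdorff topo" using compact_topo Hausdorff_topo by (rule compact_Hausdorff.intro)
    show ?thesis unfolding continuous_map_iff_ulim[OF CH CH sub]
    proof (intro allI impI)
      fix U assume "ultra (topspace topo) U"
      then have U: "ultra X U" by (simp add: topspace_topo)
      \<comment> \<open>The second mixed instance: with principal ultrafilters as k the sum is U
        again, and the image is that of U under the action by m. Together with
        \<open>\<xi>\<alpha>\<close> this is continuity read on ultrafilter limits.\<close>
      have "b (\<one>\<^bsub>M\<^esub> \<otimes>\<^bsub>M\<^esub> m) (fbind X X (fprin X) U) = b \<one>\<^bsub>M\<^esub> (fimage X X (\<lambda>x. b m (fprin X x)) U)"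
        by (rule b_bind[OF one_closed m U]) (rule ultra_fprin)
      moreover have "fimage X X (\<lambda>x. b m (fprin X x)) U = fimage X X (\<lambda>x. \<alpha> (m, x)) U"
        by (rule fimage_cong) (simp add: \<alpha>_eq[OF m])
      ultimately have "b m U = \<xi> (fimage X X (\<lambda>x. \<alpha> (m, x)) U)"
        using m by (simp add: fbind_unit[OF ultra_filt[OF U]] \<xi>_def)
      moreover have "ultra X (fimage X X (\<lambda>x. \<alpha> (m, x)) U)" using ultra_fimage[OF U] sub by (simp add: topspace_topo)
      ultimately show "\<alpha> (m, ulim topo U) = ulim topo (fimage (topspace topo) (topspace topo) (\<lambda>x. \<alpha> (m, x)) U)"
        by (simp add: ulim_topo topspace_topo U \<xi>\<alpha>[OF m U])
    qed
  qed
  have "alg (topo, \<alpha>) s = fn a s" if s: "s \<in> Po X" for s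
  proof -
    have "alg (topo, \<alpha>) s = b (mrep X s) (Uf X s)"
      by (simp add: alg_eq topspace_topo ulim_topo uU[OF s] \<xi>\<alpha> mrep_mem[OF X s])
    also have "\<dots> = fn a s" unfolding b_def using jeq[OF s refl refl] by simp
    finally show ?thesis .
  qed
  moreover have "(topo, \<alpha>) \<in> Obs"
  proof -
    have "\<alpha> ` (carrier M \<times> topspace topo) \<subseteq> topspace topo" using \<alpha> by (auto simp: topspace_topo)
    from continuous_map_discrete_prod[OF this] show ?thesis
      using X compact_topo Hausdorff_topo \<alpha> one times cont by (simp add: topspace_topo)
  qed
  ultimately show "\<exists>A\<in>Obs. (case A of (X, \<alpha>) \<Rightarrow> topspace X) = X \<and> (\<forall>s\<in>Po X. alg A s = fn a s)"
    by (intro bexI[of _ "(topo, \<alpha>)"]) (simp_all add: topspace_topo)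
qed

end

text \<open>A pushforward is determined only up to isomorphism, so each equivalence is claimed for
  every pushforward; the separate existence claims keep this from being vacuous.\<close>

theorem mainTheorem1:
  "(\<forall>E :: 'u::zf_universe set. finite E \<longrightarrow>
      (\<exists>S \<epsilon>. is_pushforward FinSet_cat Set_cat FinSet_incl (exception_monad E) S \<epsilon>) \<and>
      (\<forall>S \<epsilon>. is_pushforward FinSet_cat Set_cat FinSet_incl (exception_monad E) S \<epsilon> \<longrightarrow>
        equivalent_categories (em_category Set_cat S) (CHaus_pointed E))) \<and>
   (\<forall>M :: 'u monoid. monoid M \<and> finite (carrier M) \<longrightarrow>
      (\<exists>S \<epsilon>. is_pushforward FinSet_cat Set_cat FinSet_incl (action_monad M) S \<epsilon>) \<and>
      (\<forall>S \<epsilon>. is_pushforward FinSet_cat Set_cat FinSet_incl (action_monad M) S \<epsilon> \<longrightarrow>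
        equivalent_categories (em_category Set_cat S) (CHaus_action M))) \<and>
   (\<exists>S \<epsilon>. is_pushforward FinSet_cat Set_cat FinSet_incl
      (powerset_monad :: ('u set, 'u set_arr) mnd) S \<epsilon>) \<and>
   (\<forall>S \<epsilon>. is_pushforward FinSet_cat Set_cat FinSet_incl
      (powerset_monad :: ('u set, 'u set_arr) mnd) S \<epsilon> \<longrightarrow>
        equivalent_categories (em_category Set_cat S)
          (ContLat_cat :: ('u gorder, 'u gorder \<times> ('u \<Rightarrow> 'u) \<times> 'u gorder) cat))"
proof -
  have ex: "\<exists>S \<epsilon>. is_pushforward FinSet_cat Set_cat FinSet_incl T S \<epsilon>" if "finset_monad T"
    for T :: "('u set, 'u set_arr) mnd"
    using finset_monad.push_is_pushforward[OF that] by blast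
  have exception: "equivalent_categories (em_category Set_cat S) (CHaus_pointed E)"
    if "finite E" "is_pushforward FinSet_cat Set_cat FinSet_incl (exception_monad E) S \<epsilon>" for E :: "'u set" and S \<epsilon>
  proof -
    interpret exception_pushforward E S \<epsilon>
      using that by (intro exception_pushforward.intro finset_pushforward.intro exception_finset_monad
          finset_pushforward_axioms.intro exception_pushforward_axioms.intro)
    show ?thesis by (rule em_pointed)
  qed
  have action: "equivalent_categories (em_category Set_cat S) (CHaus_action M)"
    if "monoid M" "finite (carrier M)" "is_pushforward FinSet_cat Set_cat FinSet_incl (action_monad M) S \<epsilon>"
    for M :: "'u monoid" and S \<epsilon>
  proof -
    interpret action_pushforward M S \<epsilon>
      using that by (intro action_pushforward.intro finset_pushforward.intro action_finset_monad
          finset_pushforward_axioms.intro action_pushforward_axioms.intro)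
    show ?thesis by (rule em_action)
  qed
  have powerset: "equivalent_categories (em_category Set_cat S)
      (ContLat_cat :: ('u gorder, 'u gorder \<times> ('u \<Rightarrow> 'u) \<times> 'u gorder) cat)"
    if "is_pushforward FinSet_cat Set_cat FinSet_incl (powerset_monad :: ('u set, 'u set_arr) mnd) S \<epsilon>" for S \<epsilon>
  proof -
    interpret powerset_pushforward S \<epsilon>
      using that by (intro powerset_pushforward.intro finset_pushforward.intro powerset_finset_monad
          finset_pushforward_axioms.intro)
    show ?thesis by (rule em_continuous_lattices)
  qed
  show ?thesis
  proof (intro conjI allI impI; (elim conjE)?)
    fix E :: "'u set" assume E: "finite E"
    show "\<exists>S \<epsilon>. is_pushforward FinSet_cat Set_cat FinSet_incl (exception_monad E) S \<epsilon>"
      by (rule ex[OF exception_finset_monad[OF E]])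
  next
    fix M :: "'u monoid" assume M: "monoid M" "finite (carrier M)"
    show "\<exists>S \<epsilon>. is_pushforward FinSet_cat Set_cat FinSet_incl (action_monad M) S \<epsilon>"
      by (rule ex[OF action_finset_monad[OF M]])
  next
    show "\<exists>S \<epsilon>. is_pushforward FinSet_cat Set_cat FinSet_incl
        (powerset_monad :: ('u set, 'u set_arr) mnd) S \<epsilon>"
      by (rule ex[OF powerset_finset_monad])
  qed (rule exception action powerset; assumption)+
qed

end
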